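(* Let $A=\mathbb{F}_q[x]$ be the polynomial ring in one variable $x$ over the finite field $\mathbb{F}_q$ with $q$ elements, and let $B$ be the set of all irreducible polynomials of degree $\ge1$ in $A$ (monic or not). If $q$ is odd, then $B$ is a 3-type optimal subset of $A$.
   Context: For a non-empty subset $C$ of a ring $A$ and an integer $n\ge2$, $nC=\{c_1+\cdots+c_n: c_i\in C\}$, and $\langle C\rangle$ denotes the multiplicative sub-semigroup of $A$ generated by $C$ (all products $c_1\cdots c_k$ with $k\ge1$, $c_i\in C$). For non-empty subsets $B,C$ of $A$, write $B\gtrdot\Rightarrow_n C$ if $B\supset C$, $nB=nC$, and every $b\in B$ can be written as $b=c_1\cdots c_k$ with $k\ge1$ and $c_1,\dots,c_k\in C$. A non-empty subset $B$ is $n$-th sum-factor irreducible, written $B\in\mathcal{F}_{ir}(A)_n$, if the only non-empty subset $C\subset B$ with $B\gtrdot\Rightarrow_n C$ is $C=B$. A non-empty subset $B$ of $A$ is an $n$-type optimal subset of $A$ if $\langle B\rangle\gtrdot\Rightarrow_n B$ and $B\in\mathcal{F}_{ir}(A)_n$. *)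

theory Defs
  imports "HOL-Computational_Algebra.Polynomial" "HOL-Library.Cardinality"
begin

text \<open>Throughout, \<open>n\<close> is meant to be at least 2, although the definitions make sense for all \<open>n\<close>.\<close>

definition nfold_sumset :: "nat \<Rightarrow> 'a::comm_monoid_add set \<Rightarrow> 'a set" where
  "nfold_sumset n C = {sum_list cs | cs. length cs = n \<and> set cs \<subseteq> C}"

text \<open>The sub-semigroup need not contain 1: the empty product is excluded.\<close>

definition generated_semigroup :: "'a::monoid_mult set \<Rightarrow> 'a set" where
  "generated_semigroup C = {prod_list cs | cs. cs \<noteq> [] \<and> set cs \<subseteq> C}"

definition sum_factor_reduces :: "nat \<Rightarrow> 'a::ring_1 set \<Rightarrow> 'a set \<Rightarrow> bool" where
  "sum_factor_reduces n B C \<longleftrightarrow>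
     B \<noteq> {} \<and> C \<noteq> {} \<and> C \<subseteq> B \<and> nfold_sumset n B = nfold_sumset n C \<and>
     (\<forall>b\<in>B. \<exists>cs. cs \<noteq> [] \<and> set cs \<subseteq> C \<and> b = prod_list cs)"

definition sum_factor_irreducible :: "nat \<Rightarrow> 'a::ring_1 set \<Rightarrow> bool" where
  "sum_factor_irreducible n B \<longleftrightarrow>
     B \<noteq> {} \<and> (\<forall>C. C \<noteq> {} \<and> C \<subseteq> B \<and> sum_factor_reduces n B C \<longrightarrow> C = B)"

definition optimal_subset :: "nat \<Rightarrow> 'a::ring_1 set \<Rightarrow> bool" where
  "optimal_subset n B \<longleftrightarrow>
     B \<noteq> {} \<and> sum_factor_reduces n (generated_semigroup B) B \<and> sum_factor_irreducible n B"

end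

theory Submission
  imports Defs "HOL-Analysis.Analysis" "HOL-Computational_Algebra.Polynomial_Factorial"
    "HOL-Computational_Algebra.Fundamental_Theorem_Algebra" "HOL-Real_Asymp.Real_Asymp"
begin

text \<open>The factorisation part is immediate, since an irreducible polynomial is not a product of
  several irreducibles; the content is that every polynomial is a sum of three irreducibles of
  unrestricted degrees. We fix a large degree and prescribe the leading coefficients \<open>1, 1, -2\<close>,
  so that the sum may have small degree, together with three residue classes, coprime to the product
  \<open>W\<close> of all irreducibles of small degree, that add up to the given polynomial. The irreducibles in
  such a class, suitably weighted, are majorised by a Selberg sieve weight which is pseudorandom, and
  by Dirichlet's theorem in \<open>F\<^sub>q[x]\<close> their mean is at least 0.47. A restriction estimate for the
  majorant shows that few Fourier coefficients are large; averaging over the annihilator of the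
  corresponding characters gives bounded functions with essentially the same count of zero-sum
  triples. As 0.47 exceeds 1/3 and the order of the group is odd, the Kneser-type lemma for dense
  sets makes this count positive.\<close>

section \<open>Characters of finite abelian groups\<close>

text \<open>The majorant is the square of a sum of level \<open>R\<close>, and its mean is evaluated
  for \<open>2 * R \<le> M\<close>; so irreducibles of degree near \<open>M\<close> get relative
  density about \<open>R / M\<close>, below 1/2. Here \<open>R = 24 * s\<close> and
  \<open>M = 50 * s\<close> give 0.48, and 0.47 after losses. At this density a subgroup of index 2
  is the obstruction, since three of its cosets can avoid zero sums; this is where odd
  \<open>q\<close> enters, besides making 2 invertible in the choice of residues and leading
  coefficients. There is no division into major and minor arcs. Its substitute is a count of the
  moduli that correlate with a given additive character at all: each of them determines an extension
  of the character, and extensions are few. Dirichlet's theorem is obtained only as a limit for a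
  fixed modulus, so the order of the choices matters. The number of large Fourier coefficients is
  bounded by an absolute constant; this constant fixes the cutoff for the small irreducibles in
  \<open>W\<close>; only then does the degree tend to infinity.\<close>

locale finite_abelian =
  fixes G :: "'g set" and mul :: "'g \<Rightarrow> 'g \<Rightarrow> 'g" (infixl "\<odot>" 70) and e :: 'g
  assumes finite_G: "finite G"
    and e_G [simp]: "e \<in> G"
    and closed [simp]: "x \<in> G \<Longrightarrow> y \<in> G \<Longrightarrow> x \<odot> y \<in> G"
    and assoc: "x \<in> G \<Longrightarrow> y \<in> G \<Longrightarrow> z \<in> G \<Longrightarrow> (x \<odot> y) \<odot> z = x \<odot> (y \<odot> z)"
    and comm: "x \<in> G \<Longrightarrow> y \<in> G \<Longrightarrow> x \<odot> y = y \<odot> x"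
    and unit [simp]: "x \<in> G \<Longrightarrow> e \<odot> x = x"
    and inverse: "x \<in> G \<Longrightarrow> \<exists>y\<in>G. x \<odot> y = e"
begin

text \<open>The value 0 outside \<open>G\<close> makes equality of characters an equality of
  functions, so that \<open>chars\<close> is a finite set; for residues modulo \<open>W\<close> it
  is the usual convention for Dirichlet characters.\<close>

definition chars :: "('g \<Rightarrow> complex) set" where
  "chars = {\<psi>. (\<forall>x\<in>G. \<forall>y\<in>G. \<psi> (x \<odot> y) = \<psi> x * \<psi> y) \<and> \<psi> e = 1 \<and> (\<forall>x. x \<notin> G \<longrightarrow> \<psi> x = 0)}"

text \<open>The last clause, cancellation inside \<open>H\<close>, stands in for closure under
  inverses, as the locale has no inverse function.\<close>

definition subgrp :: "'g set \<Rightarrow> bool" where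
  "subgrp H \<longleftrightarrow> H \<subseteq> G \<and> e \<in> H \<and> (\<forall>a\<in>H. \<forall>b\<in>H. a \<odot> b \<in> H) \<and> (\<forall>a\<in>H. \<forall>b\<in>G. a \<odot> b \<in> H \<longrightarrow> b \<in> H)"

definition char_on :: "'g set \<Rightarrow> ('g \<Rightarrow> complex) \<Rightarrow> bool" where
  "char_on H \<psi> \<longleftrightarrow> (\<forall>x\<in>H. \<forall>y\<in>H. \<psi> (x \<odot> y) = \<psi> x * \<psi> y) \<and> \<psi> e = 1"

definition pw :: "'g \<Rightarrow> nat \<Rightarrow> 'g" where
  "pw y k = ((\<odot>) y ^^ k) e"

lemma unit_right [simp]: "x \<in> G \<Longrightarrow> x \<odot> e = x"
  using comm e_G unit by metis

lemma cancel: "x \<in> G \<Longrightarrow> y \<in> G \<Longrightarrow> z \<in> G \<Longrightarrow> x \<odot> y = x \<odot> z \<longleftrightarrow> y = z"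
  by (metis assoc comm inverse unit)

lemma pw_0 [simp]: "pw y 0 = e" and pw_Suc: "pw y (Suc k) = y \<odot> pw y k"
  by (simp_all add: pw_def)

lemma pw_G [simp]: "y \<in> G \<Longrightarrow> pw y k \<in> G"
  by (induction k) (simp_all add: pw_Suc)

lemma pw_add: "y \<in> G \<Longrightarrow> pw y (j + k) = pw y j \<odot> pw y k"
  by (induction j) (simp_all add: pw_Suc assoc)

lemma pw_mult: "y \<in> G \<Longrightarrow> pw y (j * k) = pw (pw y j) k"
  by (induction k) (simp_all add: pw_Suc pw_add)

lemma subgrpD:
  assumes "subgrp H"
  shows "H \<subseteq> G" "e \<in> H" "a \<in> H \<Longrightarrow> b \<in> H \<Longrightarrow> a \<odot> b \<in> H" "a \<in> H \<Longrightarrow> b \<in> G \<Longrightarrow> a \<odot> b \<in> H \<Longrightarrow> b \<in> H"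
  using assms unfolding subgrp_def by blast+

lemma subgrp_pw: "subgrp H \<Longrightarrow> y \<in> H \<Longrightarrow> pw y k \<in> H"
  by (induction k) (simp_all add: pw_Suc subgrpD(2,3))

lemma char_on_pw: "subgrp H \<Longrightarrow> char_on H \<psi> \<Longrightarrow> y \<in> H \<Longrightarrow> \<psi> (pw y k) = \<psi> y ^ k"
  by (induction k) (simp_all add: pw_Suc subgrp_pw char_on_def)

lemma ex_pw_eq_e:
  assumes y: "y \<in> G"
  shows "\<exists>n>0. pw y n = e"
proof -
  have "\<not> inj_on (pw y) UNIV"
    using finite_G y by (metis finite_imageD finite_subset image_subsetI infinite_UNIV_nat pw_G)
  then obtain i j where ij: "pw y i = pw y j" "i < j"
    unfolding inj_on_def by (metis linorder_neqE_nat)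
  have "pw y i \<odot> pw y (j - i) = pw y i \<odot> e"
    using ij y pw_add[OF y, of i "j - i"] by simp
  hence "pw y (j - i) = e" using cancel y by (metis e_G pw_G)
  thus ?thesis using ij by (intro exI[of _ "j - i"]) auto
qed

text \<open>The least \<open>n\<close> with \<open>pw y n\<close> in \<open>H\<close> leaves a
  single constraint on the value \<open>z\<close> at \<open>y\<close>. The elements of the enlarged
  subgroup are \<open>h \<odot> pw y k\<close>, and \<open>\<psi> h * z ^ k\<close> does not depend
  on the representation, because the powers of \<open>y\<close> lying in \<open>H\<close> are powers
  of \<open>pw y n\<close>.\<close>

lemma char_extend:
  assumes H: "subgrp H" and \<psi>: "char_on H \<psi>" and y: "y \<in> G"
    and n: "n > 0" "pw y n \<in> H" "\<And>k. 0 < k \<Longrightarrow> k < n \<Longrightarrow> pw y k \<notin> H"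
    and z: "z ^ n = \<psi> (pw y n)"
  shows "\<exists>H' \<psi>'. subgrp H' \<and> H \<subseteq> H' \<and> y \<in> H' \<and> char_on H' \<psi>' \<and> (\<forall>x\<in>H. \<psi>' x = \<psi> x) \<and> \<psi>' y = z"
proof -
  note HG = subgrpD(1)[OF H] and He = subgrpD(2)[OF H] and Hc = subgrpD(3)[OF H] and Hi = subgrpD(4)[OF H]
  have HGm: "h \<in> H \<Longrightarrow> h \<in> G" for h using HG by auto
  \<comment> \<open>Division of \<open>k\<close> by \<open>n\<close>: a nonzero remainder would be a
    smaller exponent with power in \<open>H\<close>.\<close>
  have val: "\<psi> (pw y k) = z ^ k \<and> n dvd k" if k: "pw y k \<in> H" for k
  proof -
    have eq: "pw y k = pw (pw y n) (k div n) \<odot> pw y (k mod n)"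
      by (metis mult_div_mod_eq pw_add pw_mult y)
    have t: "pw (pw y n) (k div n) \<in> H" using H n by (simp add: subgrp_pw)
    have "pw y (k mod n) \<in> H" using Hi[OF t] eq k y by simp
    hence 0: "k mod n = 0" using n by (metis gr0I mod_less_divisor)
    have "\<psi> (pw y k) = \<psi> (pw (pw y n) (k div n))" using eq 0 t HGm by simp
    also have "\<dots> = (z ^ n) ^ (k div n)" using char_on_pw[OF H \<psi> n(2)] z by simp
    also have "\<dots> = z ^ k" using 0 by (metis dvd_mult_div_cancel dvd_eq_mod_eq_0 power_mult)
    finally show ?thesis using 0 by auto
  qed
  have wd: "\<psi> h * z ^ k = \<psi> h' * z ^ k'"
    if h: "h \<in> H" "h' \<in> H" and eq: "h \<odot> pw y k = h' \<odot> pw y k'" for h h' k k'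
  proof -
    \<comment> \<open>With \<open>k' \<le> k\<close> the factor \<open>pw y k'\<close> can be
      cancelled without inverses; the other case follows by symmetry.\<close>
    have *: "\<psi> h * z ^ k = \<psi> h' * z ^ k'"
      if h: "h \<in> H" "h' \<in> H" and eq: "h \<odot> pw y k = h' \<odot> pw y k'" and le: "k' \<le> k" for h h' k k'
    proof -
      have p: "pw y k = pw y (k - k') \<odot> pw y k'" using pw_add[OF y, of "k - k'" k'] le by simp
      have "pw y k' \<odot> (h \<odot> pw y (k - k')) = pw y k' \<odot> h'"
        using eq p h HGm y by (metis assoc closed comm pw_G)
      hence hh: "h \<odot> pw y (k - k') = h'" using cancel h HGm y by (metis closed pw_G)
      have P: "pw y (k - k') \<in> H" using Hi[OF h(1)] hh h y by simp
      have "\<psi> h' = \<psi> h * z ^ (k - k')" using hh P val[OF P] \<psi> h unfolding char_on_def by metis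
      thus ?thesis using le by (simp flip: power_add)
    qed
    show ?thesis using *[OF h eq] *[OF h(2,1) eq[symmetric]] by (cases "k' \<le> k") auto
  qed
  define H' where "H' = {h \<odot> pw y k | h k. h \<in> H}"
  define \<psi>' where "\<psi>' x = (let (h, k) = (SOME (h, k). h \<in> H \<and> x = h \<odot> pw y k) in \<psi> h * z ^ k)" for x
  have \<psi>': "\<psi>' (h \<odot> pw y k) = \<psi> h * z ^ k" if h: "h \<in> H" for h k
  proof -
    obtain h' k' where *: "(SOME (h', k'). h' \<in> H \<and> h \<odot> pw y k = h' \<odot> pw y k') = (h', k')" by fastforce
    have "case (h', k') of (h', k') \<Rightarrow> h' \<in> H \<and> h \<odot> pw y k = h' \<odot> pw y k'"
      unfolding *[symmetric] by (rule someI[of _ "(h, k)"]) (use h in auto)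
    thus ?thesis using wd[of h' h k' k] h unfolding \<psi>'_def * by auto
  qed
  have HH': "H \<subseteq> H'" unfolding H'_def using HGm by (force intro: exI[of _ 0])
  have yH': "y \<in> H'" unfolding H'_def using He y
    by (intro CollectI exI[of _ e] exI[of _ "Suc 0"]) (simp add: pw_Suc)
  have prod: "(h \<odot> pw y k) \<odot> (h' \<odot> pw y k') = (h \<odot> h') \<odot> pw y (k + k')" if "h \<in> H" "h' \<in> H" for h h' k k'
    using that HGm y by (simp add: pw_add assoc) (metis assoc closed comm pw_G)
  have H'c: "a \<odot> b \<in> H'" if "a \<in> H'" "b \<in> H'" for a b
    using that prod Hc unfolding H'_def by (auto; metis)
  have H'G: "H' \<subseteq> G" unfolding H'_def using HGm y by auto
  have inv': "b \<in> H'" if a: "a \<in> H'" and b: "b \<in> G" and ab: "a \<odot> b \<in> H'" for a b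
  proof -
    \<comment> \<open>Finite order makes \<open>pw a (k - 1)\<close> the inverse of
      \<open>a\<close>.\<close>
    obtain k where k: "k > 0" "pw a k = e" using ex_pw_eq_e a H'G by auto
    have pk: "pw a j \<in> H'" for j
      by (induction j) (use a H'c He HH' in \<open>auto simp: pw_Suc\<close>)
    have "b = pw a (k - 1) \<odot> (a \<odot> b)"
    proof -
      have "pw a (k - 1) \<odot> a = e"
        using k pw_Suc[of a "k - 1"] comm[of a "pw a (k-1)"] a H'G by auto
      thus ?thesis using assoc a b H'G by (metis pw_G subsetD unit)
    qed
    thus ?thesis using H'c[OF pk ab] by metis
  qed
  have sub': "subgrp H'" unfolding subgrp_def using H'G H'c inv' He HH' by blast
  have ext: "\<psi>' x = \<psi> x" if "x \<in> H" for x using \<psi>'[OF that, of 0] that HGm by simp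
  have "\<psi>' y = z" using \<psi>'[OF He, of "Suc 0"] y \<psi> by (simp add: pw_Suc char_on_def)
  moreover have "char_on H' \<psi>'"
  proof -
    have "\<psi>' (a \<odot> b) = \<psi>' a * \<psi>' b" if "a \<in> H'" "b \<in> H'" for a b
    proof -
      obtain h k h' k' where *: "a = h \<odot> pw y k" "b = h' \<odot> pw y k'" "h \<in> H" "h' \<in> H"
        using \<open>a \<in> H'\<close> \<open>b \<in> H'\<close> unfolding H'_def by auto
      have "\<psi> (h \<odot> h') = \<psi> h * \<psi> h'" using \<psi> * unfolding char_on_def by auto
      thus ?thesis using * prod[OF *(3,4)] \<psi>'[OF *(3)] \<psi>'[OF *(4)] \<psi>'[OF Hc[OF *(3,4)]]
        by (simp add: power_add)
    qed
    thus ?thesis unfolding char_on_def using ext[OF He] \<psi> by (simp add: char_on_def)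
  qed
  ultimately show ?thesis using sub' HH' yH' ext by blast
qed

text \<open>Complex numbers have \<open>n\<close>-th roots, so \<open>char_extend\<close> can adjoin
  one element after another; the induction is on the number of elements still missing.\<close>

lemma char_extend_G:
  assumes "subgrp H" "char_on H \<psi>"
  shows "\<exists>\<psi>'\<in>chars. \<forall>x\<in>H. \<psi>' x = \<psi> x"
  using assms
proof (induction "card (G - H)" arbitrary: H \<psi> rule: less_induct)
  case less
  note H = less.prems(1)
  show ?case
  proof (cases "H = G")
    case True
    show ?thesis
      by (rule bexI[of _ "\<lambda>x. if x \<in> G then \<psi> x else 0"])
         (use less.prems True in \<open>auto simp: chars_def char_on_def\<close>)
  next
    case False
    then obtain y where y: "y \<in> G" "y \<notin> H" using H subgrpD(1) by blast
    have ex: "\<exists>n. n > 0 \<and> pw y n \<in> H" using ex_pw_eq_e[OF y(1)] subgrpD(2)[OF H] by metis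
    define n where "n = (LEAST n. n > 0 \<and> pw y n \<in> H)"
    have n: "n > 0" "pw y n \<in> H" using LeastI_ex[OF ex] unfolding n_def by auto
    have min: "pw y k \<notin> H" if "0 < k" "k < n" for k
      using not_less_Least[of k "\<lambda>n. n > 0 \<and> pw y n \<in> H"] that unfolding n_def by auto
    obtain z where z: "z ^ n = \<psi> (pw y n)"
    proof (cases "\<psi> (pw y n) = 0")
      case False
      show ?thesis by (rule that[of "exp (Ln (\<psi> (pw y n)) / n)"]) (use n False in \<open>simp flip: exp_of_nat_mult\<close>)
    qed (use n in \<open>auto intro!: that[of 0]\<close>)
    obtain H' \<psi>' where *: "subgrp H'" "H \<subseteq> H'" "y \<in> H'" "char_on H' \<psi>'" "\<forall>x\<in>H. \<psi>' x = \<psi> x"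
      using char_extend[OF H less.prems(2) y(1) n min z] by blast
    have "card (G - H') < card (G - H)"
      by (rule psubset_card_mono) (use finite_G * y in auto)
    from less.hyps[OF this *(1,4)] obtain \<psi>'' where c: "\<psi>'' \<in> chars" "\<forall>x\<in>H'. \<psi>'' x = \<psi>' x" by blast
    have "\<forall>x\<in>H. \<psi>'' x = \<psi> x" using c(2) *(2,5) by auto
    thus ?thesis using c(1) by blast
  qed
qed

lemma subgrp_trivial: "subgrp {e}"
proof -
  have "e \<odot> b = e \<Longrightarrow> b \<in> G \<Longrightarrow> b = e" for b using unit[of b] by simp
  moreover have "e \<odot> e = e" by simp
  ultimately show ?thesis unfolding subgrp_def by (intro conjI ballI impI) (use e_G in \<open>simp_all del: unit unit_right\<close>)
qed

lemma ex_char_neq_1: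
  assumes x: "x \<in> G" "x \<noteq> e"
  shows "\<exists>\<psi>\<in>chars. \<psi> x \<noteq> 1"
proof -
  have ex: "\<exists>n. n > 0 \<and> pw x n = e" using ex_pw_eq_e[OF x(1)] by auto
  define n where "n = (LEAST n. n > 0 \<and> pw x n = e)"
  have n: "n > 0" "pw x n \<in> {e}" using LeastI_ex[OF ex] unfolding n_def by auto
  have min: "pw x k \<notin> {e}" if "0 < k" "k < n" for k
    using not_less_Least[of k "\<lambda>n. n > 0 \<and> pw x n = e"] that unfolding n_def by auto
  have n1: "n \<noteq> 1" using n x by (auto simp: pw_Suc)
  \<comment> \<open>A primitive root of unity of the order \<open>n\<close> of \<open>x\<close>.
    Over the trivial subgroup the constraint of \<open>char_extend\<close> is just
    \<open>z ^ n = 1\<close>, so \<open>x\<close> may be given the value \<open>z\<close>.\<close>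
  define z where "z = cis (2 * pi / n)"
  have z: "z ^ n = (\<lambda>_. 1) (pw x n)" using n Complex.DeMoivre[of "2 * pi / n" n] unfolding z_def by simp
  have "z \<noteq> 1"
  proof
    assume "z = 1"
    hence "cos (2 * pi / n) = 1" unfolding z_def by (simp add: complex_eq_iff)
    then obtain m :: int where "2 * pi / n = m * 2 * pi" using cos_one_2pi_int by auto
    hence "1 = real_of_int m * n" using n by (simp add: field_simps)
    hence "1 = m * int n" by (metis of_int_1 of_int_eq_iff of_int_mult of_int_of_nat_eq)
    hence "int n dvd 1" by (metis dvd_triv_right)
    thus False using n1 by simp
  qed
  obtain H' \<psi>' where *: "subgrp H'" "x \<in> H'" "char_on H' \<psi>'" "\<psi>' x = z"
    using char_extend[OF subgrp_trivial _ x(1) n min z] by (auto simp: char_on_def)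
  from char_extend_G[OF *(1,3)] show ?thesis using * \<open>z \<noteq> 1\<close> by metis
qed

end

section \<open>Orthogonality relations and the Fourier transform\<close>

context finite_abelian
begin

lemma subgrp_G: "subgrp G"
  unfolding subgrp_def using e_G closed by blast

lemma charsD:
  assumes "\<psi> \<in> chars"
  shows "x \<in> G \<Longrightarrow> y \<in> G \<Longrightarrow> \<psi> (x \<odot> y) = \<psi> x * \<psi> y" "\<psi> e = 1" "x \<notin> G \<Longrightarrow> \<psi> x = 0"
  using assms unfolding chars_def by auto

lemma chars_char_on: "\<psi> \<in> chars \<Longrightarrow> subgrp H \<Longrightarrow> char_on H \<psi>"
  using charsD subgrpD(1) unfolding char_on_def by (metis subsetD)

lemma char_pw: "\<psi> \<in> chars \<Longrightarrow> x \<in> G \<Longrightarrow> \<psi> (pw x k) = \<psi> x ^ k"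
  using char_on_pw[OF subgrp_G chars_char_on[OF _ subgrp_G]] by blast

lemma char_norm:
  assumes "\<psi> \<in> chars" "x \<in> G"
  shows "norm (\<psi> x) = 1"
proof -
  obtain n where n: "n > 0" "pw x n = e" using ex_pw_eq_e assms by blast
  have "\<psi> x ^ n = 1" using char_pw[OF assms, of n] n charsD(2)[OF assms(1)] by simp
  thus ?thesis using n by (metis norm_one norm_power norm_ge_zero power_eq_1_iff gr_implies_not0 abs_norm_cancel real_root_pos_unique power_one zero_le_one)
qed

lemma char_cnj_mult: "\<psi> \<in> chars \<Longrightarrow> x \<in> G \<Longrightarrow> \<psi> x * cnj (\<psi> x) = 1"
  using char_norm by (metis complex_norm_square of_real_1 power_one)

lemma char_mult_chars: "\<psi> \<in> chars \<Longrightarrow> \<phi> \<in> chars \<Longrightarrow> (\<lambda>x. \<psi> x * \<phi> x) \<in> chars"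
  unfolding chars_def by auto

lemma char_cnj_chars: "\<psi> \<in> chars \<Longrightarrow> (\<lambda>x. cnj (\<psi> x)) \<in> chars"
  unfolding chars_def by auto

lemma finite_chars: "finite chars"
proof -
  obtain n where n: "\<And>x. x \<in> G \<Longrightarrow> n x > 0 \<and> pw x (n x) = e" using ex_pw_eq_e by metis
  let ?B = "PiE G (\<lambda>x. {z::complex. z ^ n x = 1})"
  have "finite ?B" using finite_G n by (intro finite_PiE finite_nth_roots) auto
  moreover have "(\<lambda>\<psi>. restrict \<psi> G) ` chars \<subseteq> ?B"
  proof (intro image_subsetI PiE_I)
    fix \<psi> x assume "\<psi> \<in> chars" "x \<in> G"
    thus "restrict \<psi> G x \<in> {z. z ^ n x = 1}" using char_pw[of \<psi> x "n x"] n charsD(2)[of \<psi>] by simp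
  qed auto
  moreover have "inj_on (\<lambda>\<psi>. restrict \<psi> G) chars"
  proof (intro inj_onI ext)
    fix \<psi> \<phi> x assume *: "\<psi> \<in> chars" "\<phi> \<in> chars" "restrict \<psi> G = restrict \<phi> G"
    show "\<psi> x = \<phi> x" using * charsD(3) by (metis restrict_apply')
  qed
  ultimately show ?thesis by (meson finite_subset inj_on_finite)
qed

lemma sum_shift: "y \<in> G \<Longrightarrow> (\<Sum>x\<in>G. f (y \<odot> x)) = (\<Sum>x\<in>G. f x)"
proof (rule sum.reindex_bij_betw)
  assume y: "y \<in> G"
  have inj: "inj_on ((\<odot>) y) G" using cancel[OF y] by (auto simp: inj_on_def)
  moreover have "(\<odot>) y ` G \<subseteq> G" using y by auto
  ultimately show "bij_betw ((\<odot>) y) G G"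
    unfolding bij_betw_def using endo_inj_surj[OF finite_G] by blast
qed

lemma sum_char_on:
  assumes "char_on G \<psi>"
  shows "(\<Sum>x\<in>G. \<psi> x) = (if \<forall>x\<in>G. \<psi> x = 1 then of_nat (card G) else 0)"
proof (cases "\<forall>x\<in>G. \<psi> x = 1")
  case False
  then obtain y where y: "y \<in> G" "\<psi> y \<noteq> 1" by auto
  have "(\<Sum>x\<in>G. \<psi> x) = (\<Sum>x\<in>G. \<psi> (y \<odot> x))" using sum_shift[OF y(1), of \<psi>] by simp
  also have "\<dots> = \<psi> y * (\<Sum>x\<in>G. \<psi> x)" using assms y unfolding char_on_def by (simp add: sum_distrib_left)
  finally show ?thesis using y False by auto
qed auto

lemma one_chars: "(\<lambda>x. if x \<in> G then 1 else 0) \<in> chars"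
  unfolding chars_def by auto

text \<open>Multiplication by a character \<open>\<phi>\<close> with
  \<open>\<phi> x \<noteq> 1\<close> permutes the characters and scales the sum by
  \<open>\<phi> x\<close>.\<close>

lemma sum_chars:
  assumes x: "x \<in> G"
  shows "(\<Sum>\<psi>\<in>chars. \<psi> x) = (if x = e then of_nat (card chars) else 0)"
proof (cases "x = e")
  case True
  have "(\<Sum>\<psi>\<in>chars. \<psi> x) = (\<Sum>\<psi>\<in>chars. 1)" using True charsD(2) by (intro sum.cong refl) blast
  thus ?thesis using True by simp
next
  case False
  then obtain \<phi> where \<phi>: "\<phi> \<in> chars" "\<phi> x \<noteq> 1" using ex_char_neq_1 x by blast
  let ?m = "\<lambda>\<psi> x. \<phi> x * \<psi> x"
  have inj: "inj_on ?m chars"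
  proof (intro inj_onI ext)
    fix \<psi> \<psi>' y assume *: "\<psi> \<in> chars" "\<psi>' \<in> chars" "?m \<psi> = ?m \<psi>'"
    show "\<psi> y = \<psi>' y"
    proof (cases "y \<in> G")
      case True
      hence "\<phi> y \<noteq> 0" using char_norm[OF \<phi>(1), of y] by auto
      thus ?thesis using fun_cong[OF *(3), of y] by simp
    qed (use charsD(3)[OF *(1)] charsD(3)[OF *(2)] in auto)
  qed
  have "?m ` chars = chars"
    by (rule endo_inj_surj[OF finite_chars _ inj]) (use char_mult_chars[OF \<phi>(1)] in auto)
  hence "(\<Sum>\<psi>\<in>chars. \<psi> x) = (\<Sum>\<psi>\<in>chars. ?m \<psi> x)"
    using sum.reindex[OF inj, of "\<lambda>\<psi>. \<psi> x"] by simp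
  also have "\<dots> = \<phi> x * (\<Sum>\<psi>\<in>chars. \<psi> x)" by (simp add: sum_distrib_left)
  finally show ?thesis using \<phi> False by auto
qed

lemma chars_ext: "\<psi> \<in> chars \<Longrightarrow> \<phi> \<in> chars \<Longrightarrow> (\<And>x. x \<in> G \<Longrightarrow> \<psi> x = \<phi> x) \<Longrightarrow> \<psi> = \<phi>"
  using charsD(3) by (metis ext)

text \<open>The double sum of all values \<open>\<psi> x\<close> is evaluated by both orthogonality
  relations.\<close>

lemma card_chars: "card chars = card G"
proof -
  have "(\<Sum>x\<in>G. \<Sum>\<psi>\<in>chars. \<psi> x) = (\<Sum>x\<in>G. if x = e then of_nat (card chars) else 0)"
    by (intro sum.cong refl sum_chars)
  also have "\<dots> = of_nat (card chars)" using finite_G by simp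
  finally have 1: "(\<Sum>x\<in>G. \<Sum>\<psi>\<in>chars. \<psi> x) = of_nat (card chars)" .
  have "(\<Sum>x\<in>G. \<Sum>\<psi>\<in>chars. \<psi> x) = (\<Sum>\<psi>\<in>chars. \<Sum>x\<in>G. \<psi> x)" by (rule sum.swap)
  also have "\<dots> = (\<Sum>\<psi>\<in>chars. if \<psi> = (\<lambda>x. if x \<in> G then 1 else 0) then of_nat (card G) else 0)"
  proof (intro sum.cong refl)
    fix \<psi> assume \<psi>: "\<psi> \<in> chars"
    have "(\<forall>x\<in>G. \<psi> x = 1) \<longleftrightarrow> \<psi> = (\<lambda>x. if x \<in> G then 1 else 0)"
      using chars_ext[OF \<psi> one_chars] by auto
    thus "(\<Sum>x\<in>G. \<psi> x) = (if \<psi> = (\<lambda>x. if x \<in> G then 1 else 0) then of_nat (card G) else 0)"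
      using sum_char_on[OF chars_char_on[OF \<psi> subgrp_G]] by simp
  qed
  also have "\<dots> = of_nat (card G)" using finite_chars one_chars by simp
  finally show ?thesis using 1 by (metis of_nat_eq_iff)
qed

lemma card_G_pos: "card G > 0"
  using finite_G e_G card_gt_0_iff by blast

lemma sum_chars_cnj:
  assumes x: "x \<in> G" "y \<in> G"
  shows "(\<Sum>\<psi>\<in>chars. \<psi> x * cnj (\<psi> y)) = (if x = y then of_nat (card G) else 0)"
proof -
  obtain z where z: "z \<in> G" "y \<odot> z = e" using inverse x by blast
  have "(\<Sum>\<psi>\<in>chars. \<psi> x * cnj (\<psi> y)) = (\<Sum>\<psi>\<in>chars. \<psi> (x \<odot> z))"
  proof (intro sum.cong refl)
    fix \<psi> assume \<psi>: "\<psi> \<in> chars"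
    have "\<psi> y * \<psi> z = 1" using charsD[OF \<psi>] x z by metis
    hence "\<psi> z = cnj (\<psi> y)" using char_cnj_mult[OF \<psi> x(2)]
      by (metis mult_cancel_left mult_zero_left zero_neq_one)
    thus "\<psi> x * cnj (\<psi> y) = \<psi> (x \<odot> z)" using charsD(1)[OF \<psi>] x z by simp
  qed
  also have "\<dots> = (if x \<odot> z = e then of_nat (card G) else 0)" using sum_chars x z card_chars by simp
  also have "x \<odot> z = e \<longleftrightarrow> x = y" using cancel[of z x y] x z comm by metis
  finally show ?thesis .
qed

lemma sum_G_cnj:
  assumes "\<psi> \<in> chars" "\<phi> \<in> chars"
  shows "(\<Sum>x\<in>G. \<psi> x * cnj (\<phi> x)) = (if \<psi> = \<phi> then of_nat (card G) else 0)"
proof -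
  have c: "(\<lambda>x. \<psi> x * cnj (\<phi> x)) \<in> chars"
    using char_mult_chars[OF assms(1) char_cnj_chars[OF assms(2)]] .
  have "(\<forall>x\<in>G. \<psi> x * cnj (\<phi> x) = 1) \<longleftrightarrow> \<psi> = \<phi>"
  proof
    assume *: "\<forall>x\<in>G. \<psi> x * cnj (\<phi> x) = 1"
    show "\<psi> = \<phi>"
    proof (rule chars_ext[OF assms])
      fix x assume x: "x \<in> G"
      thus "\<psi> x = \<phi> x" using * char_cnj_mult[OF assms(2) x]
        by (metis mult_cancel_right mult_zero_right zero_neq_one)
    qed
  qed (use char_cnj_mult assms in auto)
  thus ?thesis using sum_char_on[OF chars_char_on[OF c subgrp_G]] by simp
qed

lemma finite_abelian_subgrp:
  assumes "subgrp H"
  shows "finite_abelian H (\<odot>) e"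
proof
  note H = subgrpD[OF assms]
  show "finite H" using H(1) finite_G finite_subset by blast
  fix x assume "x \<in> H"
  thus "\<exists>y\<in>H. x \<odot> y = e" using inverse H by (metis subsetD)
qed (use subgrpD(1-3)[OF assms] in \<open>auto simp: subset_iff intro: assoc comm\<close>)

text \<open>Twisting by the conjugate of one extension \<open>\<theta>'\<close> turns extending
  \<open>\<theta>\<close> into being trivial on \<open>H\<close>, and orthogonality on
  \<open>H\<close> then counts; without any extension the set is empty. The bound serves twice: for
  the resonant moduli and for the characters trivial on an annihilator.\<close>

lemma card_extensions_le:
  assumes H: "subgrp H"
  shows "card {\<psi>\<in>chars. \<forall>x\<in>H. \<psi> x = \<theta> x} * card H \<le> card G"
proof (cases "{\<psi>\<in>chars. \<forall>x\<in>H. \<psi> x = \<theta> x} = {}")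
  case False
  then obtain \<theta>' where \<theta>': "\<theta>' \<in> chars" "\<forall>x\<in>H. \<theta>' x = \<theta> x" by auto
  interpret H: finite_abelian H "(\<odot>)" e by (rule finite_abelian_subgrp[OF H])
  let ?E = "{\<psi>\<in>chars. \<forall>x\<in>H. \<psi> x = \<theta> x}"
  have HG: "H \<subseteq> G" using subgrpD(1)[OF H] .
  have inner: "(\<Sum>x\<in>H. \<psi> x * cnj (\<theta>' x)) = (if \<psi> \<in> ?E then of_nat (card H) else 0)" if \<psi>: "\<psi> \<in> chars" for \<psi>
  proof -
    have c: "(\<lambda>x. \<psi> x * cnj (\<theta>' x)) \<in> chars"
      using char_mult_chars[OF \<psi> char_cnj_chars[OF \<theta>'(1)]] .
    have "char_on H (\<lambda>x. \<psi> x * cnj (\<theta>' x))" by (rule chars_char_on[OF c H])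
    hence c': "H.char_on H (\<lambda>x. \<psi> x * cnj (\<theta>' x))" unfolding char_on_def H.char_on_def .
    have "(\<forall>x\<in>H. \<psi> x * cnj (\<theta>' x) = 1) \<longleftrightarrow> (\<forall>x\<in>H. \<psi> x = \<theta> x)"
    proof (intro ball_cong refl)
      fix x assume x: "x \<in> H"
      hence "\<theta>' x * cnj (\<theta>' x) = 1" using char_cnj_mult[OF \<theta>'(1)] HG by auto
      thus "\<psi> x * cnj (\<theta>' x) = 1 \<longleftrightarrow> \<psi> x = \<theta> x" using \<theta>'(2) x
        by (metis mult_cancel_right mult_zero_right zero_neq_one)
    qed
    thus ?thesis using H.sum_char_on[OF c'] \<psi> by simp
  qed
  have "of_nat (card ?E * card H) = (\<Sum>\<psi>\<in>chars. if \<psi> \<in> ?E then of_nat (card H) else (0::complex))"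
    using finite_chars by (simp add: sum.If_cases Int_def conj_ac cong: conj_cong)
  also have "\<dots> = (\<Sum>\<psi>\<in>chars. \<Sum>x\<in>H. \<psi> x * cnj (\<theta>' x))" by (intro sum.cong refl inner[symmetric])
  also have "\<dots> = (\<Sum>x\<in>H. \<Sum>\<psi>\<in>chars. \<psi> x * cnj (\<theta>' x))" by (rule sum.swap)
  also have "\<dots> = (\<Sum>x\<in>H. cnj (\<theta>' x) * (if x = e then of_nat (card chars) else 0))"
  proof (intro sum.cong refl)
    fix x assume "x \<in> H"
    hence "(\<Sum>\<psi>\<in>chars. \<psi> x) = (if x = e then of_nat (card chars) else 0)" using HG sum_chars by auto
    thus "(\<Sum>\<psi>\<in>chars. \<psi> x * cnj (\<theta>' x)) = cnj (\<theta>' x) * (if x = e then of_nat (card chars) else 0)"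
      by (simp flip: sum_distrib_right)
  qed
  also have "\<dots> = (\<Sum>x\<in>H. if x = e then of_nat (card G) else 0)"
    using charsD(2)[OF \<theta>'(1)] by (intro sum.cong refl) (auto simp: card_chars)
  also have "\<dots> = of_nat (card G)" using subgrpD(2)[OF H] H.finite_G by (simp only: sum.delta) simp
  finally have "card ?E * card H = card G" by (simp only: of_nat_eq_iff)
  thus ?thesis by simp
next
  case True
  show ?thesis unfolding True by simp
qed

text \<open>Normalised by the order of the group: a function of mean 1 has coefficient 1 at the
  trivial character, and \<open>inversion\<close> carries no factor.\<close>

definition hat :: "('g \<Rightarrow> complex) \<Rightarrow> ('g \<Rightarrow> complex) \<Rightarrow> complex" where
  "hat a \<psi> = (\<Sum>x\<in>G. a x * cnj (\<psi> x)) / of_nat (card G)"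

lemma inversion:
  assumes x: "x \<in> G"
  shows "(\<Sum>\<psi>\<in>chars. hat a \<psi> * \<psi> x) = a x"
proof -
  have "(\<Sum>\<psi>\<in>chars. hat a \<psi> * \<psi> x) = (\<Sum>\<psi>\<in>chars. \<Sum>y\<in>G. a y * (\<psi> x * cnj (\<psi> y))) / of_nat (card G)"
    by (simp add: hat_def sum_divide_distrib sum_distrib_left sum_distrib_right mult_ac)
  also have "(\<Sum>\<psi>\<in>chars. \<Sum>y\<in>G. a y * (\<psi> x * cnj (\<psi> y))) = (\<Sum>y\<in>G. a y * (\<Sum>\<psi>\<in>chars. \<psi> x * cnj (\<psi> y)))"
    by (subst sum.swap) (simp add: sum_distrib_left)
  also have "\<dots> = (\<Sum>y\<in>G. if x = y then a y * of_nat (card G) else 0)"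
    using x by (intro sum.cong refl) (simp add: sum_chars_cnj)
  also have "\<dots> = a x * of_nat (card G)" using x finite_G by simp
  finally show ?thesis using card_G_pos by simp
qed

lemma parseval: "(\<Sum>\<psi>\<in>chars. (norm (hat a \<psi>))\<^sup>2) = (\<Sum>x\<in>G. (norm (a x))\<^sup>2) / card G"
proof -
  have "of_real (\<Sum>\<psi>\<in>chars. (norm (hat a \<psi>))\<^sup>2) = (\<Sum>\<psi>\<in>chars. hat a \<psi> * cnj (hat a \<psi>))"
    by (simp add: complex_norm_square del: of_real_power)
  also have "\<dots> = (\<Sum>\<psi>\<in>chars. hat a \<psi> * ((\<Sum>x\<in>G. cnj (a x) * \<psi> x) / of_nat (card G)))"
    by (simp add: hat_def)
  also have "\<dots> = (\<Sum>x\<in>G. cnj (a x) * (\<Sum>\<psi>\<in>chars. hat a \<psi> * \<psi> x)) / of_nat (card G)"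
    unfolding sum_distrib_left sum_divide_distrib
    by (subst sum.swap) (simp add: mult_ac)
  also have "\<dots> = (\<Sum>x\<in>G. cnj (a x) * a x) / of_nat (card G)"
    by (simp add: inversion)
  also have "\<dots> = of_real ((\<Sum>x\<in>G. (norm (a x))\<^sup>2) / card G)"
    by (simp add: complex_norm_square mult.commute del: of_real_power)
  finally show ?thesis by (metis of_real_eq_iff)
qed

text \<open>The indicator of \<open>x \<odot> y \<odot> z = e\<close> is the mean over all
  characters of \<open>cnj (\<psi> x) * cnj (\<psi> y) * cnj (\<psi> z)\<close>, which separates the
  three variables.\<close>

lemma sum_triples_hat:
  "(\<Sum>x\<in>G. \<Sum>y\<in>G. \<Sum>z\<in>G. if x \<odot> y \<odot> z = e then a x * b y * c z else 0)
    = of_nat (card G) ^ 2 * (\<Sum>\<psi>\<in>chars. hat a \<psi> * hat b \<psi> * hat c \<psi>)"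
proof -
  let ?N = "of_nat (card G) :: complex"
  have N: "?N \<noteq> 0" using card_G_pos by simp
  have ind: "(if x \<odot> y \<odot> z = e then a x * b y * c z else 0) * ?N =
      (\<Sum>\<psi>\<in>chars. (a x * cnj (\<psi> x)) * (b y * cnj (\<psi> y)) * (c z * cnj (\<psi> z)))"
    if "x \<in> G" "y \<in> G" "z \<in> G" for x y z
  proof -
    have "(\<Sum>\<psi>\<in>chars. (a x * cnj (\<psi> x)) * (b y * cnj (\<psi> y)) * (c z * cnj (\<psi> z)))
        = (\<Sum>\<psi>\<in>chars. a x * b y * c z * (\<psi> e * cnj (\<psi> (x \<odot> y \<odot> z))))"
      using that by (intro sum.cong refl) (simp add: charsD(1,2))
    also have "\<dots> = a x * b y * c z * (if e = x \<odot> y \<odot> z then ?N else 0)"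
      using that by (simp add: sum_chars_cnj flip: sum_distrib_left)
    finally show ?thesis by auto
  qed
  have "(\<Sum>x\<in>G. \<Sum>y\<in>G. \<Sum>z\<in>G. if x \<odot> y \<odot> z = e then a x * b y * c z else 0) * ?N
    = (\<Sum>x\<in>G. \<Sum>y\<in>G. \<Sum>z\<in>G. \<Sum>\<psi>\<in>chars. (a x * cnj (\<psi> x)) * (b y * cnj (\<psi> y)) * (c z * cnj (\<psi> z)))"
    unfolding sum_distrib_right by (intro sum.cong refl ind)
  also have "\<dots> = (\<Sum>x\<in>G. \<Sum>y\<in>G. \<Sum>\<psi>\<in>chars. \<Sum>z\<in>G. (a x * cnj (\<psi> x)) * (b y * cnj (\<psi> y)) * (c z * cnj (\<psi> z)))"
    by (intro sum.cong refl sum.swap)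
  also have "\<dots> = (\<Sum>x\<in>G. \<Sum>\<psi>\<in>chars. \<Sum>y\<in>G. \<Sum>z\<in>G. (a x * cnj (\<psi> x)) * (b y * cnj (\<psi> y)) * (c z * cnj (\<psi> z)))"
    by (intro sum.cong refl sum.swap)
  also have "\<dots> = (\<Sum>\<psi>\<in>chars. \<Sum>x\<in>G. \<Sum>y\<in>G. \<Sum>z\<in>G. (a x * cnj (\<psi> x)) * (b y * cnj (\<psi> y)) * (c z * cnj (\<psi> z)))"
    by (rule sum.swap)
  also have "\<dots> = (\<Sum>\<psi>\<in>chars. (\<Sum>x\<in>G. a x * cnj (\<psi> x)) * (\<Sum>y\<in>G. b y * cnj (\<psi> y)) * (\<Sum>z\<in>G. c z * cnj (\<psi> z)))"
    by (intro sum.cong refl) (simp flip: sum_distrib_left sum_distrib_right)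
  also have "\<dots> = (\<Sum>\<psi>\<in>chars. (hat a \<psi> * ?N) * (hat b \<psi> * ?N) * (hat c \<psi> * ?N))"
    using N by (simp add: hat_def)
  also have "\<dots> = (?N ^ 2 * (\<Sum>\<psi>\<in>chars. hat a \<psi> * hat b \<psi> * hat c \<psi>)) * ?N"
    by (simp add: sum_distrib_left sum_distrib_right power2_eq_square mult_ac)
  finally show ?thesis using N by simp
qed

end

section \<open>Zero-sum triples in dense sets\<close>

text \<open>\<open>P\<close> plays the set of popular sums. By Markov's inequality all but
  \<open>N / 100\<close> elements \<open>a\<close> of \<open>A\<close> send almost all of
  \<open>B\<close> into \<open>P\<close>. Two such translates of \<open>B\<close> each have at least
  \<open>0.44 * N\<close> points in a set of at most \<open>0.5501 * N\<close>, so they share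
  \<open>0.3299 * N\<close> points, and a common point represents \<open>a - a'\<close> as a
  difference in \<open>B\<close>.\<close>

lemma popular_half:
  fixes V A B P :: "'b::ab_group_add set" and N :: real
  assumes V: "finite V" "\<And>x y. x \<in> V \<Longrightarrow> y \<in> V \<Longrightarrow> x + y \<in> V"
    and N: "N = card V" "N > 0"
    and sub: "A \<subseteq> V" "B \<subseteq> V" "P \<subseteq> V"
    and P: "card P \<le> (5501 / 10000) * N"
    and out: "card {(a, b) \<in> A \<times> B. a + b \<notin> P} \<le> N\<^sup>2 / 10000"
    and A: "card A \<ge> (45 / 100) * N" and B: "card B \<ge> (45 / 100) * N"
  obtains A' where "A' \<subseteq> A" "card A' \<ge> (44 / 100) * N" "card A - card A' \<le> N / 100" "card B \<le> (5601 / 10000) * N"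
    "\<And>a a'. a \<in> A' \<Longrightarrow> a' \<in> A' \<Longrightarrow> card {b\<in>B. b + (a - a') \<in> B} \<ge> (3299 / 10000) * N"
proof
  have fin: "finite A" "finite B" "finite P" using sub V(1) by (auto intro: finite_subset)
  let ?g = "\<lambda>a. card {b\<in>B. a + b \<notin> P}"
  define A' where "A' = {a\<in>A. ?g a \<le> N / 100}"
  have A'A: "A' \<subseteq> A" unfolding A'_def by auto
  have finA': "finite A'" using A'A fin finite_subset by auto
  have "{(a, b) \<in> A \<times> B. a + b \<notin> P} = Sigma A (\<lambda>a. {b\<in>B. a + b \<notin> P})" by auto
  hence "(\<Sum>a\<in>A. real (?g a)) \<le> N\<^sup>2 / 10000"
    using out fin by (simp add: card_SigmaI)
  moreover have "(\<Sum>a\<in>A. real (?g a)) \<ge> (\<Sum>a\<in>A - A'. N / 100)"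
  proof -
    have "(\<Sum>a\<in>A - A'. N / 100) \<le> (\<Sum>a\<in>A - A'. real (?g a))"
      by (intro sum_mono) (auto simp: A'_def)
    also have "\<dots> \<le> (\<Sum>a\<in>A. real (?g a))" using fin by (intro sum_mono2) auto
    finally show ?thesis .
  qed
  moreover have "N\<^sup>2 / 10000 = (N / 100) * (N / 100)" by (simp add: power2_eq_square)
  ultimately have "(\<Sum>a\<in>A - A'. N / 100) \<le> (N / 100) * (N / 100)" by linarith
  hence "card (A - A') * (N / 100) \<le> (N / 100) * (N / 100)" by simp
  hence bad: "card (A - A') \<le> N / 100" using N by simp
  have dif: "card (A - A') = card A - card A'" using card_Diff_subset[OF finA' A'A] .
  have le: "card A' \<le> card A" using card_mono[OF fin(1) A'A] .
  show "real (card A' ) \<ge> (44 / 100) * N" using bad dif le A by linarith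
  show "real (card A - card A') \<le> N / 100" using bad dif by simp
  show "A' \<subseteq> A" by fact
  have good: "card {p\<in>P. p - a \<in> B} \<ge> card B - N / 100" if a: "a \<in> A'" for a
  proof -
    have "inj_on (\<lambda>b. a + b) {b\<in>B. a + b \<in> P}" by (auto simp: inj_on_def)
    hence "card {b\<in>B. a + b \<in> P} = card ((\<lambda>b. a + b) ` {b\<in>B. a + b \<in> P})" by (simp add: card_image)
    also have "\<dots> \<le> card {p\<in>P. p - a \<in> B}" using fin by (intro card_mono) auto
    finally have 1: "card {b\<in>B. a + b \<in> P} \<le> card {p\<in>P. p - a \<in> B}" .
    have "B = {b\<in>B. a + b \<in> P} \<union> {b\<in>B. a + b \<notin> P}" by auto
    hence "card B \<le> card {b\<in>B. a + b \<in> P} + ?g a" by (metis card_Un_le)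
    moreover have "?g a \<le> N / 100" using a by (simp add: A'_def)
    ultimately show ?thesis using 1 by linarith
  qed
  have "A' \<noteq> {}" using \<open>real (card A' ) \<ge> (44 / 100) * N\<close> N by auto
  then obtain a0 where "a0 \<in> A'" by auto
  have "card {p\<in>P. p - a0 \<in> B} \<le> card P" using fin by (intro card_mono) auto
  thus "card B \<le> (5601 / 10000) * N" using good[OF \<open>a0 \<in> A'\<close>] P N by linarith
  fix a a' assume a: "a \<in> A'" "a' \<in> A'"
  let ?X = "{p\<in>P. p - a \<in> B}" and ?Y = "{p\<in>P. p - a' \<in> B}"
  have "card (?X \<union> ?Y) \<le> card P" using fin by (intro card_mono) auto
  moreover have "card ?X + card ?Y = card (?X \<union> ?Y) + card (?X \<inter> ?Y)"
    using fin by (intro card_Un_Int) auto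
  ultimately have "card (?X \<inter> ?Y) \<ge> (3299 / 10000) * N"
    using good[OF a(1)] good[OF a(2)] P B N by linarith
  moreover have "card (?X \<inter> ?Y) \<le> card {b\<in>B. b + (a - a') \<in> B}"
  proof (rule card_inj_on_le)
    show "inj_on (\<lambda>p. p - a) (?X \<inter> ?Y)" by (auto simp: inj_on_def)
  qed (use fin in auto)
  ultimately show "card {b\<in>B. b + (a - a') \<in> B} \<ge> (3299 / 10000) * N" by linarith
qed

text \<open>A robust form of Kneser's theorem for three sets of density nearly \<open>1/2\<close>: by the
  popularity of the sums, the difference sets of two of them coincide with a subgroup, which has
  density above \<open>1/3\<close> and hence, the order being odd, is everything.\<close>

lemma many_zero_sum_triples:
  fixes V A B C :: "'b::comm_ring_1 set"
  assumes V: "finite V" "0 \<in> V" "\<And>x y. x \<in> V \<Longrightarrow> y \<in> V \<Longrightarrow> x - y \<in> V"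
    and half: "of_nat k * 2 = (1::'b)"
    and sub: "A \<subseteq> V" "B \<subseteq> V" "C \<subseteq> V"
    and dens: "card A \<ge> (45 / 100) * card V" "card B \<ge> (45 / 100) * card V" "card C \<ge> (45 / 100) * card V"
  shows "card {(x, y) \<in> A \<times> B. - (x + y) \<in> C} \<ge> (card V)\<^sup>2 / 100000000"
proof (rule ccontr)
  assume neg: "\<not> ?thesis"
  have Vm: "- x \<in> V" if "x \<in> V" for x using V(3)[OF V(2) that] by simp
  have Vp: "x + y \<in> V" if "x \<in> V" "y \<in> V" for x y using V(3)[OF that(1) Vm[OF that(2)]] by simp
  define N where "N = real (card V)"
  have N: "N > 0" unfolding N_def using V by (auto simp: card_gt_0_iff)
  have fin: "finite A" "finite B" "finite C" using sub V(1) by (auto intro: finite_subset)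
  let ?R = "\<lambda>s. {(x, y) \<in> A \<times> B. x + y = s}"
  define r where "r s = card (?R s)" for s
  \<comment> \<open>The threshold for a popular sum is the square root of the count to be refuted.
    Too few zero-sum triples force \<open>P\<close> to meet \<open>- C\<close> in fewer than
    \<open>N / 10000\<close> points, hence \<open>P\<close> has at most \<open>0.5501 * N\<close>
    elements.\<close>
  define P where "P = {s\<in>V. r s \<ge> N / 10000}"
  have PV: "P \<subseteq> V" and finP: "finite P" unfolding P_def using V by auto
  have finR: "finite (?R s)" for s by (rule finite_subset[of _ "A \<times> B"]) (use fin in auto)
  have cnt: "card {(x, y) \<in> A \<times> B. x + y \<in> S} = (\<Sum>s\<in>S. r s)" if "finite S" for S
  proof -
    have "{(x, y) \<in> A \<times> B. x + y \<in> S} = (\<Union>s\<in>S. ?R s)" by auto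
    moreover have "card (\<Union>s\<in>S. ?R s) = (\<Sum>s\<in>S. r s)" unfolding r_def
      by (rule card_UN_disjoint) (use that finR in auto)
    ultimately show ?thesis by simp
  qed
  let ?C = "{s\<in>V. - s \<in> C}"
  have cC: "card ?C \<ge> card C"
    by (rule card_inj_on_le[of uminus]) (use V sub Vm in auto)
  have ABV: "x + y \<in> V" if "x \<in> A" "y \<in> B" for x y using Vp that sub by blast
  have "{(x, y) \<in> A \<times> B. - (x + y) \<in> C} = {(x, y) \<in> A \<times> B. x + y \<in> ?C}"
    using ABV by auto
  hence "real (\<Sum>s\<in>?C. r s) < N\<^sup>2 / 100000000" using neg cnt[of ?C] V unfolding N_def by simp
  moreover have "real (\<Sum>s\<in>?C. r s) \<ge> (\<Sum>s\<in>P \<inter> ?C. N / 10000)"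
  proof -
    have "(\<Sum>s\<in>P \<inter> ?C. N / 10000) \<le> (\<Sum>s\<in>P \<inter> ?C. real (r s))"
      by (intro sum_mono) (auto simp: P_def)
    also have "\<dots> \<le> (\<Sum>s\<in>?C. real (r s))" using V by (intro sum_mono2) auto
    finally show ?thesis by simp
  qed
  moreover have "N\<^sup>2 / 100000000 = (N / 10000) * (N / 10000)" by (simp add: power2_eq_square)
  ultimately have "(\<Sum>s\<in>P \<inter> ?C. N / 10000) < (N / 10000) * (N / 10000)" by linarith
  hence "card (P \<inter> ?C) * (N / 10000) < (N / 10000) * (N / 10000)" by simp
  hence "card (P \<inter> ?C) < N / 10000" using N by (simp add: mult_less_cancel_right)
  moreover have "card P + card ?C = card (P \<union> ?C) + card (P \<inter> ?C)"
    using finP V by (intro card_Un_Int) auto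
  moreover have "card (P \<union> ?C) \<le> card V" using V PV by (intro card_mono) auto
  ultimately have cP: "card P \<le> (5501 / 10000) * N" using cC dens(3) unfolding N_def by linarith
  have out: "card {(a, b) \<in> A \<times> B. a + b \<notin> P} \<le> N\<^sup>2 / 10000"
  proof -
    have "{(a, b) \<in> A \<times> B. a + b \<notin> P} = {(a, b) \<in> A \<times> B. a + b \<in> V - P}" using ABV by auto
    hence "real (card {(a, b) \<in> A \<times> B. a + b \<notin> P}) = (\<Sum>s\<in>V - P. real (r s))"
      using cnt[of "V - P"] V by simp
    also have "\<dots> \<le> (\<Sum>s\<in>V - P. N / 10000)" by (intro sum_mono) (auto simp: P_def)
    also have "\<dots> \<le> (\<Sum>s\<in>V. N / 10000)" using V N by (intro sum_mono2) auto
    finally show ?thesis by (simp add: N_def power2_eq_square)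
  qed
  have out': "card {(b, a) \<in> B \<times> A. b + a \<notin> P} \<le> N\<^sup>2 / 10000"
  proof -
    have "card {(b, a) \<in> B \<times> A. b + a \<notin> P} = card {(a, b) \<in> A \<times> B. a + b \<notin> P}"
      by (rule bij_betw_same_card[of prod.swap]) (auto simp: bij_betw_def inj_on_def image_def add.commute)
    thus ?thesis using out by simp
  qed
  obtain A' where A': "A' \<subseteq> A" "card A' \<ge> (44 / 100) * N" "card A - card A' \<le> N / 100" "card B \<le> (5601 / 10000) * N"
    "\<And>a a'. a \<in> A' \<Longrightarrow> a' \<in> A' \<Longrightarrow> card {b\<in>B. b + (a - a') \<in> B} \<ge> (3299 / 10000) * N"
    by (rule popular_half[of V N A B P]) (use V Vp N N_def sub PV cP out dens in auto)
  obtain B' where B': "B' \<subseteq> B" "card B' \<ge> (44 / 100) * N" "card B - card B' \<le> N / 100" "card A \<le> (5601 / 10000) * N"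
    "\<And>a a'. a \<in> B' \<Longrightarrow> a' \<in> B' \<Longrightarrow> card {b\<in>A. b + (a - a') \<in> A} \<ge> (3299 / 10000) * N"
    by (rule popular_half[of V N B A P]) (use V Vp N N_def sub PV cP out' dens in auto)
  \<comment> \<open>\<open>x\<close> and \<open>y\<close> have \<open>0.3299 * N\<close>
    representations in \<open>B\<close>, hence \<open>0.3099 * N\<close> in \<open>B'\<close>, as
    either end may fall among the \<open>N / 100\<close> removed points. Both families lie in a set
    of at most \<open>0.5601 * N\<close> points, so they meet, and a common \<open>b\<close> gives
    \<open>x - y = (b - y) - (b - x)\<close>.\<close>
  have key: "\<exists>b\<in>B'. \<exists>b'\<in>B'. x - y = b - b'"
    if B: "finite B" "B' \<subseteq> B" "card B - card B' \<le> N / 100" "card B \<le> (5601 / 10000) * N"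
      and x: "card {b\<in>B. b + x \<in> B} \<ge> (3299 / 10000) * N" and y: "card {b\<in>B. b + y \<in> B} \<ge> (3299 / 10000) * N"
    for B B' :: "'b set" and x y
  proof -
    have fB': "finite B'" using B finite_subset by auto
    have dd: "card (B - B') \<le> N / 100" using card_Diff_subset[OF fB' B(2)] B(3) by simp
    have *: "card {b\<in>B'. b - z \<in> B'} \<ge> (3099 / 10000) * N" if z: "card {b\<in>B. b + z \<in> B} \<ge> (3299 / 10000) * N" for z
    proof -
      have "{b\<in>B. b + z \<in> B} \<subseteq> (\<lambda>b. b - z) ` {b\<in>B'. b - z \<in> B'} \<union> (B - B') \<union> (\<lambda>b. b - z) ` (B - B')"
        (is "_ \<subseteq> ?U")
      proof
        fix b assume "b \<in> {b\<in>B. b + z \<in> B}"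
        hence b: "b \<in> B" "b + z \<in> B" by auto
        have "b = (b + z) - z" by simp
        thus "b \<in> ?U" using b by (cases "b \<in> B'"; cases "b + z \<in> B'") (auto intro: image_eqI[where x = "b + z"])
      qed
      hence "card {b\<in>B. b + z \<in> B} \<le> card ?U" using B fB' by (intro card_mono) auto
      also have "\<dots> \<le> card ((\<lambda>b. b - z) ` {b\<in>B'. b - z \<in> B'}) + card (B - B') + card ((\<lambda>b. b - z) ` (B - B'))"
        by (meson add_le_cancel_right card_Un_le le_trans)
      also have "\<dots> \<le> card {b\<in>B'. b - z \<in> B'} + card (B - B') + card (B - B')"
        using B fB' by (intro add_mono card_image_le) auto
      finally show ?thesis using dd z N by linarith
    qed
    let ?X = "{b\<in>B'. b - x \<in> B'}" and ?Y = "{b\<in>B'. b - y \<in> B'}"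
    have "card (?X \<union> ?Y) \<le> card B" using B fB' by (intro card_mono) auto
    moreover have "card ?X + card ?Y = card (?X \<union> ?Y) + card (?X \<inter> ?Y)"
      using fB' by (intro card_Un_Int) auto
    ultimately have "card (?X \<inter> ?Y) > 0" using *[OF x] *[OF y] B(4) N by linarith
    then obtain b where "b \<in> ?X \<inter> ?Y" by (metis card_gt_0_iff ex_in_conv)
    hence "b - x \<in> B'" "b - y \<in> B'" "x - y = (b - y) - (b - x)" by auto
    thus ?thesis by blast
  qed
  define D where "D = {a - a' | a a'. a \<in> A' \<and> a' \<in> A'}"
  define E where "E = {b - b' | b b'. b \<in> B' \<and> b' \<in> B'}"
  \<comment> \<open>Differences of elements of one difference set lie in the other. As 0 is in both,
    \<open>E\<close> is contained in \<open>D\<close> and \<open>D\<close> is closed under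
    subtraction.\<close>
  have DE: "x - y \<in> E" if "x \<in> D" "y \<in> D" for x y
    using key[of B B' x y] fin B' A' that unfolding D_def E_def by blast
  have ED: "x - y \<in> D" if "x \<in> E" "y \<in> E" for x y
    using key[of A A' x y] fin B' A' that unfolding D_def E_def by blast
  have ne: "A' \<noteq> {}" "B' \<noteq> {}" using A'(2) B'(2) N by auto
  have 0: "0 \<in> D" "0 \<in> E" using ne unfolding D_def E_def by force+
  have "E \<subseteq> D" using ED 0 by (metis diff_zero subsetI)
  hence DD: "x - y \<in> D" if "x \<in> D" "y \<in> D" for x y using DE that by auto
  have Dm: "- x \<in> D" if "x \<in> D" for x using DD[OF 0(1) that] by simp
  have Dp: "x + y \<in> D" if "x \<in> D" "y \<in> D" for x y using DD[OF that(1) Dm[OF that(2)]] by simp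
  have DV: "D \<subseteq> V" unfolding D_def using A'(1) sub V(3) by blast
  have finD: "finite D" by (rule finite_subset[OF DV V(1)])
  have cD: "card D \<ge> (44 / 100) * N"
  proof -
    obtain a0 where a0: "a0 \<in> A'" using ne by auto
    have "card A' \<le> card D"
      by (rule card_inj_on_le[of "\<lambda>a. a - a0"]) (use a0 finD in \<open>auto simp: D_def inj_on_def\<close>)
    thus ?thesis using A'(2) by linarith
  qed
  \<comment> \<open>An element \<open>v\<close> outside the subgroup \<open>D\<close> whose double
    is outside as well gives three disjoint cosets, too many for density 0.44. The double is outside
    because \<open>half\<close> recovers \<open>v\<close> from \<open>v + v\<close>.\<close>
  have "D = V"
  proof (rule ccontr)
    assume "D \<noteq> V"
    then obtain v where v: "v \<in> V" "v \<notin> D" using DV by auto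
    have v2: "v + v \<notin> D"
    proof
      assume a: "v + v \<in> D"
      have "of_nat j * (v + v) \<in> D" for j
        by (induction j) (use 0 Dp a in \<open>auto simp: algebra_simps\<close>)
      moreover have "of_nat k * (v + v) = (of_nat k * 2) * v" by (simp add: algebra_simps)
      ultimately have "v \<in> D" unfolding half by (metis mult_1)
      thus False using v by simp
    qed
    let ?D1 = "(\<lambda>d. d + v) ` D" and ?D2 = "(\<lambda>d. d + (v + v)) ` D"
    have d1: "D \<inter> ?D1 = {}"
    proof (rule ccontr)
      assume "D \<inter> ?D1 \<noteq> {}"
      then obtain d where "d \<in> D" "d + v \<in> D" by auto
      from DD[OF this(2,1)] show False using v by simp
    qed
    have d2: "D \<inter> ?D2 = {}"
    proof (rule ccontr)
      assume "D \<inter> ?D2 \<noteq> {}"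
      then obtain d where "d \<in> D" "d + (v + v) \<in> D" by auto
      from DD[OF this(2,1)] show False using v2 by simp
    qed
    have d3: "?D1 \<inter> ?D2 = {}"
    proof (rule ccontr)
      assume "?D1 \<inter> ?D2 \<noteq> {}"
      then obtain x where "x \<in> ?D1" "x \<in> ?D2" by blast
      then obtain d d' where "d \<in> D" "d' \<in> D" and x: "x = d + v" "x = d' + (v + v)" by blast
      have "d - d' = v" using x by (metis add_diff_cancel_left' add_diff_eq add.commute diff_add_cancel)
      thus False using DD[OF \<open>d \<in> D\<close> \<open>d' \<in> D\<close>] v by simp
    qed
    have "card ?D1 = card D" "card ?D2 = card D" by (auto intro!: card_image simp: inj_on_def)
    moreover have "card (D \<union> ?D1 \<union> ?D2) = card D + card ?D1 + card ?D2"
      using d1 d2 d3 finD by (subst card_Un_disjoint; simp add: Int_Un_distrib2 card_Un_disjoint)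
    moreover have "card (D \<union> ?D1 \<union> ?D2) \<le> card V"
    proof (intro card_mono V(1))
      show "D \<union> ?D1 \<union> ?D2 \<subseteq> V" using DV v Vp by blast
    qed
    ultimately have "3 * card D \<le> card V" by simp
    hence "3 * real (card D) \<le> N" unfolding N_def by linarith
    thus False using cD N by linarith
  qed
  have finV: "finite V" by (rule V(1))
  \<comment> \<open>Now every \<open>x\<close> in \<open>V\<close> has \<open>0.3299 * N\<close>
    representations as a difference in \<open>B\<close>, whereas the number of pairs in
    \<open>B\<close> is at most \<open>0.5601 * 0.5601\<close>, about 0.3137, times the square of
    \<open>N\<close>.\<close>
  have "(\<Sum>x\<in>V. real (card {b\<in>B. b + x \<in> B})) \<ge> (\<Sum>x\<in>V. (3299 / 10000) * N)"
    by (intro sum_mono) (use A'(5) \<open>D = V\<close> in \<open>auto simp: D_def\<close>)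
  moreover have "(\<Sum>x\<in>V. real (card {b\<in>B. b + x \<in> B})) \<le> (real (card B))\<^sup>2"
  proof -
    have "(\<Sum>x\<in>V. card {b\<in>B. b + x \<in> B}) = card (Sigma V (\<lambda>x. {b\<in>B. b + x \<in> B}))"
      using V fin by (simp add: card_SigmaI)
    also have "\<dots> \<le> card (B \<times> B)"
      by (rule card_inj_on_le[of "\<lambda>(x, b). (b, b + x)"]) (use fin in \<open>auto simp: inj_on_def\<close>)
    finally show ?thesis by (simp add: card_cartesian_product power2_eq_square flip: of_nat_sum of_nat_mult)
  qed
  moreover have "(real (card B))\<^sup>2 \<le> ((5601 / 10000) * N)\<^sup>2" using A'(4) by (intro power_mono) auto
  moreover have "(\<Sum>x\<in>V. (3299 / 10000) * N) = (3299 / 10000) * N * N" by (simp add: N_def)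
  ultimately have "(3299 / 10000) * N * N \<le> ((5601 / 10000) * N)\<^sup>2" by linarith
  moreover have "((5601 / 10000) * N)\<^sup>2 < (3299 / 10000) * N * N" using N by (simp add: power2_eq_square)
  ultimately show False by linarith
qed

section \<open>Polynomials over a finite field\<close>

text \<open>Vanishing coefficients instead of a bound on \<open>degree\<close> include the zero
  polynomial for every \<open>M\<close> and make this visibly an additive group.\<close>

definition polys_below :: "nat \<Rightarrow> 'a::{field,finite} poly set" where
  "polys_below M = {p. \<forall>i\<ge>M. coeff p i = 0}"

definition pnorm :: "'a::{field,finite} poly \<Rightarrow> real" where
  "pnorm p = real CARD('a) ^ degree p"

lemma polys_below_degree: "p \<in> polys_below M \<longleftrightarrow> p = 0 \<or> degree p < M"
proof (cases "p = 0")
  case False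
  hence "coeff p (degree p) \<noteq> 0" by simp
  hence "\<not> M \<le> degree p" if "p \<in> polys_below M" using that unfolding polys_below_def by blast
  moreover have "p \<in> polys_below M" if "degree p < M" using that unfolding polys_below_def by (simp add: coeff_eq_0)
  ultimately show ?thesis using False by (meson not_le)
qed (simp add: polys_below_def)

lemma polys_below_0 [simp]: "0 \<in> polys_below M"
  and polys_below_add: "p \<in> polys_below M \<Longrightarrow> r \<in> polys_below M \<Longrightarrow> p + r \<in> polys_below M"
  and polys_below_diff: "p \<in> polys_below M \<Longrightarrow> r \<in> polys_below M \<Longrightarrow> p - r \<in> polys_below M"
  and polys_below_uminus: "p \<in> polys_below M \<Longrightarrow> - p \<in> polys_below M"
  by (auto simp: polys_below_def)

lemma polys_below_mono: "M \<le> M' \<Longrightarrow> polys_below M \<subseteq> polys_below M'"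
  by (auto simp: polys_below_def)

lemma polys_below_mult:
  assumes "v \<in> polys_below d" "degree k + d \<le> M"
  shows "k * v \<in> polys_below M"
proof (cases "k = 0 \<or> v = 0")
  case False
  hence "degree v < d" using assms(1) unfolding polys_below_degree by blast
  moreover have "degree (k * v) = degree k + degree v" using False degree_mult_eq by blast
  ultimately have "degree (k * v) < M" using assms(2) by linarith
  thus ?thesis unfolding polys_below_degree by blast
next
  case True
  hence "k * v = 0" by auto
  thus ?thesis by (metis polys_below_0)
qed

lemma polys_below_Suc:
  "polys_below (Suc M) = (\<lambda>(a, p). pCons a p) ` (UNIV \<times> polys_below M)"
proof (intro set_eqI iffI)
  fix p :: "'a poly" assume p: "p \<in> polys_below (Suc M)"
  obtain a p' where p': "p = pCons a p'" by (cases p)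
  have "coeff p' i = 0" if "i \<ge> M" for i
  proof -
    have "coeff p (Suc i) = 0" using p that unfolding polys_below_def by blast
    thus ?thesis unfolding p' by simp
  qed
  hence "p' \<in> polys_below M" unfolding polys_below_def by blast
  thus "p \<in> (\<lambda>(a, p). pCons a p) ` (UNIV \<times> polys_below M)" unfolding p' by force
next
  fix p :: "'a poly" assume "p \<in> (\<lambda>(a, p). pCons a p) ` (UNIV \<times> polys_below M)"
  then obtain a p' where p': "p = pCons a p'" "p' \<in> polys_below M" by auto
  have "coeff p i = 0" if "i \<ge> Suc M" for i
    using p' that by (cases i) (auto simp: polys_below_def)
  then show "p \<in> polys_below (Suc M)" unfolding polys_below_def by blast
qed

lemma finite_card_polys_below:
  "finite (polys_below M :: 'a::{field,finite} poly set) \<and> card (polys_below M :: 'a poly set) = CARD('a) ^ M"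
proof (induction M)
  case 0
  have "polys_below 0 = {0 :: 'a poly}" by (auto simp: polys_below_degree)
  thus ?case by simp
next
  case (Suc M)
  have "inj_on (\<lambda>(a, p). pCons a p) (UNIV \<times> (polys_below M :: 'a poly set))" by (auto simp: inj_on_def)
  thus ?case using Suc by (simp add: polys_below_Suc card_image card_cartesian_product)
qed

lemma finite_polys_below [simp]: "finite (polys_below M)"
  and card_polys_below: "card (polys_below M :: 'a::{field,finite} poly set) = CARD('a) ^ M"
  using finite_card_polys_below by blast+

lemma card_field_ge_2: "CARD('a::{field,finite}) \<ge> 2"
proof -
  have "card {0, 1::'a} \<le> CARD('a)" by (intro card_mono) auto
  thus ?thesis by simp
qed

lemma polys_below_group: "finite_abelian (polys_below M :: 'a::{field,finite} poly set) (+) 0"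
proof
  fix x :: "'a poly" assume "x \<in> polys_below M"
  thus "\<exists>y\<in>polys_below M. x + y = 0" by (intro bexI[of _ "- x"]) (auto simp: polys_below_uminus)
qed (auto simp: polys_below_add add_ac)

lemma mod_in_polys_below: "P \<noteq> 0 \<Longrightarrow> n mod P \<in> polys_below (degree P)"
  using degree_mod_less[of P n] by (auto simp: polys_below_degree)

lemma sum_polys_below_shift:
  assumes "v \<in> polys_below M"
  shows "(\<Sum>m\<in>polys_below M. f (m + v)) = (\<Sum>m\<in>polys_below M. f m)"
  by (rule sum.reindex_bij_witness[of _ "\<lambda>m. m - v" "\<lambda>m. m + v"])
     (use assms in \<open>auto simp: polys_below_add polys_below_diff\<close>)

lemma irreducible_prime_elem: "irreducible (P :: 'a::field poly) \<Longrightarrow> prime_elem P"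
  by (rule field_poly_irreducible_imp_prime)

lemma irreducible_degree_pos: "irreducible (P :: 'a::field poly) \<Longrightarrow> degree P > 0"
proof -
  assume P: "irreducible P"
  have "P \<noteq> 0" using P by auto
  thus ?thesis using is_unit_iff_degree[of P] irreducible_not_unit[OF P] by simp
qed

lemma dvd_polys_below: "P dvd v \<Longrightarrow> v \<in> polys_below (degree P) \<Longrightarrow> v = 0"
  using dvd_imp_degree_le[of P v] unfolding polys_below_degree by linarith

lemma bij_mod_prime:
  fixes P :: "'a::{field,finite} poly"
  assumes P: "irreducible P" and K: "\<not> P dvd K"
  shows "bij_betw (\<lambda>v. (s + K * v) mod P) (polys_below (degree P)) (polys_below (degree P))"
proof -
  have P0: "P \<noteq> 0" using P by auto
  have "inj_on (\<lambda>v. (s + K * v) mod P) (polys_below (degree P))"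
  proof (rule inj_onI)
    fix v v' assume *: "v \<in> polys_below (degree P)" "v' \<in> polys_below (degree P)" "(s + K * v) mod P = (s + K * v') mod P"
    have "P dvd (s + K * v) - (s + K * v')" using *(3) by (simp add: mod_eq_dvd_iff)
    hence "P dvd K * (v - v')" by (simp add: algebra_simps)
    hence "P dvd v - v'" using K irreducible_prime_elem[OF P] by (simp add: prime_elem_dvd_mult_iff)
    thus "v = v'" using dvd_polys_below[of P "v - v'"] * by (simp add: polys_below_diff)
  qed
  moreover have "(\<lambda>v. (s + K * v) mod P) ` polys_below (degree P) \<subseteq> polys_below (degree P)"
    using mod_in_polys_below[OF P0] by auto
  ultimately show ?thesis by (simp add: bij_betw_def endo_inj_surj)
qed

text \<open>Shifting \<open>m\<close> by \<open>K * v\<close> leaves \<open>G\<close> alone and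
  moves \<open>r + W * m\<close> through all residues modulo \<open>P\<close>, as \<open>P\<close>
  does not divide \<open>W * K\<close>. Averaging over \<open>v\<close> replaces \<open>h\<close> by
  its mean: the Chinese remainder theorem in analytic form.\<close>

lemma sum_periodic_prime:
  fixes P :: "'a::{field,finite} poly" and h G :: "'a poly \<Rightarrow> 'c::comm_ring_1"
  assumes P: "irreducible P" and K: "\<not> P dvd K" "degree K + degree P \<le> M" and W: "\<not> P dvd W"
    and h: "\<And>x. h x = h (x mod P)"
    and G: "\<And>m v. m \<in> polys_below M \<Longrightarrow> v \<in> polys_below (degree P) \<Longrightarrow> G (m + K * v) = G m"
  shows "of_nat (CARD('a) ^ degree P) * (\<Sum>m\<in>polys_below M. h (r + W * m) * G m)
    = (\<Sum>x\<in>polys_below (degree P). h x) * (\<Sum>m\<in>polys_below M. G m)"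
proof -
  let ?V = "polys_below M :: 'a poly set" and ?U = "polys_below (degree P) :: 'a poly set"
  have WK: "\<not> P dvd W * K" using W K irreducible_prime_elem[OF P] by (simp add: prime_elem_dvd_mult_iff)
  have "of_nat (CARD('a) ^ degree P) * (\<Sum>m\<in>?V. h (r + W * m) * G m) = (\<Sum>v\<in>?U. \<Sum>m\<in>?V. h (r + W * m) * G m)"
    by (simp add: card_polys_below)
  also have "\<dots> = (\<Sum>v\<in>?U. \<Sum>m\<in>?V. h (r + W * (m + K * v)) * G (m + K * v))"
    by (intro sum.cong refl sum_polys_below_shift[symmetric, of "K * v" M "\<lambda>m. h (r + W * m) * G m" for v])
       (use polys_below_mult K in auto)
  also have "\<dots> = (\<Sum>v\<in>?U. \<Sum>m\<in>?V. h ((r + W * m) + (W * K) * v) * G m)"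
    by (intro sum.cong refl arg_cong2[where f = "(*)"] arg_cong[where f = h] G) (simp_all add: algebra_simps)
  also have "\<dots> = (\<Sum>m\<in>?V. (\<Sum>v\<in>?U. h (((r + W * m) + (W * K) * v) mod P)) * G m)"
    by (subst sum.swap) (simp add: sum_distrib_right flip: h)
  also have "\<dots> = (\<Sum>m\<in>?V. (\<Sum>x\<in>?U. h x) * G m)"
    by (intro sum.cong refl arg_cong2[where f = "(*)"] sum.reindex_bij_betw[OF bij_mod_prime[OF P WK]])
  finally show ?thesis by (simp add: sum_distrib_left)
qed

lemma sum_periodic_prime_0:
  fixes P :: "'a::{field,finite} poly" and h G :: "'a poly \<Rightarrow> 'c::field_char_0"
  assumes "irreducible P" "\<not> P dvd K" "degree K + degree P \<le> M" "\<not> P dvd W"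
    "\<And>x. h x = h (x mod P)"
    "\<And>m v. m \<in> polys_below M \<Longrightarrow> v \<in> polys_below (degree P) \<Longrightarrow> G (m + K * v) = G m"
    "(\<Sum>x\<in>polys_below (degree P). h x) = 0"
  shows "(\<Sum>m\<in>polys_below M. h (r + W * m) * G m) = 0"
proof -
  have "of_nat (CARD('a) ^ degree P) * (\<Sum>m\<in>polys_below M. h (r + W * m) * G m) = 0"
    by (subst sum_periodic_prime[of P K M W h G r]) (use assms in auto)
  thus ?thesis by simp
qed

text \<open>One monic representative for each class of associates: divisibility between members
  becomes equality, and a squarefree modulus can be recorded as a finite set.\<close>

definition mprimes :: "'a::{field,finite} poly set" where
  "mprimes = {P. irreducible P \<and> lead_coeff P = 1}"

definition sdeg :: "'a::{field,finite} poly set \<Rightarrow> nat" where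
  "sdeg Q = (\<Sum>P\<in>Q. degree P)"

lemma mprimesD: "P \<in> mprimes \<Longrightarrow> irreducible P" "P \<in> mprimes \<Longrightarrow> P \<noteq> 0" "P \<in> mprimes \<Longrightarrow> degree P > 0"
  "P \<in> mprimes \<Longrightarrow> prime_elem P"
  by (auto simp: mprimes_def irreducible_degree_pos irreducible_prime_elem)

lemma mprimes_dvd_iff:
  assumes "P \<in> mprimes" "P' \<in> mprimes"
  shows "P dvd P' \<longleftrightarrow> P = P'"
proof
  assume "P dvd P'"
  then obtain c where c: "P' = P * c" by auto
  have "irreducible P'" "\<not> is_unit P" using assms irreducible_not_unit by (auto simp: mprimes_def)
  hence "is_unit c" using c irreducibleD by blast
  moreover have "c \<noteq> 0" using c \<open>irreducible P'\<close> by auto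
  ultimately have dc: "degree c = 0" using is_unit_iff_degree by blast
  have "lead_coeff c = 1" using c assms by (simp add: mprimes_def lead_coeff_mult)
  hence "c = 1" using dc by (metis degree_eq_zeroE coeff_pCons_0 one_pCons)
  thus "P = P'" using c by simp
qed auto

lemma prod_mprimes_nonzero: "finite Q \<Longrightarrow> Q \<subseteq> mprimes \<Longrightarrow> \<Prod>Q \<noteq> 0"
  by (subst prod_zero_iff) (auto dest: mprimesD(2))

lemma degree_prod_mprimes: "finite Q \<Longrightarrow> Q \<subseteq> mprimes \<Longrightarrow> degree (\<Prod>Q) = sdeg Q"
proof (induction Q rule: finite_induct)
  case (insert P Q)
  have "P \<noteq> 0" "\<Prod>Q \<noteq> 0" using insert mprimesD(2) prod_mprimes_nonzero by auto
  thus ?case using insert by (simp add: degree_mult_eq sdeg_def)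
qed (simp add: sdeg_def)

lemma mprime_dvd_prod_iff:
  assumes "P \<in> mprimes" "finite Q" "Q \<subseteq> mprimes"
  shows "P dvd \<Prod>Q \<longleftrightarrow> P \<in> Q"
  using assms(2,3)
proof (induction Q rule: finite_induct)
  case empty
  thus ?case using assms(1) irreducible_not_unit by (auto simp: mprimes_def)
next
  case (insert P' Q)
  thus ?case using assms(1) by (auto simp: prime_elem_dvd_mult_iff mprimesD(4) mprimes_dvd_iff)
qed

lemma prod_mprimes_dvd_iff:
  assumes "finite Q" "Q \<subseteq> mprimes"
  shows "\<Prod>Q dvd n \<longleftrightarrow> (\<forall>P\<in>Q. P dvd n)"
  using assms
proof (induction Q arbitrary: n rule: finite_induct)
  case (insert P Q)
  show ?case
  proof
    assume *: "\<forall>P'\<in>insert P Q. P' dvd n"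
    then obtain m where m: "n = P * m" by auto
    have "P' dvd m" if "P' \<in> Q" for P'
    proof -
      have "P' dvd P * m" using * m that by auto
      moreover have "\<not> P' dvd P" using insert that mprimes_dvd_iff[of P' P] by auto
      moreover have "prime_elem P'" using mprimesD(4)[of P'] insert.prems that by blast
      ultimately show ?thesis using prime_elem_dvd_mult_iff by blast
    qed
    hence "\<Prod>Q dvd m" using insert by auto
    thus "\<Prod>(insert P Q) dvd n" using insert m by simp
  qed (use insert in \<open>auto intro: dvd_trans dest: dvd_mult_left dvd_mult_right\<close>)
qed auto

text \<open>Exact independence of the residues modulo the members of \<open>Q\<close>: their degrees
  add up to at most \<open>M\<close>, so every system of residues is hit equally often. The
  induction removes one prime and uses the product of the others as the period
  \<open>K\<close>.\<close>

lemma sum_indep: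
  fixes h :: "'a::{field,finite} poly \<Rightarrow> 'a poly \<Rightarrow> real"
  assumes "finite Q" "Q \<subseteq> mprimes" "\<And>P. P \<in> Q \<Longrightarrow> \<not> P dvd W" "sdeg Q \<le> M"
    "\<And>P x. P \<in> Q \<Longrightarrow> h P x = h P (x mod P)"
  shows "(\<Sum>m\<in>polys_below M. \<Prod>P\<in>Q. h P (r + W * m))
    = real CARD('a) ^ M * (\<Prod>P\<in>Q. (\<Sum>x\<in>polys_below (degree P). h P x) / pnorm P)"
  using assms
proof (induction Q rule: finite_induct)
  case empty
  show ?case by (simp add: card_polys_below)
next
  case (insert P Q)
  note fin = insert.hyps(1,2) and sub = insert.prems(1-3) and per = insert.prems(4)
  have P: "P \<in> mprimes" and Q: "Q \<subseteq> mprimes" using sub by auto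
  have d: "sdeg (insert P Q) = degree P + sdeg Q" using fin by (simp add: sdeg_def)
  have nz: "real (CARD('a) ^ degree P) \<noteq> 0" by simp
  have "real (CARD('a) ^ degree P) * (\<Sum>m\<in>polys_below M. h P (r + W * m) * (\<Prod>P\<in>Q. h P (r + W * m)))
     = (\<Sum>x\<in>polys_below (degree P). h P x) * (\<Sum>m\<in>polys_below M. (\<Prod>P\<in>Q. h P (r + W * m)))"
  proof (rule sum_periodic_prime[where K = "\<Prod>Q"])
    show "irreducible P" by (rule mprimesD(1)[OF P])
    show "\<not> P dvd W" using sub by auto
    show "h P x = h P (x mod P)" for x by (rule per) simp
    show "\<not> P dvd \<Prod>Q" using mprime_dvd_prod_iff[OF P fin(1) Q] fin by auto
    show "degree (\<Prod>Q) + degree P \<le> M" using sub d degree_prod_mprimes[OF fin(1) Q] by simp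
    fix m v
    show "(\<Prod>P\<in>Q. h P (r + W * (m + \<Prod>Q * v))) = (\<Prod>P\<in>Q. h P (r + W * m))"
    proof (intro prod.cong refl)
      fix P' assume P': "P' \<in> Q"
      hence "P' dvd \<Prod>Q" using fin by auto
      hence "P' dvd W * (\<Prod>Q * v)" by simp
      hence "(r + W * (m + \<Prod>Q * v)) mod P' = (r + W * m) mod P'"
        by (simp add: distrib_left mod_eq_dvd_iff)
      thus "h P' (r + W * (m + \<Prod>Q * v)) = h P' (r + W * m)" using per[of P'] P' by (metis insertI2)
    qed
  qed
  also have "(\<Sum>m\<in>polys_below M. (\<Prod>P\<in>Q. h P (r + W * m))) = real CARD('a) ^ M * (\<Prod>P\<in>Q. (\<Sum>x\<in>polys_below (degree P). h P x) / pnorm P)"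
  proof (rule insert.IH[OF Q])
    show "\<not> P dvd W" if "P \<in> Q" for P using sub that by auto
    show "sdeg Q \<le> M" using sub d by simp
    show "h P x = h P (x mod P)" if "P \<in> Q" for P x by (rule per) (use that in simp)
  qed
  finally have "(\<Sum>m\<in>polys_below M. h P (r + W * m) * (\<Prod>P\<in>Q. h P (r + W * m)))
    = (\<Sum>x\<in>polys_below (degree P). h P x) / pnorm P * (real CARD('a) ^ M * (\<Prod>P\<in>Q. (\<Sum>x\<in>polys_below (degree P). h P x) / pnorm P))"
    using nz unfolding pnorm_def by (simp add: field_simps)
  thus ?case using fin by simp
qed

text \<open>Each element of \<open>Q\<close> lies in the first set only, in the second only, or in
  both. For the square of the sieve sum this counts the pairs of moduli with given least common
  multiple.\<close>

lemma card_pairs_Un: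
  assumes "finite Q"
  shows "finite {(X, Y). X \<union> Y = Q} \<and> card {(X, Y). X \<union> Y = Q} = 3 ^ card Q"
  using assms
proof (induction Q rule: finite_induct)
  case empty
  have "{(X, Y). X \<union> Y = {}} = {({}, {})}" by auto
  thus ?case by simp
next
  case (insert a Q)
  let ?P = "{(X, Y). X \<union> Y = Q}"
  let ?f = "\<lambda>(X, Y). (insert a X, Y)" and ?g = "\<lambda>(X, Y). (X, insert a Y)" and ?h = "\<lambda>(X, Y). (insert a X, insert a Y)"
  have no: "a \<notin> X" "a \<notin> Y" if "X \<union> Y = Q" for X Y using that insert by auto
  have "{(X, Y). X \<union> Y = insert a Q} = ?f ` ?P \<union> ?g ` ?P \<union> ?h ` ?P" (is "?A = ?B")
  proof (intro set_eqI iffI)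
    fix z assume "z \<in> ?A"
    then obtain X Y where z: "z = (X, Y)" "X \<union> Y = insert a Q" by auto
    have "(X - {a}) \<union> (Y - {a}) = Q" using z insert by auto
    hence p: "(X - {a}, Y - {a}) \<in> ?P" by simp
    have "a \<in> X \<or> a \<in> Y" using z by auto
    then consider "a \<in> X" "a \<notin> Y" | "a \<notin> X" "a \<in> Y" | "a \<in> X" "a \<in> Y" by auto
    thus "z \<in> ?B"
    proof cases
      case 1
      hence "z = ?f (X - {a}, Y - {a})" using z by auto
      thus ?thesis using p by blast
    next
      case 2
      hence "z = ?g (X - {a}, Y - {a})" using z by auto
      thus ?thesis using p by blast
    next
      case 3
      hence "z = ?h (X - {a}, Y - {a})" using z by auto
      thus ?thesis using p by blast
    qed
  qed auto
  moreover have "inj_on ?f ?P" "inj_on ?g ?P" "inj_on ?h ?P"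
    using no by (auto simp: inj_on_def) (metis insert_ident)+
  moreover have "?f ` ?P \<inter> ?g ` ?P = {}" "(?f ` ?P \<union> ?g ` ?P) \<inter> ?h ` ?P = {}"
    using no by auto
  ultimately show ?case using insert by (simp add: card_Un_disjoint card_image)
qed

section \<open>The Selberg majorant\<close>

text \<open>\<open>bp P\<close> has mean zero modulo \<open>P\<close>, so by the Chinese remainder theorem the products \<open>bs Q\<close> behave
  like independent noise; \<open>Lam\<close> below is a truncated sum of them that peaks at irreducibles.\<close>

definition bp :: "'a::{field,finite} poly \<Rightarrow> 'a poly \<Rightarrow> real" where
  "bp P n = (if P dvd n then - 1 else 1 / (pnorm P - 1))"

definition bs :: "'a::{field,finite} poly set \<Rightarrow> 'a poly \<Rightarrow> real" where
  "bs Q n = (\<Prod>P\<in>Q. bp P n)"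

text \<open>The reciprocal of Euler's function at the squarefree modulus
  \<open>\<Prod>Q\<close>.\<close>

definition wt :: "'a::{field,finite} poly set \<Rightarrow> real" where
  "wt Q = (\<Prod>P\<in>Q. 1 / (pnorm P - 1))"

text \<open>Squarefree moduli of degree at most \<open>k\<close> with prime factors in
  \<open>PP\<close>, encoded by the set of these factors; the empty set is the modulus 1.\<close>

definition psets :: "'a::{field,finite} poly set \<Rightarrow> nat \<Rightarrow> 'a poly set set" where
  "psets PP k = {S. S \<subseteq> PP \<and> finite S \<and> sdeg S \<le> k}"

lemma pnorm_mprime: "P \<in> mprimes \<Longrightarrow> pnorm (P :: 'a::{field,finite} poly) \<ge> 2"
proof -
  assume P: "P \<in> mprimes"
  have "real CARD('a) ^ 1 \<le> real CARD('a) ^ degree P"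
    using mprimesD(3)[OF P] card_field_ge_2[where 'a = 'a] by (intro power_increasing) auto
  moreover have "real CARD('a) \<ge> 2" using card_field_ge_2[where 'a = 'a] by simp
  ultimately show ?thesis unfolding pnorm_def power_one_right by linarith
qed

lemma finite_psets: "PP \<subseteq> mprimes \<Longrightarrow> finite (psets PP k :: 'a::{field,finite} poly set set)"
proof (rule finite_subset)
  show "finite (Pow (polys_below (Suc k) :: 'a poly set))" by simp
  show "psets PP k \<subseteq> Pow (polys_below (Suc k))"
  proof (intro subsetI PowI)
    fix S P assume S: "S \<in> psets PP k" "P \<in> S"
    have "degree P \<le> sdeg S" unfolding sdeg_def
      using S by (intro member_le_sum) (auto simp: psets_def)
    also have "\<dots> \<le> k" using S by (simp add: psets_def)
    finally show "P \<in> polys_below (Suc k)" by (simp add: polys_below_degree)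
  qed
qed

lemma sdeg_mono: "S \<subseteq> T \<Longrightarrow> finite T \<Longrightarrow> sdeg S \<le> sdeg T"
  unfolding sdeg_def by (intro sum_mono2) auto

lemma sdeg_Un_le: "finite S \<Longrightarrow> finite T \<Longrightarrow> sdeg (S \<union> T) \<le> sdeg S + sdeg T"
  using sum.union_inter[of S T degree] unfolding sdeg_def by linarith

lemma wt_pos: "Q \<subseteq> mprimes \<Longrightarrow> wt Q > 0"
  unfolding wt_def using pnorm_mprime by (intro prod_pos) (force simp: field_simps)

lemma bs_periodic: "finite Q \<Longrightarrow> Q \<subseteq> mprimes \<Longrightarrow> \<Prod>Q dvd x - y \<Longrightarrow> bs Q x = bs Q y"
  unfolding bs_def
proof (intro prod.cong refl)
  fix P assume *: "finite Q" "\<Prod>Q dvd x - y" "P \<in> Q"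
  have "P dvd x - y" using * by (meson dvd_prodI dvd_trans)
  hence "P dvd x \<longleftrightarrow> P dvd y" by (metis dvd_diff_left_iff dvd_diff_right_iff diff_diff_eq2 add_diff_cancel_left' dvd_add_right_iff diff_add_cancel)
  thus "bp P x = bp P y" by (simp add: bp_def)
qed

lemma bp_mod: "bp P x = bp P (x mod P)"
  unfolding bp_def by (simp add: dvd_mod_iff)

lemma sum_bp: "P \<in> mprimes \<Longrightarrow> (\<Sum>x\<in>polys_below (degree P). bp P x) = 0"
proof -
  assume P: "P \<in> (mprimes :: 'a poly set)"
  let ?V = "polys_below (degree P) :: 'a poly set"
  have "(\<Sum>x\<in>?V. bp P x) = bp P 0 + (\<Sum>x\<in>?V - {0}. bp P x)"
    by (simp add: sum.remove)
  also have "(\<Sum>x\<in>?V - {0}. bp P x) = (\<Sum>x\<in>?V - {0}. 1 / (pnorm P - 1))"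
    using dvd_polys_below[of P] by (intro sum.cong refl) (auto simp: bp_def)
  also have "\<dots> = (pnorm P - 1) * (1 / (pnorm P - 1))"
    using card_field_ge_2[where 'a = 'a] by (simp add: card_Diff_singleton card_polys_below pnorm_def of_nat_diff)
  also have "\<dots> = 1" using pnorm_mprime[OF P] by simp
  finally show ?thesis by (simp add: bp_def)
qed

lemma sum_abs_bp: "P \<in> mprimes \<Longrightarrow> (\<Sum>x\<in>polys_below (degree P). \<bar>bp P x\<bar>) = 2"
proof -
  assume P: "P \<in> (mprimes :: 'a poly set)"
  let ?V = "polys_below (degree P) :: 'a poly set"
  have "(\<Sum>x\<in>?V. \<bar>bp P x\<bar>) = \<bar>bp P 0\<bar> + (\<Sum>x\<in>?V - {0}. \<bar>bp P x\<bar>)"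
    by (rule sum.remove) simp_all
  also have "(\<Sum>x\<in>?V - {0}. \<bar>bp P x\<bar>) = (\<Sum>x\<in>?V - {0}. 1 / (pnorm P - 1))"
    using dvd_polys_below[of P] pnorm_mprime[OF P] by (intro sum.cong refl) (auto simp: bp_def)
  also have "\<dots> = (pnorm P - 1) * (1 / (pnorm P - 1))"
    using card_field_ge_2[where 'a = 'a] by (simp add: card_Diff_singleton card_polys_below pnorm_def of_nat_diff)
  also have "\<dots> = 1" using pnorm_mprime[OF P] by simp
  finally show ?thesis by (simp add: bp_def)
qed

definition kap :: "'a::{field,finite} poly \<Rightarrow> real" where
  "kap P = - (pnorm P - 2) / (pnorm P - 1)"

text \<open>\<open>bp P\<close> takes two values and so satisfies a quadratic equation. The constant
  term is its variance modulo \<open>P\<close>, because its mean is 0.\<close>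

lemma bp_square: "P \<in> mprimes \<Longrightarrow> bp P n * bp P n = 1 / (pnorm P - 1) + kap P * bp P n"
proof -
  assume P: "P \<in> mprimes"
  define x where "x = pnorm P - 1"
  have "pnorm P = x + 1" "x \<ge> 1" using pnorm_mprime[OF P] by (auto simp: x_def)
  thus ?thesis by (auto simp: bp_def kap_def field_simps)
qed

lemma abs_kap: "P \<in> mprimes \<Longrightarrow> \<bar>kap P\<bar> \<le> 1"
  using pnorm_mprime[of P] by (auto simp: kap_def field_simps)

text \<open>At a common prime \<open>bp_square\<close> splits the square into a constant and a
  multiple of \<open>bp P\<close>. \<open>T\<close> collects the primes at which the constant is
  taken; these disappear from the modulus.\<close>

lemma bs_mult:
  assumes S: "finite S" "S \<subseteq> mprimes" and S': "finite S'" "S' \<subseteq> mprimes"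
  shows "bs S n * bs S' n = (\<Sum>T\<in>Pow (S \<inter> S'). wt T * (\<Prod>P\<in>S \<inter> S' - T. kap P) * bs (S \<union> S' - T) n)"
proof -
  let ?A = "S \<inter> S'"
  have fA: "finite ?A" using S by simp
  have "bs S n = bs (S - S') n * bs ?A n" "bs S' n = bs (S' - S) n * bs ?A n"
    unfolding bs_def using S S' prod.Int_Diff[of S "\<lambda>P. bp P n" S'] prod.Int_Diff[of S' "\<lambda>P. bp P n" S]
    by (simp_all add: Int_commute mult.commute)
  hence "bs S n * bs S' n = bs (S - S') n * bs (S' - S) n * (\<Prod>P\<in>?A. bp P n * bp P n)"
    by (simp add: bs_def prod.distrib)
  also have "(\<Prod>P\<in>?A. bp P n * bp P n) = (\<Prod>P\<in>?A. 1 / (pnorm P - 1) + kap P * bp P n)"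
    using S by (intro prod.cong refl bp_square) auto
  also have "\<dots> = (\<Sum>T\<in>Pow ?A. wt T * (\<Prod>P\<in>?A - T. kap P * bp P n))"
    unfolding wt_def by (rule prod_add[OF fA])
  also have "bs (S - S') n * bs (S' - S) n * \<dots> = (\<Sum>T\<in>Pow ?A. wt T * (\<Prod>P\<in>?A - T. kap P) * bs (S \<union> S' - T) n)"
    unfolding sum_distrib_left
  proof (intro sum.cong refl)
    fix T assume T: "T \<in> Pow ?A"
    have "S \<union> S' - T = (S - S') \<union> (S' - S) \<union> (?A - T)" using T by auto
    moreover have "bs ((S - S') \<union> (S' - S) \<union> (?A - T)) n = bs (S - S') n * bs (S' - S) n * bs (?A - T) n"
      unfolding bs_def using S S' by (subst prod.union_disjoint; (subst prod.union_disjoint)?) auto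
    ultimately show "bs (S - S') n * bs (S' - S) n * (wt T * (\<Prod>P\<in>?A - T. kap P * bp P n)) =
        wt T * (\<Prod>P\<in>?A - T. kap P) * bs (S \<union> S' - T) n"
      by (simp add: prod.distrib bs_def mult_ac)
  qed
  finally show ?thesis .
qed

locale sieve =
  fixes W :: "'a::{field,finite} poly" and PP :: "'a poly set" and R M :: nat
  assumes PP: "PP \<subseteq> mprimes" and W: "\<And>P. P \<in> PP \<Longrightarrow> \<not> P dvd W" and RM: "2 * R \<le> M"
begin

text \<open>Classically \<open>bs S n\<close> is the Moebius function times the Ramanujan sum over
  Euler's function, all at the modulus \<open>\<Prod>S\<close>. So \<open>Lam\<close> is the
  truncated Hardy expansion of the von Mangoldt function, and \<open>L\<close> is the usual
  normaliser of Selberg's sieve: division by it gives \<open>nu\<close> mean 1 and the value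
  \<open>L\<close> at every \<open>n\<close> free of sieving primes.\<close>

definition L :: real where "L = (\<Sum>S\<in>psets PP R. wt S)"

definition Lam :: "'a poly \<Rightarrow> real" where "Lam n = (\<Sum>S\<in>psets PP R. bs S n)"

definition nu :: "'a poly \<Rightarrow> real" where "nu n = (Lam n)\<^sup>2 / L"

lemma psetsD: "S \<in> psets PP k \<Longrightarrow> S \<subseteq> PP" "S \<in> psets PP k \<Longrightarrow> finite S" "S \<in> psets PP k \<Longrightarrow> sdeg S \<le> k"
  "S \<in> psets PP k \<Longrightarrow> S \<subseteq> mprimes"
  using PP by (auto simp: psets_def)

lemma fin_psets [simp]: "finite (psets PP k)"
  by (rule finite_psets[OF PP])

lemma empty_psets [simp]: "{} \<in> psets PP k"
  by (simp add: psets_def sdeg_def)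

lemma psets_subset: "T \<subseteq> S \<Longrightarrow> S \<in> psets PP k \<Longrightarrow> T \<in> psets PP k"
  using sdeg_mono[of T S] by (auto simp: psets_def intro: finite_subset)

lemma wt_nonneg: "S \<in> psets PP k \<Longrightarrow> wt S \<ge> 0"
  using wt_pos[OF psetsD(4)] less_imp_le by blast

lemma L_ge_1: "L \<ge> 1"
proof -
  have "wt ({} :: 'a poly set) \<le> L" unfolding L_def
    by (rule member_le_sum[of "{}" "psets PP R" wt]) (auto intro: wt_nonneg)
  thus ?thesis by (simp add: wt_def)
qed

lemma nu_nonneg: "nu n \<ge> 0"
  unfolding nu_def using L_ge_1 by simp

lemma nu_prime: "(\<And>P. P \<in> PP \<Longrightarrow> degree P \<le> R \<Longrightarrow> \<not> P dvd n) \<Longrightarrow> nu n = L"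
proof -
  assume *: "\<And>P. P \<in> PP \<Longrightarrow> degree P \<le> R \<Longrightarrow> \<not> P dvd n"
  have "bs S n = wt S" if S: "S \<in> psets PP R" for S
    unfolding bs_def wt_def
  proof (intro prod.cong refl)
    fix P assume P: "P \<in> S"
    have "degree P \<le> sdeg S" unfolding sdeg_def using P psetsD(2)[OF S] by (intro member_le_sum) auto
    hence "\<not> P dvd n" using * psetsD(1,3)[OF S] P by force
    thus "bp P n = 1 / (pnorm P - 1)" by (simp add: bp_def)
  qed
  hence "Lam n = L" unfolding Lam_def L_def by (intro sum.cong) auto
  thus ?thesis unfolding nu_def using L_ge_1 by (simp add: power2_eq_square)
qed

text \<open>Squaring \<open>Lam\<close> by \<open>bs_mult\<close> gives terms indexed by
  \<open>((S, S'), T)\<close>. The diagonal \<open>S = S' = T\<close> leaves the empty modulus with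
  total weight \<open>L\<close>, the main term. Every other term has a nonempty modulus
  \<open>Q = S \<union> S' - T\<close>; for fixed \<open>T\<close> at most \<open>3 ^ card Q\<close>
  pairs produce it, and the weights of all \<open>T\<close> sum to \<open>L\<close>, which cancels
  the normalisation.\<close>

lemma nu_expand:
  fixes G :: "'a poly \<Rightarrow> complex"
  shows "norm ((\<Sum>m\<in>X. of_real (nu (r + W * m)) * G m) - (\<Sum>m\<in>X. G m))
    \<le> (\<Sum>Q\<in>psets PP (2 * R) - {{}}. 3 ^ card Q * norm (\<Sum>m\<in>X. of_real (bs Q (r + W * m)) * G m))"
proof -
  define g where "g Q = (\<Sum>m\<in>X. of_real (bs Q (r + W * m)) * G m)" for Q
  define Z where "Z = Sigma (psets PP R \<times> psets PP R) (\<lambda>(S, S'). Pow (S \<inter> S'))"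
  define c where "c = (\<lambda>((S, S'), T). wt T * (\<Prod>P\<in>S \<inter> S' - T. kap (P :: 'a poly)))"
  define qf where "qf = (\<lambda>((S, S'), T). S \<union> S' - T :: 'a poly set)"
  have finZ: "finite Z" unfolding Z_def using psetsD(2) by (intro finite_SigmaI) auto
  have ZD: "S \<in> psets PP R \<and> S' \<in> psets PP R \<and> T \<subseteq> S \<and> T \<subseteq> S'" if "((S, S'), T) \<in> Z" for S S' T
    using that by (auto simp: Z_def)
  have expand: "L * nu n = (\<Sum>z\<in>Z. c z * bs (qf z) n)" for n
  proof -
    have "L * nu n = Lam n * Lam n" unfolding nu_def using L_ge_1 by (simp add: power2_eq_square)
    also have "\<dots> = (\<Sum>(S, S')\<in>psets PP R \<times> psets PP R. bs S n * bs S' n)"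
      unfolding Lam_def by (simp add: sum_product sum.cartesian_product)
    also have "\<dots> = (\<Sum>p\<in>psets PP R \<times> psets PP R. \<Sum>T\<in>(\<lambda>(S, S'). Pow (S \<inter> S')) p. c (p, T) * bs (qf (p, T)) n)"
      by (intro sum.cong refl) (auto simp: c_def qf_def bs_mult psetsD)
    also have "\<dots> = (\<Sum>z\<in>Z. c z * bs (qf z) n)"
      unfolding Z_def by (subst sum.Sigma) (auto dest: psetsD simp: case_prod_unfold)
    finally show ?thesis .
  qed
  have main: "of_real L * (\<Sum>m\<in>X. of_real (nu (r + W * m)) * G m) = (\<Sum>z\<in>Z. of_real (c z) * g (qf z))"
  proof -
    have "of_real L * (\<Sum>m\<in>X. of_real (nu (r + W * m)) * G m) = (\<Sum>m\<in>X. of_real (L * nu (r + W * m)) * G m)"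
      by (simp add: sum_distrib_left mult_ac)
    also have "\<dots> = (\<Sum>m\<in>X. \<Sum>z\<in>Z. of_real (c z) * (of_real (bs (qf z) (r + W * m)) * G m))"
      by (simp add: expand sum_distrib_right sum_distrib_left mult_ac)
    also have "\<dots> = (\<Sum>z\<in>Z. of_real (c z) * g (qf z))"
      by (subst sum.swap) (simp add: g_def sum_distrib_left)
    finally show ?thesis .
  qed
  define Z0 where "Z0 = (\<lambda>T. ((T, T), T)) ` psets PP R"
  have Z0: "Z0 \<subseteq> Z" "z \<in> Z \<Longrightarrow> qf z = {} \<Longrightarrow> z \<in> Z0" for z
    by (auto simp: Z0_def Z_def qf_def image_iff)
  have s0: "(\<Sum>z\<in>Z0. of_real (c z) * g (qf z)) = of_real L * g {}"
    unfolding Z0_def by (subst sum.reindex) (auto simp: inj_on_def c_def qf_def L_def sum_distrib_right)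
  have g0: "g {} = (\<Sum>m\<in>X. G m)" by (simp add: g_def bs_def)
  have "of_real L * ((\<Sum>m\<in>X. of_real (nu (r + W * m)) * G m) - (\<Sum>m\<in>X. G m)) = (\<Sum>z\<in>Z - Z0. of_real (c z) * g (qf z))"
    using main s0 g0 sum_diff[OF finZ Z0(1), of "\<lambda>z. of_real (c z) * g (qf z)"] by (simp add: algebra_simps)
  hence "L * norm ((\<Sum>m\<in>X. of_real (nu (r + W * m)) * G m) - (\<Sum>m\<in>X. G m)) = norm (\<Sum>z\<in>Z - Z0. of_real (c z) * g (qf z))"
    using L_ge_1 norm_mult[of "of_real L" "(\<Sum>m\<in>X. of_real (nu (r + W * m)) * G m) - (\<Sum>m\<in>X. G m)"] by simp
  also have "\<dots> \<le> (\<Sum>z\<in>Z - Z0. wt (snd z) * norm (g (qf z)))"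
  proof (rule sum_norm_le)
    fix z assume "z \<in> Z - Z0"
    then obtain S S' T where z: "z = ((S, S'), T)" "S \<in> psets PP R" "S' \<in> psets PP R" "T \<subseteq> S" "T \<subseteq> S'"
      using ZD by (metis DiffD1 surj_pair)
    have wT: "wt T > 0" using wt_pos psetsD(4) z by blast
    have "\<bar>\<Prod>P\<in>S \<inter> S' - T. kap P\<bar> \<le> 1"
      unfolding abs_prod using abs_kap psetsD(4)[OF z(2)] by (intro prod_le_1) auto
    hence "\<bar>c z\<bar> \<le> wt T" using wT unfolding z(1) c_def by (simp add: abs_mult mult_left_le)
    thus "norm (of_real (c z) * g (qf z)) \<le> wt (snd z) * norm (g (qf z))"
      unfolding z(1) by (simp add: norm_mult mult_right_mono)
  qed
  also have "\<dots> \<le> (\<Sum>(T, Q, XY)\<in>Sigma (psets PP R) (\<lambda>_. Sigma (psets PP (2 * R) - {{}}) (\<lambda>Q. {(X, Y). X \<union> Y = Q})). wt T * norm (g Q))"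
    (is "_ \<le> sum ?F ?U")
  proof -
    \<comment> \<open>\<open>T\<close>, \<open>S - T\<close> and \<open>S' - T\<close> determine the
      triple, since \<open>T\<close> is contained in both sets.\<close>
    let ?\<phi> = "\<lambda>((S, S'), T). (T, S \<union> S' - T, (S - T, S' - T))"
    have inj: "inj_on ?\<phi> (Z - Z0)"
    proof (rule inj_onI)
      fix z z' assume *: "z \<in> Z - Z0" "z' \<in> Z - Z0" "?\<phi> z = ?\<phi> z'"
      obtain S S' T U U' T' where z: "z = ((S, S'), T)" "z' = ((U, U'), T')" by (metis surj_pair)
      have "T \<subseteq> S" "T \<subseteq> S'" "T' \<subseteq> U" "T' \<subseteq> U'" using ZD * z by blast+
      moreover have "T = T'" "S - T = U - T'" "S' - T = U' - T'" using *(3) z by auto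
      ultimately show "z = z'" unfolding z by blast
    qed
    have sub: "?\<phi> ` (Z - Z0) \<subseteq> ?U"
    proof (intro image_subsetI)
      fix z assume z: "z \<in> Z - Z0"
      obtain S S' T where z': "z = ((S, S'), T)" by (metis surj_pair)
      have S: "S \<in> psets PP R" "S' \<in> psets PP R" "T \<subseteq> S" "T \<subseteq> S'" using ZD z z' by blast+
      have "S \<union> S' \<in> psets PP (2 * R)"
        using S sdeg_Un_le[of S S'] by (auto simp: psets_def)
      hence "S \<union> S' - T \<in> psets PP (2 * R)" using psets_subset by blast
      moreover have "S \<union> S' - T \<noteq> {}" using Z0(2)[of z] z unfolding z' qf_def by auto
      moreover have "T \<in> psets PP R" using psets_subset S by blast
      ultimately show "?\<phi> z \<in> ?U" unfolding z' by auto
    qed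
    have finU: "finite ?U"
      using card_pairs_Un psetsD(2) by (intro finite_SigmaI) auto
    have "(\<Sum>z\<in>Z - Z0. wt (snd z) * norm (g (qf z))) = (\<Sum>u\<in>?\<phi> ` (Z - Z0). ?F u)"
      by (subst sum.reindex[OF inj]) (auto intro!: sum.cong simp: qf_def)
    also have "\<dots> \<le> sum ?F ?U"
      using sub finU wt_nonneg by (intro sum_mono2) (auto intro!: mult_nonneg_nonneg)
    finally show ?thesis .
  qed
  also have "\<dots> = (\<Sum>T\<in>psets PP R. \<Sum>Q\<in>psets PP (2 * R) - {{}}. \<Sum>XY\<in>{(X, Y). X \<union> Y = Q}. wt T * norm (g Q))"
  proof -
    have 1: "finite (Sigma (psets PP (2 * R) - {{}}) (\<lambda>Q. {(X, Y). X \<union> Y = Q}))"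
      using card_pairs_Un psetsD(2) by (intro finite_SigmaI) auto
    have 2: "finite {(X, Y). X \<union> Y = Q}" if "Q \<in> psets PP (2 * R) - {{}}" for Q
      using that card_pairs_Un psetsD(2) by auto
    show ?thesis by (subst sum.Sigma[symmetric], simp, use 1 in simp)
       (intro sum.cong refl, subst sum.Sigma[symmetric], use 2 in \<open>auto\<close>)
  qed
  also have "\<dots> = L * (\<Sum>Q\<in>psets PP (2 * R) - {{}}. 3 ^ card Q * norm (g Q))"
    unfolding L_def sum_distrib_left sum_distrib_right
    by (subst sum.swap, intro sum.cong refl) (use card_pairs_Un psetsD(2) in \<open>auto simp: mult_ac\<close>)
  finally show ?thesis using L_ge_1 unfolding g_def by simp
qed

lemma sum_bs:
  assumes "Q \<in> psets PP M" "Q \<noteq> {}"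
  shows "(\<Sum>m\<in>polys_below M. bs Q (r + W * m)) = 0"
proof -
  have Q: "finite Q" "Q \<subseteq> mprimes" "sdeg Q \<le> M" "\<And>P. P \<in> Q \<Longrightarrow> \<not> P dvd W"
    using psetsD[OF assms(1)] W by auto
  have "(\<Sum>m\<in>polys_below M. bs Q (r + W * m)) = real CARD('a) ^ M * (\<Prod>P\<in>Q. (\<Sum>x\<in>polys_below (degree P). bp P x) / pnorm P)"
    unfolding bs_def by (rule sum_indep[OF Q(1,2,4,3)]) (auto intro: bp_mod)
  also have "\<dots> = 0" using Q assms(2) sum_bp by (auto simp: subset_iff)
  finally show ?thesis .
qed

text \<open>All nonempty moduli that occur have degree at most \<open>2 * R \<le> M\<close>, where
  their sums vanish exactly.\<close>

lemma sum_nu: "(\<Sum>m\<in>polys_below M. nu (r + W * m)) = real CARD('a) ^ M"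
proof -
  have "norm ((\<Sum>m\<in>polys_below M. of_real (nu (r + W * m)) * 1) - (\<Sum>m\<in>(polys_below M :: 'a poly set). 1 :: complex))
    \<le> (\<Sum>Q\<in>psets PP (2 * R) - {{}}. 3 ^ card Q * norm (\<Sum>m\<in>polys_below M. of_real (bs Q (r + W * m)) * (1::complex)))"
    by (rule nu_expand)
  also have "\<dots> = 0"
  proof (intro sum.neutral ballI)
    fix Q assume Q: "Q \<in> psets PP (2 * R) - {{}}"
    hence "(\<Sum>m\<in>polys_below M. bs Q (r + W * m)) = 0" using RM by (intro sum_bs) (auto simp: psets_def)
    thus "3 ^ card Q * norm (\<Sum>m\<in>polys_below M. of_real (bs Q (r + W * m)) * (1::complex)) = 0"
      by (simp flip: of_real_sum)
  qed
  finally have "(\<Sum>m\<in>polys_below M. complex_of_real (nu (r + W * m))) = of_nat (CARD('a) ^ M)"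
    by (simp add: card_polys_below)
  hence "complex_of_real (\<Sum>m\<in>polys_below M. nu (r + W * m)) = complex_of_real (real CARD('a) ^ M)"
    by simp
  thus ?thesis by (simp only: of_real_eq_iff)
qed

end

text \<open>The 6 is the 3 of \<open>card_pairs_Un\<close> times the 2 of \<open>sum_abs_bp\<close>.
  Beyond \<open>6 ^ 32\<close> this factor costs only 1/32 in the exponent, which is why the sieving
  primes are taken that large.\<close>

lemma powr_6_le:
  assumes "(x::real) \<ge> 6 ^ 32"
  shows "6 / x \<le> x powr (- 31 / 32)"
proof -
  have x: "x > 0" using assms by (rule less_le_trans[rotated]) simp
  have "6 = (6 ^ 32) powr (1 / 32 :: real)" by (simp add: powr_power)
  also have "\<dots> \<le> x powr (1 / 32)" using assms by (intro powr_mono2) auto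
  finally have "6 / x \<le> x powr (1 / 32) / x powr 1" using x by (simp add: divide_right_mono)
  also have "\<dots> = x powr (- 31 / 32)" using powr_diff[of x "1 / 32" 1] by simp
  finally show ?thesis .
qed

section \<open>Correlation of the sieve terms with additive characters\<close>

context sieve
begin

sublocale V: finite_abelian "polys_below M :: 'a poly set" "(+)" 0
  by (rule polys_below_group)

definition resonant :: "'a poly \<Rightarrow> ('a poly \<Rightarrow> complex) \<Rightarrow> nat \<Rightarrow> 'a poly set set" where
  "resonant r \<theta> k = {Q \<in> psets PP k. sdeg Q = k \<and> (\<Sum>m\<in>polys_below M. of_real (bs Q (r + W * m)) * \<theta> m) \<noteq> 0}"

text \<open>A shift of \<open>m\<close> by a multiple of \<open>\<Prod>Q\<close> fixes
  \<open>bs Q\<close> and multiplies the correlation by \<open>\<theta> v\<close>; a nonzero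
  correlation permits only the factor 1.\<close>

lemma resonant_trivial:
  assumes \<theta>: "\<theta> \<in> V.chars" and Q: "Q \<in> resonant r \<theta> k" and v: "v \<in> polys_below M" "\<Prod>Q dvd v"
  shows "\<theta> v = 1"
proof -
  have Q': "Q \<in> psets PP k" and nz: "(\<Sum>m\<in>polys_below M. of_real (bs Q (r + W * m)) * \<theta> m) \<noteq> 0" (is "?S \<noteq> 0")
    using Q by (auto simp: resonant_def)
  have "?S = (\<Sum>m\<in>polys_below M. of_real (bs Q (r + W * (m + v))) * \<theta> (m + v))"
    by (rule sum_polys_below_shift[OF v(1), symmetric])
  also have "\<dots> = (\<Sum>m\<in>polys_below M. (of_real (bs Q (r + W * m)) * \<theta> m) * \<theta> v)"
  proof (intro sum.cong refl)
    fix m :: "'a poly" assume m: "m \<in> polys_below M"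
    have "bs Q (r + W * (m + v)) = bs Q (r + W * m)"
      by (rule bs_periodic) (use psetsD(2,4)[OF Q'] v in \<open>auto simp: distrib_left\<close>)
    thus "of_real (bs Q (r + W * (m + v))) * \<theta> (m + v) = (of_real (bs Q (r + W * m)) * \<theta> m) * \<theta> v"
      using V.charsD(1)[OF \<theta> m v(1)] by simp
  qed
  also have "\<dots> = ?S * \<theta> v" by (rule sum_distrib_right[symmetric])
  finally show ?thesis using nz by simp
qed

text \<open>If \<open>Q\<close> resonates with \<open>\<theta>\<close>, then \<open>\<theta>\<close> is trivial on multiples of \<open>\<Prod>Q\<close>, so \<open>n \<mapsto> \<theta> (n mod \<Prod>Q)\<close>
  extends \<open>\<theta>\<close> to the polynomials of degree below \<open>2 k\<close>. Distinct \<open>Q\<close> give distinct extensions, and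
  there are at most \<open>q ^ (2 * k - M)\<close> of these.\<close>

lemma card_resonant:
  assumes \<theta>: "\<theta> \<in> V.chars" and k: "k \<le> M"
  shows "finite (resonant r \<theta> k)" "real (card (resonant r \<theta> k)) \<le> 1 + real CARD('a) ^ (2 * k) / real CARD('a) ^ M"
proof -
  let ?N = "resonant r \<theta> k"
  show fin: "finite ?N" by (rule finite_subset[OF _ fin_psets[of k]]) (auto simp: resonant_def)
  define \<eta> where "\<eta> Q n = \<theta> (n mod \<Prod>Q)" for Q n
  \<comment> \<open>Two moduli of degree \<open>k\<close> have a product of degree
    \<open>2 * k\<close>, so values below that degree decide whether the two extensions agree; the
    maximum with \<open>M\<close> keeps the domain of \<open>\<theta>\<close> inside.\<close>
  define M' where "M' = max M (2 * k)"
  interpret V': finite_abelian "polys_below M' :: 'a poly set" "(+)" 0 by (rule polys_below_group)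
  have ND: "Q \<in> psets PP k" "finite Q" "Q \<subseteq> mprimes" "\<Prod>Q \<noteq> 0" "degree (\<Prod>Q) = k" "sdeg Q = k" if "Q \<in> ?N" for Q
    using that psetsD[of Q k] prod_mprimes_nonzero[of Q] degree_prod_mprimes[of Q] by (auto simp: resonant_def)
  have modM: "n mod \<Prod>Q \<in> polys_below M" if "Q \<in> ?N" for Q n
    using mod_in_polys_below[OF ND(4)[OF that]] ND(5)[OF that] polys_below_mono[OF k] by auto
  have add: "\<eta> Q (x + y) = \<eta> Q x * \<eta> Q y" if "Q \<in> ?N" for Q x y
    unfolding \<eta>_def poly_mod_add_left using V.charsD(1)[OF \<theta> modM[OF that] modM[OF that]] .
  have zero: "\<eta> Q v = 1" if "\<Prod>Q dvd v" for Q v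
    unfolding \<eta>_def using that V.charsD(2)[OF \<theta>] by (simp add: dvd_imp_mod_0)
  have ext: "\<eta> Q m = \<theta> m" if Q: "Q \<in> ?N" and m: "m \<in> polys_below M" for Q m
  proof -
    have "m - m mod \<Prod>Q \<in> polys_below M" using m modM[OF Q] by (rule polys_below_diff)
    moreover have "\<Prod>Q dvd m - m mod \<Prod>Q" by (simp add: minus_mod_eq_mult_div)
    ultimately have "\<theta> (m - m mod \<Prod>Q) = 1" by (rule resonant_trivial[OF \<theta> Q])
    moreover have "\<theta> (m - m mod \<Prod>Q + m mod \<Prod>Q) = \<theta> (m - m mod \<Prod>Q) * \<theta> (m mod \<Prod>Q)"
      by (rule V.charsD(1)[OF \<theta>]) (use m modM[OF Q] polys_below_diff in auto)
    ultimately show ?thesis by (simp add: \<eta>_def)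
  qed
  have inj: "Q = Q'" if Q: "Q \<in> ?N" "Q' \<in> ?N" and eq: "\<And>n. n \<in> polys_below M' \<Longrightarrow> \<eta> Q n = \<eta> Q' n" for Q Q'
  proof (rule ccontr)
    assume "Q \<noteq> Q'"
    have eq': "\<eta> Q n = \<eta> Q' n" for n
    proof -
      let ?D = "\<Prod>Q * \<Prod>Q'"
      have D: "?D \<noteq> 0" "degree ?D = 2 * k" using ND[OF Q(1)] ND[OF Q(2)] by (auto simp: degree_mult_eq)
      have "n mod ?D \<in> polys_below M'"
        using mod_in_polys_below[OF D(1)] D(2) polys_below_mono[of "2 * k" M'] unfolding M'_def by auto
      from eq[OF this] show ?thesis unfolding \<eta>_def by (simp add: mod_mod_cancel)
    qed
    \<comment> \<open>Equal total degrees exclude a proper inclusion.\<close>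
    have "\<not> Q \<subseteq> Q'"
    proof
      assume sub: "Q \<subseteq> Q'"
      then obtain P where P: "P \<in> Q'" "P \<notin> Q" using \<open>Q \<noteq> Q'\<close> by auto
      have "sdeg (insert P Q) \<le> sdeg Q'" using sub P ND[OF Q(2)] by (intro sdeg_mono) auto
      moreover have "sdeg (insert P Q) = degree P + sdeg Q" using P ND(2)[OF Q(1)] by (simp add: sdeg_def)
      moreover have "degree P > 0" using mprimesD(3) ND(3)[OF Q(2)] P by blast
      ultimately show False using ND(6)[OF Q(1)] ND(6)[OF Q(2)] by simp
    qed
    then obtain P where P: "P \<in> Q" "P \<notin> Q'" by auto
    have Pm: "P \<in> mprimes" using P ND(3)[OF Q(1)] by auto
    define K where "K = \<Prod>(Q - {P})"
    have PK: "\<Prod>Q = P * K" unfolding K_def using prod.remove[OF ND(2)[OF Q(1)] P(1), of "\<lambda>x. x"] by simp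
    have Qm: "finite (Q - {P})" "Q - {P} \<subseteq> mprimes" using ND[OF Q(1)] by auto
    have K0: "K \<noteq> 0" unfolding K_def using prod_mprimes_nonzero[OF Qm] .
    have nPK: "\<not> P dvd K" unfolding K_def using mprime_dvd_prod_iff[OF Pm Qm] by simp
    have dK: "degree K + degree P = k"
      using ND(5)[OF Q(1)] PK K0 mprimesD(2)[OF Pm] by (simp add: degree_mult_eq)
    have nPQ': "\<not> P dvd \<Prod>Q'" using mprime_dvd_prod_iff[OF Pm ND(2,3)[OF Q(2)]] P by simp
    \<comment> \<open>\<open>\<Prod>Q'\<close> is invertible modulo \<open>P\<close>, so
      \<open>K * v\<close> is a multiple of \<open>\<Prod>Q\<close> plus a multiple of
      \<open>\<Prod>Q'\<close>; if the extensions agree, both have value 1. Then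
      \<open>\<theta>\<close> does not see the prime \<open>P\<close>, and the mean zero of
      \<open>bp P\<close> kills the correlation.\<close>
    have triv: "\<eta> Q (K * v) = 1" for v
    proof -
      have "v mod P \<in> (\<lambda>x. (0 + \<Prod>Q' * x) mod P) ` polys_below (degree P)"
        using bij_mod_prime[OF mprimesD(1)[OF Pm] nPQ', of 0] mod_in_polys_below[OF mprimesD(2)[OF Pm]]
        by (simp add: bij_betw_def)
      then obtain x where "v mod P = (\<Prod>Q' * x) mod P" by auto
      hence "P dvd v - \<Prod>Q' * x" by (simp add: mod_eq_dvd_iff)
      hence "\<Prod>Q dvd K * (v - \<Prod>Q' * x)" unfolding PK by (simp add: mult.commute)
      moreover have "K * v = K * (v - \<Prod>Q' * x) + \<Prod>Q' * (K * x)" by (simp add: algebra_simps)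
      ultimately have "\<eta> Q (K * v) = \<eta> Q' (\<Prod>Q' * (K * x))" using add[OF Q(1)] zero[of Q] eq' by simp
      also have "\<dots> = 1" by (rule zero) simp
      finally show ?thesis .
    qed
    have "(\<Sum>m\<in>polys_below M. of_real (bp P (r + W * m)) * (of_real (bs (Q - {P}) (r + W * m)) * \<theta> m)) = 0"
    proof (rule sum_periodic_prime_0[where K = K])
      show "irreducible P" using mprimesD(1)[OF Pm] .
      show "\<not> P dvd K" by fact
      show "degree K + degree P \<le> M" using dK k by simp
      show "\<not> P dvd W" using W psetsD(1)[OF ND(1)[OF Q(1)]] P by auto
      show "complex_of_real (bp P x) = of_real (bp P (x mod P))" for x by (subst bp_mod) simp
      show "(\<Sum>x\<in>polys_below (degree P). complex_of_real (bp P x)) = 0"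
        using sum_bp[OF Pm] by (metis of_real_0 of_real_sum)
      fix m v :: "'a poly" assume m: "m \<in> polys_below M" and v: "v \<in> polys_below (degree P)"
      have Kv: "K * v \<in> polys_below M" using polys_below_mult[OF v, of K M] dK k by simp
      have "bs (Q - {P}) (r + W * (m + K * v)) = bs (Q - {P}) (r + W * m)"
        by (rule bs_periodic[OF Qm]) (simp add: distrib_left flip: K_def)
      moreover have "\<theta> (m + K * v) = \<theta> m"
        using V.charsD(1)[OF \<theta> m Kv] ext[OF Q(1) Kv] triv[of v] by simp
      ultimately show "of_real (bs (Q - {P}) (r + W * (m + K * v))) * \<theta> (m + K * v) = of_real (bs (Q - {P}) (r + W * m)) * \<theta> m"
        by simp
    qed
    moreover have "bs Q n = bp P n * bs (Q - {P}) n" for n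
      unfolding bs_def using prod.remove[OF ND(2)[OF Q(1)] P(1)] .
    ultimately have "(\<Sum>m\<in>polys_below M. of_real (bs Q (r + W * m)) * \<theta> m) = 0" by (simp add: mult.assoc)
    thus False using Q(1) by (simp add: resonant_def)
  qed
  define E where "E = {\<psi>\<in>V'.chars. \<forall>x\<in>polys_below M. \<psi> x = \<theta> x}"
  let ?f = "\<lambda>Q n. if n \<in> polys_below M' then \<eta> Q n else 0"
  have MM': "polys_below M \<subseteq> (polys_below M' :: 'a poly set)" unfolding M'_def by (rule polys_below_mono) simp
  have "card ?N \<le> card E"
  proof (rule card_inj_on_le)
    show "inj_on ?f ?N"
    proof (rule inj_onI)
      fix Q Q' assume *: "Q \<in> ?N" "Q' \<in> ?N" "?f Q = ?f Q'"
      show "Q = Q'"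
      proof (rule inj[OF *(1,2)])
        fix n :: "'a poly" assume "n \<in> polys_below M'"
        thus "\<eta> Q n = \<eta> Q' n" using fun_cong[OF *(3), of n] by simp
      qed
    qed
    show "?f ` ?N \<subseteq> E"
    proof (intro image_subsetI)
      fix Q assume Q: "Q \<in> ?N"
      have "?f Q \<in> V'.chars" unfolding V'.chars_def
        using add[OF Q] zero[of Q 0] by (auto simp: polys_below_add)
      thus "?f Q \<in> E" unfolding E_def using ext[OF Q] MM' by auto
    qed
    show "finite E" unfolding E_def using V'.finite_chars by simp
  qed
  moreover have "card E * card (polys_below M :: 'a poly set) \<le> card (polys_below M' :: 'a poly set)"
    unfolding E_def
  proof (rule V'.card_extensions_le)
    show "V'.subgrp (polys_below M)" unfolding V'.subgrp_def
    proof (intro conjI ballI impI)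
      fix a b :: "'a poly" assume "a \<in> polys_below M" "a + b \<in> polys_below M"
      thus "b \<in> polys_below M" using polys_below_diff[of "a + b" M a] by simp
    qed (use MM' in \<open>auto simp: polys_below_add\<close>)
  qed
  ultimately have "card ?N * CARD('a) ^ M \<le> CARD('a) ^ M'"
    by (metis card_polys_below le_trans mult_le_mono1)
  hence "real (card ?N) * real CARD('a) ^ M \<le> real CARD('a) ^ M'"
    by (metis of_nat_le_iff of_nat_mult of_nat_power)
  also have "\<dots> \<le> real CARD('a) ^ M + real CARD('a) ^ (2 * k)"
    unfolding M'_def by (simp add: max_def)
  finally show "real (card ?N) \<le> 1 + real CARD('a) ^ (2 * k) / real CARD('a) ^ M"
    by (simp add: field_simps)
qed

text \<open>The bound without cancellation: the values \<open>\<bar>bp P\<bar>\<close> average to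
  \<open>2 / pnorm P\<close> and are independent.\<close>

lemma norm_sum_bs_le:
  assumes \<theta>: "\<And>m. m \<in> polys_below M \<Longrightarrow> norm (\<theta> m :: complex) \<le> 1" and Q: "Q \<in> psets PP M"
  shows "norm (\<Sum>m\<in>polys_below M. of_real (bs Q (r + W * m)) * \<theta> m) \<le> real CARD('a) ^ M * (\<Prod>P\<in>Q. 2 / pnorm P)"
proof -
  have "norm (\<Sum>m\<in>polys_below M. of_real (bs Q (r + W * m)) * \<theta> m) \<le> (\<Sum>m\<in>polys_below M. \<Prod>P\<in>Q. \<bar>bp P (r + W * m)\<bar>)"
  proof (intro sum_norm_le)
    fix m :: "'a poly" assume m: "m \<in> polys_below M"
    have "norm (of_real (bs Q (r + W * m)) * \<theta> m) \<le> \<bar>bs Q (r + W * m)\<bar>"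
      using \<theta>[OF m] by (simp add: norm_mult mult_left_le)
    thus "norm (of_real (bs Q (r + W * m)) * \<theta> m) \<le> (\<Prod>P\<in>Q. \<bar>bp P (r + W * m)\<bar>)"
      by (simp add: bs_def abs_prod)
  qed
  also have "\<dots> = real CARD('a) ^ M * (\<Prod>P\<in>Q. (\<Sum>x\<in>polys_below (degree P). \<bar>bp P x\<bar>) / pnorm P)"
    by (rule sum_indep) (use psetsD[OF Q] W in \<open>auto intro: arg_cong[where f = abs] bp_mod\<close>)
  also have "(\<Prod>P\<in>Q. (\<Sum>x\<in>polys_below (degree P). \<bar>bp P x\<bar>) / pnorm P) = (\<Prod>P\<in>Q. 2 / pnorm P)"
    using psetsD(4)[OF Q] by (intro prod.cong refl) (auto simp: sum_abs_bp)
  finally show ?thesis .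
qed

text \<open>Write \<open>q\<close> for \<open>CARD('a)\<close>. In degree \<open>k\<close> the
  number of resonant moduli is at most 1 plus \<open>q\<close> to the power
  \<open>2 * k - M\<close>, and each contributes at most \<open>q\<close> to the power
  \<open>M - 31 * k / 32\<close>. The 1 yields a geometric series of ratio below 1/2. The rest has
  exponent \<open>33 * k / 32 - 50 * s\<close> relative to \<open>q ^ M\<close>, at most
  \<open>- s / 2\<close> for \<open>k \<le> 48 * s\<close> because
  \<open>33 * 48 / 32 = 49.5\<close>; this dictates \<open>R = 24 * s\<close> against
  \<open>M = 50 * s\<close>.\<close>

lemma tail_bound:
  assumes \<theta>: "\<theta> \<in> V.chars" and q: "CARD('a) \<ge> 3" and M: "M = 50 * s" and R: "R = 24 * s"
    and large: "\<And>P. P \<in> PP \<Longrightarrow> pnorm P \<ge> 6 ^ 32"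
  shows "(\<Sum>Q\<in>{Q\<in>psets PP (2 * R). sdeg Q > k0}. 3 ^ card Q * norm (\<Sum>m\<in>polys_below M. of_real (bs Q (r + W * m)) * \<theta> m))
    \<le> real CARD('a) ^ M * ((1/2) ^ k0 + 48 * real s * real CARD('a) powr (- real s / 2))"
proof -
  let ?q = "real CARD('a)"
  let ?n = "\<lambda>Q. norm (\<Sum>m\<in>polys_below M. of_real (bs Q (r + W * m)) * \<theta> m)"
  let ?A = "{Q\<in>psets PP (2 * R). sdeg Q > k0}"
  have q3: "?q \<ge> 3" using q by simp
  have single: "3 ^ card Q * ?n Q \<le> ?q ^ M * ?q powr (- 31 / 32 * sdeg Q)" if Q: "Q \<in> psets PP M" for Q
  proof -
    have "3 ^ card Q * ?n Q \<le> 3 ^ card Q * (?q ^ M * (\<Prod>P\<in>Q. 2 / pnorm P))"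
      by (intro mult_left_mono norm_sum_bs_le Q) (use V.char_norm[OF \<theta>] in auto)
    also have "\<dots> = ?q ^ M * (\<Prod>P\<in>Q. 3 * (2 / pnorm P))" by (simp only: prod.distrib prod_constant mult.left_commute)
    also have "(\<Prod>P\<in>Q. 3 * (2 / pnorm P)) \<le> (\<Prod>P\<in>Q. pnorm P powr (- 31 / 32))"
    proof (intro prod_mono conjI)
      fix P assume "P \<in> Q"
      hence "pnorm P \<ge> 6 ^ 32" using large psetsD(1)[OF Q] by auto
      from powr_6_le[OF this] show "3 * (2 / pnorm P) \<le> pnorm P powr (- 31 / 32)" by simp
      show "0 \<le> 3 * (2 / pnorm P)" by (simp add: pnorm_def)
    qed
    also have "\<dots> = (\<Prod>P\<in>Q. ?q powr (- 31 / 32 * degree P))"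
      using q3 by (intro prod.cong refl) (simp add: pnorm_def powr_powr mult.commute flip: powr_realpow)
    also have "\<dots> = ?q powr (- 31 / 32 * sdeg Q)"
      using q3 psetsD(2)[OF Q] by (simp add: sdeg_def sum_distrib_left flip: powr_sum)
    finally show ?thesis using q3 by (simp add: mult_left_mono)
  qed
  have finA: "finite ?A" by simp
  have img: "sdeg ` ?A \<subseteq> {k0<..48 * s}" using psetsD(3) R by fastforce
  have "(\<Sum>Q\<in>?A. 3 ^ card Q * ?n Q) = (\<Sum>k\<in>{k0<..48 * s}. \<Sum>Q\<in>{Q\<in>?A. sdeg Q = k}. 3 ^ card Q * ?n Q)"
    by (rule sum.group[OF finA _ img, symmetric]) simp
  also have "\<dots> \<le> (\<Sum>k\<in>{k0<..48 * s}. ?q ^ M * ((1/2) ^ k + ?q powr (- real s / 2)))"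
  proof (intro sum_mono)
    fix k assume k: "k \<in> {k0<..48 * s}"
    hence kM: "k \<le> M" using M by simp
    let ?N = "resonant r \<theta> k"
    have "(\<Sum>Q\<in>{Q\<in>?A. sdeg Q = k}. 3 ^ card Q * ?n Q) = (\<Sum>Q\<in>{Q\<in>?A. sdeg Q = k} \<inter> ?N. 3 ^ card Q * ?n Q)"
    proof (intro sum.mono_neutral_right ballI)
      fix Q assume Q: "Q \<in> {Q\<in>?A. sdeg Q = k} - {Q\<in>?A. sdeg Q = k} \<inter> ?N"
      hence "Q \<in> psets PP k" by (auto simp: psets_def)
      hence "(\<Sum>m\<in>polys_below M. of_real (bs Q (r + W * m)) * \<theta> m) = 0" using Q by (auto simp: resonant_def)
      thus "3 ^ card Q * ?n Q = 0" by simp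
    qed auto
    also have "\<dots> \<le> (\<Sum>Q\<in>?N. 3 ^ card Q * ?n Q)"
      by (intro sum_mono2 card_resonant[OF \<theta> kM]) auto
    also have "\<dots> \<le> (\<Sum>Q\<in>?N. ?q ^ M * ?q powr (- 31 / 32 * k))"
    proof (intro sum_mono)
      fix Q assume "Q \<in> ?N"
      hence "Q \<in> psets PP M" "sdeg Q = k" using kM by (auto simp: resonant_def psets_def)
      thus "3 ^ card Q * ?n Q \<le> ?q ^ M * ?q powr (- 31 / 32 * k)" using single by blast
    qed
    also have "\<dots> = card ?N * (?q ^ M * ?q powr (- 31 / 32 * k))" by simp
    also have "\<dots> \<le> (1 + ?q ^ (2 * k) / ?q ^ M) * (?q ^ M * ?q powr (- 31 / 32 * k))"
      by (intro mult_right_mono card_resonant[OF \<theta> kM]) auto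
    also have "\<dots> = ?q ^ M * (?q powr (- 31 / 32 * k) + ?q powr (real (2 * k) - real M + (- 31 / 32 * k)))"
      unfolding powr_add powr_diff using q3 powr_realpow[of ?q "2 * k"] by (simp add: distrib_right distrib_left powr_realpow)
    also have "\<dots> \<le> ?q ^ M * ((1/2) ^ k + ?q powr (- real s / 2))"
    proof (intro mult_left_mono add_mono)
      \<comment> \<open>The base of the geometric series: \<open>?q powr (31 / 32)\<close> is at
        least 2 since \<open>2 ^ 32 \<le> 3 ^ 31\<close>.\<close>
      have "2 = (2 ^ 32) powr (1 / 32 :: real)" by (simp add: powr_power)
      also have "\<dots> \<le> (?q ^ 31) powr (1 / 32)"
      proof (intro powr_mono2)
        have "(2::real) ^ 32 \<le> 3 ^ 31" by simp
        also have "\<dots> \<le> ?q ^ 31" using q3 by (intro power_mono) auto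
        finally show "2 ^ 32 \<le> ?q ^ 31" .
      qed auto
      also have "?q ^ 31 = ?q powr 31" using powr_realpow[of ?q 31] q3 by simp
      also have "(?q powr 31) powr (1 / 32) = ?q powr (31 / 32)" unfolding powr_powr by simp
      finally have 2: "2 \<le> ?q powr (31 / 32)" .
      have "1 / ?q powr (31 / 32) = ?q powr (- 31 / 32)" by (simp add: powr_minus_divide)
      hence "?q powr (- 31 / 32 * k) = (1 / ?q powr (31 / 32)) ^ k"
        using q3 by (simp only:) (simp add: powr_power mult.commute)
      also have "\<dots> \<le> (1 / 2) ^ k" using 2 by (intro power_mono divide_left_mono) auto
      finally show "?q powr (- 31 / 32 * k) \<le> (1 / 2) ^ k" .
      have "real k \<le> 48 * s" using k by simp
      hence "real (2 * k) - M + (- 31 / 32 * k) \<le> - real s / 2" unfolding M by (simp add: field_simps)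
      thus "?q powr (real (2 * k) - real M + (- 31 / 32 * k)) \<le> ?q powr (- real s / 2)" using q3 by (intro powr_mono) auto
    qed auto
    finally show "(\<Sum>Q\<in>{Q\<in>?A. sdeg Q = k}. 3 ^ card Q * ?n Q) \<le> ?q ^ M * ((1/2) ^ k + ?q powr (- real s / 2))" .
  qed
  also have "\<dots> = ?q ^ M * ((\<Sum>k\<in>{k0<..48 * s}. (1/2) ^ k) + real (48 * s - k0) * ?q powr (- real s / 2))"
    by (simp add: sum.distrib flip: sum_distrib_left)
  also have "\<dots> \<le> ?q ^ M * ((1/2) ^ k0 + 48 * real s * ?q powr (- real s / 2))"
  proof (intro mult_left_mono add_mono mult_right_mono)
    \<comment> \<open>The subtracted last term makes the estimate inductive.\<close>
    have "(\<Sum>k\<in>{k0<..n}. (1/2::real) ^ k) \<le> (1/2) ^ k0 - (if k0 \<le> n then (1/2) ^ n else 0)" for n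
    proof (induction n)
      case (Suc n)
      show ?case
      proof (cases "k0 \<le> n")
        case True
        have "{k0<..Suc n} = insert (Suc n) {k0<..n}" using True by auto
        thus ?thesis using Suc True by simp
      qed (auto simp: le_Suc_eq)
    qed auto
    hence "(\<Sum>k\<in>{k0<..48 * s}. (1/2::real) ^ k) \<le> (1/2) ^ k0 - (if k0 \<le> 48 * s then (1/2) ^ (48 * s) else 0)" .
    also have "\<dots> \<le> (1/2) ^ k0" by simp
    finally show "(\<Sum>k\<in>{k0<..48 * s}. (1/2::real) ^ k) \<le> (1/2) ^ k0" .
  qed auto
  finally show ?thesis .
qed

end

section \<open>Irreducible polynomials in residue classes\<close>

lemma fps_conv_radius_ge_1:
  fixes A :: "complex fps"
  assumes bound: "\<And>n. norm (fps_nth A n) \<le> 1"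
  shows "fps_conv_radius A \<ge> 1"
  unfolding fps_conv_radius_def
proof (rule conv_radius_geI_ex')
  fix r :: real assume r: "0 < r" "ereal r < 1"
  show "summable (\<lambda>n. fps_nth A n * of_real r ^ n)"
  proof (rule summable_comparison_test[of _ "\<lambda>n. r ^ n"])
    show "\<exists>N. \<forall>n\<ge>N. norm (fps_nth A n * of_real r ^ n) \<le> r ^ n"
      using bound r by (auto simp: norm_mult norm_power intro!: exI[of _ 0] mult_left_le_one_le)
    show "summable (\<lambda>n. r ^ n)" using r by (intro summable_geometric) auto
  qed
qed

lemma sums_eval_fps_bounded:
  fixes A :: "complex fps"
  assumes "\<And>n. norm (fps_nth A n) \<le> 1" "norm u < 1"
  shows "(\<lambda>n. fps_nth A n * u ^ n) sums eval_fps A u"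
proof (rule sums_eval_fps)
  show "ereal (norm u) < fps_conv_radius A" using fps_conv_radius_ge_1[OF assms(1)] assms(2)
    by (metis ereal_less(3) less_le_trans one_ereal_def)
qed

lemma norm_eval_fps_le:
  fixes A :: "complex fps"
  assumes bound: "\<And>n. norm (fps_nth A n) \<le> 1" and "norm u < 1"
  shows "norm (eval_fps A u) \<le> 1 / (1 - norm u)"
proof -
  have *: "norm (fps_nth A n * u ^ n) \<le> norm u ^ n" for n
    using bound[of n] by (simp add: norm_mult norm_power mult_left_le_one_le)
  have s: "summable (\<lambda>n. norm u ^ n)" using assms by (intro summable_geometric) auto
  have "norm (eval_fps A u) \<le> (\<Sum>n. norm u ^ n)" unfolding eval_fps_def
  proof -
    have "summable (\<lambda>n. norm (fps_nth A n * u ^ n))"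
      by (rule summable_comparison_test'[OF s, of 0]) (use * in auto)
    thus "norm (\<Sum>n. fps_nth A n * u ^ n) \<le> (\<Sum>n. norm u ^ n)"
      using * s by (intro order_trans[OF summable_norm suminf_le]) auto
  qed
  also have "\<dots> = 1 / (1 - norm u)" using assms by (intro suminf_geometric) auto
  finally show ?thesis .
qed

text \<open>\<open>A\<close> is the power series of \<open>u p' / p\<close>, stated without
  division. For an L-polynomial its coefficients are normalised character sums over prime powers,
  hence bounded by 1; they tend to 0 once \<open>p\<close> has no zero in the closed unit
  disc.\<close>

locale log_derivative =
  fixes A :: "complex fps" and p :: "complex poly"
  assumes eq: "A * fps_of_poly p = fps_of_poly (pCons 0 (pderiv p))"
    and bound: "\<And>n. norm (fps_nth A n) \<le> 1" and p0: "poly p 0 \<noteq> 0"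
begin

lemma p_nz: "p \<noteq> 0" using p0 by auto

lemmas conv_radius_ge = fps_conv_radius_ge_1[OF bound]

lemmas norm_eval_le = norm_eval_fps_le[OF bound]

lemma eval_eq:
  assumes "norm u < 1"
  shows "eval_fps A u * poly p u = u * poly (pderiv p) u"
proof -
  have "ereal (norm u) < fps_conv_radius A" using assms conv_radius_ge
    by (metis ereal_less(3) less_le_trans one_ereal_def)
  hence "eval_fps (A * fps_of_poly p) u = eval_fps A u * eval_fps (fps_of_poly p) u"
    by (intro eval_fps_mult) auto
  thus ?thesis unfolding eq by simp
qed

text \<open>A zero of order \<open>m\<close> gives the logarithmic derivative a simple pole: with
  \<open>p = (u - z) ^ m * K\<close>, its polar part at \<open>u = t * z\<close> is
  \<open>- m * t / (1 - t)\<close>.\<close>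

lemma radial_limit:
  assumes z: "norm z \<le> 1" "z \<noteq> 0"
  shows "((\<lambda>t. of_real (1 - t) * eval_fps A (of_real t * z)) \<longlongrightarrow> - of_nat (order z p)) (at_left 1)"
proof -
  define m where "m = order z p"
  obtain K where K: "p = [:- z, 1:] ^ m * K" "\<not> [:- z, 1:] dvd K"
    using order_decomp[OF p_nz, of z] unfolding m_def by blast
  have Kz: "poly K z \<noteq> 0" using K(2) by (simp add: poly_eq_0_iff_dvd)
  have lim_tz: "((\<lambda>t. of_real t * z) \<longlongrightarrow> z) (at_left 1)"
  proof -
    have "((\<lambda>t. of_real t * z) \<longlongrightarrow> of_real 1 * z) (at_left 1)" by (intro tendsto_intros)
    thus ?thesis by simp
  qed
  have limK: "((\<lambda>t. poly K (of_real t * z)) \<longlongrightarrow> poly K z) (at_left 1)"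
    by (rule tendsto_compose[OF _ lim_tz]) (use poly_isCont isCont_def in blast)
  have limK': "((\<lambda>t. poly (pderiv K) (of_real t * z)) \<longlongrightarrow> poly (pderiv K) z) (at_left 1)"
    by (rule tendsto_compose[OF _ lim_tz]) (use poly_isCont isCont_def in blast)
  have evK: "\<forall>\<^sub>F t in at_left 1. poly K (of_real t * z) \<noteq> 0"
    using tendsto_imp_eventually_ne[OF limK Kz] .
  have ev01: "\<forall>\<^sub>F t in at_left (1::real). t \<in> {0<..<1}"
    by (rule eventually_at_leftI[of 0]) auto
  have main: "((\<lambda>t. - (of_nat m * of_real t) + of_real (1 - t) * (of_real t * z * poly (pderiv K) (of_real t * z) / poly K (of_real t * z)))
     \<longlongrightarrow> - (of_nat m * of_real 1) + of_real (1 - 1) * (of_real 1 * z * poly (pderiv K) z / poly K z)) (at_left 1)"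
    by (intro tendsto_intros limK limK' Kz)
  have "\<forall>\<^sub>F t in at_left 1. - (of_nat m * of_real t) + of_real (1 - t) * (of_real t * z * poly (pderiv K) (of_real t * z) / poly K (of_real t * z))
     = of_real (1 - t) * eval_fps A (of_real t * z)"
    using evK ev01
  proof eventually_elim
    case (elim t)
    let ?u = "of_real t * z"
    have u1: "norm ?u < 1" using elim z by (auto simp: norm_mult) (meson le_less_trans mult_left_le less_eq_real_def)
    have uz: "?u - z = of_real (t - 1) * z" by (simp add: algebra_simps)
    have d: "?u - z \<noteq> 0" unfolding uz using elim z by auto
    have "poly p ?u = (?u - z) ^ m * poly K ?u" unfolding K(1) by simp
    moreover have "poly (pderiv p) ?u = (?u - z) ^ m * poly (pderiv K) ?u + of_nat m * (?u - z) ^ (m - 1) * poly K ?u"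
      unfolding K(1) by (simp add: pderiv_mult pderiv_power pderiv_pCons algebra_simps)
    ultimately have "eval_fps A ?u * ((?u - z) ^ m * poly K ?u)
        = ?u * ((?u - z) ^ m * poly (pderiv K) ?u + of_nat m * (?u - z) ^ (m - 1) * poly K ?u)"
      using eval_eq[OF u1] by simp
    moreover have "of_nat m * (?u - z) ^ (m - 1) = of_nat m * ((?u - z) ^ m / (?u - z))"
      using d by (cases m) auto
    ultimately have "eval_fps A ?u * ((?u - z) ^ m * poly K ?u)
        = (?u - z) ^ m * (?u * poly (pderiv K) ?u + ?u * of_nat m / (?u - z) * poly K ?u)"
    proof -
      have "u * (Dm * K' + X * Kv) = Dm * (u * K' + u * m' / D * Kv)" if "X = m' * (Dm / D)"
        for u Dm K' X Kv m' D :: complex by (simp add: that algebra_simps)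
      from this[OF \<open>of_nat m * (?u - z) ^ (m - 1) = of_nat m * ((?u - z) ^ m / (?u - z))\<close>]
      show ?thesis using \<open>eval_fps A ?u * ((?u - z) ^ m * poly K ?u) = _\<close> by (simp only:)
    qed
    hence "eval_fps A ?u * poly K ?u = ?u * poly (pderiv K) ?u + ?u * of_nat m / (?u - z) * poly K ?u"
      using d by simp
    hence "eval_fps A ?u = ?u * poly (pderiv K) ?u / poly K ?u + ?u * of_nat m / (?u - z)"
      using elim by (simp add: field_simps)
    moreover have "of_real (1 - t) * (?u * of_nat m / (?u - z)) = - (of_nat m * of_real t)"
    proof -
      have "of_real t - 1 \<noteq> (0::complex)" using elim by auto
      thus ?thesis unfolding uz using z by (simp add: field_simps)
    qed
    ultimately show ?case by (simp add: distrib_left)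
  qed
  from Lim_transform_eventually[OF main this] show ?thesis by (simp add: m_def)
qed

text \<open>Bounded coefficients keep \<open>A\<close> bounded along the radius to a point inside
  the disc, so the radial limit is 0, and with it the order.\<close>

lemma no_small_roots:
  assumes "norm z < 1"
  shows "poly p z \<noteq> 0"
proof (cases "z = 0")
  case False
  have "((\<lambda>t. of_real (1 - t) * eval_fps A (of_real t * z)) \<longlongrightarrow> 0) (at_left 1)"
  proof (rule Lim_null_comparison)
    have ev01: "\<forall>\<^sub>F t in at_left (1::real). t \<in> {0<..<1}"
      by (rule eventually_at_leftI[of 0]) auto
    thus "\<forall>\<^sub>F t in at_left 1. norm (of_real (1 - t) * eval_fps A (of_real t * z)) \<le> (1 - t) * (1 / (1 - norm z))"
    proof eventually_elim
      case (elim t)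
      have le: "norm (of_real t * z) \<le> norm z" using elim by (simp add: norm_mult mult_left_le_one_le)
      hence "norm (eval_fps A (of_real t * z)) \<le> 1 / (1 - norm (of_real t * z))" using assms by (intro norm_eval_le) auto
      also have "\<dots> \<le> 1 / (1 - norm z)" using le assms by (intro divide_left_mono) auto
      finally have "\<bar>1 - t\<bar> * norm (eval_fps A (of_real t * z)) \<le> (1 - t) * (1 / (1 - norm z))"
        using elim by (intro mult_mono) auto
      thus ?case by (simp only: norm_mult norm_of_real)
    qed
    have "((\<lambda>t. (1 - t) * (1 / (1 - norm z))) \<longlongrightarrow> (1 - 1) * (1 / (1 - norm z))) (at_left 1)"
      by (intro tendsto_intros)
    thus "((\<lambda>t. (1 - t) * (1 / (1 - norm z))) \<longlongrightarrow> 0) (at_left 1)" by simp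
  qed
  from tendsto_unique[OF _ this radial_limit] assms False have "of_nat (order z p) = (0::complex)" by force
  thus ?thesis using p_nz by (simp add: order_root)
qed (use p0 in auto)

end

text \<open>The logarithmic derivative is additive in the roots, and a root \<open>x\<close>
  contributes the series \<open>B\<close> with coefficients \<open>- (1 / x) ^ n\<close>, which tend
  to 0. The induction splits off one root at a time.\<close>

lemma log_derivative_coeffs_tendsto_0:
  fixes A :: "complex fps"
  assumes "A * fps_of_poly p = fps_of_poly (pCons 0 (pderiv p))" "p \<noteq> 0"
    "\<And>z. poly p z = 0 \<Longrightarrow> norm z > 1"
  shows "fps_nth A \<longlonglongrightarrow> 0"
  using assms
proof (induction "degree p" arbitrary: p A)
  case 0
  hence "pderiv p = 0" by (simp add: pderiv_eq_0_iff)
  hence "A * fps_of_poly p = 0" using 0 by simp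
  hence "A = 0" using 0 by simp
  thus ?case by simp
next
  case (Suc d)
  obtain x where x: "poly p x = 0"
    using fundamental_theorem_of_algebra[of p] Suc(2) by (metis constant_degree Zero_not_Suc)
  then obtain p1 where p1: "p = [:- x, 1:] * p1" by (metis poly_eq_0_iff_dvd dvdE)
  have nx: "norm x > 1" using Suc.prems x by blast
  hence x0: "x \<noteq> 0" by auto
  have p1nz: "p1 \<noteq> 0" using p1 Suc.prems by auto
  have d1: "d = degree p1" using Suc(2) unfolding p1 by (subst (asm) degree_mult_eq) (use p1nz in auto)
  define B where "B = Abs_fps (\<lambda>n. if n = 0 then 0 else - ((1 / x) ^ n))"
  have B: "B * fps_of_poly [:- x, 1:] = fps_X"
  proof (rule fps_ext)
    fix n
    have e: "fps_of_poly [:- x, 1:] = fps_X - fps_const x" by (simp add: fps_of_poly_pCons)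
    have "B * fps_of_poly [:- x, 1:] = fps_X * B - fps_const x * B" unfolding e by (simp add: algebra_simps)
    hence "fps_nth (B * fps_of_poly [:- x, 1:]) n = (if n = 0 then 0 else fps_nth B (n - 1)) - x * fps_nth B n" by simp
    also have "\<dots> = fps_nth fps_X n"
      using x0 by (cases n) (auto simp: B_def)
    finally show "fps_nth (B * fps_of_poly [:- x, 1:]) n = fps_nth fps_X n" .
  qed
  have "(A - B) * fps_of_poly p1 = fps_of_poly (pCons 0 (pderiv p1))"
  proof -
    have "A * (fps_of_poly [:- x, 1:] * fps_of_poly p1) = fps_of_poly (pCons 0 (pderiv p))"
      using Suc.prems(1) unfolding p1 by (simp only: fps_of_poly_mult)
    also have "pCons 0 (pderiv p) = [:- x, 1:] * pCons 0 (pderiv p1) + pCons 0 p1"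
    proof -
      have c: "pCons 0 r = [:0, 1:] * r" for r :: "complex poly" by simp
      have "pderiv p = [:- x, 1:] * pderiv p1 + p1" unfolding p1 pderiv_mult by (simp add: pderiv_pCons)
      thus ?thesis unfolding c[of "pderiv p"] c[of "pderiv p1"] c[of p1]
        by (simp only: distrib_left mult.left_commute)
    qed
    also have "fps_of_poly \<dots> = fps_of_poly [:- x, 1:] * fps_of_poly (pCons 0 (pderiv p1)) + fps_X * fps_of_poly p1"
      by (simp only: fps_of_poly_add fps_of_poly_mult) (simp add: fps_of_poly_pCons[of 0 p1] mult.commute)
    finally have "fps_of_poly [:- x, 1:] * ((A - B) * fps_of_poly p1 - fps_of_poly (pCons 0 (pderiv p1))) = 0"
      unfolding B[symmetric] by (simp only: algebra_simps add_0_left)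
    moreover have "fps_of_poly [:- x, 1:] \<noteq> 0" using fps_of_poly_eq_iff[of "[:- x, 1:]" 0] by simp
    ultimately show ?thesis by simp
  qed
  hence "fps_nth (A - B) \<longlonglongrightarrow> 0"
    by (rule Suc(1)[OF d1]) (use p1nz Suc.prems(3) p1 in auto)
  moreover have "(\<lambda>n. - ((1 / x) ^ n)) \<longlonglongrightarrow> - 0"
    using nx by (intro tendsto_minus LIMSEQ_power_zero) (simp add: norm_divide divide_less_eq)
  hence "(\<lambda>n. fps_nth B n) \<longlonglongrightarrow> 0"
    using Lim_transform_eventually[of "\<lambda>n. - ((1 / x) ^ n)" 0 sequentially "\<lambda>n. fps_nth B n"]
    by (simp add: B_def eventually_mono[OF eventually_gt_at_top[of 0]])
  ultimately have "(\<lambda>n. fps_nth (A - B) n + fps_nth B n) \<longlonglongrightarrow> 0 + 0" by (intro tendsto_add)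
  thus ?case by simp
qed

section \<open>Monic polynomials and the von Mangoldt weight\<close>

lemma ex_mprime_dvd:
  fixes f :: "'a::{field,finite} poly"
  assumes "degree f > 0"
  shows "\<exists>P\<in>mprimes. P dvd f"
proof -
  let ?D = "\<lambda>n. \<exists>d. d dvd f \<and> lead_coeff d = 1 \<and> degree d > 0 \<and> degree d = n"
  have f0: "f \<noteq> 0" using assms by auto
  have norm: "\<exists>d. d dvd g \<and> lead_coeff d = 1 \<and> degree d = degree g" if "g \<noteq> 0" for g :: "'a poly"
    by (rule exI[of _ "smult (inverse (lead_coeff g)) g"]) (use that in \<open>auto simp: smult_dvd_iff\<close>)
  have ex: "\<exists>n. ?D n" using norm[OF f0] assms by auto
  define n where "n = (LEAST n. ?D n)"
  have "?D n" unfolding n_def by (rule LeastI_ex[OF ex])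
  then obtain d where d: "d dvd f" "lead_coeff d = 1" "degree d > 0" "degree d = n" by blast
  have d0: "d \<noteq> 0" using d by auto
  have "irreducible d"
  proof (rule irreducibleI)
    show "\<not> is_unit d" using is_unit_iff_degree[OF d0] d by simp
    fix a b assume ab: "d = a * b"
    hence ab0: "a \<noteq> 0" "b \<noteq> 0" using d0 by auto
    show "is_unit a \<or> is_unit b"
    proof (rule ccontr)
      assume "\<not> (is_unit a \<or> is_unit b)"
      hence pos: "degree a > 0" "degree b > 0" using is_unit_iff_degree ab0 by auto
      have "degree a < n" using pos d(4) ab ab0 by (simp add: degree_mult_eq)
      moreover have "?D (degree a)"
      proof -
        obtain a' where a': "a' dvd a" "lead_coeff a' = 1" "degree a' = degree a" using norm[OF ab0(1)] by blast
        moreover have "a' dvd f" using a'(1) ab d(1) by (meson dvd_trans dvd_triv_left)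
        ultimately show ?thesis using pos by auto
      qed
      ultimately show False unfolding n_def using not_less_Least by blast
    qed
  qed (fact d0)
  thus ?thesis using d unfolding mprimes_def by auto
qed

definition monics :: "nat \<Rightarrow> 'a::{field,finite} poly set" where
  "monics n = {f. lead_coeff f = 1 \<and> degree f = n}"

lemma monics_eq: "monics n = (\<lambda>m. monom 1 n + m) ` polys_below n"
proof (intro set_eqI iffI)
  fix f :: "'a poly" assume f: "f \<in> monics n"
  have "coeff (f - monom 1 n) i = 0" if "i \<ge> n" for i
    using f that by (cases "i = n") (auto simp: monics_def coeff_eq_0)
  hence "f - monom 1 n \<in> polys_below n" unfolding polys_below_def by blast
  thus "f \<in> (\<lambda>m. monom 1 n + m) ` polys_below n" by (intro image_eqI[of _ _ "f - monom 1 n"]) auto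
next
  fix f :: "'a poly" assume "f \<in> (\<lambda>m. monom 1 n + m) ` polys_below n"
  then obtain m where m: "f = monom 1 n + m" "m \<in> polys_below n" by auto
  have c: "coeff f n = 1" using m by (simp add: polys_below_def)
  have "degree f \<le> n"
  proof (rule degree_le, intro allI impI)
    fix i assume "n < i"
    thus "coeff f i = 0" using m by (simp add: polys_below_def)
  qed
  moreover have "n \<le> degree f" by (rule le_degree) (simp add: c)
  ultimately show "f \<in> monics n" using c by (auto simp: monics_def)
qed

lemma sum_monics: "(\<Sum>f\<in>monics n. g f) = (\<Sum>m\<in>polys_below n. g (monom 1 n + m))"
  unfolding monics_eq by (subst sum.reindex) (auto simp: inj_on_def)

lemma finite_monics [simp]: "finite (monics n)"
  unfolding monics_eq by simp

lemma card_monics: "card (monics n :: 'a::{field,finite} poly set) = CARD('a) ^ n"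
  unfolding monics_eq by (subst card_image) (auto simp: inj_on_def card_polys_below)

lemma monics_mult: "f \<in> monics m \<Longrightarrow> g \<in> monics n \<Longrightarrow> f * g \<in> monics (m + n)"
  using lead_coeff_mult[of f g] degree_mult_eq[of f g] by (cases "f = 0 \<or> g = 0") (auto simp: monics_def)

lemma monics_div: "f * g \<in> monics n \<Longrightarrow> f \<in> monics k \<Longrightarrow> k \<le> n \<and> g \<in> monics (n - k)"
  using lead_coeff_mult[of f g] degree_mult_eq[of f g] by (cases "f = 0 \<or> g = 0") (auto simp: monics_def)

lemma mprimes_monics: "P \<in> mprimes \<Longrightarrow> P \<in> monics (degree P)"
  by (simp add: mprimes_def monics_def)

lemma monics_power: "f \<in> monics k \<Longrightarrow> f ^ j \<in> monics (j * k)"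
proof (induction j)
  case 0
  show ?case by (simp add: monics_def)
next
  case (Suc j)
  thus ?case using monics_mult[of f k "f ^ j" "j * k"] by simp
qed

lemma monics_0: "monics 0 = {1}"
proof -
  have "polys_below 0 = {0 :: 'a poly}" by (auto simp: polys_below_degree)
  thus ?thesis unfolding monics_eq by simp
qed

text \<open>The support of the von Mangoldt function among the divisors of \<open>f\<close>; a pair
  \<open>(P, j)\<close> stands for \<open>P ^ j\<close> and will carry the weight
  \<open>degree P\<close>.\<close>

definition prime_power_divisors :: "'a::{field,finite} poly \<Rightarrow> ('a poly \<times> nat) set" where
  "prime_power_divisors f = {(P, j). P \<in> mprimes \<and> 1 \<le> j \<and> P ^ j dvd f}"

lemma prime_power_dvd_cancel:
  assumes "P \<in> mprimes" "P0 \<in> mprimes" "P \<noteq> P0"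
  shows "P ^ j dvd P0 * g \<Longrightarrow> P ^ j dvd g"
proof (induction j arbitrary: g)
  case (Suc j)
  have "P dvd P0 * g" using Suc(2) by (metis dvd_trans dvd_triv_left power_Suc)
  hence "P dvd g" using assms mprimesD(4)[OF assms(1)] by (simp add: prime_elem_dvd_mult_iff mprimes_dvd_iff)
  then obtain g' where g': "g = P * g'" by auto
  have "P * P ^ j dvd P * (P0 * g')" using Suc(2) g' by (simp add: mult_ac)
  hence "P ^ j dvd P0 * g'" using dvd_times_left_cancel_iff[OF mprimesD(2)[OF assms(1)]] by blast
  hence "P ^ j dvd g'" by (rule Suc(1))
  thus ?case unfolding g' power_Suc by (rule mult_dvd_mono[OF dvd_refl])
qed simp

text \<open>The analogue of the sum of the von Mangoldt function over divisors being the logarithm.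
  Removing one prime \<open>P0\<close> lowers the exponents at \<open>P0\<close> by one and loses
  exactly the pair \<open>(P0, 1)\<close>.\<close>

lemma degree_prime_power_divisors:
  "f \<in> monics n \<Longrightarrow> finite (prime_power_divisors f) \<and> (\<Sum>(P, j)\<in>prime_power_divisors f. degree P) = n"
proof (induction n arbitrary: f rule: less_induct)
  case (less n)
  show ?case
  proof (cases "n = 0")
    case True
    have f: "f = 1" using less(2) unfolding True monics_0 by simp
    have "\<not> P ^ j dvd 1" if P: "P \<in> mprimes" and j: "1 \<le> j" for P :: "'a poly" and j
    proof
      assume "P ^ j dvd 1"
      moreover have "P dvd P ^ j" using j by (intro dvd_power) auto
      ultimately have "is_unit P" by (rule dvd_trans[rotated])
      thus False using irreducible_not_unit[OF mprimesD(1)[OF P]] by contradiction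
    qed
    hence "prime_power_divisors f = {}" unfolding f prime_power_divisors_def by auto
    thus ?thesis using True by simp
  next
    case False
    hence "degree f > 0" using less(2) by (simp add: monics_def)
    then obtain P0 g where P0: "P0 \<in> mprimes" and f: "f = P0 * g" using ex_mprime_dvd by blast
    let ?d = "degree P0"
    have g: "?d \<le> n" "g \<in> monics (n - ?d)" using monics_div[of P0 g n ?d] less(2) f mprimes_monics[OF P0] by auto
    have dpos: "?d > 0" using mprimesD(3)[OF P0] .
    have IH: "finite (prime_power_divisors g)" "(\<Sum>(P, j)\<in>prime_power_divisors g. degree P) = n - ?d"
      using less(1)[OF _ g(2)] dpos False by auto
    let ?s = "\<lambda>(P, j). (P, if P = P0 then Suc j else j)"
    have eq: "prime_power_divisors f = insert (P0, 1) (?s ` prime_power_divisors g)"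
    proof (intro set_eqI iffI)
      fix x assume "x \<in> prime_power_divisors f"
      then obtain P j where x: "x = (P, j)" "P \<in> mprimes" "1 \<le> j" "P ^ j dvd P0 * g"
        by (auto simp: prime_power_divisors_def f)
      show "x \<in> insert (P0, 1) (?s ` prime_power_divisors g)"
      proof (cases "P = P0")
        case True
        then obtain i where i: "j = Suc i" using x by (cases j) auto
        have "P0 ^ i dvd g" using x(4) mprimesD(2)[OF P0] unfolding True i by simp
        thus ?thesis using x i True P0 by (cases "i = 0") (auto simp: prime_power_divisors_def image_iff)
      next
        case neq: False
        have "P ^ j dvd g" by (rule prime_power_dvd_cancel[OF x(2) P0 neq x(4)])
        thus ?thesis using x neq by (auto simp: prime_power_divisors_def image_iff intro!: bexI[of _ "(P, j)"])
      qed
    qed (use P0 in \<open>auto simp: prime_power_divisors_def f intro: dvd_mult split: if_splits\<close>)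
    have nin: "(P0, 1) \<notin> ?s ` prime_power_divisors g" by (auto simp: prime_power_divisors_def split: if_splits)
    have inj: "inj_on ?s (prime_power_divisors g)" by (auto simp: inj_on_def split: if_splits)
    have "(\<Sum>(P, j)\<in>prime_power_divisors f. degree P) = ?d + (\<Sum>(P, j)\<in>?s ` prime_power_divisors g. degree P)"
      unfolding eq using nin IH(1) by simp
    also have "(\<Sum>(P, j)\<in>?s ` prime_power_divisors g. degree P) = (\<Sum>(P, j)\<in>prime_power_divisors g. degree P)"
      by (subst sum.reindex[OF inj]) (auto intro!: sum.cong)
    finally show ?thesis using IH g(1) unfolding eq by simp
  qed
qed

definition prime_powers :: "nat \<Rightarrow> ('a::{field,finite} poly \<times> nat) set" where
  "prime_powers n = {(P, j). P \<in> mprimes \<and> 1 \<le> j \<and> j * degree P = n}"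

lemma finite_prime_powers [simp]: "finite (prime_powers n :: ('a::{field,finite} poly \<times> nat) set)"
proof (rule finite_subset)
  show "finite ((polys_below (Suc n) :: 'a poly set) \<times> {..n})" by simp
  show "prime_powers n \<subseteq> (polys_below (Suc n) :: 'a poly set) \<times> {..n}"
  proof
    fix x :: "'a poly \<times> nat" assume "x \<in> prime_powers n"
    then obtain P j where x: "x = (P, j)" "P \<in> mprimes" "1 \<le> j" "j * degree P = n" by (auto simp: prime_powers_def)
    have "1 * degree P \<le> j * degree P" "j * 1 \<le> j * degree P"
      using x mprimesD(3)[OF x(2)] by (intro mult_le_mono; simp)+
    thus "x \<in> (polys_below (Suc n) :: 'a poly set) \<times> {..n}" using x by (auto simp: polys_below_degree)
  qed
qed

definition multiplicative :: "('a::{field,finite} poly \<Rightarrow> complex) \<Rightarrow> bool" where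
  "multiplicative f \<longleftrightarrow> f 1 = 1 \<and> (\<forall>x y. f (x * y) = f x * f y)"

lemma multiplicative_power: "multiplicative f \<Longrightarrow> f (x ^ j) = f x ^ j"
  by (induction j) (auto simp: multiplicative_def)

text \<open>\<open>lsum f\<close> gives the coefficients of the L-series of \<open>f\<close>, and
  \<open>csum f\<close> those of its logarithmic derivative, that is, of the von Mangoldt function
  twisted by \<open>f\<close>.\<close>

definition lsum :: "('a::{field,finite} poly \<Rightarrow> complex) \<Rightarrow> nat \<Rightarrow> complex" where
  "lsum f n = (\<Sum>g\<in>monics n. f g)"

definition csum :: "('a::{field,finite} poly \<Rightarrow> complex) \<Rightarrow> nat \<Rightarrow> complex" where
  "csum f n = (\<Sum>(P, j)\<in>prime_powers n. of_nat (degree P) * f P ^ j)"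

text \<open>Coefficientwise \<open>u L' = (u L' / L) L\<close>. The factor \<open>n\<close> is the
  degree of each \<open>g\<close>, spread over the prime powers \<open>P ^ j\<close> dividing it;
  the cofactor of \<open>P ^ j\<close> then runs over all monic polynomials of degree
  \<open>n - k\<close>.\<close>

lemma lsum_csum:
  assumes f: "multiplicative f"
  shows "of_nat n * lsum f n = (\<Sum>k=1..n. csum f k * lsum f (n - k))"
proof -
  let ?U = "SIGMA k:{1..n}. (prime_powers k :: ('a poly \<times> nat) set)"
  have key: "of_nat n * f g = (\<Sum>(k, P, j)\<in>?U. if P ^ j dvd g then of_nat (degree P) * f g else 0)"
    if g: "g \<in> monics n" for g
  proof -
    have D: "prime_power_divisors g = snd ` {u \<in> ?U. case u of (k, P, j) \<Rightarrow> P ^ j dvd g}"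
    proof (intro set_eqI iffI)
      fix x assume "x \<in> prime_power_divisors g"
      then obtain P j h where x: "x = (P, j)" "P \<in> mprimes" "1 \<le> j" "g = P ^ j * h"
        unfolding prime_power_divisors_def by blast
      have "P ^ j \<in> monics (j * degree P)" using monics_power[OF mprimes_monics[OF x(2)]] .
      hence "j * degree P \<le> n" using monics_div[of "P ^ j" h n] g x(4) by auto
      hence "(j * degree P, P, j) \<in> {u \<in> ?U. case u of (k, P, j) \<Rightarrow> P ^ j dvd g}"
        using x mprimesD(3)[OF x(2)] by (auto simp: prime_powers_def Suc_le_eq)
      thus "x \<in> snd ` {u \<in> ?U. case u of (k, P, j) \<Rightarrow> P ^ j dvd g}"
        using x(1) by (intro image_eqI[of x snd "(j * degree P, P, j)"]) simp_all
    qed (auto simp: prime_power_divisors_def prime_powers_def)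
    have inj: "inj_on snd {u \<in> ?U. case u of (k, P, j) \<Rightarrow> P ^ j dvd g}"
      by (auto simp: inj_on_def prime_powers_def)
    have finU: "finite ?U" by simp
    have "of_nat n = (of_nat (\<Sum>(P, j)\<in>prime_power_divisors g. degree P) :: complex)"
      using degree_prime_power_divisors[OF g] by simp
    also have "\<dots> = (\<Sum>(P, j)\<in>prime_power_divisors g. of_nat (degree P))" by (simp add: case_prod_unfold)
    also have "\<dots> = (\<Sum>(k, P, j)\<in>{u \<in> ?U. case u of (k, P, j) \<Rightarrow> P ^ j dvd g}. of_nat (degree P))"
      unfolding D by (subst sum.reindex[OF inj]) (simp add: case_prod_unfold)
    also have "\<dots> = (\<Sum>(k, P, j)\<in>?U. if P ^ j dvd g then of_nat (degree P) else 0)"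
      by (subst sum.inter_filter[OF finU]) (auto intro!: sum.cong)
    finally have "of_nat n * f g = (\<Sum>(k, P, j)\<in>?U. if P ^ j dvd g then of_nat (degree P) else 0) * f g" by simp
    thus ?thesis unfolding sum_distrib_right by (simp add: case_prod_unfold if_distrib[of "\<lambda>x. x * f g"] cong: if_cong)
  qed
  have "of_nat n * lsum f n = (\<Sum>g\<in>monics n. \<Sum>(k, P, j)\<in>?U. if P ^ j dvd g then of_nat (degree P) * f g else 0)"
    unfolding lsum_def sum_distrib_left by (intro sum.cong refl key)
  also have "\<dots> = (\<Sum>(k, P, j)\<in>?U. \<Sum>g\<in>monics n. if P ^ j dvd g then of_nat (degree P) * f g else 0)"
    by (subst sum.swap) (simp add: case_prod_unfold)
  also have "\<dots> = (\<Sum>(k, P, j)\<in>?U. of_nat (degree P) * f P ^ j * lsum f (n - k))"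
  proof (intro sum.cong refl, clarify)
    fix k j and P :: "'a poly" assume k: "k \<in> {1..n}" and "(P, j) \<in> prime_powers k"
    hence P: "P \<in> mprimes" "1 \<le> j" "j * degree P = k" by (auto simp: prime_powers_def)
    have Pj: "P ^ j \<in> monics k" using monics_power[OF mprimes_monics[OF P(1)], of j] P(3) by simp
    have Pj0: "P ^ j \<noteq> 0" using mprimesD(2)[OF P(1)] by simp
    have "(\<Sum>g\<in>monics n. if P ^ j dvd g then of_nat (degree P) * f g else 0)
        = (\<Sum>g\<in>{g\<in>monics n. P ^ j dvd g}. of_nat (degree P) * f g)"
      by (subst sum.inter_filter) auto
    also have "{g\<in>monics n. P ^ j dvd g} = (\<lambda>h. P ^ j * h) ` monics (n - k)"
    proof (intro set_eqI iffI)
      fix g assume "g \<in> {g\<in>monics n. P ^ j dvd g}"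
      then obtain h where h: "g = P ^ j * h" "g \<in> monics n" by auto
      hence "h \<in> monics (n - k)" using monics_div[of "P ^ j" h n k] Pj by simp
      thus "g \<in> (\<lambda>h. P ^ j * h) ` monics (n - k)" using h by auto
    next
      fix g assume "g \<in> (\<lambda>h. P ^ j * h) ` monics (n - k)"
      then obtain h where h: "g = P ^ j * h" "h \<in> monics (n - k)" by auto
      thus "g \<in> {g\<in>monics n. P ^ j dvd g}" using monics_mult[OF Pj h(2)] k by simp
    qed
    also have "(\<Sum>g\<in>(\<lambda>h. P ^ j * h) ` monics (n - k). of_nat (degree P) * f g)
        = (\<Sum>h\<in>monics (n - k). of_nat (degree P) * (f P ^ j * f h))"
    proof (subst sum.reindex)
      show "inj_on (\<lambda>h. P ^ j * h) (monics (n - k))" using Pj0 by (auto simp: inj_on_def)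
      have "f (P ^ j * h) = f P ^ j * f h" for h
        using f multiplicative_power[OF f] unfolding multiplicative_def by simp
      thus "sum ((\<lambda>g. of_nat (degree P) * f g) \<circ> (\<lambda>h. P ^ j * h)) (monics (n - k))
         = (\<Sum>h\<in>monics (n - k). of_nat (degree P) * (f P ^ j * f h))" by simp
    qed
    finally show "(\<Sum>g\<in>monics n. if P ^ j dvd g then of_nat (degree P) * f g else 0)
        = of_nat (degree P) * f P ^ j * lsum f (n - k)"
      by (simp add: lsum_def sum_distrib_left mult_ac)
  qed
  also have "\<dots> = (\<Sum>k=1..n. \<Sum>(P, j)\<in>prime_powers k. of_nat (degree P) * f P ^ j * lsum f (n - k))"
    by (subst sum.Sigma) (auto simp: case_prod_unfold)
  also have "\<dots> = (\<Sum>k=1..n. csum f k * lsum f (n - k))"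
    by (simp add: csum_def sum_distrib_right case_prod_unfold)
  finally show ?thesis .
qed

text \<open>The prime number theorem, exact here: the L-series has coefficients
  \<open>q ^ k\<close>, and the recurrence \<open>lsum_csum\<close> determines \<open>csum\<close>
  inductively.\<close>

lemma csum_1:
  assumes "n > 0"
  shows "csum (\<lambda>_ :: 'a::{field,finite} poly. 1) n = of_nat CARD('a) ^ n"
  using assms
proof (induction n rule: less_induct)
  case (less n)
  let ?q = "of_nat CARD('a) :: complex"
  have mult: "multiplicative (\<lambda>_ :: 'a poly. 1)" by (simp add: multiplicative_def)
  have l: "lsum (\<lambda>_ :: 'a poly. 1) k = ?q ^ k" for k by (simp add: lsum_def card_monics)
  have "of_nat n * ?q ^ n = (\<Sum>k=1..n. csum (\<lambda>_ :: 'a poly. 1) k * ?q ^ (n - k))"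
    using lsum_csum[OF mult, of n] by (simp only: l)
  also have "\<dots> = csum (\<lambda>_ :: 'a poly. 1) n + (\<Sum>k=1..<n. csum (\<lambda>_ :: 'a poly. 1) k * ?q ^ (n - k))"
  proof -
    have "{1..n} = insert n {1..<n}" using less(2) by auto
    thus ?thesis by simp
  qed
  also have "(\<Sum>k=1..<n. csum (\<lambda>_ :: 'a poly. 1) k * ?q ^ (n - k)) = (\<Sum>k=1..<n. ?q ^ n)"
    using less(1) by (intro sum.cong refl) (auto simp flip: power_add)
  also have "\<dots> = of_nat (n - 1) * ?q ^ n" by simp
  finally have "csum (\<lambda>_ :: 'a poly. 1) n = (of_nat n - of_nat (n - 1)) * ?q ^ n" by (simp add: algebra_simps)
  thus ?case using less(2) by (simp add: of_nat_diff)
qed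

lemma prime_powers_weight:
  assumes "n > 0"
  shows "(\<Sum>(P, j)\<in>(prime_powers n :: ('a::{field,finite} poly \<times> nat) set). degree P) = CARD('a) ^ n"
proof -
  have "of_nat (\<Sum>(P, j)\<in>(prime_powers n :: ('a poly \<times> nat) set). degree P) = (of_nat (CARD('a) ^ n) :: complex)"
    using csum_1[OF assms, where 'a = 'a] by (simp add: csum_def case_prod_unfold)
  thus ?thesis by (simp only: of_nat_eq_iff)
qed

lemma card_mprimes_le: "n > 0 \<Longrightarrow> n * card {P\<in>(mprimes :: 'a::{field,finite} poly set). degree P = n} \<le> CARD('a) ^ n"
proof -
  assume n: "n > 0"
  let ?S = "{P\<in>(mprimes :: 'a poly set). degree P = n}"
  have sub: "(\<lambda>P. (P, 1)) ` ?S \<subseteq> prime_powers n" by (auto simp: prime_powers_def)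
  have "n * card ?S = (\<Sum>(P, j)\<in>(\<lambda>P. (P, 1::nat)) ` ?S. degree P)"
    by (subst sum.reindex) (auto simp: inj_on_def)
  also have "\<dots> \<le> (\<Sum>(P, j)\<in>(prime_powers n :: ('a poly \<times> nat) set). degree P)"
    by (intro sum_mono2 sub) auto
  also have "\<dots> = CARD('a) ^ n" by (rule prime_powers_weight[OF n])
  finally show ?thesis .
qed

lemma bij_mod_shift:
  fixes W :: "'a::{field,finite} poly"
  assumes W: "W \<noteq> 0"
  shows "bij_betw (\<lambda>v. (s + v) mod W) (polys_below (degree W)) (polys_below (degree W))"
proof -
  have "inj_on (\<lambda>v. (s + v) mod W) (polys_below (degree W))"
  proof (rule inj_onI)
    fix v v' assume *: "v \<in> polys_below (degree W)" "v' \<in> polys_below (degree W)" "(s + v) mod W = (s + v') mod W"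
    have "W dvd (s + v) - (s + v')" using *(3) by (simp add: mod_eq_dvd_iff)
    hence "W dvd v - v'" by simp
    thus "v = v'" using dvd_polys_below[of W "v - v'"] * by (simp add: polys_below_diff)
  qed
  moreover have "(\<lambda>v. (s + v) mod W) ` polys_below (degree W) \<subseteq> polys_below (degree W)"
    using mod_in_polys_below[OF W] by auto
  ultimately show ?thesis by (simp add: bij_betw_def endo_inj_surj)
qed

text \<open>Equidistribution modulo \<open>W\<close> is exact as soon as \<open>n\<close> reaches
  \<open>degree W\<close>; this makes the L-series of a nonprincipal character a polynomial.\<close>

lemma sum_mod:
  fixes W :: "'a::{field,finite} poly" and h :: "'a poly \<Rightarrow> complex"
  assumes W: "W \<noteq> 0" and n: "degree W \<le> n"
  shows "(\<Sum>m\<in>polys_below n. h ((r + m) mod W)) = of_nat CARD('a) ^ (n - degree W) * (\<Sum>u\<in>polys_below (degree W). h u)"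
proof -
  let ?V = "polys_below n :: 'a poly set" and ?U = "polys_below (degree W) :: 'a poly set"
  have UV: "?U \<subseteq> ?V" by (rule polys_below_mono[OF n])
  have "of_nat (CARD('a) ^ degree W) * (\<Sum>m\<in>?V. h ((r + m) mod W)) = (\<Sum>v\<in>?U. \<Sum>m\<in>?V. h ((r + m) mod W))"
    by (simp add: card_polys_below)
  also have "\<dots> = (\<Sum>v\<in>?U. \<Sum>m\<in>?V. h ((r + (m + v)) mod W))"
    by (intro sum.cong refl sum_polys_below_shift[symmetric, of _ n "\<lambda>m. h ((r + m) mod W)"]) (use UV in auto)
  also have "\<dots> = (\<Sum>m\<in>?V. \<Sum>v\<in>?U. h (((r + m) + v) mod W))"
    by (subst sum.swap) (simp add: add.assoc)
  also have "\<dots> = (\<Sum>m\<in>?V. \<Sum>u\<in>?U. h u)"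
    by (intro sum.cong refl sum.reindex_bij_betw[OF bij_mod_shift[OF W]])
  also have "\<dots> = of_nat (CARD('a) ^ n) * (\<Sum>u\<in>?U. h u)" by (simp add: card_polys_below)
  also have "CARD('a) ^ n = CARD('a) ^ degree W * CARD('a) ^ (n - degree W)" using n by (simp flip: power_add)
  finally show ?thesis by simp
qed

section \<open>Dirichlet characters and L-polynomials modulo a squarefree polynomial\<close>

locale modulus =
  fixes S :: "'a::{field,finite} poly set"
  assumes fin: "finite S" and primes: "S \<subseteq> mprimes" and nonempty: "S \<noteq> {}"
begin

definition W :: "'a poly" where "W = \<Prod>S"

abbreviation "D \<equiv> degree W"

definition U :: "'a poly set" where "U = {f \<in> polys_below D. \<forall>P\<in>S. \<not> P dvd f}"

lemma W_nz: "W \<noteq> 0" unfolding W_def by (rule prod_mprimes_nonzero[OF fin primes])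

lemma dvd_W: "P \<in> S \<Longrightarrow> P dvd W" unfolding W_def using fin by auto

lemma D_eq: "D = sdeg S" unfolding W_def by (rule degree_prod_mprimes[OF fin primes])

lemma D_pos: "D > 0"
proof -
  obtain P where P: "P \<in> S" using nonempty by auto
  have "degree P \<le> sdeg S" unfolding sdeg_def using P fin by (intro member_le_sum) auto
  thus ?thesis using mprimesD(3) P primes D_eq by fastforce
qed

lemma W_dvd_iff: "W dvd n \<longleftrightarrow> (\<forall>P\<in>S. P dvd n)"
  unfolding W_def by (rule prod_mprimes_dvd_iff[OF fin primes])

lemma dvd_mod_W: "P \<in> S \<Longrightarrow> P dvd f mod W \<longleftrightarrow> P dvd f"
  using dvd_W by (simp add: dvd_mod_iff)

lemma mod_W_U: "f mod W \<in> U \<longleftrightarrow> (\<forall>P\<in>S. \<not> P dvd f)"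
  unfolding U_def using mod_in_polys_below[OF W_nz] dvd_mod_W by auto

lemma prime_S: "P \<in> S \<Longrightarrow> prime_elem P"
  using mprimesD(4) primes by auto

lemma mod_W_id: "f \<in> polys_below D \<Longrightarrow> f mod W = f"
  by (cases "f = 0") (auto simp: polys_below_degree mod_poly_less)

lemma one_U: "1 \<in> U"
proof -
  have "\<not> P dvd 1" if "P \<in> S" for P using prime_S[OF that] by (simp add: prime_elem_def)
  thus ?thesis unfolding U_def using D_pos by (auto simp: polys_below_degree)
qed

lemma mult_U: "f \<in> U \<Longrightarrow> g \<in> U \<Longrightarrow> (f * g) mod W \<in> U"
  unfolding mod_W_U using prime_S by (auto simp: U_def prime_elem_dvd_mult_iff)

lemma U_sub: "U \<subseteq> polys_below D" unfolding U_def by auto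

lemma inv_U:
  assumes f: "f \<in> U"
  shows "\<exists>g\<in>U. (f * g) mod W = 1"
proof -
  have "inj_on (\<lambda>g. (f * g) mod W) U"
  proof (rule inj_onI)
    fix g g' assume *: "g \<in> U" "g' \<in> U" "(f * g) mod W = (f * g') mod W"
    have "W dvd f * g - f * g'" using *(3) by (simp add: mod_eq_dvd_iff)
    hence "W dvd f * (g - g')" by (simp add: algebra_simps)
    hence "\<forall>P\<in>S. P dvd g - g'" using f prime_S by (auto simp: W_dvd_iff U_def prime_elem_dvd_mult_iff)
    hence "W dvd g - g'" by (simp add: W_dvd_iff)
    moreover have "g - g' \<in> polys_below D" using * U_sub by (auto intro: polys_below_diff)
    ultimately show "g = g'" using dvd_polys_below[of W "g - g'"] by simp
  qed
  moreover have "(\<lambda>g. (f * g) mod W) ` U \<subseteq> U" using mult_U[OF f] by auto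
  moreover have "finite U" using U_sub finite_polys_below finite_subset by blast
  ultimately have "(\<lambda>g. (f * g) mod W) ` U = U" by (intro endo_inj_surj) auto
  hence "1 \<in> (\<lambda>g. (f * g) mod W) ` U" using one_U by simp
  then obtain g where "1 = (f * g) mod W" "g \<in> U" by (rule imageE)
  thus ?thesis by (intro bexI[of _ g]) simp_all
qed

sublocale U: finite_abelian U "\<lambda>f g. (f * g) mod W" 1
proof
  show "finite U" using U_sub finite_polys_below finite_subset by blast
  show "1 \<in> U" by (rule one_U)
  show "\<And>x y. x \<in> U \<Longrightarrow> y \<in> U \<Longrightarrow> x * y mod W \<in> U" by (rule mult_U)
  show "\<And>x y z. x * y mod W * z mod W = x * (y * z mod W) mod W" by (simp add: mod_simps mult.assoc)
  show "\<And>x y. x * y mod W = y * x mod W" by (simp add: mult.commute)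
  show "\<And>x. x \<in> U \<Longrightarrow> 1 * x mod W = x" using mod_W_id U_sub by auto
  show "\<And>x. x \<in> U \<Longrightarrow> \<exists>y\<in>U. x * y mod W = 1" by (rule inv_U)
qed

definition ext :: "('a poly \<Rightarrow> complex) \<Rightarrow> 'a poly \<Rightarrow> complex" where
  "ext \<psi> f = \<psi> (f mod W)"

definition principal :: "'a poly \<Rightarrow> complex" where
  "principal = (\<lambda>x. if x \<in> U then 1 else 0)"

lemma principal_char: "principal \<in> U.chars"
  unfolding principal_def by (rule U.one_chars)

lemma mod_W_mult_U: "(f * g) mod W \<in> U \<longleftrightarrow> f mod W \<in> U \<and> g mod W \<in> U"
  unfolding mod_W_U using prime_S by (auto simp: prime_elem_dvd_mult_iff)

lemma ext_multiplicative:
  assumes \<psi>: "\<psi> \<in> U.chars"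
  shows "multiplicative (ext \<psi>)"
  unfolding multiplicative_def
proof (intro conjI allI)
  show "ext \<psi> 1 = 1" unfolding ext_def mod_W_id[OF subsetD[OF U_sub one_U]] by (rule U.charsD(2)[OF \<psi>])
  fix f g
  show "ext \<psi> (f * g) = ext \<psi> f * ext \<psi> g"
  proof (cases "(f * g) mod W \<in> U")
    case True
    hence "f mod W \<in> U" "g mod W \<in> U" using mod_W_mult_U by auto
    from U.charsD(1)[OF \<psi> this] show ?thesis by (simp add: ext_def mod_mult_eq)
  next
    case False
    hence "f mod W \<notin> U \<or> g mod W \<notin> U" using mod_W_mult_U by auto
    thus ?thesis using False U.charsD(3)[OF \<psi>] unfolding ext_def by auto
  qed
qed

lemma ext_norm:
  assumes \<psi>: "\<psi> \<in> U.chars"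
  shows "ext \<psi> f = 0 \<or> norm (ext \<psi> f) = 1"
  unfolding ext_def using U.char_norm[OF \<psi>] U.charsD(3)[OF \<psi>] by (cases "f mod W \<in> U") auto

lemma lsum_ext:
  assumes \<psi>: "\<psi> \<in> U.chars" "\<psi> \<noteq> principal" and n: "n \<ge> D"
  shows "lsum (ext \<psi>) n = 0"
proof -
  have "lsum (ext \<psi>) n = of_nat CARD('a) ^ (n - D) * (\<Sum>u\<in>polys_below D. \<psi> u)"
    unfolding lsum_def sum_monics ext_def by (rule sum_mod[OF W_nz n])
  also have "(\<Sum>u\<in>polys_below D. \<psi> u) = (\<Sum>u\<in>U. \<psi> u)"
    by (rule sum.mono_neutral_right) (use U_sub U.charsD(3)[OF \<psi>(1)] in auto)
  also have "\<dots> = 0"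
  proof -
    have "\<not> (\<forall>x\<in>U. \<psi> x = 1)"
      using U.chars_ext[OF \<psi>(1) principal_char] \<psi>(2) unfolding principal_def by auto
    thus ?thesis unfolding U.sum_char_on[OF U.chars_char_on[OF \<psi>(1) U.subgrp_G]] by (rule if_not_P)
  qed
  finally show ?thesis by simp
qed

text \<open>The division by \<open>q ^ n\<close> moves the line of real part 1 to the unit circle:
  what has to be excluded are zeros with \<open>norm z \<le> 1\<close>, and the aim is that these
  coefficients tend to 0 for nonprincipal \<open>\<psi>\<close>.\<close>

definition logfps :: "('a poly \<Rightarrow> complex) \<Rightarrow> complex fps" where
  "logfps \<psi> = Abs_fps (\<lambda>n. if n = 0 then 0 else csum (ext \<psi>) n / of_nat CARD('a) ^ n)"

definition lpoly :: "('a poly \<Rightarrow> complex) \<Rightarrow> complex poly" where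
  "lpoly \<psi> = (\<Sum>n<D. monom (lsum (ext \<psi>) n / of_nat CARD('a) ^ n) n)"

lemma coeff_lpoly:
  assumes "\<psi> \<in> U.chars" "\<psi> \<noteq> principal"
  shows "coeff (lpoly \<psi>) n = lsum (ext \<psi>) n / of_nat CARD('a) ^ n"
proof -
  have "coeff (lpoly \<psi>) n = (\<Sum>k<D. if k = n then lsum (ext \<psi>) k / of_nat CARD('a) ^ k else 0)"
    unfolding lpoly_def by (simp add: coeff_sum)
  thus ?thesis using lsum_ext[OF assms, of n] by (cases "n < D") auto
qed

lemma prime_powers_weight_real:
  "n > 0 \<Longrightarrow> (\<Sum>(P, j)\<in>prime_powers n. real (degree (P :: 'a poly))) = real CARD('a) ^ n"
proof -
  assume n: "n > 0"
  have "real (\<Sum>(P, j)\<in>(prime_powers n :: ('a poly \<times> nat) set). degree P) = real (CARD('a) ^ n)"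
    by (simp only: prime_powers_weight[OF n])
  thus ?thesis by (simp add: case_prod_unfold)
qed

lemma norm_csum_le:
  assumes "\<psi> \<in> U.chars"
  shows "norm (csum (ext \<psi>) n) \<le> real CARD('a) ^ n"
proof (cases "n = 0")
  case True
  have "prime_powers 0 = ({} :: ('a poly \<times> nat) set)" using mprimesD(3) by (fastforce simp: prime_powers_def)
  thus ?thesis using True by (simp add: csum_def)
next
  case False
  have le: "norm (ext \<psi> P ^ j) \<le> 1" for P j
    using ext_norm[OF assms, of P] by (auto simp: norm_power power_0_left)
  have "norm (csum (ext \<psi>) n) \<le> (\<Sum>(P, j)\<in>prime_powers n. real (degree (P :: 'a poly)))"
    unfolding csum_def using le by (intro sum_norm_le) (auto simp: norm_mult intro!: mult_left_le)
  thus ?thesis using prime_powers_weight_real[of n] False by simp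
qed

lemma logfps_bound:
  assumes "\<psi> \<in> U.chars"
  shows "norm (fps_nth (logfps \<psi>) n) \<le> 1"
  using norm_csum_le[OF assms, of n] by (simp add: logfps_def norm_divide norm_power divide_le_eq)

lemma log_derivative_lpoly:
  assumes \<psi>: "\<psi> \<in> U.chars" "\<psi> \<noteq> principal"
  shows "log_derivative (logfps \<psi>) (lpoly \<psi>)"
proof
  let ?q = "of_nat CARD('a) :: complex"
  have q: "?q \<noteq> 0" by simp
  show "norm (fps_nth (logfps \<psi>) n) \<le> 1" for n by (rule logfps_bound[OF \<psi>(1)])
  have "lsum (ext \<psi>) 0 = 1" using ext_multiplicative[OF \<psi>(1)] by (simp add: lsum_def monics_0 multiplicative_def)
  thus "poly (lpoly \<psi>) 0 \<noteq> 0" using coeff_lpoly[OF \<psi>, of 0] by (simp add: poly_0_coeff_0)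
  show "logfps \<psi> * fps_of_poly (lpoly \<psi>) = fps_of_poly (pCons 0 (pderiv (lpoly \<psi>)))"
  proof (rule fps_ext)
    fix n
    have "fps_nth (logfps \<psi> * fps_of_poly (lpoly \<psi>)) n
        = (\<Sum>k=0..n. fps_nth (logfps \<psi>) k * (lsum (ext \<psi>) (n - k) / ?q ^ (n - k)))"
      by (simp add: fps_mult_nth coeff_lpoly[OF \<psi>])
    also have "\<dots> = (\<Sum>k=1..n. csum (ext \<psi>) k / ?q ^ k * (lsum (ext \<psi>) (n - k) / ?q ^ (n - k)))"
      by (intro sum.mono_neutral_cong_right) (auto simp: logfps_def)
    also have "\<dots> = (\<Sum>k=1..n. csum (ext \<psi>) k * lsum (ext \<psi>) (n - k)) / ?q ^ n"
      unfolding sum_divide_distrib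
    proof (intro sum.cong refl)
      fix k assume k: "k \<in> {1..n}"
      hence "?q ^ n = ?q ^ k * ?q ^ (n - k)" by (simp flip: power_add)
      thus "csum (ext \<psi>) k / ?q ^ k * (lsum (ext \<psi>) (n - k) / ?q ^ (n - k)) = csum (ext \<psi>) k * lsum (ext \<psi>) (n - k) / ?q ^ n"
        by simp
    qed
    also have "\<dots> = of_nat n * coeff (lpoly \<psi>) n"
      using lsum_csum[OF ext_multiplicative[OF \<psi>(1)], of n] by (simp add: coeff_lpoly[OF \<psi>])
    also have "\<dots> = fps_nth (fps_of_poly (pCons 0 (pderiv (lpoly \<psi>)))) n"
      by (cases n) (auto simp: coeff_pderiv)
    finally show "fps_nth (logfps \<psi> * fps_of_poly (lpoly \<psi>)) n = fps_nth (fps_of_poly (pCons 0 (pderiv (lpoly \<psi>)))) n" .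
  qed
qed

text \<open>\<open>d\<close> is the weight of the powers of primes dividing \<open>W\<close>. Each
  such prime has at most one power of degree \<open>n\<close>, so \<open>d\<close> is at most the
  sum of their degrees.\<close>

lemma csum_principal_le:
  assumes "n > 0"
  shows "\<exists>d. csum (ext principal) n = of_real (real CARD('a) ^ n - d) \<and> 0 \<le> d \<and> d \<le> D"
proof -
  let ?B = "{(P, j) \<in> prime_powers n. P \<in> S}"
  define d where "d = (\<Sum>(P, j)\<in>?B. real (degree P))"
  have e: "ext principal P ^ j = (if P \<in> S then 0 else 1)" if "(P, j) \<in> prime_powers n" for P j
  proof -
    have P: "P \<in> mprimes" "j \<ge> 1" using that by (auto simp: prime_powers_def)
    have "P mod W \<in> U \<longleftrightarrow> P \<notin> S"
      unfolding mod_W_U using mprimes_dvd_iff P(1) primes by auto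
    thus ?thesis using P(2) by (auto simp: ext_def principal_def)
  qed
  have "csum (ext principal) n = (\<Sum>(P, j)\<in>prime_powers n. of_real (real (degree P)) - of_real (if P \<in> S then real (degree P) else 0))"
    unfolding csum_def by (intro sum.cong refl) (auto simp: e)
  also have "\<dots> = of_real (\<Sum>(P, j)\<in>prime_powers n. real (degree (P :: 'a poly))) - of_real d"
  proof -
    have "d = (\<Sum>(P, j)\<in>prime_powers n. if P \<in> S then real (degree P) else 0)"
      unfolding d_def case_prod_unfold prod.collapse by (rule sum.inter_filter) simp
    thus ?thesis by (simp only: case_prod_unfold sum_subtractf of_real_sum)
  qed
  also have "\<dots> = of_real (real CARD('a) ^ n - d)" using prime_powers_weight_real[OF assms] by simp
  finally have 1: "csum (ext principal) n = of_real (real CARD('a) ^ n - d)" .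
  have inj: "inj_on fst ?B"
  proof (rule inj_onI)
    fix x y assume *: "x \<in> ?B" "y \<in> ?B" "fst x = fst y"
    have "snd x * degree (fst x) = n" "snd y * degree (fst x) = n" "degree (fst x) > 0"
      using * mprimesD(3)[of "fst x"] by (auto simp: prime_powers_def)
    hence "snd x = snd y" by (metis mult_cancel2 less_numeral_extra(3))
    thus "x = y" using * by (simp add: prod_eq_iff)
  qed
  have "d = (\<Sum>P\<in>fst ` ?B. real (degree P))"
    unfolding d_def by (subst sum.reindex[OF inj]) (simp add: case_prod_unfold)
  also have "\<dots> \<le> (\<Sum>P\<in>S. real (degree P))" using fin by (intro sum_mono2) auto
  also have "\<dots> = D" unfolding D_eq sdeg_def by simp
  finally have "d \<le> D" .
  moreover have "d \<ge> 0" unfolding d_def by (intro sum_nonneg) auto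
  ultimately show ?thesis using 1 by blast
qed

end

lemma ex_power_decomp:
  assumes P: "P \<in> mprimes" and f: "f \<noteq> 0"
  shows "\<exists>k g. f = P ^ k * g \<and> \<not> P dvd g"
  using f
proof (induction "degree f" arbitrary: f rule: less_induct)
  case less
  show ?case
  proof (cases "P dvd f")
    case True
    then obtain f' where f': "f = P * f'" by auto
    have "f' \<noteq> 0" using f' less(2) by auto
    moreover have "degree f' < degree f"
      using f' less(2) mprimesD(3)[OF P] degree_mult_eq[of P f'] by auto
    ultimately obtain k g where "f' = P ^ k * g" "\<not> P dvd g" using less(1)[of f'] by blast
    hence "f = P ^ Suc k * g \<and> \<not> P dvd g" using f' by (simp add: mult.assoc)
    thus ?thesis by blast
  next
    case False
    hence "f = P ^ 0 * f \<and> \<not> P dvd f" by simp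
    thus ?thesis by blast
  qed
qed

lemma mprime_power_dvd_mult_cancel:
  assumes "P \<in> mprimes" "\<not> P dvd e"
  shows "P ^ k dvd e * h \<Longrightarrow> P ^ k dvd h"
proof (induction k arbitrary: h)
  case (Suc k)
  have "P dvd e * h" using Suc(2) by (metis dvd_trans dvd_triv_left power_Suc)
  hence "P dvd h" using assms mprimesD(4)[OF assms(1)] by (simp add: prime_elem_dvd_mult_iff)
  then obtain h' where h': "h = P * h'" by auto
  have "P * P ^ k dvd P * (e * h')" using Suc(2) h' by (simp add: mult_ac)
  hence "P ^ k dvd e * h'" using dvd_times_left_cancel_iff[OF mprimesD(2)[OF assms(1)]] by blast
  hence "P ^ k dvd h'" by (rule Suc(1))
  thus ?case unfolding h' power_Suc by (rule mult_dvd_mono[OF dvd_refl])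
qed simp

definition mdivs :: "'a::{field,finite} poly \<Rightarrow> 'a poly set" where
  "mdivs f = {d. lead_coeff d = 1 \<and> d dvd f}"

lemma finite_mdivs: "f \<noteq> 0 \<Longrightarrow> finite (mdivs f)"
proof (rule finite_subset)
  assume f: "f \<noteq> 0"
  show "mdivs f \<subseteq> polys_below (Suc (degree f))"
    using dvd_imp_degree_le[OF _ f] by (auto simp: mdivs_def polys_below_degree less_Suc_eq_le)
qed simp

text \<open>A monic divisor of \<open>P ^ k * g\<close> is uniquely \<open>P ^ i * c\<close> with
  \<open>c\<close> dividing \<open>g\<close>. Multiplicativity is asked at nonzero arguments only,
  because \<open>e\<close> will contain a factor depending on the degree, and there degrees
  add.\<close>

lemma mdivs_power_mult:
  assumes P: "P \<in> mprimes" and g: "\<not> P dvd g" and e: "\<And>x y. x \<noteq> 0 \<Longrightarrow> y \<noteq> 0 \<Longrightarrow> e (x * y) = e x * e y" "e 1 = (1::real)"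
  shows "(\<Sum>d\<in>mdivs (P ^ k * g). e d) = (\<Sum>i\<le>k. e P ^ i) * (\<Sum>d\<in>mdivs g. e d)"
proof -
  have P0: "P \<noteq> 0" and P1: "lead_coeff P = 1" using P by (auto simp: mprimes_def)
  have g0: "g \<noteq> 0" using g by auto
  have eP: "e (P ^ i) = e P ^ i" for i by (induction i) (simp_all add: e P0)
  have nd: "\<not> P dvd d" if "d \<in> mdivs g" for d using that g unfolding mdivs_def by (auto dest: dvd_trans)
  have d0: "d \<noteq> 0" if "d \<in> mdivs g" for d using that nd[OF that] by auto
  let ?f = "\<lambda>(i, d). P ^ i * d"
  have img: "mdivs (P ^ k * g) = ?f ` ({..k} \<times> mdivs g)"
  proof (intro set_eqI iffI)
    fix d assume d: "d \<in> mdivs (P ^ k * g)"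
    have dnz: "d \<noteq> 0" using d by (auto simp: mdivs_def)
    obtain i c where ic: "d = P ^ i * c" "\<not> P dvd c" using ex_power_decomp[OF P dnz] by blast
    have "lead_coeff c = 1" using d ic(1) P1 by (simp add: mdivs_def lead_coeff_mult lead_coeff_power)
    have dd: "P ^ i * c dvd P ^ k * g" using d ic(1) by (simp add: mdivs_def)
    have "i \<le> k"
    proof (rule ccontr)
      assume "\<not> i \<le> k"
      hence "P ^ i = P ^ k * P ^ (i - k)" by (simp flip: power_add)
      hence "P ^ k * P ^ (i - k) dvd P ^ k * g" using dd by (metis dvd_mult_left)
      hence "P ^ (i - k) dvd g" using P0 by simp
      moreover have "P dvd P ^ (i - k)" using \<open>\<not> i \<le> k\<close> by (intro dvd_power) auto
      ultimately show False using g dvd_trans by blast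
    qed
    moreover have "c dvd g"
    proof -
      have "c dvd P ^ k * g" using dd by (rule dvd_mult_right)
      then obtain h where h: "P ^ k * g = c * h" by auto
      have "P ^ k dvd c * h" using h by (metis dvd_triv_left)
      hence "P ^ k dvd h" by (rule mprime_power_dvd_mult_cancel[OF P ic(2)])
      then obtain h' where "h = P ^ k * h'" by auto
      hence "P ^ k * g = P ^ k * (c * h')" using h by (simp add: mult_ac)
      hence "g = c * h'" using P0 by simp
      thus ?thesis by simp
    qed
    ultimately show "d \<in> ?f ` ({..k} \<times> mdivs g)"
      using ic(1) \<open>lead_coeff c = 1\<close> by (auto simp: mdivs_def image_iff intro!: bexI[of _ "(i, c)"])
  next
    fix d assume "d \<in> ?f ` ({..k} \<times> mdivs g)"
    then obtain i c where ic: "d = P ^ i * c" "i \<le> k" "c \<in> mdivs g" by auto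
    have "P ^ i dvd P ^ k" using ic(2) by (rule le_imp_power_dvd)
    thus "d \<in> mdivs (P ^ k * g)" using ic P1
      by (simp add: mdivs_def lead_coeff_mult lead_coeff_power mult_dvd_mono)
  qed
  have inj: "inj_on ?f ({..k} \<times> mdivs g)"
  proof -
    have *: "i \<le> j \<Longrightarrow> P ^ i * c = P ^ j * d \<Longrightarrow> c \<in> mdivs g \<Longrightarrow> i = j \<and> c = d" for i j c d
    proof -
      assume a: "i \<le> j" "P ^ i * c = P ^ j * d" "c \<in> mdivs g"
      have "P ^ j = P ^ i * P ^ (j - i)" using a(1) by (simp flip: power_add)
      hence c: "c = P ^ (j - i) * d" using a(2) P0 by (simp add: mult.assoc)
      have "j - i = 0"
      proof (rule ccontr)
        assume "j - i \<noteq> 0"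
        hence "P dvd P ^ (j - i)" by (intro dvd_power) auto
        thus False using nd[OF a(3)] c by simp
      qed
      thus ?thesis using c a(1) by simp
    qed
    show ?thesis
    proof (rule inj_onI, clarify)
      fix i c j d assume a: "c \<in> mdivs g" "d \<in> mdivs g" "P ^ i * c = P ^ j * d"
      show "i = j \<and> c = d" using *[of i j c d] *[of j i d c] a by (cases "i \<le> j") auto
    qed
  qed
  have "(\<Sum>d\<in>mdivs (P ^ k * g). e d) = (\<Sum>(i, d)\<in>{..k} \<times> mdivs g. e P ^ i * e d)"
    unfolding img by (subst sum.reindex[OF inj], intro sum.cong refl) (auto simp: e(1) P0 d0 eP)
  also have "\<dots> = (\<Sum>i\<le>k. e P ^ i) * (\<Sum>d\<in>mdivs g. e d)"
    by (simp add: sum_product sum.cartesian_product)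
  finally show ?thesis .
qed

text \<open>The sum is a product of factors \<open>1 + e P + ... + e P ^ k\<close>, each
  nonnegative; for \<open>e P = - 1\<close> the alternating sum is 0 or 1.\<close>

lemma sum_mdivs_nonneg:
  assumes e: "\<And>x y. x \<noteq> 0 \<Longrightarrow> y \<noteq> 0 \<Longrightarrow> e (x * y) = e x * e y" "e 1 = (1::real)" "\<And>x. e x \<in> {-1, 0, 1}"
  shows "f \<in> monics n \<Longrightarrow> (\<Sum>d\<in>mdivs f. e d) \<ge> 0"
proof (induction n arbitrary: f rule: less_induct)
  case (less n)
  show ?case
  proof (cases "n = 0")
    case True
    hence f: "f = 1" using less(2) monics_0 by auto
    have "mdivs f = {1}"
    proof (intro set_eqI iffI)
      fix d assume d: "d \<in> mdivs f"
      hence "degree d = 0" "lead_coeff d = 1" using dvd_imp_degree_le[of d f] by (auto simp: f mdivs_def)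
      thus "d \<in> {1}" by (metis degree_eq_zeroE coeff_pCons_0 one_pCons singletonI)
    qed (auto simp: mdivs_def f)
    thus ?thesis using e by simp
  next
    case False
    hence "degree f > 0" using less(2) by (simp add: monics_def)
    then obtain P where P: "P \<in> mprimes" "P dvd f" using ex_mprime_dvd by blast
    have "f \<noteq> 0" using \<open>degree f > 0\<close> by auto
    then obtain k g where kg: "f = P ^ k * g" "\<not> P dvd g" using ex_power_decomp[OF P(1)] by blast
    have k0: "k \<noteq> 0" using kg P(2) by (cases k) auto
    have "P ^ k \<in> monics (k * degree P)" using monics_power[OF mprimes_monics[OF P(1)]] .
    hence g: "k * degree P \<le> n" "g \<in> monics (n - k * degree P)" using monics_div[of "P ^ k" g n] less(2) kg(1) by auto
    have "k * degree P > 0" using k0 mprimesD(3)[OF P(1)] by simp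
    hence r: "(\<Sum>d\<in>mdivs g. e d) \<ge> 0" using less(1)[OF _ g(2)] False by simp
    have "(\<Sum>i\<le>k. e P ^ i) \<ge> 0"
    proof (cases "e P = -1")
      case True
      have "(\<Sum>i\<le>k. (-1 :: real) ^ i) = (if even k then 1 else 0)" by (induction k) auto
      thus ?thesis unfolding True by simp
    next
      case False
      hence "e P \<ge> 0" using e(3)[of P] by auto
      thus ?thesis by (intro sum_nonneg) auto
    qed
    moreover have "(\<Sum>d\<in>mdivs f. e d) = (\<Sum>i\<le>k. e P ^ i) * (\<Sum>d\<in>mdivs g. e d)"
      unfolding kg(1) by (intro mdivs_power_mult[OF P(1) kg(2)] e(1,2))
    ultimately show ?thesis using r by simp
  qed
qed

text \<open>After exchanging the sums, a divisor of degree \<open>k\<close> has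
  \<open>q ^ (n - k)\<close> monic cofactors.\<close>

lemma sum_sum_mdivs:
  fixes e :: "'a::{field,finite} poly \<Rightarrow> real"
  shows "(\<Sum>f\<in>monics n. \<Sum>d\<in>mdivs f. e d) = (\<Sum>k\<le>n. real CARD('a) ^ (n - k) * (\<Sum>d\<in>monics k. e d))"
proof -
  let ?A = "SIGMA f:(monics n :: 'a poly set). mdivs f" and ?B = "SIGMA k:{..n}. (monics k :: 'a poly set) \<times> (monics (n - k) :: 'a poly set)"
  have nz: "f \<noteq> 0" if "f \<in> monics n" for f :: "'a poly" using that by (auto simp: monics_def)
  have inj: "inj_on (\<lambda>(k, d, h). (d * h, d)) ?B"
  proof (rule inj_onI, clarify)
    fix k d h k' d' h'
    assume a: "k \<le> n" "d' \<in> monics k" "h \<in> monics (n - k)" "k' \<le> n" "d' \<in> monics k'" "h' \<in> monics (n - k')"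
      "d' * h = d' * h'"
    have "d' \<noteq> 0" using a by (auto simp: monics_def)
    thus "k = k' \<and> (d', h) = (d', h')" using a by (simp add: monics_def)
  qed
  have img: "?A = (\<lambda>(k, d, h). (d * h, d)) ` ?B"
  proof (intro set_eqI iffI)
    fix x assume "x \<in> ?A"
    then obtain f d where x: "x = (f, d)" "f \<in> monics n" "lead_coeff d = 1" "d dvd f" by (auto simp: mdivs_def)
    from x(4) obtain h where h: "f = d * h" by auto
    have d: "d \<in> monics (degree d)" using x(3) by (simp add: monics_def)
    have "degree d \<le> n \<and> h \<in> monics (n - degree d)" using monics_div[of d h n] x(2) h d by auto
    thus "x \<in> (\<lambda>(k, d, h). (d * h, d)) ` ?B" using x(1) h d
      by (intro image_eqI[of _ _ "(degree d, d, h)"]) auto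
  next
    fix x assume "x \<in> (\<lambda>(k, d, h). (d * h, d)) ` ?B"
    then obtain k d h where x: "x = (d * h, d)" "k \<le> n" "d \<in> monics k" "h \<in> monics (n - k)" by auto
    have "d * h \<in> monics n" using monics_mult[OF x(3,4)] x(2) by simp
    thus "x \<in> ?A" using x by (auto simp: mdivs_def monics_def)
  qed
  have "(\<Sum>f\<in>monics n. \<Sum>d\<in>mdivs f. e d) = (\<Sum>(f, d)\<in>?A. e d)"
  proof (rule sum.Sigma)
    show "\<forall>f\<in>(monics n :: 'a poly set). finite (mdivs f)"
    proof
      fix f :: "'a poly" assume "f \<in> monics n"
      from finite_mdivs[OF nz[OF this]] show "finite (mdivs f)" .
    qed
  qed simp
  also have "\<dots> = (\<Sum>(k, d, h)\<in>?B. e d)"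
    unfolding img by (subst sum.reindex[OF inj]) (simp add: case_prod_unfold)
  also have "\<dots> = (\<Sum>k\<le>n. \<Sum>(d, h)\<in>monics k \<times> (monics (n - k) :: 'a poly set). e d)"
    by (rule sum.Sigma[symmetric]) auto
  also have "\<dots> = (\<Sum>k\<le>n. real CARD('a) ^ (n - k) * (\<Sum>d\<in>monics k. e d))"
  proof (intro sum.cong refl)
    fix k
    have "(\<Sum>(d, h)\<in>monics k \<times> (monics (n - k) :: 'a poly set). e d) = (\<Sum>d\<in>monics k. \<Sum>h\<in>(monics (n - k) :: 'a poly set). e d)"
      by (rule sum.cartesian_product[symmetric])
    thus "(\<Sum>(d, h)\<in>monics k \<times> (monics (n - k) :: 'a poly set). e d) = real CARD('a) ^ (n - k) * (\<Sum>d\<in>monics k. e d)"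
      by (simp add: card_monics sum_distrib_left)
  qed
  finally show ?thesis .
qed

section \<open>Non-vanishing of L-polynomials on the unit circle\<close>

context modulus
begin

lemma q_ge_2: "real CARD('a) \<ge> 2"
  using card_field_ge_2[where 'a = 'a] by simp

text \<open>For a real character, the divisor sums of \<open>\<psi>\<close>, twisted by \<open>z\<close> to the degree, are nonnegative,
  and equal to 1 at powers of a prime divisor of \<open>W\<close>; a zero would make their total over a large degree vanish.\<close>

lemma lpoly_real_nonzero:
  assumes \<psi>: "\<psi> \<in> U.chars" "\<psi> \<noteq> principal" and sq: "(\<lambda>x. \<psi> x * \<psi> x) = principal" and z: "z ^ 2 = (1::complex)"
  shows "poly (lpoly \<psi>) z \<noteq> 0"
proof
  assume root: "poly (lpoly \<psi>) z = 0"
  have zz: "z = 1 \<or> z = -1" using z by (simp add: power2_eq_1_iff)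
  define \<epsilon> where "\<epsilon> d = ext \<psi> d * z ^ degree d" for d
  define e where "e d = Re (\<epsilon> d)" for d
  have "ext \<psi> d * ext \<psi> d = 0 \<or> ext \<psi> d * ext \<psi> d = 1" for d
    using fun_cong[OF sq, of "d mod W"] unfolding ext_def principal_def by auto
  hence chi: "ext \<psi> d \<in> {-1, 0, 1}" for d
    by (metis insertCI mult_eq_0_iff square_eq_1_iff)
  have zp: "z ^ n = 1 \<or> z ^ n = -1" for n using zz by (cases "even n") auto
  have ev: "\<epsilon> d \<in> {-1, 0, 1}" for d unfolding \<epsilon>_def using chi[of d] zp[of "degree d"] by auto
  have er: "\<epsilon> d = of_real (e d)" "e d \<in> {-1, 0, 1}" for d
  proof -
    consider "\<epsilon> d = -1" | "\<epsilon> d = 0" | "\<epsilon> d = 1" using ev[of d] by blast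
    hence "\<epsilon> d = of_real (e d) \<and> e d \<in> {-1, 0, 1}" by cases (simp_all add: e_def)
    thus "\<epsilon> d = of_real (e d)" "e d \<in> {-1, 0, 1}" by auto
  qed
  have mult: "ext \<psi> (x * y) = ext \<psi> x * ext \<psi> y" "ext \<psi> 1 = 1" for x y
    using ext_multiplicative[OF \<psi>(1)] by (auto simp: multiplicative_def)
  have e1: "e 1 = 1" unfolding e_def \<epsilon>_def by (simp add: mult)
  have em: "e (x * y) = e x * e y" if "x \<noteq> 0" "y \<noteq> 0" for x y
  proof -
    have "\<epsilon> (x * y) = \<epsilon> x * \<epsilon> y" unfolding \<epsilon>_def using that by (simp add: mult degree_mult_eq power_add)
    hence "complex_of_real (e (x * y)) = of_real (e x * e y)" using er(1) by simp
    thus ?thesis by (simp only: of_real_eq_iff)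
  qed
  obtain P where P: "P \<in> S" using nonempty by auto
  have Pm: "P \<in> mprimes" using P primes by auto
  \<comment> \<open>The degree of \<open>P ^ D\<close>. It is at least \<open>D\<close>, so the
    convolution sum over \<open>monics n\<close> contains the whole L-polynomial and equals
    \<open>q ^ n\<close> times its value at \<open>z\<close>.\<close>
  define n where "n = D * degree P"
  have n: "n \<ge> D" unfolding n_def using mprimesD(3)[OF Pm] by simp
  have "(\<Sum>f\<in>monics n. \<Sum>d\<in>mdivs f. e d) = 0"
  proof -
    let ?q = "of_nat CARD('a) :: complex"
    have dle: "degree (lpoly \<psi>) \<le> n"
      by (rule degree_le) (use lsum_ext[OF \<psi>] n in \<open>auto simp: coeff_lpoly[OF \<psi>]\<close>)
    have "complex_of_real (\<Sum>f\<in>monics n. \<Sum>d\<in>mdivs f. e d) = (\<Sum>k\<le>n. ?q ^ (n - k) * (\<Sum>d\<in>monics k. \<epsilon> d))"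
      unfolding sum_sum_mdivs by (simp add: er(1))
    also have "\<dots> = (\<Sum>k\<le>n. ?q ^ n * (coeff (lpoly \<psi>) k * z ^ k))"
    proof (intro sum.cong refl)
      fix k assume k: "k \<in> {..n}"
      have "(\<Sum>d\<in>monics k. \<epsilon> d) = lsum (ext \<psi>) k * z ^ k"
        unfolding lsum_def sum_distrib_right by (intro sum.cong refl) (auto simp: \<epsilon>_def monics_def)
      moreover have "?q ^ n = ?q ^ (n - k) * ?q ^ k" using k by (simp flip: power_add)
      ultimately show "?q ^ (n - k) * (\<Sum>d\<in>monics k. \<epsilon> d) = ?q ^ n * (coeff (lpoly \<psi>) k * z ^ k)"
        by (simp add: coeff_lpoly[OF \<psi>])
    qed
    also have "\<dots> = ?q ^ n * (\<Sum>k\<le>n. coeff (lpoly \<psi>) k * z ^ k)" by (simp add: sum_distrib_left)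
    also have "(\<Sum>k\<le>n. coeff (lpoly \<psi>) k * z ^ k) = poly (lpoly \<psi>) z"
      unfolding poly_altdef using dle by (intro sum.mono_neutral_right) (auto simp: coeff_eq_0)
    finally show ?thesis using root by (simp only: mult_zero_right of_real_eq_0_iff)
  qed
  moreover have "(\<Sum>d\<in>mdivs (P ^ D). e d) \<le> (\<Sum>f\<in>monics n. \<Sum>d\<in>mdivs f. e d)"
  proof (rule member_le_sum)
    show "P ^ D \<in> monics n" unfolding n_def by (rule monics_power[OF mprimes_monics[OF Pm]])
    show "0 \<le> (\<Sum>d\<in>mdivs f. e d)" if "f \<in> monics n - {P ^ D}" for f
      using sum_mdivs_nonneg[of e f n, OF em e1 er(2)] that by auto
  qed simp
  moreover have "(\<Sum>d\<in>mdivs (P ^ D). e d) = 1"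
  proof -
    have "P mod W \<notin> U" using mod_W_U[of P] P dvd_refl by blast
    hence "\<epsilon> P = 0" unfolding \<epsilon>_def ext_def using U.charsD(3)[OF \<psi>(1)] by simp
    hence "e P = 0" by (simp add: e_def)
    have "\<not> P dvd 1" using mprimesD(1)[OF Pm] irreducible_not_unit by auto
    have "mdivs 1 = {1 :: 'a poly}"
    proof (intro set_eqI iffI)
      fix d assume d: "d \<in> mdivs (1 :: 'a poly)"
      hence "degree d = 0" "lead_coeff d = 1" using dvd_imp_degree_le[of d 1] by (auto simp: mdivs_def)
      thus "d \<in> {1}" by (metis degree_eq_zeroE coeff_pCons_0 one_pCons singletonI)
    qed (auto simp: mdivs_def)
    hence "(\<Sum>d\<in>mdivs (P ^ D * 1). e d) = (\<Sum>i\<le>D. e P ^ i)"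
      using mdivs_power_mult[OF Pm \<open>\<not> P dvd 1\<close>, of e D, OF em e1] e1 by simp
    also have "\<dots> = (\<Sum>i\<le>D. if i = 0 then 1 else 0)" unfolding \<open>e P = 0\<close> by (intro sum.cong) auto
    also have "\<dots> = 1" by simp
    finally show ?thesis by simp
  qed
  ultimately show False by simp
qed

text \<open>Coefficients of positive index differ from 1 by at most \<open>D / q ^ n\<close>, so the
  series is \<open>u / (1 - u)\<close> up to a bounded function, and only the radius towards 1 sees
  a pole.\<close>

lemma logfps_principal_limit:
  assumes w: "norm w = 1" "w \<noteq> 1"
  shows "((\<lambda>t. of_real (1 - t) * eval_fps (logfps principal) (of_real t * w)) \<longlongrightarrow> 0) (at_left 1)"
proof -
  let ?A = "logfps principal" and ?q = "real CARD('a)"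
  define C where "C = real D / (1 - 1 / ?q)"
  have close: "norm (u / (1 - u) - eval_fps ?A u) \<le> C" if u: "norm u < 1" for u
  proof -
    have s1: "(\<lambda>n. fps_nth ?A n * u ^ n) sums eval_fps ?A u"
      by (rule sums_eval_fps_bounded[OF logfps_bound[OF principal_char] u])
    have s2: "(\<lambda>n. u ^ n) sums (1 / (1 - u))" by (rule geometric_sums[OF u])
    have s3: "(\<lambda>n. if n = 0 then 1 else 0) sums (1::complex)"
      using sums_single[of 0 "\<lambda>_. 1 :: complex"] by simp
    have s: "(\<lambda>n. u ^ n - (if n = 0 then 1 else 0) - fps_nth ?A n * u ^ n) sums (1 / (1 - u) - 1 - eval_fps ?A u)"
      by (intro sums_diff s1 s2 s3)
    have le: "norm (u ^ n - (if n = 0 then 1 else 0) - fps_nth ?A n * u ^ n) \<le> D * (1 / ?q) ^ n" for n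
    proof (cases "n = 0")
      case False
      then obtain d where d: "csum (ext principal) n = of_real (?q ^ n - d)" "0 \<le> d" "d \<le> D"
        using csum_principal_le by blast
      have "fps_nth ?A n = of_real ((?q ^ n - d) / ?q ^ n)" using False d by (simp add: logfps_def)
      also have "(?q ^ n - d) / ?q ^ n = 1 - d / ?q ^ n" by (simp add: diff_divide_distrib)
      finally have c: "fps_nth ?A n = 1 - of_real (d / ?q ^ n)" by simp
      have "u ^ n - (if n = 0 then 1 else 0) - fps_nth ?A n * u ^ n = of_real (d / ?q ^ n) * u ^ n"
        using False unfolding c by (simp add: left_diff_distrib)
      hence "norm (u ^ n - (if n = 0 then 1 else 0) - fps_nth ?A n * u ^ n) = d / ?q ^ n * norm u ^ n"
        using d by (simp add: norm_mult norm_power norm_divide)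
      also have "\<dots> \<le> d / ?q ^ n" using u d by (intro mult_left_le) (auto intro: power_le_one)
      also have "\<dots> \<le> D / ?q ^ n" using d by (intro divide_right_mono) auto
      finally show ?thesis by (simp add: power_one_over field_simps)
    qed (simp add: logfps_def)
    have "norm (1 / (1 - u) - 1 - eval_fps ?A u) \<le> (\<Sum>n. D * (1 / ?q) ^ n)"
      unfolding sums_unique[OF s] by (rule norm_suminf_le[OF le]) (use q_ge_2 in \<open>auto intro!: summable_mult summable_geometric\<close>)
    also have "\<dots> = C" unfolding C_def using q_ge_2 by (subst suminf_mult) (auto simp: suminf_geometric intro!: summable_geometric)
    also have "1 / (1 - u) - 1 = u / (1 - u)"
    proof -
      have "1 - u \<noteq> 0" using u by auto
      thus ?thesis by (simp add: divide_simps)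
    qed
    finally show ?thesis .
  qed
  have ev01: "\<forall>\<^sub>F t in at_left (1::real). t \<in> {0<..<1}"
    by (rule eventually_at_leftI[of 0]) auto
  have "((\<lambda>t. of_real (1 - t) * (of_real t * w / (1 - of_real t * w) - eval_fps ?A (of_real t * w))) \<longlongrightarrow> 0) (at_left 1)"
  proof (rule Lim_null_comparison)
    show "\<forall>\<^sub>F t in at_left 1. norm (of_real (1 - t) * (of_real t * w / (1 - of_real t * w) - eval_fps ?A (of_real t * w))) \<le> (1 - t) * C"
      using ev01
    proof eventually_elim
      case (elim t)
      have "norm (of_real t * w) < 1" using elim w by (simp add: norm_mult)
      from close[OF this] have "\<bar>1 - t\<bar> * norm (of_real t * w / (1 - of_real t * w) - eval_fps ?A (of_real t * w)) \<le> (1 - t) * C"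
        using elim by (intro mult_mono) auto
      thus ?case by (simp only: norm_mult norm_of_real)
    qed
    have "((\<lambda>t. (1 - t) * C) \<longlongrightarrow> (1 - 1) * C) (at_left 1)" by (intro tendsto_intros)
    thus "((\<lambda>t. (1 - t) * C) \<longlongrightarrow> 0) (at_left 1)" by simp
  qed
  moreover have "((\<lambda>t. of_real (1 - t) * (of_real t * w / (1 - of_real t * w))) \<longlongrightarrow> of_real (1 - 1) * (of_real 1 * w / (1 - of_real 1 * w))) (at_left 1)"
    using w by (intro tendsto_intros) auto
  ultimately have "((\<lambda>t. of_real (1 - t) * (of_real t * w / (1 - of_real t * w)) -
     of_real (1 - t) * (of_real t * w / (1 - of_real t * w) - eval_fps ?A (of_real t * w))) \<longlongrightarrow> of_real (1 - 1) * (of_real 1 * w / (1 - of_real 1 * w)) - 0) (at_left 1)"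
    by (intro tendsto_diff)
  thus ?thesis by (simp add: algebra_simps)
qed

text \<open>The inequality \<open>3 + 4 cos \<theta> + cos 2\<theta> \<ge> 0\<close> of Hadamard and Mertens; here it is used
  along the radius towards the hypothetical zero.\<close>

lemma three_four_one:
  assumes \<psi>: "\<psi> \<in> U.chars" and z: "norm z = 1" and t: "0 < t" "t < 1"
  shows "3 * t + 4 * Re (of_real (1 - t) * eval_fps (logfps \<psi>) (of_real t * z))
    + Re (of_real (1 - t) * eval_fps (logfps (\<lambda>x. \<psi> x * \<psi> x)) (of_real t * z\<^sup>2)) \<ge> 0"
proof -
  let ?q = "real CARD('a)"
  define \<psi>2 where "\<psi>2 = (\<lambda>x. \<psi> x * \<psi> x)"
  have \<psi>2: "\<psi>2 \<in> U.chars" unfolding \<psi>2_def by (rule U.char_mult_chars[OF \<psi> \<psi>])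
  let ?A = "logfps \<psi>" and ?B = "logfps \<psi>2"
  have nz: "norm (of_real t * z) < 1" "norm (of_real t * z\<^sup>2) < 1" using t z by (auto simp: norm_mult norm_power)
  have pos: "3 + 4 * Re (fps_nth ?A n * z ^ n) + Re (fps_nth ?B n * (z\<^sup>2) ^ n) \<ge> 0" if n: "n > 0" for n
  proof -
    \<comment> \<open>For \<open>norm X = 1\<close> the expression is twice the square of
      \<open>Re X + 1\<close>; the value \<open>X = 0\<close> comes from primes dividing
      \<open>W\<close>.\<close>
    have trig: "3 + 4 * Re X + Re (X * X) \<ge> 0" if "X = 0 \<or> norm X = 1" for X :: complex
      using that
    proof
      assume "norm X = 1"
      hence "(Re X)\<^sup>2 + (Im X)\<^sup>2 = 1" by (simp add: cmod_def)
      hence "3 + 4 * Re X + Re (X * X) = 2 * (Re X + 1)\<^sup>2" by (simp add: power2_eq_square algebra_simps)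
      thus ?thesis by simp
    qed auto
    have q: "?q ^ n > 0" by simp
    have A: "fps_nth ?A n * z ^ n = (\<Sum>(P, j)\<in>prime_powers n. of_real (real (degree P)) * (ext \<psi> P ^ j * z ^ n)) / of_real (?q ^ n)"
      using n by (simp add: logfps_def csum_def sum_distrib_right case_prod_unfold mult.assoc)
    have B: "fps_nth ?B n * (z\<^sup>2) ^ n = (\<Sum>(P, j)\<in>prime_powers n. of_real (real (degree P)) * ((ext \<psi> P ^ j * z ^ n) * (ext \<psi> P ^ j * z ^ n))) / of_real (?q ^ n)"
      using n by (simp add: logfps_def csum_def sum_distrib_right case_prod_unfold ext_def \<psi>2_def power_mult_distrib
          power2_eq_square sum_distrib_left mult_ac)
    have "0 \<le> (\<Sum>(P, j)\<in>prime_powers n. real (degree P) * (3 + 4 * Re (ext \<psi> P ^ j * z ^ n) + Re ((ext \<psi> P ^ j * z ^ n) * (ext \<psi> P ^ j * z ^ n))))"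
    proof (intro sum_nonneg, clarify)
      fix P j
      have "ext \<psi> P ^ j * z ^ n = 0 \<or> norm (ext \<psi> P ^ j * z ^ n) = 1"
        using ext_norm[OF \<psi>, of P] z by (auto simp: norm_mult norm_power power_0_left)
      from trig[OF this] show "0 \<le> real (degree P) * (3 + 4 * Re (ext \<psi> P ^ j * z ^ n) + Re ((ext \<psi> P ^ j * z ^ n) * (ext \<psi> P ^ j * z ^ n)))"
        by simp
    qed
    also have "\<dots> = 3 * (\<Sum>(P, j)\<in>prime_powers n. real (degree (P :: 'a poly)))
        + 4 * Re (\<Sum>(P, j)\<in>prime_powers n. of_real (real (degree P)) * (ext \<psi> P ^ j * z ^ n))
        + Re (\<Sum>(P, j)\<in>prime_powers n. of_real (real (degree P)) * ((ext \<psi> P ^ j * z ^ n) * (ext \<psi> P ^ j * z ^ n)))"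
      unfolding Re_sum sum_distrib_left sum.distrib[symmetric]
      by (intro sum.cong refl) (simp add: case_prod_unfold algebra_simps)
    also have "\<dots> = ?q ^ n * (3 + 4 * Re (fps_nth ?A n * z ^ n) + Re (fps_nth ?B n * (z\<^sup>2) ^ n))"
      unfolding A B prime_powers_weight_real[OF n] Re_divide_of_real using q by (simp add: field_simps)
    finally show ?thesis using q by (simp add: zero_le_mult_iff)
  qed
  have sA: "(\<lambda>n. Re (fps_nth ?A n * (of_real t * z) ^ n)) sums Re (eval_fps ?A (of_real t * z))"
    by (intro sums_Re sums_eval_fps_bounded nz logfps_bound \<psi>)
  have sB: "(\<lambda>n. Re (fps_nth ?B n * (of_real t * z\<^sup>2) ^ n)) sums Re (eval_fps ?B (of_real t * z\<^sup>2))"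
    by (intro sums_Re sums_eval_fps_bounded nz logfps_bound \<psi>2)
  have s1: "(\<lambda>n. t ^ n) sums (1 / (1 - t))" using t by (intro geometric_sums) auto
  have s2: "(\<lambda>n. if n = 0 then 1 else 0) sums (1::real)" using sums_single[of 0 "\<lambda>_. 1 :: real"] by simp
  have total: "(\<lambda>n. 3 * (t ^ n - (if n = 0 then 1 else 0)) + 4 * Re (fps_nth ?A n * (of_real t * z) ^ n) + Re (fps_nth ?B n * (of_real t * z\<^sup>2) ^ n))
    sums (3 * (1 / (1 - t) - 1) + 4 * Re (eval_fps ?A (of_real t * z)) + Re (eval_fps ?B (of_real t * z\<^sup>2)))"
    by (intro sums_add sums_mult sums_diff s1 s2 sA sB)
  have nonneg: "0 \<le> 3 * (t ^ n - (if n = 0 then 1 else 0)) + 4 * Re (fps_nth ?A n * (of_real t * z) ^ n) + Re (fps_nth ?B n * (of_real t * z\<^sup>2) ^ n)" for n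
  proof (cases "n = 0")
    case False
    have eq: "Re (c * (of_real t * y) ^ n) = t ^ n * Re (c * y ^ n)" for c y
    proof -
      have "c * (of_real t * y) ^ n = of_real (t ^ n) * (c * y ^ n)" by (simp add: power_mult_distrib)
      hence "Re (c * (of_real t * y) ^ n) = Re (of_real (t ^ n) * (c * y ^ n))" by (rule arg_cong)
      also have "\<dots> = t ^ n * Re (c * y ^ n)" unfolding times_complex.simps(1) Re_complex_of_real Im_complex_of_real by simp
      finally show ?thesis .
    qed
    have "0 \<le> t ^ n * (3 + 4 * Re (fps_nth ?A n * z ^ n) + Re (fps_nth ?B n * (z\<^sup>2) ^ n))"
      using pos[of n] False t by simp
    thus ?thesis using False unfolding eq by (simp add: algebra_simps)
  qed (simp add: logfps_def)
  have "0 \<le> 3 * (1 / (1 - t) - 1) + 4 * Re (eval_fps ?A (of_real t * z)) + Re (eval_fps ?B (of_real t * z\<^sup>2))"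
    by (rule sums_le[OF nonneg sums_zero total])
  hence "0 \<le> (1 - t) * (3 * (1 / (1 - t) - 1) + 4 * Re (eval_fps ?A (of_real t * z)) + Re (eval_fps ?B (of_real t * z\<^sup>2)))"
    using t by simp
  also have "\<dots> = 3 * t + 4 * ((1 - t) * Re (eval_fps ?A (of_real t * z))) + (1 - t) * Re (eval_fps ?B (of_real t * z\<^sup>2))"
    using t by (simp add: field_simps)
  finally show ?thesis unfolding \<psi>2_def by simp
qed

text \<open>In the limit \<open>three_four_one\<close> reads \<open>3 - 4 * m - m2 \<ge> 0\<close>,
  where \<open>m \<ge> 1\<close> is the order of the zero and \<open>m2 \<ge> 0\<close> belongs to
  the squared character at the squared point. A pole there would add 1 and allow
  \<open>m = 1\<close>; it arises only for a principal square at \<open>z\<^sup>2 = 1\<close>, the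
  case settled by \<open>lpoly_real_nonzero\<close>.\<close>

lemma lpoly_nonzero:
  assumes \<psi>: "\<psi> \<in> U.chars" "\<psi> \<noteq> principal" and z: "norm z = 1"
  shows "poly (lpoly \<psi>) z \<noteq> 0"
proof
  assume root: "poly (lpoly \<psi>) z = 0"
  interpret A: log_derivative "logfps \<psi>" "lpoly \<psi>" by (rule log_derivative_lpoly[OF \<psi>])
  define \<psi>2 where "\<psi>2 = (\<lambda>x. \<psi> x * \<psi> x)"
  have \<psi>2: "\<psi>2 \<in> U.chars" unfolding \<psi>2_def by (rule U.char_mult_chars[OF \<psi>(1) \<psi>(1)])
  have z2: "norm (z\<^sup>2) = 1" using z by (simp add: norm_power)
  have nz: "z \<noteq> 0" "z\<^sup>2 \<noteq> 0" using z by auto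
  define m where "m = order z (lpoly \<psi>)"
  have m: "m \<ge> 1" using root A.p_nz order_root[of "lpoly \<psi>" z] unfolding m_def by simp
  have limA: "((\<lambda>t. of_real (1 - t) * eval_fps (logfps \<psi>) (of_real t * z)) \<longlongrightarrow> - of_nat m) (at_left 1)"
    unfolding m_def using z nz by (intro A.radial_limit) auto
  have "\<exists>m2\<ge>0. ((\<lambda>t. of_real (1 - t) * eval_fps (logfps \<psi>2) (of_real t * z\<^sup>2)) \<longlongrightarrow> complex_of_real (- m2)) (at_left 1)"
  proof (cases "\<psi>2 = principal")
    case True
    have "z\<^sup>2 \<noteq> 1" using lpoly_real_nonzero[OF \<psi> True[unfolded \<psi>2_def]] root by blast
    thus ?thesis using logfps_principal_limit[OF z2] unfolding True by (intro exI[of _ 0]) simp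
  next
    case False
    interpret B: log_derivative "logfps \<psi>2" "lpoly \<psi>2" by (rule log_derivative_lpoly[OF \<psi>2 False])
    show ?thesis using B.radial_limit[of "z\<^sup>2"] z2 nz
      by (intro exI[of _ "real (order (z\<^sup>2) (lpoly \<psi>2))"]) simp
  qed
  then obtain m2 where m2: "m2 \<ge> 0"
    "((\<lambda>t. of_real (1 - t) * eval_fps (logfps \<psi>2) (of_real t * z\<^sup>2)) \<longlongrightarrow> complex_of_real (- m2)) (at_left 1)"
    by blast
  have lim: "((\<lambda>t. 3 * t + 4 * Re (of_real (1 - t) * eval_fps (logfps \<psi>) (of_real t * z))
    + Re (of_real (1 - t) * eval_fps (logfps \<psi>2) (of_real t * z\<^sup>2))) \<longlongrightarrow> 3 * 1 + 4 * Re (- of_nat m) + Re (complex_of_real (- m2))) (at_left 1)"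
    by (intro tendsto_intros limA m2(2))
  have ev01: "\<forall>\<^sub>F t in at_left (1::real). t \<in> {0<..<1}"
    by (rule eventually_at_leftI[of 0]) auto
  have "0 \<le> 3 * 1 + 4 * Re (- of_nat m) + Re (complex_of_real (- m2))"
  proof (rule tendsto_lowerbound[OF lim])
    show "\<forall>\<^sub>F t in at_left 1. 0 \<le> 3 * t + 4 * Re (of_real (1 - t) * eval_fps (logfps \<psi>) (of_real t * z))
        + Re (of_real (1 - t) * eval_fps (logfps \<psi>2) (of_real t * z\<^sup>2))"
      using ev01 by eventually_elim (use three_four_one[OF \<psi>(1) z] in \<open>auto simp: \<psi>2_def\<close>)
  qed simp
  thus False using m m2(1) by simp
qed

lemma csum_nonprincipal_tendsto_0:
  assumes \<psi>: "\<psi> \<in> U.chars" "\<psi> \<noteq> principal"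
  shows "(\<lambda>n. csum (ext \<psi>) n / of_nat CARD('a) ^ n) \<longlonglongrightarrow> 0"
proof -
  interpret A: log_derivative "logfps \<psi>" "lpoly \<psi>" by (rule log_derivative_lpoly[OF \<psi>])
  have "norm z > 1" if "poly (lpoly \<psi>) z = 0" for z
    using A.no_small_roots[of z] lpoly_nonzero[OF \<psi>, of z] that by (meson linorder_neqE_linordered_idom)
  hence "fps_nth (logfps \<psi>) \<longlonglongrightarrow> 0"
    by (intro log_derivative_coeffs_tendsto_0[OF A.eq A.p_nz])
  moreover have "\<forall>\<^sub>F n in sequentially. fps_nth (logfps \<psi>) n = csum (ext \<psi>) n / of_nat CARD('a) ^ n"
    by (rule eventually_mono[OF eventually_gt_at_top[of 0]]) (simp add: logfps_def)
  ultimately show ?thesis by (rule Lim_transform_eventually)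
qed

end

section \<open>Dirichlet's theorem\<close>

lemma prime_powers_fst_inj: "inj_on fst (prime_powers n :: ('a::{field,finite} poly \<times> nat) set)"
proof (rule inj_onI)
  fix x y :: "'a poly \<times> nat" assume *: "x \<in> prime_powers n" "y \<in> prime_powers n" "fst x = fst y"
  have "snd x * degree (fst x) = n" "snd y * degree (fst x) = n" "degree (fst x) > 0"
    using * mprimesD(3)[of "fst x"] by (auto simp: prime_powers_def)
  hence "snd x = snd y" by (metis mult_cancel2 less_numeral_extra(3))
  thus "x = y" using * by (simp add: prod_eq_iff)
qed

text \<open>A proper power of degree \<open>n\<close> has a base of degree at most
  \<open>n div 2\<close>, each base occurs once, and the irreducibles of degree \<open>d\<close>
  weigh at most \<open>q ^ d\<close>.\<close>

lemma higher_prime_powers_weight: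
  "(\<Sum>(P, j)\<in>{x \<in> prime_powers n. snd x \<noteq> 1}. real (degree (P :: 'a::{field,finite} poly))) \<le> real n * real CARD('a) ^ (n div 2)"
proof -
  let ?H = "{x \<in> (prime_powers n :: ('a poly \<times> nat) set). snd x \<noteq> 1}"
  let ?T = "\<lambda>d. {P \<in> (mprimes :: 'a poly set). degree P = d}"
  have q: "real CARD('a) \<ge> 2" using card_field_ge_2[where 'a = 'a] by simp
  have finT: "finite (?T d)" for d
    by (rule finite_subset[of _ "polys_below (Suc d)"]) (auto simp: polys_below_degree)
  have inj: "inj_on fst ?H" by (rule inj_on_subset[OF prime_powers_fst_inj]) auto
  have "(\<Sum>(P, j)\<in>?H. real (degree P)) = (\<Sum>P\<in>fst ` ?H. real (degree P))"
    by (subst sum.reindex[OF inj]) (simp add: case_prod_unfold)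
  also have "\<dots> \<le> (\<Sum>P\<in>(\<Union>d\<in>{1..n div 2}. ?T d). real (degree P))"
  proof (rule sum_mono2)
    show "fst ` ?H \<subseteq> (\<Union>d\<in>{1..n div 2}. ?T d)"
    proof
      fix P assume "P \<in> fst ` ?H"
      then obtain j where P: "P \<in> mprimes" "1 \<le> j" "j \<noteq> 1" "j * degree P = n" by (auto simp: prime_powers_def)
      have "2 * degree P \<le> j * degree P" using P by (intro mult_right_mono) auto
      hence "degree P \<le> n div 2" using P by simp
      thus "P \<in> (\<Union>d\<in>{1..n div 2}. ?T d)" using P mprimesD(3)[OF P(1)] by auto
    qed
  qed (use finT in auto)
  also have "\<dots> = (\<Sum>d=1..n div 2. \<Sum>P\<in>?T d. real (degree P))"
    by (rule sum.UNION_disjoint) (use finT in auto)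
  also have "\<dots> \<le> (\<Sum>d=1..n div 2. real CARD('a) ^ (n div 2))"
  proof (intro sum_mono)
    fix d assume d: "d \<in> {1..n div 2}"
    have "(\<Sum>P\<in>?T d. real (degree P)) = real (d * card (?T d))" by simp
    also have "\<dots> \<le> real (CARD('a) ^ d)" using card_mprimes_le[of d, where 'a = 'a] d by (simp only: of_nat_le_iff) auto
    also have "\<dots> \<le> real CARD('a) ^ (n div 2)" using d q by (simp add: power_increasing)
    finally show "(\<Sum>P\<in>?T d. real (degree P)) \<le> real CARD('a) ^ (n div 2)" .
  qed
  also have "\<dots> = real (n div 2) * real CARD('a) ^ (n div 2)" by simp
  also have "\<dots> \<le> real n * real CARD('a) ^ (n div 2)" by (intro mult_right_mono) auto
  finally show ?thesis .
qed

lemma higher_prime_powers_tendsto_0: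
  assumes "q \<ge> (2::real)"
  shows "(\<lambda>n. real n * q ^ (n div 2) / q ^ n) \<longlonglongrightarrow> 0"
proof (rule Lim_null_comparison)
  show "(\<lambda>n. real n * sqrt (1/2) ^ n) \<longlonglongrightarrow> 0"
    using powser_times_n_limit_0[of "sqrt (1/2)"] by (simp add: real_sqrt_divide)
  show "\<forall>\<^sub>F n in sequentially. norm (real n * q ^ (n div 2) / q ^ n) \<le> real n * sqrt (1/2) ^ n"
  proof (intro always_eventually allI)
    fix n
    have q: "q > 0" using assms by simp
    have "q ^ n = q ^ (n div 2) * q ^ (n - n div 2)" by (simp flip: power_add)
    hence "real n * q ^ (n div 2) / q ^ n = real n * (1 / q) ^ (n - n div 2)" using q by (simp add: power_one_over)
    also have "\<dots> \<le> real n * (1 / 2) ^ (n - n div 2)"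
      using assms by (intro mult_left_mono power_mono divide_left_mono) auto
    also have "(1 / 2 :: real) ^ (n - n div 2) = sqrt (1/2) ^ (2 * (n - n div 2))"
      by (simp add: power_mult)
    also have "\<dots> \<le> sqrt (1/2) ^ n" by (intro power_decreasing) auto
    finally show "norm (real n * q ^ (n div 2) / q ^ n) \<le> real n * sqrt (1/2) ^ n"
      using q by (simp add: mult_left_mono)
  qed
qed

context modulus
begin

lemma card_U: "real (card U) = real CARD('a) ^ D * (\<Prod>P\<in>S. (pnorm P - 1) / pnorm P)"
proof -
  let ?h = "\<lambda>P x. if P dvd x then 0 else 1 :: real"
  have prod_ind: "(\<Prod>P\<in>S. ?h P m) = (if \<forall>P\<in>S. \<not> P dvd m then 1 else 0)" for m
    using fin by (induction S rule: finite_induct) auto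
  have "real (card U) = (\<Sum>m\<in>polys_below D. if \<forall>P\<in>S. \<not> P dvd m then 1 else 0)"
    unfolding U_def by (subst sum.inter_filter[symmetric]) auto
  also have "\<dots> = (\<Sum>m\<in>polys_below D. \<Prod>P\<in>S. ?h P (0 + 1 * m))" by (simp add: prod_ind)
  also have "\<dots> = real CARD('a) ^ D * (\<Prod>P\<in>S. (\<Sum>x\<in>polys_below (degree P). ?h P x) / pnorm P)"
  proof (rule sum_indep[OF fin primes])
    show "\<not> P dvd 1" if "P \<in> S" for P using prime_S[OF that] by (simp add: prime_elem_def)
    show "sdeg S \<le> D" by (simp add: D_eq)
    show "?h P x = ?h P (x mod P)" for P x :: "'a poly" by (simp add: dvd_mod_iff)
  qed
  also have "(\<Prod>P\<in>S. (\<Sum>x\<in>polys_below (degree P). ?h P x) / pnorm P) = (\<Prod>P\<in>S. (pnorm P - 1) / pnorm P)"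
  proof (intro prod.cong refl arg_cong2[where f = "(/)"])
    fix P assume "P \<in> S"
    have "(\<Sum>x\<in>polys_below (degree P). ?h P x) = (\<Sum>x\<in>polys_below (degree P) - {0 :: 'a poly}. 1)"
      by (rule sum.mono_neutral_cong_right) (use dvd_polys_below[of P] in auto)
    also have "\<dots> = pnorm P - 1"
      using card_field_ge_2[where 'a = 'a] by (simp add: card_Diff_singleton card_polys_below pnorm_def of_nat_diff)
    finally show "(\<Sum>x\<in>polys_below (degree P). ?h P x) = pnorm P - 1" .
  qed
  finally show ?thesis .
qed

lemma csum_principal_tendsto: "(\<lambda>n. csum (ext principal) n / of_nat CARD('a) ^ n) \<longlonglongrightarrow> 1"
proof -
  let ?q = "real CARD('a)"
  have "(\<lambda>n. csum (ext principal) n / of_nat CARD('a) ^ n - 1) \<longlonglongrightarrow> 0"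
  proof (rule Lim_null_comparison)
    have "(\<lambda>n. real D * (1 / ?q) ^ n) \<longlonglongrightarrow> real D * 0"
      using q_ge_2 by (intro tendsto_mult tendsto_const LIMSEQ_power_zero) auto
    thus "(\<lambda>n. real D * (1 / ?q) ^ n) \<longlonglongrightarrow> 0" by simp
    show "\<forall>\<^sub>F n in sequentially. norm (csum (ext principal) n / of_nat CARD('a) ^ n - 1) \<le> real D * (1 / ?q) ^ n"
    proof (rule eventually_mono[OF eventually_gt_at_top[of 0]])
      fix n :: nat assume "n > 0"
      then obtain d where d: "csum (ext principal) n = of_real (?q ^ n - d)" "0 \<le> d" "d \<le> D"
        using csum_principal_le by blast
      have "csum (ext principal) n / of_nat CARD('a) ^ n - 1 = of_real ((?q ^ n - d) / ?q ^ n - 1)" using d by simp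
      also have "(?q ^ n - d) / ?q ^ n - 1 = - (d / ?q ^ n)" by (simp add: diff_divide_distrib)
      finally have "norm (csum (ext principal) n / of_nat CARD('a) ^ n - 1) = d / ?q ^ n"
        using d by (simp add: norm_divide norm_power)
      thus "norm (csum (ext principal) n / of_nat CARD('a) ^ n - 1) \<le> real D * (1 / ?q) ^ n"
        using d by (simp add: power_one_over divide_right_mono)
    qed
  qed
  from tendsto_add[OF this tendsto_const[of 1]] show ?thesis by simp
qed

text \<open>Orthogonality on \<open>U\<close> expresses the class sum through the
  \<open>csum\<close> of all characters; after division by \<open>q ^ n\<close> only the principal
  one survives.\<close>

lemma prime_powers_in_class:
  assumes b: "\<And>P. P \<in> S \<Longrightarrow> \<not> P dvd b"
  shows "(\<lambda>n. (\<Sum>(P, j)\<in>{x \<in> prime_powers n. fst x ^ snd x mod W = b mod W}. real (degree P)) / real CARD('a) ^ n)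
    \<longlonglongrightarrow> 1 / card U"
proof -
  let ?q = "of_nat CARD('a) :: complex"
  define g where "g n = (\<Sum>(P, j)\<in>{x \<in> prime_powers n. fst x ^ snd x mod W = b mod W}. real (degree P))" for n
  have bU: "b mod W \<in> U" using b mod_W_U by auto
  have cU: "card U \<noteq> 0" using U.card_G_pos by simp
  have eq: "of_nat (card U) * complex_of_real (g n) = (\<Sum>\<psi>\<in>U.chars. cnj (\<psi> (b mod W)) * csum (ext \<psi>) n)" for n
  proof -
    have "(\<Sum>\<psi>\<in>U.chars. cnj (\<psi> (b mod W)) * csum (ext \<psi>) n)
        = (\<Sum>\<psi>\<in>U.chars. \<Sum>x\<in>prime_powers n. of_nat (degree (fst x)) * (\<psi> (fst x ^ snd x mod W) * cnj (\<psi> (b mod W))))"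
    proof (intro sum.cong refl)
      fix \<psi> assume \<psi>: "\<psi> \<in> U.chars"
      have "ext \<psi> P ^ j = \<psi> (P ^ j mod W)" for P j
        using multiplicative_power[OF ext_multiplicative[OF \<psi>], of P j] by (simp add: ext_def)
      thus "cnj (\<psi> (b mod W)) * csum (ext \<psi>) n
        = (\<Sum>x\<in>prime_powers n. of_nat (degree (fst x)) * (\<psi> (fst x ^ snd x mod W) * cnj (\<psi> (b mod W))))"
        by (simp add: csum_def sum_distrib_left case_prod_unfold mult_ac)
    qed
    also have "\<dots> = (\<Sum>x\<in>prime_powers n. of_nat (degree (fst x)) * (\<Sum>\<psi>\<in>U.chars. \<psi> (fst x ^ snd x mod W) * cnj (\<psi> (b mod W))))"
      by (subst sum.swap) (simp add: sum_distrib_left)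
    also have "\<dots> = (\<Sum>x\<in>prime_powers n. if fst x ^ snd x mod W = b mod W then of_nat (card U) * of_nat (degree (fst x)) else 0)"
    proof (intro sum.cong refl)
      fix x
      have "(\<Sum>\<psi>\<in>U.chars. \<psi> (fst x ^ snd x mod W) * cnj (\<psi> (b mod W))) = (if fst x ^ snd x mod W = b mod W then of_nat (card U) else 0)"
      proof (cases "fst x ^ snd x mod W \<in> U")
        case True
        thus ?thesis by (rule U.sum_chars_cnj[OF _ bU])
      next
        case False
        hence "(\<Sum>\<psi>\<in>U.chars. \<psi> (fst x ^ snd x mod W) * cnj (\<psi> (b mod W))) = 0"
          using U.charsD(3) by (intro sum.neutral) auto
        thus ?thesis using False bU by auto
      qed
      thus "of_nat (degree (fst x)) * (\<Sum>\<psi>\<in>U.chars. \<psi> (fst x ^ snd x mod W) * cnj (\<psi> (b mod W)))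
        = (if fst x ^ snd x mod W = b mod W then of_nat (card U) * of_nat (degree (fst x)) else 0)" by simp
    qed
    also have "\<dots> = (\<Sum>x\<in>{x \<in> prime_powers n. fst x ^ snd x mod W = b mod W}. of_nat (card U) * of_nat (degree (fst x)))"
      by (rule sum.inter_filter[symmetric]) simp
    also have "\<dots> = of_nat (card U) * complex_of_real (g n)"
      unfolding g_def by (simp add: sum_distrib_left case_prod_unfold)
    finally show ?thesis by simp
  qed
  have "(\<lambda>n. \<Sum>\<psi>\<in>U.chars. cnj (\<psi> (b mod W)) * (csum (ext \<psi>) n / ?q ^ n)) \<longlonglongrightarrow> (\<Sum>\<psi>\<in>U.chars. if \<psi> = principal then 1 else 0)"
  proof (intro tendsto_sum)
    fix \<psi> assume \<psi>: "\<psi> \<in> U.chars"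
    show "(\<lambda>n. cnj (\<psi> (b mod W)) * (csum (ext \<psi>) n / ?q ^ n)) \<longlonglongrightarrow> (if \<psi> = principal then 1 else 0)"
    proof (cases "\<psi> = principal")
      case True
      have "principal (b mod W) = 1" using bU by (simp add: principal_def)
      thus ?thesis using csum_principal_tendsto unfolding True by simp
    next
      case False
      from tendsto_mult[OF tendsto_const csum_nonprincipal_tendsto_0[OF \<psi> False]] show ?thesis using False by simp
    qed
  qed
  also have "(\<Sum>\<psi>\<in>U.chars. if \<psi> = principal then 1 else 0) = (1::complex)"
    using U.finite_chars principal_char by simp
  also have "(\<lambda>n. \<Sum>\<psi>\<in>U.chars. cnj (\<psi> (b mod W)) * (csum (ext \<psi>) n / ?q ^ n)) = (\<lambda>n. complex_of_real (card U * (g n / real CARD('a) ^ n)))"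
    using eq by (simp add: sum_divide_distrib[symmetric])
  finally have "(\<lambda>n. complex_of_real (card U * (g n / real CARD('a) ^ n))) \<longlonglongrightarrow> complex_of_real 1"
    by (simp only: of_real_1)
  hence "(\<lambda>n. card U * (g n / real CARD('a) ^ n)) \<longlonglongrightarrow> 1"
    by (simp only: tendsto_of_real_iff)
  from tendsto_divide[OF this tendsto_const[of "real (card U)"]] cU
  have "(\<lambda>n. g n / real CARD('a) ^ n) \<longlonglongrightarrow> 1 / card U" by simp
  thus ?thesis unfolding g_def .
qed

text \<open>Proper prime powers are negligible, so the limit passes to irreducibles. No rate is
  claimed; the modulus stays fixed while the degree grows.\<close>

theorem primes_in_class:
  assumes b: "\<And>P. P \<in> S \<Longrightarrow> \<not> P dvd b"
  shows "(\<lambda>n. real n * card {P \<in> mprimes. degree P = n \<and> P mod W = b mod W} / real CARD('a) ^ n) \<longlonglongrightarrow> 1 / card U"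
proof -
  let ?q = "real CARD('a)"
  define g where "g n = (\<Sum>(P, j)\<in>{x \<in> prime_powers n. fst x ^ snd x mod W = b mod W}. real (degree P))" for n
  define h where "h n = real n * card {P \<in> mprimes. degree P = n \<and> P mod W = b mod W}" for n
  have diff: "h n \<le> g n" "g n - h n \<le> real n * ?q ^ (n div 2)" if n: "n > 0" for n
  proof -
    let ?X = "{x \<in> prime_powers n. fst x ^ snd x mod W = b mod W}"
    let ?Y = "(\<lambda>P. (P, 1::nat)) ` {P \<in> mprimes. degree P = n \<and> P mod W = b mod W}"
    have sub: "?Y \<subseteq> ?X" by (auto simp: prime_powers_def)
    have hY: "h n = (\<Sum>(P, j)\<in>?Y. real (degree P))"
      unfolding h_def by (subst sum.reindex) (auto simp: inj_on_def)
    have "g n = (\<Sum>(P, j)\<in>?X - ?Y. real (degree P)) + h n"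
      unfolding g_def hY by (rule sum.subset_diff[OF sub]) simp
    moreover have "(\<Sum>(P, j)\<in>?X - ?Y. real (degree P)) \<le> (\<Sum>(P, j)\<in>{x \<in> prime_powers n. snd x \<noteq> 1}. real (degree (P :: 'a poly)))"
    proof (rule sum_mono2)
      show "?X - ?Y \<subseteq> {x \<in> prime_powers n. snd x \<noteq> 1}" by (auto simp: prime_powers_def image_iff)
    qed auto
    moreover have "(\<Sum>(P, j)\<in>?X - ?Y. real (degree P)) \<ge> 0" by (intro sum_nonneg) auto
    ultimately show "h n \<le> g n" "g n - h n \<le> real n * ?q ^ (n div 2)"
      using higher_prime_powers_weight[of n, where 'a = 'a] by linarith+
  qed
  have "(\<lambda>n. g n / ?q ^ n - h n / ?q ^ n) \<longlonglongrightarrow> 0"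
  proof (rule Lim_null_comparison[OF _ higher_prime_powers_tendsto_0[OF q_ge_2]])
    show "\<forall>\<^sub>F n in sequentially. norm (g n / ?q ^ n - h n / ?q ^ n) \<le> real n * ?q ^ (n div 2) / ?q ^ n"
    proof (rule eventually_mono[OF eventually_gt_at_top[of 0]])
      fix n :: nat assume "n > 0"
      from diff[OF this] have "\<bar>g n - h n\<bar> \<le> real n * ?q ^ (n div 2)" by simp
      thus "norm (g n / ?q ^ n - h n / ?q ^ n) \<le> real n * ?q ^ (n div 2) / ?q ^ n"
        by (simp add: divide_right_mono flip: diff_divide_distrib)
    qed
  qed
  moreover have "(\<lambda>n. g n / ?q ^ n) \<longlonglongrightarrow> 1 / card U"
    unfolding g_def by (rule prime_powers_in_class[OF b])
  ultimately have "(\<lambda>n. g n / ?q ^ n - (g n / ?q ^ n - h n / ?q ^ n)) \<longlonglongrightarrow> 1 / card U - 0" by (intro tendsto_diff)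
  thus ?thesis unfolding h_def by simp
qed

end

section \<open>Restriction estimate for the majorant\<close>

lemma sum_Pow_power:
  assumes "finite U"
  shows "(\<Sum>X\<in>Pow U. (c::real) ^ card X) = (c + 1) ^ card U"
  using prod_add[OF assms, of "\<lambda>_. c" "\<lambda>_. 1"] by simp

text \<open>In each degree \<open>d\<close> there are at most \<open>q ^ d / d\<close> members: the
  upper half of Mertens' theorem.\<close>

lemma sum_inverse_pnorm_le:
  "(\<Sum>P\<in>{P\<in>mprimes. degree P \<le> K}. 1 / pnorm (P :: 'a::{field,finite} poly)) \<le> (\<Sum>k=1..K. 1 / real k)"
proof -
  let ?T = "\<lambda>d. {P \<in> (mprimes :: 'a poly set). degree P = d}"
  have q: "real CARD('a) \<ge> 2" using card_field_ge_2[where 'a = 'a] by simp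
  have finT: "finite (?T d)" for d
    by (rule finite_subset[of _ "polys_below (Suc d)"]) (auto simp: polys_below_degree)
  have "{P\<in>mprimes. degree P \<le> K} = (\<Union>d\<in>{1..K}. ?T d)" using mprimesD(3) by (auto simp: Suc_le_eq)
  hence "(\<Sum>P\<in>{P\<in>mprimes. degree P \<le> K}. 1 / pnorm (P :: 'a poly)) = (\<Sum>d=1..K. \<Sum>P\<in>?T d. 1 / pnorm P)"
    by (simp only:) (rule sum.UNION_disjoint, use finT in auto)
  also have "\<dots> \<le> (\<Sum>d=1..K. 1 / real d)"
  proof (intro sum_mono)
    fix d assume d: "d \<in> {1..K}"
    have eq: "(\<Sum>P\<in>?T d. 1 / pnorm P) = card (?T d) / real CARD('a) ^ d" by (simp add: pnorm_def)
    have "real (d * card (?T d)) \<le> real (CARD('a) ^ d)"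
      using card_mprimes_le[of d, where 'a = 'a] d by (simp only: of_nat_le_iff) auto
    thus "(\<Sum>P\<in>?T d. 1 / pnorm P) \<le> 1 / real d" unfolding eq using d q by (simp add: field_simps)
  qed
  finally show ?thesis .
qed

lemma harmonic_le_ln: "K \<ge> 1 \<Longrightarrow> (\<Sum>k=1..K. 1 / real k) \<le> 1 + ln (real K)"
proof (induction K rule: dec_induct)
  case (step n)
  have "ln (real n / (1 + real n)) \<le> real n / (1 + real n) - 1" using step by (intro ln_le_minus_one) auto
  moreover have "ln (real n / (1 + real n)) = ln (real n) - ln (1 + real n)" using step by (simp add: ln_div)
  moreover have "real n / (1 + real n) - 1 = - (1 / (1 + real n))" by (simp add: field_simps)
  ultimately have "1 / (1 + real n) \<le> ln (1 + real n) - ln (real n)" by linarith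
  thus ?case using step by simp
qed simp

text \<open>\<open>1 + x \<le> exp x\<close> reduces the product to the Mertens sum, at most
  \<open>1 + ln K\<close>; products over irreducibles thus cost only a power of
  \<open>K\<close>.\<close>

lemma prod_mprimes_le:
  assumes "A \<subseteq> {P\<in>(mprimes :: 'a::{field,finite} poly set). degree P \<le> K}" "K \<ge> 1"
    and f: "\<And>P. P \<in> A \<Longrightarrow> 0 \<le> f P" "\<And>P. P \<in> A \<Longrightarrow> f P \<le> real C / pnorm P"
  shows "(\<Prod>P\<in>A. 1 + f P) \<le> (exp 1 * real K) ^ C"
proof -
  let ?M = "{P\<in>(mprimes :: 'a poly set). degree P \<le> K}"
  have finM: "finite ?M"
    by (rule finite_subset[of _ "polys_below (Suc K)"]) (auto simp: polys_below_degree)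
  have finA: "finite A" using assms(1) finM finite_subset by blast
  have "(\<Prod>P\<in>A. 1 + f P) \<le> (\<Prod>P\<in>A. exp (real C / pnorm P))"
    using f by (intro prod_mono) (auto intro: order_trans[OF exp_ge_add_one_self] add_nonneg_nonneg)
  also have "\<dots> = exp (\<Sum>P\<in>A. real C / pnorm P)" using finA by (simp add: exp_sum)
  also have "\<dots> \<le> exp (real C * (1 + ln (real K)))"
  proof -
    have "(\<Sum>P\<in>A. real C / pnorm P) = real C * (\<Sum>P\<in>A. 1 / pnorm P)" by (simp add: sum_distrib_left)
    also have "(\<Sum>P\<in>A. 1 / pnorm P) \<le> (\<Sum>P\<in>?M. 1 / pnorm P)"
      using assms(1) finM by (intro sum_mono2) (auto simp: pnorm_def)
    also have "\<dots> \<le> 1 + ln (real K)" using sum_inverse_pnorm_le[of K, where 'a = 'a] harmonic_le_ln[OF assms(2)] by linarith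
    finally show ?thesis by (simp add: mult_left_mono)
  qed
  also have "exp (real C * (1 + ln (real K))) = (exp 1 * real K) ^ C"
    using assms(2) by (simp add: exp_of_nat_mult exp_add)
  finally show ?thesis .
qed

section \<open>Moments of truncated divisor functions\<close>

context sieve
begin

text \<open>A generalised divisor function over squarefree divisors of degree at most
  \<open>k\<close>, with weight \<open>c\<close> per prime factor. The truncation lets
  \<open>sum_indep\<close> compute its mean.\<close>

definition divcount :: "nat \<Rightarrow> nat \<Rightarrow> 'a poly \<Rightarrow> real" where
  "divcount c k n = (\<Sum>Q\<in>psets PP k. real c ^ card Q * (if \<forall>P\<in>Q. P dvd n then 1 else 0))"

lemma divcount_nonneg: "divcount c k n \<ge> 0"
  unfolding divcount_def by (intro sum_nonneg) auto

text \<open>Two divisors are merged into their least common multiple \<open>U\<close>; the pairs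
  with union \<open>U\<close> are among all pairs of subsets of \<open>U\<close>, whence the factor
  \<open>(c + 1)\<^sup>2\<close> per prime.\<close>

lemma divcount_square: "(divcount c k n)\<^sup>2 \<le> divcount ((c + 1)\<^sup>2) (2 * k) n"
proof -
  let ?i = "\<lambda>Q. if \<forall>P\<in>Q. P dvd n then 1 else 0 :: real"
  let ?A = "psets PP k \<times> psets PP k"
  let ?u = "\<lambda>(X, Y). X \<union> Y :: 'a poly set"
  have img: "?u ` ?A \<subseteq> psets PP (2 * k)"
  proof (intro image_subsetI, clarify)
    fix X Y assume "X \<in> psets PP k" "Y \<in> psets PP k"
    thus "X \<union> Y \<in> psets PP (2 * k)" using sdeg_Un_le[of X Y] by (auto simp: psets_def)
  qed
  have "(divcount c k n)\<^sup>2 = (\<Sum>(X, Y)\<in>?A. (real c ^ card X * real c ^ card Y) * ?i (X \<union> Y))"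
    unfolding divcount_def power2_eq_square sum_product sum.cartesian_product
    by (intro sum.cong refl) (auto simp: ball_Un)
  also have "\<dots> = (\<Sum>U\<in>psets PP (2 * k). \<Sum>p\<in>{p\<in>?A. ?u p = U}. (case p of (X, Y) \<Rightarrow> (real c ^ card X * real c ^ card Y) * ?i (X \<union> Y)))"
    by (rule sum.group[OF _ _ img, symmetric]) auto
  also have "\<dots> \<le> (\<Sum>U\<in>psets PP (2 * k). real ((c + 1)\<^sup>2) ^ card U * ?i U)"
  proof (intro sum_mono)
    fix U assume U: "U \<in> psets PP (2 * k)"
    have finU: "finite U" using psetsD(2)[OF U] .
    have "(\<Sum>p\<in>{p\<in>?A. ?u p = U}. (case p of (X, Y) \<Rightarrow> (real c ^ card X * real c ^ card Y) * ?i (X \<union> Y)))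
       = (\<Sum>p\<in>{p\<in>?A. ?u p = U}. (case p of (X, Y) \<Rightarrow> (real c ^ card X * real c ^ card Y) * ?i U))"
      by (intro sum.cong refl) auto
    also have "\<dots> \<le> (\<Sum>p\<in>Pow U \<times> Pow U. (case p of (X, Y) \<Rightarrow> (real c ^ card X * real c ^ card Y) * ?i U))"
      using finU by (intro sum_mono2) auto
    also have "\<dots> = (\<Sum>X\<in>Pow U. real c ^ card X) * (\<Sum>Y\<in>Pow U. real c ^ card Y) * ?i U"
      by (simp only: sum_product sum.cartesian_product) (simp only: sum_distrib_right case_prod_unfold)
    also have "\<dots> = real ((c + 1)\<^sup>2) ^ card U * ?i U"
    proof -
      have "real ((c + 1)\<^sup>2) = (real c + 1) * (real c + 1)" by (simp add: power2_eq_square algebra_simps)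
      thus ?thesis unfolding sum_Pow_power[OF finU] by (simp only: power_mult_distrib)
    qed
    finally show "(\<Sum>p\<in>{p\<in>?A. ?u p = U}. (case p of (X, Y) \<Rightarrow> (real c ^ card X * real c ^ card Y) * ?i (X \<union> Y)))
       \<le> real ((c + 1)\<^sup>2) ^ card U * ?i U" .
  qed
  finally show ?thesis unfolding divcount_def .
qed

lemma sum_divcount:
  assumes k: "k \<le> M" "k \<ge> 1"
  shows "(\<Sum>m\<in>polys_below M. divcount c k (r + W * m)) \<le> real CARD('a) ^ M * (exp 1 * real k) ^ c"
proof -
  let ?A = "{P\<in>PP. degree P \<le> k}"
  have finA: "finite ?A"
    by (rule finite_subset[of _ "polys_below (Suc k)"]) (auto simp: polys_below_degree)
  have ind: "(\<Sum>m\<in>polys_below M. if \<forall>P\<in>Q. P dvd r + W * m then 1 else 0) = real CARD('a) ^ M * (\<Prod>P\<in>Q. 1 / pnorm P)"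
    if Q: "Q \<in> psets PP k" for Q
  proof -
    let ?h = "\<lambda>P x. if P dvd x then 1 else 0 :: real"
    have fQ: "finite Q" by (rule psetsD(2)[OF Q])
    have prod_ind: "(\<Prod>P\<in>Q. ?h P m) = (if \<forall>P\<in>Q. P dvd m then 1 else 0)" for m
      using fQ by (induction Q rule: finite_induct) auto
    have "(\<Sum>m\<in>polys_below M. if \<forall>P\<in>Q. P dvd r + W * m then 1 else 0) = (\<Sum>m\<in>polys_below M. \<Prod>P\<in>Q. ?h P (r + W * m))"
      by (simp add: prod_ind)
    also have "\<dots> = real CARD('a) ^ M * (\<Prod>P\<in>Q. (\<Sum>x\<in>polys_below (degree P). ?h P x) / pnorm P)"
    proof (rule sum_indep[OF fQ psetsD(4)[OF Q]])
      show "\<not> P dvd W" if "P \<in> Q" for P using W psetsD(1)[OF Q] that by auto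
      show "sdeg Q \<le> M" using psetsD(3)[OF Q] k by simp
      show "?h P x = ?h P (x mod P)" for P x :: "'a poly" by (simp add: dvd_mod_iff)
    qed
    also have "(\<Prod>P\<in>Q. (\<Sum>x\<in>polys_below (degree P). ?h P x) / pnorm P) = (\<Prod>P\<in>Q. 1 / pnorm P)"
    proof (intro prod.cong refl arg_cong2[where f = "(/)"])
      fix P assume "P \<in> Q"
      have "(\<Sum>x\<in>polys_below (degree P). ?h P x) = (\<Sum>x\<in>{0 :: 'a poly}. 1)"
        by (rule sum.mono_neutral_cong_right) (use dvd_polys_below[of P] in auto)
      thus "(\<Sum>x\<in>polys_below (degree P). ?h P x) = 1" by simp
    qed
    finally show ?thesis .
  qed
  have "(\<Sum>m\<in>polys_below M. divcount c k (r + W * m))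
     = (\<Sum>Q\<in>psets PP k. real c ^ card Q * (\<Sum>m\<in>polys_below M. if \<forall>P\<in>Q. P dvd r + W * m then 1 else 0))"
    unfolding divcount_def by (subst sum.swap) (simp add: sum_distrib_left)
  also have "\<dots> = (\<Sum>Q\<in>psets PP k. real CARD('a) ^ M * (\<Prod>P\<in>Q. real c / pnorm P))"
    by (intro sum.cong refl) (simp add: ind prod_dividef)
  also have "\<dots> \<le> (\<Sum>Q\<in>Pow ?A. real CARD('a) ^ M * (\<Prod>P\<in>Q. real c / pnorm P))"
  proof (rule sum_mono2)
    show "psets PP k \<subseteq> Pow ?A"
    proof (intro subsetI PowI)
      fix Q P assume Q: "Q \<in> psets PP k" "P \<in> Q"
      have "degree P \<le> sdeg Q" unfolding sdeg_def using Q psetsD(2) by (intro member_le_sum) auto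
      thus "P \<in> ?A" using Q psetsD(1,3)[OF Q(1)] by auto
    qed
  qed (use finA in \<open>auto intro!: mult_nonneg_nonneg prod_nonneg simp: pnorm_def\<close>)
  also have "\<dots> = real CARD('a) ^ M * (\<Prod>P\<in>?A. 1 + real c / pnorm P)"
    using prod_add[OF finA, of "\<lambda>P. real c / pnorm P" "\<lambda>_. 1"] by (simp add: sum_distrib_left add.commute)
  also have "\<dots> \<le> real CARD('a) ^ M * (exp 1 * real k) ^ c"
    using PP k by (intro mult_left_mono prod_mprimes_le) (auto simp: pnorm_def)
  finally show ?thesis .
qed

text \<open>What \<open>nu_expand\<close> charges to moduli of degree at most \<open>k\<close> if
  absolute values are taken pointwise and no cancellation is used.\<close>

definition majcount :: "nat \<Rightarrow> 'a poly \<Rightarrow> real" where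
  "majcount k n = (\<Sum>Q\<in>psets PP k. 3 ^ card Q * \<bar>bs Q n\<bar>)"

text \<open>\<open>\<bar>bp P n\<bar>\<close> is at most \<open>1 / (pnorm P - 1)\<close> plus the
  indicator of \<open>P dvd n\<close>. When the product is expanded, the first parts sum to an Euler
  product, bounded through \<open>3 / (pnorm P - 1) \<le> 6 / pnorm P\<close>, and the second parts
  form \<open>divcount 3\<close>.\<close>

lemma majcount_le:
  assumes k: "k \<ge> 1"
  shows "majcount k n \<le> (exp 1 * real k) ^ 6 * divcount 3 k n"
proof -
  let ?A = "{P\<in>PP. degree P \<le> k}"
  have finA: "finite ?A"
    by (rule finite_subset[of _ "polys_below (Suc k)"]) (auto simp: polys_below_degree)
  let ?i = "\<lambda>Q. if \<forall>P\<in>Q. P dvd n then 1 else 0 :: real"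
  let ?f = "\<lambda>X Y. (\<Prod>P\<in>X. 3 / (pnorm P - 1)) * (3 ^ card Y * ?i Y)"
  have f0: "(\<Prod>P\<in>X. 3 / (pnorm P - 1)) \<ge> 0" if "X \<subseteq> mprimes" for X :: "'a poly set"
    using that pnorm_mprime by (intro prod_nonneg) force
  have sub: "psets PP k \<subseteq> Pow ?A"
  proof (intro subsetI PowI)
    fix Q P assume Q: "Q \<in> psets PP k" "P \<in> Q"
    have "degree P \<le> sdeg Q" unfolding sdeg_def using Q psetsD(2) by (intro member_le_sum) auto
    thus "P \<in> ?A" using Q psetsD(1,3)[OF Q(1)] by auto
  qed
  have "majcount k n \<le> (\<Sum>Q\<in>psets PP k. \<Sum>X\<in>Pow Q. ?f X (Q - X))"
    unfolding majcount_def
  proof (intro sum_mono)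
    fix Q assume Q: "Q \<in> psets PP k"
    have fQ: "finite Q" by (rule psetsD(2)[OF Q])
    have ind: "(\<Prod>P\<in>Y. 3 * (if P dvd n then 1 else 0 :: real)) = 3 ^ card Y * ?i Y" if "finite Y" for Y
      using that by (induction Y rule: finite_induct) auto
    have "3 ^ card Q * \<bar>bs Q n\<bar> = (\<Prod>P\<in>Q. 3 * \<bar>bp P n\<bar>)"
      by (simp add: bs_def abs_prod prod.distrib)
    also have "\<dots> \<le> (\<Prod>P\<in>Q. 3 / (pnorm P - 1) + 3 * (if P dvd n then 1 else 0))"
      using pnorm_mprime psetsD(4)[OF Q] by (intro prod_mono) (force simp: bp_def)
    also have "\<dots> = (\<Sum>X\<in>Pow Q. (\<Prod>P\<in>X. 3 / (pnorm P - 1)) * (\<Prod>P\<in>Q - X. 3 * (if P dvd n then 1 else 0)))"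
      by (rule prod_add[OF fQ])
    also have "\<dots> = (\<Sum>X\<in>Pow Q. ?f X (Q - X))"
      by (intro sum.cong refl) (simp add: ind fQ)
    finally show "3 ^ card Q * \<bar>bs Q n\<bar> \<le> (\<Sum>X\<in>Pow Q. ?f X (Q - X))" .
  qed
  also have "\<dots> = (\<Sum>(Q, X)\<in>Sigma (psets PP k) Pow. ?f X (Q - X))"
    using psetsD(2) by (subst sum.Sigma) auto
  also have "\<dots> = (\<Sum>(X, Y)\<in>(\<lambda>(Q, X). (X, Q - X)) ` Sigma (psets PP k) Pow. ?f X Y)"
    by (subst sum.reindex) (auto simp: inj_on_def case_prod_unfold)
  also have "\<dots> \<le> (\<Sum>(X, Y)\<in>Pow ?A \<times> psets PP k. ?f X Y)"
  proof (rule sum_mono2)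
    show "(\<lambda>(Q, X). (X, Q - X)) ` Sigma (psets PP k) Pow \<subseteq> Pow ?A \<times> psets PP k"
    proof (intro image_subsetI)
      fix z assume "z \<in> Sigma (psets PP k) Pow"
      then obtain Q X where z: "z = (Q, X)" "Q \<in> psets PP k" "X \<subseteq> Q" by auto
      have "X \<subseteq> ?A" "Q - X \<in> psets PP k" using z sub psets_subset[of "Q - X" Q k] by auto
      thus "(\<lambda>(Q, X). (X, Q - X)) z \<in> Pow ?A \<times> psets PP k" unfolding z(1) by simp
    qed
    show "finite (Pow ?A \<times> psets PP k)" using finA by simp
    show "0 \<le> (case b of (X, Y) \<Rightarrow> ?f X Y)"
      if "b \<in> Pow ?A \<times> psets PP k - (\<lambda>(Q, X). (X, Q - X)) ` Sigma (psets PP k) Pow" for b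
    proof -
      have "fst b \<subseteq> mprimes" using that PP by auto
      thus ?thesis using f0[of "fst b"] by (auto simp: case_prod_unfold intro!: mult_nonneg_nonneg)
    qed
  qed
  also have "\<dots> = (\<Sum>X\<in>Pow ?A. \<Prod>P\<in>X. 3 / (pnorm P - 1)) * divcount 3 k n"
    unfolding divcount_def sum_product sum.cartesian_product by simp
  also have "(\<Sum>X\<in>Pow ?A. \<Prod>P\<in>X. 3 / (pnorm P - 1)) = (\<Prod>P\<in>?A. 1 + 3 / (pnorm P - 1))"
    using prod_add[OF finA, of "\<lambda>P. 3 / (pnorm P - 1)" "\<lambda>_. 1"] by (simp add: add.commute)
  also have "\<dots> * divcount 3 k n \<le> (exp 1 * real k) ^ 6 * divcount 3 k n"
  proof (intro mult_right_mono divcount_nonneg prod_mprimes_le)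
    show "?A \<subseteq> {P\<in>mprimes. degree P \<le> k}" using PP by auto
    fix P assume "P \<in> ?A"
    hence p2: "pnorm P \<ge> 2" using PP pnorm_mprime by auto
    show "0 \<le> 3 / (pnorm P - 1)" using p2 by simp
    show "3 / (pnorm P - 1) \<le> real 6 / pnorm P" using p2 by (simp add: field_simps)
  qed (rule k)
  finally show ?thesis .
qed

lemma majcount_nonneg: "majcount k n \<ge> 0"
  unfolding majcount_def by (intro sum_nonneg) auto

text \<open>\<open>divcount_square\<close> is applied twice: the weight goes from 3 to
  \<open>(3 + 1)\<^sup>2 = 16\<close> and \<open>(16 + 1)\<^sup>2 = 289\<close>, the degree from
  \<open>k\<close> to \<open>4 * k\<close>, while the power 6 of the prefactor becomes 24.\<close>

lemma majcount_moment:
  assumes k: "k \<ge> 1" "4 * k \<le> M"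
  shows "(\<Sum>m\<in>polys_below M. majcount k (r + W * m) ^ 4)
    \<le> real CARD('a) ^ M * ((exp 1 * real k) ^ 24 * (exp 1 * real (4 * k)) ^ 289)"
proof -
  have "majcount k n ^ 4 \<le> (exp 1 * real k) ^ 24 * divcount 289 (4 * k) n" for n
  proof -
    have "(divcount 3 k n)\<^sup>2 \<le> divcount 16 (2 * k) n" using divcount_square[of 3 k n] by simp
    hence "((divcount 3 k n)\<^sup>2)\<^sup>2 \<le> (divcount 16 (2 * k) n)\<^sup>2" by (intro power_mono) auto
    also have "\<dots> \<le> divcount 289 (4 * k) n" using divcount_square[of 16 "2 * k" n] by simp
    finally have 1: "divcount 3 k n ^ 4 \<le> divcount 289 (4 * k) n" by (simp flip: power_mult)
    have "majcount k n ^ 4 \<le> ((exp 1 * real k) ^ 6 * divcount 3 k n) ^ 4"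
      by (intro power_mono majcount_le majcount_nonneg k)
    also have "\<dots> = (exp 1 * real k) ^ 24 * divcount 3 k n ^ 4" by (simp add: power_mult_distrib flip: power_mult)
    also have "\<dots> \<le> (exp 1 * real k) ^ 24 * divcount 289 (4 * k) n" using 1 by (intro mult_left_mono) auto
    finally show ?thesis .
  qed
  hence "(\<Sum>m\<in>polys_below M. majcount k (r + W * m) ^ 4) \<le> (\<Sum>m\<in>polys_below M. (exp 1 * real k) ^ 24 * divcount 289 (4 * k) (r + W * m))"
    by (intro sum_mono)
  also have "\<dots> = (exp 1 * real k) ^ 24 * (\<Sum>m\<in>polys_below M. divcount 289 (4 * k) (r + W * m))"
    by (simp add: sum_distrib_left)
  also have "\<dots> \<le> (exp 1 * real k) ^ 24 * (real CARD('a) ^ M * (exp 1 * real (4 * k)) ^ 289)"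
    using k by (intro mult_left_mono sum_divcount) auto
  finally show ?thesis by (simp only: mult_ac)
qed

end

definition moment_bound :: "nat \<Rightarrow> real" where
  "moment_bound k = (exp 1 * real k) ^ 24 * (exp 1 * real (4 * k)) ^ 289"

text \<open>The restriction argument for Fourier coefficients of size \<open>16 powr (- j)\<close> truncates the expansion of \<open>nu\<close>
  at total degree \<open>8 * j + 2\<close>, beyond which it contributes at most \<open>256 powr (- j) / 2\<close>; all that matters
  is that the fourth moment grows subexponentially in this level.\<close>

lemma moment_constant: "\<exists>y::real. y \<ge> 1 \<and> (\<forall>j. 4 * moment_bound (8 * j + 2) \<le> y ^ 3 * 2 ^ j)"
proof -
  define c where "c = (exp 1 :: real) ^ 24 * (exp 1 * 4) ^ 289"
  have eq: "moment_bound k = c * real k ^ 313" for k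
  proof -
    have "moment_bound k = c * (real k ^ 24 * real k ^ 289)"
      by (simp only: moment_bound_def c_def power_mult_distrib of_nat_mult of_nat_numeral mult_ac)
    thus ?thesis by (simp flip: power_add)
  qed
  have "(\<lambda>j. real (8 * j + 2) ^ 313 / 2 ^ j) \<longlonglongrightarrow> 0"
    by real_asymp
  then have "Bseq (\<lambda>j. real (8 * j + 2) ^ 313 / 2 ^ j)" by (intro convergent_imp_Bseq) (auto simp: convergent_def)
  then obtain B where B: "B > 0" "\<And>j. norm (real (8 * j + 2) ^ 313 / 2 ^ j) \<le> B" by (auto elim: BseqE)
  define y where "y = max 1 (4 * c * B)"
  have c0: "c > 0" by (simp add: c_def)
  have "4 * moment_bound (8 * j + 2) \<le> y ^ 3 * 2 ^ j" for j
  proof -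
    have "real (8 * j + 2) ^ 313 \<le> B * 2 ^ j" using B(2)[of j] by (simp add: divide_le_eq)
    hence "4 * moment_bound (8 * j + 2) \<le> (4 * c * B) * 2 ^ j" unfolding eq using c0 by simp
    also have "\<dots> \<le> y * 2 ^ j" by (intro mult_right_mono) (auto simp: y_def)
    also have "\<dots> \<le> y ^ 3 * 2 ^ j" using self_le_power[of y 3] by (intro mult_right_mono) (auto simp: y_def)
    finally show ?thesis .
  qed
  thus ?thesis by (intro exI[of _ y]) (auto simp: y_def)
qed

text \<open>The part of \<open>tail_bound\<close> due to the resonant moduli beyond the first in
  each degree; it tends to 0 with \<open>s\<close>, whatever the cutoff \<open>k0\<close>.\<close>

definition sieve_err :: "real \<Rightarrow> nat \<Rightarrow> real" where
  "sieve_err q s = 48 * real s * q powr (- real s / 2)"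

locale transference =
  fixes W :: "'a::{field,finite} poly" and PP :: "'a poly set" and s :: nat
  assumes PP_mprimes: "PP \<subseteq> mprimes" and W_coprime: "\<And>P. P \<in> PP \<Longrightarrow> \<not> P dvd W"
    and q3: "CARD('a) \<ge> 3" and large: "\<And>P. P \<in> PP \<Longrightarrow> pnorm P \<ge> 6 ^ 32"
begin

sublocale sieve W PP "24 * s" "50 * s"
  by standard (use PP_mprimes W_coprime in auto)

abbreviation "VV \<equiv> (polys_below (50 * s) :: 'a poly set)"

lemma tail:
  assumes "\<theta> \<in> V.chars"
  shows "(\<Sum>Q\<in>{Q\<in>psets PP (2 * (24 * s)). sdeg Q > k0}. 3 ^ card Q * norm (\<Sum>m\<in>VV. of_real (bs Q (r + W * m)) * \<theta> m))
    \<le> (real CARD('a) ^ (50 * s)) * ((1/2) ^ k0 + sieve_err (real CARD('a)) s)"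
  unfolding sieve_err_def by (rule tail_bound[OF assms q3 refl refl large])

text \<open>The main term of \<open>nu_expand\<close> vanishes at a nontrivial character, and a
  nonempty modulus made of primes of degree above \<open>w\<close> has itself degree above
  \<open>w\<close>, so everything left belongs to the tail.\<close>

lemma hat_nu_le:
  assumes \<theta>: "\<theta> \<in> V.chars" and w: "\<And>P. P \<in> PP \<Longrightarrow> degree P > w"
    and nt: "\<theta> \<noteq> (\<lambda>x. if x \<in> VV then 1 else 0)"
  shows "norm (V.hat (\<lambda>m. of_real (nu (r + W * m))) \<theta>) \<le> (1/2) ^ w + sieve_err (real CARD('a)) s"
proof -
  let ?c = "\<lambda>m. cnj (\<theta> m)"
  have c: "?c \<in> V.chars" by (rule V.char_cnj_chars[OF \<theta>])
  have "\<not> (\<forall>x\<in>VV. ?c x = 1)"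
  proof
    assume "\<forall>x\<in>VV. ?c x = 1"
    hence "\<forall>x\<in>VV. \<theta> x = 1" by (metis complex_cnj_one complex_cnj_cnj)
    hence "\<theta> = (\<lambda>x. if x \<in> VV then 1 else 0)" by (intro V.chars_ext[OF \<theta> V.one_chars]) auto
    thus False using nt by contradiction
  qed
  hence 0: "(\<Sum>m\<in>VV. ?c m) = 0"
    unfolding V.sum_char_on[OF V.chars_char_on[OF c V.subgrp_G]] by (rule if_not_P)
  have sub: "psets PP (2 * (24 * s)) - {{}} \<subseteq> {Q\<in>psets PP (2 * (24 * s)). sdeg Q > w}"
  proof
    fix Q assume Q: "Q \<in> psets PP (2 * (24 * s)) - {{}}"
    then obtain P where P: "P \<in> Q" by auto
    have "degree P \<le> sdeg Q" unfolding sdeg_def using Q P psetsD(2) by (intro member_le_sum) auto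
    moreover have "degree P > w" using w P psetsD(1) Q by blast
    ultimately show "Q \<in> {Q\<in>psets PP (2 * (24 * s)). sdeg Q > w}" using Q by auto
  qed
  have "norm (\<Sum>m\<in>VV. of_real (nu (r + W * m)) * ?c m) = norm ((\<Sum>m\<in>VV. of_real (nu (r + W * m)) * ?c m) - (\<Sum>m\<in>VV. ?c m))"
    unfolding 0 by simp
  also have "\<dots> \<le> (\<Sum>Q\<in>psets PP (2 * (24 * s)) - {{}}. 3 ^ card Q * norm (\<Sum>m\<in>VV. of_real (bs Q (r + W * m)) * ?c m))"
    by (rule nu_expand)
  also have "\<dots> \<le> (\<Sum>Q\<in>{Q\<in>psets PP (2 * (24 * s)). sdeg Q > w}. 3 ^ card Q * norm (\<Sum>m\<in>VV. of_real (bs Q (r + W * m)) * ?c m))"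
    by (intro sum_mono2 sub) auto
  also have "\<dots> \<le> (real CARD('a) ^ (50 * s)) * ((1/2) ^ w + sieve_err (real CARD('a)) s)" by (rule tail[OF c])
  finally show ?thesis unfolding V.hat_def card_polys_below norm_divide by (simp add: divide_le_eq mult.commute norm_power)
qed

text \<open>Duality: \<open>a\<close> is tested against a combination \<open>F\<close> of the
  \<open>n\<close> characters in \<open>R\<close>, with phases that align all terms. Cauchy-Schwarz
  and \<open>a m \<le> nu (r + W * m)\<close> lead to the \<open>nu\<close>-mean of the square of
  \<open>norm (F m)\<close>. Moduli of degree above \<open>k0\<close> add a small multiple of
  \<open>n\<^sup>2\<close>. For the others \<open>majcount\<close> is cut at a height
  \<open>Y\<close>: below it the cost is \<open>Y * n\<close>, above it the fourth moment gives
  \<open>n\<^sup>2\<close> over \<open>Y ^ 3\<close>. The outcome \<open>n\<^sup>2 / 256 ^ j \<le> Y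
  * n + (3/4) * n\<^sup>2 / 256 ^ j\<close> bounds \<open>n\<close>.\<close>

lemma large_spectrum_card:
  fixes a :: "'a poly \<Rightarrow> real"
  assumes a: "\<And>m. m \<in> VV \<Longrightarrow> 0 \<le> a m" "\<And>m. m \<in> VV \<Longrightarrow> a m \<le> nu (r + W * m)"
    and R: "R \<subseteq> V.chars" "\<And>\<psi>. \<psi> \<in> R \<Longrightarrow> norm (V.hat (\<lambda>m. of_real (a m)) \<psi>) \<ge> 1 / 16 ^ j"
    and y: "y \<ge> 1" "4 * moment_bound (8 * j + 2) \<le> y ^ 3 * 2 ^ j"
    and s: "4 * (8 * j + 2) \<le> 50 * s" and e: "4 * sieve_err (real CARD('a)) s \<le> 1 / 256 ^ j"
  shows "real (card R) \<le> 4 * y * 2048 ^ j"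
proof (cases "R = {}")
  case False
  have finR: "finite R" using R(1) V.finite_chars finite_subset by blast
  define n where "n = real (card R)"
  have n0: "n > 0" unfolding n_def using False finR by (simp add: card_gt_0_iff)
  let ?h = "V.hat (\<lambda>m. complex_of_real (a m))"
  \<comment> \<open>Chosen so that \<open>(1/2) ^ k0 = 1 / (4 * 256 ^ j)\<close>, a quarter of what
    has to be beaten.\<close>
  define k0 where "k0 = 8 * j + 2"
  define c where "c \<psi> = cnj (?h \<psi>) / of_real (norm (?h \<psi>))" for \<psi>
  have hpos: "norm (?h \<psi>) > 0" if "\<psi> \<in> R" for \<psi>
    using R(2)[OF that] by (rule less_le_trans[rotated]) simp
  have c: "norm (c \<psi>) = 1" "c \<psi> * ?h \<psi> = of_real (norm (?h \<psi>))" if "\<psi> \<in> R" for \<psi>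
  proof -
    show "norm (c \<psi>) = 1" unfolding c_def using hpos[OF that] by (simp add: norm_divide)
    have "cnj (?h \<psi>) * ?h \<psi> = of_real (norm (?h \<psi>)) * of_real (norm (?h \<psi>))"
      using complex_norm_square[of "?h \<psi>"] by (simp add: power2_eq_square mult.commute)
    thus "c \<psi> * ?h \<psi> = of_real (norm (?h \<psi>))" unfolding c_def using hpos[OF that] by (simp add: field_simps)
  qed
  define F where "F m = (\<Sum>\<psi>\<in>R. c \<psi> * cnj (\<psi> m))" for m
  have F_le: "norm (F m) \<le> n" if m: "m \<in> VV" for m
  proof -
    have "norm (F m) \<le> (\<Sum>\<psi>\<in>R. 1)" unfolding F_def
      using c(1) V.char_norm[of _ m] R(1) m by (intro sum_norm_le) (auto simp: norm_mult subset_iff)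
    thus ?thesis by (simp add: n_def)
  qed
  have F_sq: "of_real ((norm (F m))\<^sup>2) = (\<Sum>\<psi>\<in>R. \<Sum>\<phi>\<in>R. (c \<psi> * cnj (c \<phi>)) * (cnj (\<psi> m) * \<phi> m))" for m
    unfolding complex_norm_square F_def cnj_sum sum_product by (intro sum.cong refl) simp
  have F_int: "(\<Sum>m\<in>VV. G m * of_real ((norm (F m))\<^sup>2)) = (\<Sum>\<psi>\<in>R. \<Sum>\<phi>\<in>R. (c \<psi> * cnj (c \<phi>)) * (\<Sum>m\<in>VV. G m * (cnj (\<psi> m) * \<phi> m)))" for G
  proof -
    have "(\<Sum>m\<in>VV. G m * of_real ((norm (F m))\<^sup>2)) = (\<Sum>m\<in>VV. \<Sum>\<psi>\<in>R. \<Sum>\<phi>\<in>R. G m * ((c \<psi> * cnj (c \<phi>)) * (cnj (\<psi> m) * \<phi> m)))"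
      by (simp only: F_sq sum_distrib_left)
    also have "\<dots> = (\<Sum>\<psi>\<in>R. \<Sum>m\<in>VV. \<Sum>\<phi>\<in>R. G m * ((c \<psi> * cnj (c \<phi>)) * (cnj (\<psi> m) * \<phi> m)))" by (rule sum.swap)
    also have "\<dots> = (\<Sum>\<psi>\<in>R. \<Sum>\<phi>\<in>R. \<Sum>m\<in>VV. G m * ((c \<psi> * cnj (c \<phi>)) * (cnj (\<psi> m) * \<phi> m)))"
      by (intro sum.cong refl sum.swap)
    also have "\<dots> = (\<Sum>\<psi>\<in>R. \<Sum>\<phi>\<in>R. (c \<psi> * cnj (c \<phi>)) * (\<Sum>m\<in>VV. G m * (cnj (\<psi> m) * \<phi> m)))"
      by (simp add: sum_distrib_left mult_ac)
    finally show ?thesis .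
  qed
  have F2: "(\<Sum>m\<in>VV. (norm (F m))\<^sup>2) = (real CARD('a) ^ (50 * s)) * n"
  proof -
    have "complex_of_real (\<Sum>m\<in>VV. (norm (F m))\<^sup>2) = (\<Sum>m\<in>VV. 1 * of_real ((norm (F m))\<^sup>2))" by simp
    also have "\<dots> = (\<Sum>\<psi>\<in>R. \<Sum>\<phi>\<in>R. (c \<psi> * cnj (c \<phi>)) * (\<Sum>m\<in>VV. 1 * (cnj (\<psi> m) * \<phi> m)))" by (rule F_int)
    also have "\<dots> = (\<Sum>\<psi>\<in>R. \<Sum>\<phi>\<in>R. if \<phi> = \<psi> then of_nat (card VV) else 0)"
    proof (intro sum.cong refl)
      fix \<psi> \<phi> assume *: "\<psi> \<in> R" "\<phi> \<in> R"
      have "(\<Sum>m\<in>VV. 1 * (cnj (\<psi> m) * \<phi> m)) = (if \<phi> = \<psi> then of_nat (card VV) else 0)"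
        using V.sum_G_cnj[of \<phi> \<psi>] * R(1) by (simp add: mult.commute subset_iff)
      moreover have "c \<psi> * cnj (c \<psi>) = 1" using c(1)[OF *(1)] complex_norm_square[of "c \<psi>"] by simp
      ultimately show "(c \<psi> * cnj (c \<phi>)) * (\<Sum>m\<in>VV. 1 * (cnj (\<psi> m) * \<phi> m)) = (if \<phi> = \<psi> then of_nat (card VV) else 0)" by auto
    qed
    also have "\<dots> = complex_of_real ((real CARD('a) ^ (50 * s)) * n)" using finR by (simp add: n_def card_polys_below)
    finally show ?thesis by (simp only: of_real_eq_iff)
  qed
  have step1: "(real CARD('a) ^ (50 * s)) * (n / 16 ^ j) \<le> (\<Sum>m\<in>VV. a m * norm (F m))"
  proof -
    have "(\<Sum>\<psi>\<in>R. norm (?h \<psi>)) \<ge> (\<Sum>\<psi>\<in>R. 1 / 16 ^ j)" by (intro sum_mono R(2))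
    hence "n / 16 ^ j \<le> (\<Sum>\<psi>\<in>R. norm (?h \<psi>))" by (simp add: n_def)
    hence "(real CARD('a) ^ (50 * s)) * (n / 16 ^ j) \<le> (real CARD('a) ^ (50 * s)) * (\<Sum>\<psi>\<in>R. norm (?h \<psi>))" by (intro mult_left_mono) auto
    also have "\<dots> = norm (complex_of_real ((real CARD('a) ^ (50 * s)) * (\<Sum>\<psi>\<in>R. norm (?h \<psi>))))"
      unfolding norm_of_real by (intro abs_of_nonneg[symmetric] mult_nonneg_nonneg sum_nonneg) auto
    also have "complex_of_real ((real CARD('a) ^ (50 * s)) * (\<Sum>\<psi>\<in>R. norm (?h \<psi>))) = of_real (real CARD('a) ^ (50 * s)) * (\<Sum>\<psi>\<in>R. c \<psi> * ?h \<psi>)"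
      using c(2) by simp
    also have "\<dots> = (\<Sum>\<psi>\<in>R. c \<psi> * (of_real (real CARD('a) ^ (50 * s)) * ?h \<psi>))"
      unfolding sum_distrib_left by (intro sum.cong refl) (simp only: mult.left_commute)
    also have "\<dots> = (\<Sum>\<psi>\<in>R. c \<psi> * (\<Sum>m\<in>VV. of_real (a m) * cnj (\<psi> m)))"
      by (simp add: V.hat_def card_polys_below)
    also have "\<dots> = (\<Sum>m\<in>VV. of_real (a m) * F m)"
      unfolding F_def sum_distrib_left by (subst sum.swap) (simp add: mult_ac)
    also have "norm \<dots> \<le> (\<Sum>m\<in>VV. a m * norm (F m))"
      using a(1) by (intro sum_norm_le) (auto simp: norm_mult)
    finally show ?thesis .
  qed
  have step2: "(\<Sum>m\<in>VV. a m * norm (F m))\<^sup>2 \<le> (real CARD('a) ^ (50 * s)) * (\<Sum>m\<in>VV. nu (r + W * m) * (norm (F m))\<^sup>2)"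
  proof -
    have "(\<Sum>m\<in>VV. a m * norm (F m))\<^sup>2 = (\<Sum>m\<in>VV. sqrt (a m) * (sqrt (a m) * norm (F m)))\<^sup>2"
      using a(1) by (intro arg_cong[where f = "\<lambda>x. x\<^sup>2"] sum.cong refl) (simp flip: mult.assoc)
    also have "\<dots> \<le> (\<Sum>m\<in>VV. (sqrt (a m))\<^sup>2) * (\<Sum>m\<in>VV. (sqrt (a m) * norm (F m))\<^sup>2)"
      by (rule Cauchy_Schwarz_ineq_sum)
    also have "\<dots> = (\<Sum>m\<in>VV. a m) * (\<Sum>m\<in>VV. a m * (norm (F m))\<^sup>2)"
      using a(1) by (simp add: power_mult_distrib)
    also have "\<dots> \<le> (\<Sum>m\<in>VV. nu (r + W * m)) * (\<Sum>m\<in>VV. nu (r + W * m) * (norm (F m))\<^sup>2)"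
      using a nu_nonneg by (intro mult_mono sum_mono mult_right_mono sum_nonneg) auto
    finally show ?thesis unfolding sum_nu .
  qed
  let ?B = "psets PP (2 * (24 * s))"
  let ?G = "\<lambda>m. complex_of_real ((norm (F m))\<^sup>2)"
  let ?t = "\<lambda>Q. 3 ^ card Q * norm (\<Sum>m\<in>VV. of_real (bs Q (r + W * m)) * ?G m)"
  have step3: "(\<Sum>m\<in>VV. nu (r + W * m) * (norm (F m))\<^sup>2) \<le> (\<Sum>Q\<in>?B. ?t Q)"
  proof -
    have "norm ((\<Sum>m\<in>VV. of_real (nu (r + W * m)) * ?G m) - (\<Sum>m\<in>VV. ?G m)) \<le> (\<Sum>Q\<in>?B - {{}}. ?t Q)"
      by (rule nu_expand)
    also have "(\<Sum>m\<in>VV. of_real (nu (r + W * m)) * ?G m) - (\<Sum>m\<in>VV. ?G m)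
        = of_real ((\<Sum>m\<in>VV. nu (r + W * m) * (norm (F m))\<^sup>2) - (\<Sum>m\<in>VV. (norm (F m))\<^sup>2))" by simp
    finally have "(\<Sum>m\<in>VV. nu (r + W * m) * (norm (F m))\<^sup>2) - (\<Sum>m\<in>VV. (norm (F m))\<^sup>2) \<le> (\<Sum>Q\<in>?B - {{}}. ?t Q)"
      unfolding norm_of_real by (rule order_trans[OF abs_ge_self])
    moreover have "(\<Sum>Q\<in>?B. ?t Q) = ?t {} + (\<Sum>Q\<in>?B - {{}}. ?t Q)"
      by (rule sum.remove) auto
    moreover have "?t {} = (\<Sum>m\<in>VV. (norm (F m))\<^sup>2)"
    proof -
      have "?t {} = norm (complex_of_real (\<Sum>m\<in>VV. (norm (F m))\<^sup>2))" by (simp add: bs_def)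
      thus ?thesis unfolding norm_of_real by (simp add: sum_nonneg)
    qed
    ultimately show ?thesis by linarith
  qed
  have split: "(\<Sum>Q\<in>?B. ?t Q) \<le> (\<Sum>Q\<in>psets PP k0. ?t Q) + (\<Sum>Q\<in>{Q\<in>?B. sdeg Q > k0}. ?t Q)"
  proof -
    have "?B \<subseteq> psets PP k0 \<union> {Q\<in>?B. sdeg Q > k0}" by (auto simp: psets_def)
    hence "(\<Sum>Q\<in>?B. ?t Q) \<le> (\<Sum>Q\<in>psets PP k0 \<union> {Q\<in>?B. sdeg Q > k0}. ?t Q)" by (intro sum_mono2) auto
    also have "\<dots> = (\<Sum>Q\<in>psets PP k0. ?t Q) + (\<Sum>Q\<in>{Q\<in>?B. sdeg Q > k0}. ?t Q)"
    proof (rule sum.union_disjoint)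
      show "psets PP k0 \<inter> {Q\<in>?B. sdeg Q > k0} = {}" by (auto simp: psets_def)
    qed simp_all
    finally show ?thesis .
  qed
  \<comment> \<open>Opening the square of \<open>norm (F m)\<close> yields \<open>n\<^sup>2\<close>
    products of two characters, each again a character, so \<open>tail\<close> applies to every
    one.\<close>
  have step4: "(\<Sum>Q\<in>{Q\<in>?B. sdeg Q > k0}. ?t Q) \<le> n\<^sup>2 * ((real CARD('a) ^ (50 * s)) * ((1/2) ^ k0 + sieve_err (real CARD('a)) s))"
  proof -
    let ?C = "{Q\<in>?B. sdeg Q > k0}"
    have "(\<Sum>Q\<in>?C. ?t Q) \<le> (\<Sum>Q\<in>?C. \<Sum>\<psi>\<in>R. \<Sum>\<phi>\<in>R. 3 ^ card Q * norm (\<Sum>m\<in>VV. of_real (bs Q (r + W * m)) * (cnj (\<psi> m) * \<phi> m)))"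
    proof (intro sum_mono)
      fix Q
      have "norm (\<Sum>m\<in>VV. of_real (bs Q (r + W * m)) * ?G m)
         \<le> (\<Sum>\<psi>\<in>R. \<Sum>\<phi>\<in>R. norm (\<Sum>m\<in>VV. of_real (bs Q (r + W * m)) * (cnj (\<psi> m) * \<phi> m)))"
        unfolding F_int using c(1) by (intro sum_norm_le) (simp add: norm_mult)
      from mult_left_mono[OF this, of "3 ^ card Q"]
      show "?t Q \<le> (\<Sum>\<psi>\<in>R. \<Sum>\<phi>\<in>R. 3 ^ card Q * norm (\<Sum>m\<in>VV. of_real (bs Q (r + W * m)) * (cnj (\<psi> m) * \<phi> m)))"
        by (simp add: sum_distrib_left)
    qed
    also have "\<dots> = (\<Sum>\<psi>\<in>R. \<Sum>\<phi>\<in>R. \<Sum>Q\<in>?C. 3 ^ card Q * norm (\<Sum>m\<in>VV. of_real (bs Q (r + W * m)) * (cnj (\<psi> m) * \<phi> m)))"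
      by (subst sum.swap) (intro sum.cong refl sum.swap)
    also have "\<dots> \<le> (\<Sum>\<psi>\<in>R. \<Sum>\<phi>\<in>R. (real CARD('a) ^ (50 * s)) * ((1/2) ^ k0 + sieve_err (real CARD('a)) s))"
      using R(1) by (intro sum_mono tail V.char_mult_chars V.char_cnj_chars) auto
    also have "\<dots> = n\<^sup>2 * ((real CARD('a) ^ (50 * s)) * ((1/2) ^ k0 + sieve_err (real CARD('a)) s))" by (simp add: n_def power2_eq_square)
    finally show ?thesis .
  qed
  \<comment> \<open>\<open>Y ^ 3\<close> has to exceed \<open>256 ^ j\<close> times four moments,
    which are at most \<open>y ^ 3 * 2 ^ j\<close>; as \<open>8 ^ 3 = 256 * 2\<close>, the factor
    \<open>8 ^ j\<close> is exactly enough. The final count has base \<open>256 * 8 = 2048\<close>,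
    below \<open>16 ^ 3\<close>, as \<open>cube_sum_le\<close> requires.\<close>
  define Y where "Y = y * 8 ^ j"
  have Y1: "Y \<ge> 1" unfolding Y_def using mult_mono[of 1 y 1 "8 ^ j"] y(1) by simp
  have step5: "(\<Sum>Q\<in>psets PP k0. ?t Q) \<le> (real CARD('a) ^ (50 * s)) * (Y * n + n\<^sup>2 * (moment_bound k0 / Y ^ 3))"
  proof -
    have "(\<Sum>Q\<in>psets PP k0. ?t Q) \<le> (\<Sum>Q\<in>psets PP k0. \<Sum>m\<in>VV. 3 ^ card Q * \<bar>bs Q (r + W * m)\<bar> * (norm (F m))\<^sup>2)"
    proof (intro sum_mono)
      fix Q
      have "norm (\<Sum>m\<in>VV. of_real (bs Q (r + W * m)) * ?G m) \<le> (\<Sum>m\<in>VV. \<bar>bs Q (r + W * m)\<bar> * (norm (F m))\<^sup>2)"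
        by (intro sum_norm_le) (simp add: norm_mult norm_power)
      from mult_left_mono[OF this, of "3 ^ card Q"]
      show "?t Q \<le> (\<Sum>m\<in>VV. 3 ^ card Q * \<bar>bs Q (r + W * m)\<bar> * (norm (F m))\<^sup>2)"
        by (simp add: sum_distrib_left mult.assoc)
    qed
    also have "\<dots> = (\<Sum>m\<in>VV. majcount k0 (r + W * m) * (norm (F m))\<^sup>2)"
      unfolding majcount_def by (subst sum.swap) (simp add: sum_distrib_right)
    also have "\<dots> \<le> (\<Sum>m\<in>VV. Y * (norm (F m))\<^sup>2 + n\<^sup>2 / Y ^ 3 * majcount k0 (r + W * m) ^ 4)"
    proof (intro sum_mono)
      fix m assume m: "m \<in> VV"
      let ?D = "majcount k0 (r + W * m)"
      have D0: "?D \<ge> 0" by (rule majcount_nonneg)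
      show "?D * (norm (F m))\<^sup>2 \<le> Y * (norm (F m))\<^sup>2 + n\<^sup>2 / Y ^ 3 * ?D ^ 4"
      proof (cases "?D \<le> Y")
        case True
        hence "?D * (norm (F m))\<^sup>2 \<le> Y * (norm (F m))\<^sup>2" by (intro mult_right_mono) auto
        moreover have "n\<^sup>2 / Y ^ 3 * ?D ^ 4 \<ge> 0" using Y1 by simp
        ultimately show ?thesis by linarith
      next
        case False
        hence "Y ^ 3 \<le> ?D ^ 3" using Y1 by (intro power_mono) auto
        hence "?D * Y ^ 3 \<le> ?D * ?D ^ 3" using D0 by (intro mult_left_mono) auto
        hence "?D \<le> ?D ^ 4 / Y ^ 3" using Y1 by (simp add: le_divide_eq power4_eq_xxxx power3_eq_cube mult.assoc)
        moreover have "(norm (F m))\<^sup>2 \<le> n\<^sup>2" using F_le[OF m] by (intro power_mono) auto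
        ultimately have "?D * (norm (F m))\<^sup>2 \<le> ?D ^ 4 / Y ^ 3 * n\<^sup>2" using D0 Y1 by (intro mult_mono) auto
        moreover have "Y * (norm (F m))\<^sup>2 \<ge> 0" using Y1 by simp
        ultimately show ?thesis by (simp add: mult.commute)
      qed
    qed
    also have "\<dots> = Y * ((real CARD('a) ^ (50 * s)) * n) + n\<^sup>2 / Y ^ 3 * (\<Sum>m\<in>VV. majcount k0 (r + W * m) ^ 4)"
      by (simp only: sum.distrib F2 sum_distrib_left[symmetric])
    also have "\<dots> \<le> Y * ((real CARD('a) ^ (50 * s)) * n) + n\<^sup>2 / Y ^ 3 * ((real CARD('a) ^ (50 * s)) * moment_bound k0)"
      unfolding moment_bound_def using s Y1
      by (intro add_left_mono mult_left_mono majcount_moment) (auto simp: k0_def)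
    finally show ?thesis by (simp add: algebra_simps)
  qed
  have step6: "(\<Sum>m\<in>VV. nu (r + W * m) * (norm (F m))\<^sup>2)
      \<le> (real CARD('a) ^ (50 * s)) * (Y * n + n\<^sup>2 * (moment_bound k0 / Y ^ 3)) + n\<^sup>2 * ((real CARD('a) ^ (50 * s)) * ((1/2) ^ k0 + sieve_err (real CARD('a)) s))"
    using step3 split step4 step5 by linarith
  have "((real CARD('a) ^ (50 * s)) * (n / 16 ^ j))\<^sup>2 \<le> (\<Sum>m\<in>VV. a m * norm (F m))\<^sup>2"
    using step1 n0 by (intro power_mono) auto
  also have "\<dots> \<le> (real CARD('a) ^ (50 * s)) * ((real CARD('a) ^ (50 * s)) * (Y * n + n\<^sup>2 * (moment_bound k0 / Y ^ 3)) + n\<^sup>2 * ((real CARD('a) ^ (50 * s)) * ((1/2) ^ k0 + sieve_err (real CARD('a)) s)))"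
    by (rule order_trans[OF step2 mult_left_mono[OF step6]]) simp
  also have "\<dots> = (real CARD('a) ^ (50 * s))\<^sup>2 * (Y * n + n\<^sup>2 * (moment_bound k0 / Y ^ 3 + (1/2) ^ k0 + sieve_err (real CARD('a)) s))"
    by (simp add: power2_eq_square algebra_simps)
  finally have "(real CARD('a) ^ (50 * s))\<^sup>2 * (n / 16 ^ j)\<^sup>2 \<le> (real CARD('a) ^ (50 * s))\<^sup>2 * (Y * n + n\<^sup>2 * (moment_bound k0 / Y ^ 3 + (1/2) ^ k0 + sieve_err (real CARD('a)) s))"
    by (simp only: power_mult_distrib)
  hence total: "(n / 16 ^ j)\<^sup>2 \<le> Y * n + n\<^sup>2 * (moment_bound k0 / Y ^ 3 + (1/2) ^ k0 + sieve_err (real CARD('a)) s)"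
    by (rule mult_left_le_imp_le) simp
  have A: "moment_bound k0 / Y ^ 3 \<le> 1 / (4 * 256 ^ j)"
  proof -
    have "((8::real) ^ j) ^ 3 = (8 ^ 3) ^ j" by (simp only: power_mult[symmetric] mult.commute)
    hence "Y ^ 3 = y ^ 3 * 512 ^ j" unfolding Y_def by (simp add: power_mult_distrib)
    moreover have "(512::real) ^ j = 256 ^ j * 2 ^ j" by (simp flip: power_mult_distrib)
    ultimately have Y3: "Y ^ 3 = 256 ^ j * (y ^ 3 * 2 ^ j)" by simp
    have "256 ^ j * (4 * moment_bound k0) \<le> Y ^ 3"
      unfolding Y3 k0_def by (intro mult_left_mono y(2)) simp
    moreover have "Y ^ 3 > 0" using Y1 by simp
    ultimately show ?thesis by (simp add: pos_divide_le_eq pos_le_divide_eq mult_ac)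
  qed
  have B: "(1/2) ^ k0 \<le> 1 / (4 * 256 ^ j :: real)"
    unfolding k0_def by (simp add: power_add power_mult power_one_over)
  have C: "sieve_err (real CARD('a)) s \<le> 1 / (4 * 256 ^ j)" using e by (simp add: field_simps)
  have "3 / (4 * 256 ^ j) = 1 / (4 * 256 ^ j) + 1 / (4 * 256 ^ j) + 1 / (4 * 256 ^ j :: real)" by simp
  hence "moment_bound k0 / Y ^ 3 + (1/2) ^ k0 + sieve_err (real CARD('a)) s \<le> 3 / (4 * 256 ^ j)"
    using A B C by linarith
  hence "n\<^sup>2 * (moment_bound k0 / Y ^ 3 + (1/2) ^ k0 + sieve_err (real CARD('a)) s) \<le> n\<^sup>2 * (3 / (4 * 256 ^ j))"
    by (rule mult_left_mono) simp
  hence "(n / 16 ^ j)\<^sup>2 \<le> Y * n + n\<^sup>2 * (3 / (4 * 256 ^ j))" using total by linarith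
  moreover have "(n / 16 ^ j)\<^sup>2 = n\<^sup>2 * (1 / 256 ^ j)"
  proof -
    have "((16::real) ^ j)\<^sup>2 = (16\<^sup>2) ^ j" by (simp only: power_mult[symmetric] mult.commute)
    thus ?thesis by (simp add: power_divide)
  qed
  moreover have "n\<^sup>2 * (1 / 256 ^ j) - n\<^sup>2 * (3 / (4 * 256 ^ j)) = n\<^sup>2 * (1 / (4 * 256 ^ j))" by (simp add: field_simps)
  ultimately have "n\<^sup>2 * (1 / (4 * 256 ^ j)) \<le> Y * n" by linarith
  hence "n * (n * (1 / (4 * 256 ^ j))) \<le> n * Y" by (simp add: power2_eq_square mult_ac)
  hence "n * (1 / (4 * 256 ^ j)) \<le> Y" by (rule mult_left_le_imp_le[OF _ n0])
  hence "n \<le> 4 * (256 ^ j * Y)" by (simp add: field_simps)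
  also have "256 ^ j * Y = y * 2048 ^ j" unfolding Y_def by (simp add: mult_ac flip: power_mult_distrib)
  finally show ?thesis by (simp add: n_def)
qed (use y in simp)

end

section \<open>Transference\<close>

text \<open>Translation by 1 permutes the field, so the sum of all elements equals itself plus
  \<open>CARD('a)\<close> ones.\<close>

lemma of_nat_card_field: "of_nat CARD('a::{field,finite}) = (0::'a)"
proof -
  have "(\<Sum>x\<in>(UNIV::'a set). x) = (\<Sum>x\<in>UNIV. x + 1)"
    by (rule sum.reindex_bij_witness[of _ "\<lambda>x. x + 1" "\<lambda>x. x - 1"]) auto
  also have "\<dots> = (\<Sum>x\<in>(UNIV::'a set). x) + of_nat CARD('a)" by (simp add: sum.distrib)
  finally show ?thesis by simp
qed

lemma sum_Un_le:
  fixes f :: "'b \<Rightarrow> real"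
  assumes "finite A" "finite B" "\<And>x. f x \<ge> 0"
  shows "sum f (A \<union> B) \<le> sum f A + sum f B"
  using sum.union_inter[OF assms(1,2), of f] sum_nonneg[of "A \<inter> B" f] assms(3) by simp

context finite_abelian
begin

text \<open>A shift by \<open>h\<close> multiplies a coefficient by \<open>\<psi> h\<close>, and the
  mean of \<open>\<psi>\<close> over \<open>H\<close> is 1 or 0.\<close>

lemma hat_smooth:
  assumes H: "subgrp H" and \<psi>: "\<psi> \<in> chars"
  shows "hat (\<lambda>x. (\<Sum>h\<in>H. a (x \<odot> h)) / of_nat (card H)) \<psi> = (if \<forall>h\<in>H. \<psi> h = 1 then hat a \<psi> else 0)"
proof -
  interpret H: finite_abelian H "(\<odot>)" e by (rule finite_abelian_subgrp[OF H])
  have HG: "h \<in> H \<Longrightarrow> h \<in> G" for h using subgrpD(1)[OF H] by auto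
  have cH: "of_nat (card H) \<noteq> (0::complex)" using H.card_G_pos by simp
  have shift: "(\<Sum>x\<in>G. a (x \<odot> h) * cnj (\<psi> x)) = \<psi> h * (\<Sum>x\<in>G. a x * cnj (\<psi> x))" if h: "h \<in> H" for h
  proof -
    have "\<psi> h * (\<Sum>x\<in>G. a x * cnj (\<psi> x)) = \<psi> h * (\<Sum>x\<in>G. a (h \<odot> x) * cnj (\<psi> (h \<odot> x)))"
      using sum_shift[OF HG[OF h], of "\<lambda>x. a x * cnj (\<psi> x)"] by simp
    also have "\<dots> = (\<Sum>x\<in>G. (\<psi> h * cnj (\<psi> h)) * (a (x \<odot> h) * cnj (\<psi> x)))"
      unfolding sum_distrib_left
      by (intro sum.cong refl) (simp add: charsD(1)[OF \<psi>] HG[OF h] comm[OF HG[OF h]])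
    also have "\<dots> = (\<Sum>x\<in>G. a (x \<odot> h) * cnj (\<psi> x))" using char_cnj_mult[OF \<psi> HG[OF h]] by simp
    finally show ?thesis by simp
  qed
  have "char_on H \<psi>" by (rule chars_char_on[OF \<psi> H])
  hence c: "H.char_on H \<psi>" unfolding char_on_def H.char_on_def .
  have "hat (\<lambda>x. (\<Sum>h\<in>H. a (x \<odot> h)) / of_nat (card H)) \<psi>
      = (\<Sum>x\<in>G. \<Sum>h\<in>H. a (x \<odot> h) * cnj (\<psi> x)) / of_nat (card H) / of_nat (card G)"
    by (simp add: hat_def sum_divide_distrib sum_distrib_right)
  also have "(\<Sum>x\<in>G. \<Sum>h\<in>H. a (x \<odot> h) * cnj (\<psi> x)) = (\<Sum>h\<in>H. \<psi> h * (\<Sum>x\<in>G. a x * cnj (\<psi> x)))"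
    by (subst sum.swap) (intro sum.cong refl shift)
  also have "\<dots> = (\<Sum>h\<in>H. \<psi> h) * (\<Sum>x\<in>G. a x * cnj (\<psi> x))" by (rule sum_distrib_right[symmetric])
  also have "(\<Sum>h\<in>H. \<psi> h) = (if \<forall>h\<in>H. \<psi> h = 1 then of_nat (card H) else 0)" by (rule H.sum_char_on[OF c])
  finally show ?thesis using cH by (simp add: hat_def)
qed

text \<open>Characters in \<open>S\<close> take values among the \<open>q\<close>-th roots of unity,
  so the tuple of values has at most \<open>q ^ card S\<close> forms, and elements with equal tuples
  differ by an element of the annihilator. The index is thus bounded independently of the order of
  \<open>G\<close>.\<close>

lemma card_annihilator:
  assumes S: "S \<subseteq> chars" and q: "q > 0" "\<And>x. x \<in> G \<Longrightarrow> pw x q = e"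
  shows "subgrp {x\<in>G. \<forall>\<psi>\<in>S. \<psi> x = 1}" "card G \<le> q ^ card S * card {x\<in>G. \<forall>\<psi>\<in>S. \<psi> x = 1}"
proof -
  let ?H = "{x\<in>G. \<forall>\<psi>\<in>S. \<psi> x = 1}"
  have Sc: "\<psi> \<in> S \<Longrightarrow> \<psi> \<in> chars" for \<psi> using S by auto
  show sub: "subgrp ?H"
    unfolding subgrp_def
  proof (intro conjI ballI impI)
    show "?H \<subseteq> G" by auto
    show "e \<in> ?H" using charsD(2)[OF Sc] e_G by blast
    show "a \<odot> b \<in> ?H" if "a \<in> ?H" "b \<in> ?H" for a b
    proof -
      have "\<psi> (a \<odot> b) = 1" if \<psi>: "\<psi> \<in> S" for \<psi>
      proof -
        have "\<psi> a = 1" "\<psi> b = 1" using \<open>a \<in> ?H\<close> \<open>b \<in> ?H\<close> \<psi> by blast+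
        moreover have "\<psi> (a \<odot> b) = \<psi> a * \<psi> b" using charsD(1)[OF Sc[OF \<psi>]] \<open>a \<in> ?H\<close> \<open>b \<in> ?H\<close> by blast
        ultimately show ?thesis by simp
      qed
      thus ?thesis using that by simp
    qed
    show "b \<in> ?H" if "a \<in> ?H" "b \<in> G" "a \<odot> b \<in> ?H" for a b
    proof -
      have "\<psi> b = 1" if "\<psi> \<in> S" for \<psi>
      proof -
        have "\<psi> (a \<odot> b) = \<psi> a * \<psi> b" using charsD(1)[OF Sc[OF that]] \<open>a \<in> ?H\<close> \<open>b \<in> G\<close> by simp
        moreover have "\<psi> a = 1" "\<psi> (a \<odot> b) = 1" using \<open>a \<in> ?H\<close> \<open>a \<odot> b \<in> ?H\<close> that by blast+
        ultimately show ?thesis by simp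
      qed
      thus ?thesis using \<open>b \<in> G\<close> by simp
    qed
  qed
  let ?f = "\<lambda>x. restrict (\<lambda>\<psi>. \<psi> x) S"
  have finS: "finite S" using S finite_chars finite_subset by blast
  have finH: "finite ?H" using finite_G by simp
  have img: "?f ` G \<subseteq> (\<Pi>\<^sub>E \<psi>\<in>S. {z. z ^ q = 1})"
  proof (intro image_subsetI PiE_I)
    fix x \<psi> assume x: "x \<in> G" and \<psi>: "\<psi> \<in> S"
    have "\<psi> x ^ q = 1" using char_pw[OF Sc[OF \<psi>] x, of q] q(2)[OF x] charsD(2)[OF Sc[OF \<psi>]] by simp
    thus "?f x \<psi> \<in> {z. z ^ q = 1}" using \<psi> by simp
  qed auto
  have fin1: "finite {z::complex. z ^ q = 1}" using q by (intro finite_nth_roots) auto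
  have "card (?f ` G) \<le> card (\<Pi>\<^sub>E \<psi>\<in>S. {z::complex. z ^ q = 1})"
    using fin1 finS by (intro card_mono img finite_PiE) auto
  also have "\<dots> = q ^ card S" using finS q by (simp add: card_PiE card_roots_unity_eq)
  finally have ci: "card (?f ` G) \<le> q ^ card S" .
  have fib: "card {x\<in>G. ?f x = c} \<le> card ?H" if c: "c \<in> ?f ` G" for c
  proof -
    obtain x0 where x0: "x0 \<in> G" "c = ?f x0" using c by auto
    obtain x1 where x1: "x1 \<in> G" "x0 \<odot> x1 = e" using inverse[OF x0(1)] by blast
    show ?thesis
    proof (rule card_inj_on_le[OF _ _ finH])
      show "inj_on ((\<odot>) x1) {x\<in>G. ?f x = c}" using cancel[OF x1(1)] by (auto simp: inj_on_def)
      show "(\<odot>) x1 ` {x\<in>G. ?f x = c} \<subseteq> ?H"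
      proof (intro image_subsetI)
        fix x assume "x \<in> {x\<in>G. ?f x = c}"
        hence x: "x \<in> G" "?f x = ?f x0" using x0 by auto
        have "\<psi> (x1 \<odot> x) = 1" if \<psi>: "\<psi> \<in> S" for \<psi>
        proof -
          have "\<psi> x = \<psi> x0" using fun_cong[OF x(2), of \<psi>] \<psi> by simp
          hence "\<psi> (x1 \<odot> x) = \<psi> x1 * \<psi> x0" using charsD(1)[OF Sc[OF \<psi>] x1(1) x(1)] by simp
          also have "\<dots> = \<psi> (x0 \<odot> x1)" using charsD(1)[OF Sc[OF \<psi>] x0(1) x1(1)] by (simp only: mult.commute)
          also have "\<dots> = 1" unfolding x1(2) by (rule charsD(2)[OF Sc[OF \<psi>]])
          finally show ?thesis .
        qed
        thus "x1 \<odot> x \<in> ?H" using x1 x by simp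
      qed
    qed
  qed
  have "card G = (\<Sum>c\<in>?f ` G. card {x\<in>G. ?f x = c})"
    using sum.image_gen[OF finite_G, of "\<lambda>_. 1::nat" ?f] by simp
  also have "\<dots> \<le> (\<Sum>c\<in>?f ` G. card ?H)" by (intro sum_mono fib)
  also have "\<dots> = card (?f ` G) * card ?H" by simp
  also have "\<dots> \<le> q ^ card S * card ?H" using ci by (rule mult_le_mono1)
  finally show "card G \<le> q ^ card S * card ?H" .
qed

text \<open>Coefficients are sorted into bands between consecutive powers of 1/16. A band holds at
  most \<open>4 * y * 2048 ^ Suc J\<close> of them with cubes at most
  \<open>1 / 16 ^ (3 * J)\<close>, and \<open>2048 / 4096 = 1/2\<close> makes the bands summable.
  Below the last band one factor is at most \<open>1 / 16 ^ J\<close> and Parseval handles the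
  square.\<close>

lemma cube_sum_le:
  assumes cnt: "\<And>j. j \<le> J \<Longrightarrow> real (card {\<psi>\<in>chars. norm (hat a \<psi>) \<ge> 1 / 16 ^ j}) \<le> 4 * y * 2048 ^ j"
    and y: "y \<ge> 0" and j0: "j0 \<le> J" and l2: "(\<Sum>x\<in>G. (norm (a x))\<^sup>2) / card G \<le> B"
  shows "(\<Sum>\<psi>\<in>{\<psi>\<in>chars. norm (hat a \<psi>) < 1 / 16 ^ j0}. norm (hat a \<psi>) ^ 3) \<le> 16384 * y * (1/2) ^ j0 + B / 16 ^ J"
proof -
  let ?n = "\<lambda>\<psi>. norm (hat a \<psi>)"
  let ?M = "\<lambda>J. {\<psi>\<in>chars. 1 / 16 ^ J \<le> ?n \<psi> \<and> ?n \<psi> < 1 / 16 ^ j0}"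
  have "(\<Sum>\<psi>\<in>?M J. ?n \<psi> ^ 3) \<le> 16384 * y * ((1/2) ^ j0 - (1/2) ^ J)"
    using j0 cnt
  proof (induction J rule: dec_induct)
    case base
    have "?M j0 = {}" by auto
    thus ?case by (simp only: sum.empty) simp
  next
    case (step J)
    let ?A = "{\<psi>\<in>chars. 1 / 16 ^ Suc J \<le> ?n \<psi> \<and> ?n \<psi> < 1 / 16 ^ J}"
    have "(\<Sum>\<psi>\<in>?A. ?n \<psi> ^ 3) \<le> (\<Sum>\<psi>\<in>?A. (1 / 16 ^ J) ^ 3)"
      by (intro sum_mono power_mono) auto
    also have "\<dots> = card ?A * (1 / 16 ^ J) ^ 3" by simp
    also have "\<dots> \<le> (4 * y * 2048 ^ Suc J) * (1 / 16 ^ J) ^ 3"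
    proof (intro mult_right_mono)
      have "card ?A \<le> card {\<psi>\<in>chars. ?n \<psi> \<ge> 1 / 16 ^ Suc J}" using finite_chars by (intro card_mono) auto
      thus "real (card ?A) \<le> 4 * y * 2048 ^ Suc J" using step.prems[of "Suc J"] by linarith
    qed simp
    also have "\<dots> = 8192 * y * (1/2) ^ J"
    proof -
      have "((1/16 :: real) ^ J) ^ 3 = ((1/16) ^ 3) ^ J" by (simp only: power_mult[symmetric] mult.commute)
      hence "(1 / 16 ^ J :: real) ^ 3 = ((1/16) ^ 3) ^ J" unfolding power_one_over .
      moreover have "2048 * (1/16) ^ 3 = (1/2 :: real)" by (simp add: power3_eq_cube)
      hence "(2048::real) ^ J * ((1/16) ^ 3) ^ J = (1/2) ^ J" by (simp only: power_mult_distrib[symmetric])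
      moreover have "4 * y * 2048 ^ Suc J * c = 8192 * y * (2048 ^ J * c)" for c by simp
      ultimately show ?thesis by (simp only:)
    qed
    finally have new: "(\<Sum>\<psi>\<in>?A. ?n \<psi> ^ 3) \<le> 8192 * y * (1/2) ^ J" .
    have "?M (Suc J) \<subseteq> ?M J \<union> ?A" by auto
    hence "(\<Sum>\<psi>\<in>?M (Suc J). ?n \<psi> ^ 3) \<le> (\<Sum>\<psi>\<in>?M J \<union> ?A. ?n \<psi> ^ 3)"
      using finite_chars by (intro sum_mono2) auto
    also have "\<dots> \<le> (\<Sum>\<psi>\<in>?M J. ?n \<psi> ^ 3) + (\<Sum>\<psi>\<in>?A. ?n \<psi> ^ 3)"
      using finite_chars by (intro sum_Un_le) auto
    also have "\<dots> \<le> 16384 * y * ((1/2) ^ j0 - (1/2) ^ J) + 8192 * y * (1/2) ^ J"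
      using new step.IH step.prems by (intro add_mono) auto
    also have "\<dots> = 16384 * y * ((1/2) ^ j0 - (1/2) ^ Suc J)" by (simp add: algebra_simps)
    finally show ?case .
  qed
  also have "\<dots> \<le> 16384 * y * (1/2) ^ j0" using y by (intro mult_left_mono) auto
  finally have large: "(\<Sum>\<psi>\<in>?M J. ?n \<psi> ^ 3) \<le> 16384 * y * (1/2) ^ j0" .
  let ?T = "{\<psi>\<in>chars. ?n \<psi> < 1 / 16 ^ J}"
  have "(\<Sum>\<psi>\<in>?T. ?n \<psi> ^ 3) \<le> (\<Sum>\<psi>\<in>?T. 1 / 16 ^ J * (?n \<psi>)\<^sup>2)"
  proof (intro sum_mono)
    fix \<psi> assume "\<psi> \<in> ?T"
    hence "?n \<psi> * (?n \<psi>)\<^sup>2 \<le> 1 / 16 ^ J * (?n \<psi>)\<^sup>2" by (intro mult_right_mono) auto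
    thus "?n \<psi> ^ 3 \<le> 1 / 16 ^ J * (?n \<psi>)\<^sup>2" by (simp add: power3_eq_cube power2_eq_square mult.assoc)
  qed
  also have "\<dots> \<le> (\<Sum>\<psi>\<in>chars. 1 / 16 ^ J * (?n \<psi>)\<^sup>2)" using finite_chars by (intro sum_mono2) auto
  also have "\<dots> = 1 / 16 ^ J * ((\<Sum>x\<in>G. (norm (a x))\<^sup>2) / card G)" unfolding parseval[symmetric] by (rule sum_distrib_left[symmetric])
  also have "\<dots> \<le> 1 / 16 ^ J * B" by (intro mult_left_mono l2) simp
  finally have small: "(\<Sum>\<psi>\<in>?T. ?n \<psi> ^ 3) \<le> B / 16 ^ J" by simp
  have "(\<Sum>\<psi>\<in>{\<psi>\<in>chars. ?n \<psi> < 1 / 16 ^ j0}. ?n \<psi> ^ 3) \<le> (\<Sum>\<psi>\<in>?M J \<union> ?T. ?n \<psi> ^ 3)"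
    using finite_chars by (intro sum_mono2) auto
  also have "\<dots> \<le> (\<Sum>\<psi>\<in>?M J. ?n \<psi> ^ 3) + (\<Sum>\<psi>\<in>?T. ?n \<psi> ^ 3)"
    using finite_chars by (intro sum_Un_le) auto
  finally show ?thesis using large small by linarith
qed

end

context transference
begin

lemma pw_VV: "V.pw x k = of_nat k * x"
  by (induction k) (simp_all add: V.pw_Suc distrib_right)

text \<open>The functions \<open>a i\<close> are only bounded by \<open>B\<close>, which grows with
  \<open>s\<close>, so the count for dense sets is applied to their averages \<open>g i\<close> over
  the annihilator \<open>H\<close> of all large coefficients: these have the same mean and are at
  most 1.02. The two counts of triples differ only at characters outside the large spectrum, where
  the cube sums are at most \<open>1 / 10 ^ 15\<close>.\<close>

lemma zero_sum_triple:
  fixes a :: "nat \<Rightarrow> 'a poly \<Rightarrow> real" and r :: "nat \<Rightarrow> 'a poly"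
  assumes a: "\<And>i m. i < 3 \<Longrightarrow> m \<in> VV \<Longrightarrow> 0 \<le> a i m" "\<And>i m. i < 3 \<Longrightarrow> m \<in> VV \<Longrightarrow> a i m \<le> nu (r i + W * m)"
      "\<And>i m. i < 3 \<Longrightarrow> m \<in> VV \<Longrightarrow> a i m \<le> B"
    and avg: "\<And>i. i < 3 \<Longrightarrow> (\<Sum>m\<in>VV. a i m) \<ge> 47 / 100 * real CARD('a) ^ (50 * s)"
    and half: "of_nat k * 2 = (1 :: 'a poly)"
    and y: "y \<ge> 1" "\<And>j. 4 * moment_bound (8 * j + 2) \<le> y ^ 3 * 2 ^ j"
    and J: "4 * (8 * J + 2) \<le> 50 * s" "4 * sieve_err (real CARD('a)) s \<le> 1 / 256 ^ J" "j0 \<le> J"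
    and small: "16384 * y * (1/2) ^ j0 + B / 16 ^ J \<le> 1 / 10 ^ 15"
    and w: "\<And>P. P \<in> PP \<Longrightarrow> degree P > w"
    and K: "12 * y * 2048 ^ j0 \<le> real K" "real CARD('a) ^ K * ((1/2) ^ w + sieve_err (real CARD('a)) s) \<le> 1 / 50"
  shows "\<exists>x1\<in>VV. \<exists>x2\<in>VV. \<exists>x3\<in>VV. x1 + x2 + x3 = 0 \<and> a 0 x1 > 0 \<and> a 1 x2 > 0 \<and> a 2 x3 > 0"
proof (rule ccontr)
  assume neg: "\<not> ?thesis"
  define q where "q = real CARD('a)"
  define n where "n = q ^ (50 * s)"
  have cV: "real (card VV) = n" by (simp add: n_def q_def card_polys_below)
  have n0: "n > 0" by (simp add: n_def q_def)
  define h where "h i = V.hat (\<lambda>m. complex_of_real (a i m))" for i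
  define S where "S = (\<Union>i<3. {\<psi>\<in>V.chars. norm (h i \<psi>) \<ge> 1 / 16 ^ j0})"
  have count: "real (card {\<psi>\<in>V.chars. norm (h i \<psi>) \<ge> 1 / 16 ^ j}) \<le> 4 * y * 2048 ^ j" if i: "i < 3" and j: "j \<le> J" for i j
  proof (rule large_spectrum_card[of "a i" "r i"])
    show "0 \<le> a i m" "a i m \<le> nu (r i + W * m)" if "m \<in> VV" for m using a i that by auto
    show "4 * (8 * j + 2) \<le> 50 * s" using j J(1) by simp
    have "(256::real) ^ j \<le> 256 ^ J" using j by (intro power_increasing) auto
    hence "1 / 256 ^ J \<le> 1 / (256::real) ^ j" by (intro divide_left_mono) auto
    thus "4 * sieve_err (real CARD('a)) s \<le> 1 / 256 ^ j" using J(2) by linarith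
  qed (use y in \<open>auto simp: h_def\<close>)
  have SC: "S \<subseteq> V.chars" unfolding S_def by auto
  have finS: "finite S" using SC V.finite_chars finite_subset by blast
  have cS: "card S \<le> K"
  proof -
    have "card S \<le> (\<Sum>i<3. card {\<psi>\<in>V.chars. norm (h i \<psi>) \<ge> 1 / 16 ^ j0})"
      unfolding S_def by (rule card_UN_le) simp
    hence "real (card S) \<le> (\<Sum>i<3. real (card {\<psi>\<in>V.chars. norm (h i \<psi>) \<ge> 1 / 16 ^ j0}))"
      by (simp only: of_nat_sum[symmetric] of_nat_le_iff)
    also have "\<dots> \<le> (\<Sum>i<3::nat. 4 * y * 2048 ^ j0)" by (intro sum_mono count J(3)) auto
    also have "\<dots> = 12 * y * 2048 ^ j0" by simp
    finally show ?thesis using K(1) by linarith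
  qed
  define H where "H = {x\<in>VV. \<forall>\<psi>\<in>S. \<psi> x = 1}"
  have pwq: "V.pw x CARD('a) = 0" for x
    unfolding pw_VV by (metis mult_zero_left of_nat_card_field of_nat_poly pCons_0_0)
  have H: "V.subgrp H" and cH: "card VV \<le> CARD('a) ^ card S * card H"
    unfolding H_def by (rule V.card_annihilator[OF SC _ pwq]; simp)+
  interpret H: finite_abelian H "(+)" 0 by (rule V.finite_abelian_subgrp[OF H])
  have HV: "H \<subseteq> VV" unfolding H_def by auto
  have H0: "real (card H) > 0" using H.card_G_pos by simp
  \<comment> \<open>The characters that survive averaging over \<open>H\<close>. There are at most
    \<open>q ^ K\<close> of them, whatever \<open>s\<close> is.\<close>
  define T where "T = {\<psi>\<in>V.chars. \<forall>x\<in>H. \<psi> x = 1}"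
  have cT: "real (card T) \<le> q ^ K"
  proof -
    have "card T * card H \<le> card VV" unfolding T_def by (rule V.card_extensions_le[OF H, of "\<lambda>_. 1"])
    also have "\<dots> \<le> CARD('a) ^ card S * card H" by (rule cH)
    finally have "card T \<le> CARD('a) ^ card S" using H.card_G_pos by simp
    also have "\<dots> \<le> CARD('a) ^ K" using cS by (intro power_increasing) auto
    finally show ?thesis unfolding q_def by (metis of_nat_le_iff of_nat_power)
  qed
  have ST: "\<psi> \<in> T" if "\<psi> \<in> S" for \<psi> using that SC unfolding T_def H_def by auto
  define g where "g i x = (\<Sum>m\<in>H. a i (x + m)) / card H" for i x
  have xm: "x + m \<in> VV" if "x \<in> VV" "m \<in> H" for x m using that HV by (auto intro: polys_below_add)
  have g0: "g i x \<ge> 0" if "i < 3" "x \<in> VV" for i x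
    unfolding g_def using a(1)[OF that(1)] xm[OF that(2)] by (intro divide_nonneg_nonneg sum_nonneg) auto
  \<comment> \<open>Averaged over \<open>H\<close>, \<open>nu\<close> keeps at most
    \<open>q ^ K\<close> coefficients: 1 at the trivial character and at most
    \<open>(1/2) ^ w + sieve_err q s\<close> elsewhere. This forces \<open>w\<close> to be chosen
    after \<open>K\<close>.\<close>
  have g1: "g i x \<le> 51 / 50" if i: "i < 3" and x: "x \<in> VV" for i x
  proof -
    let ?nu = "\<lambda>m. complex_of_real (nu (r i + W * m))"
    let ?s = "\<lambda>x. (\<Sum>m\<in>H. ?nu (x + m)) / of_nat (card H)"
    let ?one = "\<lambda>x :: 'a poly. if x \<in> VV then 1 else 0 :: complex"
    have "g i x \<le> (\<Sum>m\<in>H. nu (r i + W * (x + m))) / card H"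
      unfolding g_def using a(2)[OF i] xm[OF x] by (intro divide_right_mono sum_mono) auto
    also have "\<dots> = norm (?s x)"
    proof -
      have e: "?s x = of_real ((\<Sum>m\<in>H. nu (r i + W * (x + m))) / card H)" by simp
      show ?thesis unfolding e norm_of_real by (simp add: sum_nonneg nu_nonneg)
    qed
    also have "?s x = (\<Sum>\<psi>\<in>V.chars. V.hat ?s \<psi> * \<psi> x)" by (rule V.inversion[OF x, symmetric])
    also have "\<dots> = (\<Sum>\<psi>\<in>T. V.hat ?nu \<psi> * \<psi> x)"
    proof (rule sum.mono_neutral_cong_right)
      show "\<forall>\<psi>\<in>V.chars - T. V.hat ?s \<psi> * \<psi> x = 0"
      proof
        fix \<psi> assume "\<psi> \<in> V.chars - T"
        hence "\<psi> \<in> V.chars" "\<not> (\<forall>m\<in>H. \<psi> m = 1)" unfolding T_def by blast+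
        thus "V.hat ?s \<psi> * \<psi> x = 0" using V.hat_smooth[OF H \<open>\<psi> \<in> V.chars\<close>, of ?nu] by auto
      qed
      show "V.hat ?s \<psi> * \<psi> x = V.hat ?nu \<psi> * \<psi> x" if "\<psi> \<in> T" for \<psi>
      proof -
        have "\<psi> \<in> V.chars" "\<forall>m\<in>H. \<psi> m = 1" using that unfolding T_def by blast+
        thus ?thesis using V.hat_smooth[OF H \<open>\<psi> \<in> V.chars\<close>, of ?nu] by auto
      qed
    qed (use V.finite_chars in \<open>auto simp: T_def\<close>)
    also have "norm \<dots> \<le> (\<Sum>\<psi>\<in>T. if \<psi> = ?one then 1 else (1/2) ^ w + sieve_err q s)"
    proof (rule sum_norm_le)
      fix \<psi> assume "\<psi> \<in> T"
      hence \<psi>: "\<psi> \<in> V.chars" unfolding T_def by blast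
      have "norm (V.hat ?nu \<psi> * \<psi> x) = norm (V.hat ?nu \<psi>)" using V.char_norm[OF \<psi> x] by (simp add: norm_mult)
      also have "\<dots> \<le> (if \<psi> = ?one then 1 else (1/2) ^ w + sieve_err q s)"
      proof (cases "\<psi> = ?one")
        case True
        have "V.hat ?nu ?one = of_real (\<Sum>m\<in>VV. nu (r i + W * m)) / of_nat (card VV)" unfolding V.hat_def by simp
        also have "\<dots> = 1" unfolding sum_nu by (simp add: card_polys_below)
        finally show ?thesis using True by simp
      next
        case False
        thus ?thesis using hat_nu_le[OF \<psi> w False, of "r i"] unfolding q_def by simp
      qed
      finally show "norm (V.hat ?nu \<psi> * \<psi> x) \<le> (if \<psi> = ?one then 1 else (1/2) ^ w + sieve_err q s)" .
    qed
    also have "\<dots> \<le> (\<Sum>\<psi>\<in>T. (if \<psi> = ?one then 1 else 0) + ((1/2) ^ w + sieve_err q s))"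
      by (intro sum_mono) (auto simp: sieve_err_def)
    also have "\<dots> \<le> 1 + real (card T) * ((1/2) ^ w + sieve_err q s)"
    proof -
      have "finite T" using V.finite_chars unfolding T_def by simp
      hence "(\<Sum>\<psi>\<in>T. if \<psi> = ?one then 1 else 0) \<le> (1::real)" by simp
      thus ?thesis unfolding sum.distrib sum_constant distrib_left by linarith
    qed
    also have "\<dots> \<le> 1 + q ^ K * ((1/2) ^ w + sieve_err q s)"
      by (intro add_left_mono mult_right_mono cT) (auto simp: sieve_err_def)
    also have "\<dots> \<le> 1 + 1 / 50" using K(2) unfolding q_def by simp
    finally show ?thesis by simp
  qed
  \<comment> \<open>If \<open>d\<close> is the density of \<open>A i\<close>, then
    \<open>0.47 \<le> 1.02 * d + 0.01\<close>, hence \<open>d > 0.45\<close>.\<close>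
  define A where "A i = {x\<in>VV. g i x \<ge> 1 / 100}" for i
  have dens: "card (A i) \<ge> 45 / 100 * card VV" if i: "i < 3" for i
  proof -
    have "(\<Sum>x\<in>VV. g i x) = (\<Sum>m\<in>H. \<Sum>x\<in>VV. a i (x + m)) / card H"
      unfolding g_def sum_divide_distrib[symmetric] by (subst sum.swap) (rule refl)
    also have "(\<Sum>m\<in>H. \<Sum>x\<in>VV. a i (x + m)) = (\<Sum>m\<in>H. \<Sum>x\<in>VV. a i x)"
      using HV by (intro sum.cong refl sum_polys_below_shift) auto
    finally have "(\<Sum>x\<in>VV. g i x) = (\<Sum>x\<in>VV. a i x)" using H0 by simp
    hence "47 / 100 * n \<le> (\<Sum>x\<in>VV. g i x)" using avg[OF i] unfolding n_def q_def by simp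
    also have "\<dots> \<le> (\<Sum>x\<in>VV. (if x \<in> A i then 51 / 50 else 0) + 1 / 100)"
    proof (intro sum_mono)
      fix x assume x: "x \<in> VV"
      show "g i x \<le> (if x \<in> A i then 51 / 50 else 0) + 1 / 100"
        using g1[OF i x] x by (cases "x \<in> A i") (auto simp: A_def)
    qed
    also have "\<dots> = 51 / 50 * card (A i) + n / 100"
    proof -
      have "(\<Sum>x\<in>VV. if x \<in> A i then 51 / 50 else 0 :: real) = (\<Sum>x\<in>A i. 51 / 50)"
        by (rule sum.mono_neutral_cong_right) (auto simp: A_def)
      thus ?thesis unfolding sum.distrib using cV by simp
    qed
    finally show ?thesis unfolding cV using n0 by linarith
  qed
  have many: "card {(x1, x2) \<in> A 0 \<times> A 1. - (x1 + x2) \<in> A 2} \<ge> (card VV)\<^sup>2 / 100000000"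
    by (rule many_zero_sum_triples[OF _ _ _ half]) (use dens in \<open>auto simp: A_def polys_below_diff\<close>)
  let ?trip = "\<lambda>f :: nat \<Rightarrow> 'a poly \<Rightarrow> real. \<Sum>x1\<in>VV. \<Sum>x2\<in>VV. \<Sum>x3\<in>VV. if x1 + x2 + x3 = 0 then f 0 x1 * f 1 x2 * f 2 x3 else 0"
  have trip_hat: "of_real (?trip f) = complex_of_real n ^ 2 * (\<Sum>\<psi>\<in>V.chars. V.hat (\<lambda>x. of_real (f 0 x)) \<psi> * V.hat (\<lambda>x. of_real (f 1 x)) \<psi> * V.hat (\<lambda>x. of_real (f 2 x)) \<psi>)" for f
  proof -
    have "of_real (?trip f) = (\<Sum>x1\<in>VV. \<Sum>x2\<in>VV. \<Sum>x3\<in>VV. if x1 + x2 + x3 = 0 then complex_of_real (f 0 x1) * of_real (f 1 x2) * of_real (f 2 x3) else 0)"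
      unfolding of_real_sum by (intro sum.cong refl) simp
    also have "\<dots> = of_nat (card VV) ^ 2 * (\<Sum>\<psi>\<in>V.chars. V.hat (\<lambda>x. of_real (f 0 x)) \<psi> * V.hat (\<lambda>x. of_real (f 1 x)) \<psi> * V.hat (\<lambda>x. of_real (f 2 x)) \<psi>)"
      by (rule V.sum_triples_hat)
    also have "of_nat (card VV) = complex_of_real n" using cV by (metis of_real_of_nat_eq)
    finally show ?thesis .
  qed
  have ta: "?trip a = 0"
  proof (intro sum.neutral ballI)
    fix x1 x2 x3 assume x: "x1 \<in> VV" "x2 \<in> VV" "x3 \<in> VV"
    show "(if x1 + x2 + x3 = 0 then a 0 x1 * a 1 x2 * a 2 x3 else 0) = 0"
    proof (cases "x1 + x2 + x3 = 0")
      case True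
      hence "\<not> (a 0 x1 > 0 \<and> a 1 x2 > 0 \<and> a 2 x3 > 0)" using neg x by blast
      hence "a 0 x1 = 0 \<or> a 1 x2 = 0 \<or> a 2 x3 = 0" using a(1)[of 0 x1] a(1)[of 1 x2] a(1)[of 2 x3] x by linarith
      thus ?thesis by auto
    qed simp
  qed
  \<comment> \<open>\<open>n\<^sup>2 / 10 ^ 8\<close> triples of weight at least
    \<open>(1 / 100) ^ 3\<close>, to be compared with the error
    \<open>3 * n\<^sup>2 / 10 ^ 15\<close>.\<close>
  have tg: "?trip g \<ge> n\<^sup>2 / 10 ^ 14"
  proof -
    let ?P = "{(x1, x2) \<in> A 0 \<times> A 1. - (x1 + x2) \<in> A 2}"
    have finP: "finite ?P" by (rule finite_subset[of _ "VV \<times> VV"]) (auto simp: A_def)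
    have "n\<^sup>2 / 10 ^ 14 = (real (card VV))\<^sup>2 / 100000000 * (1 / 100) ^ 3" unfolding cV by (simp add: power3_eq_cube)
    also have "\<dots> \<le> card ?P * (1 / 100) ^ 3" using many by (intro mult_right_mono) auto
    also have "\<dots> = (\<Sum>(x1, x2)\<in>?P. (1 / 100) ^ 3)" by simp
    also have "\<dots> \<le> (\<Sum>(x1, x2)\<in>?P. g 0 x1 * g 1 x2 * g 2 (- (x1 + x2)))"
    proof (intro sum_mono, clarify)
      fix x1 x2 assume "x1 \<in> A 0" "x2 \<in> A 1" "- (x1 + x2) \<in> A 2"
      hence "1 / 100 \<le> g 0 x1" "1 / 100 \<le> g 1 x2" "1 / 100 \<le> g 2 (- (x1 + x2))" by (auto simp: A_def)
      thus "(1 / 100) ^ 3 \<le> g 0 x1 * g 1 x2 * g 2 (- (x1 + x2))"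
        unfolding power3_eq_cube by (intro mult_mono mult_nonneg_nonneg) auto
    qed
    also have "\<dots> \<le> (\<Sum>(x1, x2)\<in>VV \<times> VV. g 0 x1 * g 1 x2 * g 2 (- (x1 + x2)))"
    proof (rule sum_mono2)
      show "?P \<subseteq> VV \<times> VV" by (auto simp: A_def)
      fix p assume "p \<in> VV \<times> VV - ?P"
      then obtain x1 x2 where p: "p = (x1, x2)" "x1 \<in> VV" "x2 \<in> VV" by auto
      have "- (x1 + x2) \<in> VV" using p by (intro polys_below_uminus polys_below_add)
      thus "0 \<le> (case p of (x1, x2) \<Rightarrow> g 0 x1 * g 1 x2 * g 2 (- (x1 + x2)))"
        using p g0[of 0 x1] g0[of 1 x2] g0[of 2 "- (x1 + x2)"] by simp
    qed simp
    also have "\<dots> = (\<Sum>x1\<in>VV. \<Sum>x2\<in>VV. g 0 x1 * g 1 x2 * g 2 (- (x1 + x2)))"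
      by (rule sum.cartesian_product[symmetric])
    also have "\<dots> = ?trip g"
    proof (intro sum.cong refl)
      fix x1 x2 assume x: "x1 \<in> VV" "x2 \<in> VV"
      have m: "- (x1 + x2) \<in> VV" using x by (intro polys_below_uminus polys_below_add)
      have "(\<Sum>x3\<in>VV. if x1 + x2 + x3 = 0 then g 0 x1 * g 1 x2 * g 2 x3 else 0)
          = (\<Sum>x3\<in>VV. if x3 = - (x1 + x2) then g 0 x1 * g 1 x2 * g 2 x3 else 0)"
        by (intro sum.cong refl if_cong) (simp only: add_eq_0_iff)
      also have "\<dots> = g 0 x1 * g 1 x2 * g 2 (- (x1 + x2))" using m by simp
      finally show "g 0 x1 * g 1 x2 * g 2 (- (x1 + x2)) = (\<Sum>x3\<in>VV. if x1 + x2 + x3 = 0 then g 0 x1 * g 1 x2 * g 2 x3 else 0)" by simp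
    qed
    finally show ?thesis .
  qed
  have hg: "V.hat (\<lambda>x. of_real (g i x)) \<psi> = (if \<psi> \<in> T then h i \<psi> else 0)" if \<psi>: "\<psi> \<in> V.chars" for i \<psi>
  proof -
    have "(\<lambda>x. complex_of_real (g i x)) = (\<lambda>x. (\<Sum>m\<in>H. complex_of_real (a i (x + m))) / of_nat (card H))"
      by (rule ext) (simp add: g_def)
    thus ?thesis using V.hat_smooth[OF H \<psi>, of "\<lambda>x. complex_of_real (a i x)"] \<psi> unfolding h_def T_def by auto
  qed
  \<comment> \<open>The mean square needed for Parseval is at most \<open>B\<close>, because one
    factor is bounded by \<open>B\<close> and the other by \<open>nu\<close>, of mean 1.\<close>
  have cubes: "(\<Sum>\<psi>\<in>{\<psi>\<in>V.chars. norm (h i \<psi>) < 1 / 16 ^ j0}. norm (h i \<psi>) ^ 3) \<le> 1 / 10 ^ 15" if i: "i < 3" for i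
  proof -
    have "(\<Sum>x\<in>VV. (norm (complex_of_real (a i x)))\<^sup>2) / card VV \<le> B"
    proof -
      have "(\<Sum>x\<in>VV. (norm (complex_of_real (a i x)))\<^sup>2) \<le> (\<Sum>x\<in>VV. B * nu (r i + W * x))"
        using a(1-3)[OF i] nu_nonneg by (intro sum_mono) (auto simp: power2_eq_square intro!: mult_mono intro: order_trans)
      also have "\<dots> = B * n" by (simp add: sum_nu n_def q_def flip: sum_distrib_left)
      finally show ?thesis unfolding cV using n0 by (simp add: divide_le_eq)
    qed
    from V.cube_sum_le[OF count[OF i, unfolded h_def] _ J(3) this] y(1) small
    show ?thesis unfolding h_def by linarith
  qed
  have diff: "norm ((\<Sum>\<psi>\<in>V.chars. h 0 \<psi> * h 1 \<psi> * h 2 \<psi>) - (\<Sum>\<psi>\<in>V.chars. V.hat (\<lambda>x. of_real (g 0 x)) \<psi> * V.hat (\<lambda>x. of_real (g 1 x)) \<psi> * V.hat (\<lambda>x. of_real (g 2 x)) \<psi>)) \<le> 3 / 10 ^ 15"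
  proof -
    let ?L = "\<lambda>i. {\<psi>\<in>V.chars. norm (h i \<psi>) < 1 / 16 ^ j0}"
    have "(\<Sum>\<psi>\<in>V.chars. h 0 \<psi> * h 1 \<psi> * h 2 \<psi>) - (\<Sum>\<psi>\<in>V.chars. V.hat (\<lambda>x. of_real (g 0 x)) \<psi> * V.hat (\<lambda>x. of_real (g 1 x)) \<psi> * V.hat (\<lambda>x. of_real (g 2 x)) \<psi>)
      = (\<Sum>\<psi>\<in>V.chars. if \<psi> \<in> T then 0 else h 0 \<psi> * h 1 \<psi> * h 2 \<psi>)"
      unfolding sum_subtractf[symmetric] by (intro sum.cong refl) (auto simp: hg)
    also have "norm \<dots> \<le> (\<Sum>\<psi>\<in>V.chars - S. norm (h 0 \<psi>) ^ 3 + norm (h 1 \<psi>) ^ 3 + norm (h 2 \<psi>) ^ 3)"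
    proof -
      have "norm (\<Sum>\<psi>\<in>V.chars. if \<psi> \<in> T then 0 else h 0 \<psi> * h 1 \<psi> * h 2 \<psi>) \<le> (\<Sum>\<psi>\<in>V.chars. if \<psi> \<in> S then 0 else norm (h 0 \<psi>) ^ 3 + norm (h 1 \<psi>) ^ 3 + norm (h 2 \<psi>) ^ 3)"
      proof (rule sum_norm_le)
        fix \<psi> assume "\<psi> \<in> V.chars"
        have amgm: "x * y * z \<le> x ^ 3 + y ^ 3 + z ^ 3" if "0 \<le> x" "0 \<le> y" "0 \<le> z" for x y z :: real
        proof -
          define m where "m = max x (max y z)"
          have "x * y * z \<le> m * m * m" using that unfolding m_def by (intro mult_mono) auto
          moreover have "m = x \<or> m = y \<or> m = z" unfolding m_def by linarith
          moreover have "x ^ 3 \<ge> 0" "y ^ 3 \<ge> 0" "z ^ 3 \<ge> 0" using that by auto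
          ultimately show ?thesis by (auto simp: power3_eq_cube)
        qed
        show "norm (if \<psi> \<in> T then 0 else h 0 \<psi> * h 1 \<psi> * h 2 \<psi>) \<le> (if \<psi> \<in> S then 0 else norm (h 0 \<psi>) ^ 3 + norm (h 1 \<psi>) ^ 3 + norm (h 2 \<psi>) ^ 3)"
          using ST[of \<psi>] amgm[of "norm (h 0 \<psi>)" "norm (h 1 \<psi>)" "norm (h 2 \<psi>)"] by (auto simp: norm_mult)
      qed
      also have "\<dots> = (\<Sum>\<psi>\<in>V.chars - S. norm (h 0 \<psi>) ^ 3 + norm (h 1 \<psi>) ^ 3 + norm (h 2 \<psi>) ^ 3)"
        using V.finite_chars by (intro sum.mono_neutral_cong_right) auto
      finally show ?thesis .
    qed
    also have "\<dots> = (\<Sum>i<3::nat. \<Sum>\<psi>\<in>V.chars - S. norm (h i \<psi>) ^ 3)"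
      by (simp add: eval_nat_numeral sum.distrib)
    also have "\<dots> \<le> (\<Sum>i<3::nat. 1 / 10 ^ 15)"
    proof (intro sum_mono)
      fix i :: nat assume i: "i \<in> {..<3}"
      have "(\<Sum>\<psi>\<in>V.chars - S. norm (h i \<psi>) ^ 3) \<le> (\<Sum>\<psi>\<in>?L i. norm (h i \<psi>) ^ 3)"
      proof (rule sum_mono2)
        show "V.chars - S \<subseteq> ?L i"
        proof
          fix \<psi> assume \<psi>: "\<psi> \<in> V.chars - S"
          have "\<not> norm (h i \<psi>) \<ge> 1 / 16 ^ j0" using \<psi> i unfolding S_def by blast
          thus "\<psi> \<in> ?L i" using \<psi> by simp
        qed
      qed (use V.finite_chars in auto)
      thus "(\<Sum>\<psi>\<in>V.chars - S. norm (h i \<psi>) ^ 3) \<le> 1 / 10 ^ 15" using cubes[of i] i by simp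
    qed
    finally show ?thesis by simp
  qed
  let ?Z = "(\<Sum>\<psi>\<in>V.chars. h 0 \<psi> * h 1 \<psi> * h 2 \<psi>) - (\<Sum>\<psi>\<in>V.chars. V.hat (\<lambda>x. of_real (g 0 x)) \<psi> * V.hat (\<lambda>x. of_real (g 1 x)) \<psi> * V.hat (\<lambda>x. of_real (g 2 x)) \<psi>)"
  have "complex_of_real n ^ 2 * ?Z
     = of_real (?trip a) - of_real (?trip g)"
    unfolding trip_hat h_def by (rule right_diff_distrib)
  also have "\<dots> = - of_real (?trip g)" unfolding ta by simp
  finally have E: "complex_of_real n ^ 2 * ?Z = - of_real (?trip g)" .
  have "n\<^sup>2 * norm ?Z = norm (complex_of_real n ^ 2 * ?Z)" using n0 by (simp add: norm_mult norm_power)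
  also have "\<dots> = \<bar>?trip g\<bar>" unfolding E norm_minus_cancel norm_of_real ..
  finally have "n\<^sup>2 * norm ?Z = \<bar>?trip g\<bar>" .
  hence "\<bar>?trip g\<bar> \<le> n\<^sup>2 * (3 / 10 ^ 15)" using mult_left_mono[OF diff, of "n\<^sup>2"] by simp
  hence "n\<^sup>2 / 10 ^ 14 \<le> n\<^sup>2 * (3 / 10 ^ 15)" using tg by linarith
  thus False using n0 by (simp add: field_simps)
qed

end

section \<open>Sums of three irreducible polynomials\<close>

definition smooth_monics :: "'a::{field,finite} poly set \<Rightarrow> nat \<Rightarrow> 'a poly set" where
  "smooth_monics Q R = {f. lead_coeff f = 1 \<and> degree f \<le> R \<and> (\<forall>P\<in>mprimes. P dvd f \<longrightarrow> P \<in> Q)}"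

text \<open>Sums of \<open>1 / pnorm f\<close> over all monic \<open>f\<close> are easy to evaluate,
  whereas \<open>L\<close> runs over squarefree moduli. As \<open>1 / (pnorm P - 1)\<close> is the
  sum of the reciprocals of all powers of \<open>P\<close>, the weight of a squarefree modulus
  dominates all \<open>f\<close> with that radical.\<close>

definition smooth_sum :: "'a::{field,finite} poly set \<Rightarrow> nat \<Rightarrow> real" where
  "smooth_sum Q R = (\<Sum>f\<in>smooth_monics Q R. 1 / pnorm f)"

lemma finite_smooth_monics [simp]: "finite (smooth_monics Q R)"
  by (rule finite_subset[of _ "polys_below (Suc R)"]) (auto simp: smooth_monics_def polys_below_degree less_Suc_eq_le)

lemma pnorm_mult: "f \<noteq> 0 \<Longrightarrow> g \<noteq> 0 \<Longrightarrow> pnorm (f * g) = pnorm f * pnorm (g :: 'a::{field,finite} poly)"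
  by (simp add: pnorm_def degree_mult_eq power_add)

lemma smooth_sum_nonneg: "smooth_sum Q R \<ge> 0"
  unfolding smooth_sum_def by (intro sum_nonneg) (simp add: pnorm_def)

lemma smooth_sum_mono: "Q \<subseteq> Q' \<Longrightarrow> R \<le> R' \<Longrightarrow> smooth_sum Q R \<le> smooth_sum Q' R'"
  unfolding smooth_sum_def
proof (rule sum_mono2)
  assume "Q \<subseteq> Q'" "R \<le> R'"
  thus "smooth_monics Q R \<subseteq> smooth_monics Q' R'" by (auto simp: smooth_monics_def)
qed (simp_all add: pnorm_def)

lemma smooth_sum_insert:
  assumes P: "P \<in> mprimes" "P \<notin> Q"
  shows "smooth_sum (insert P Q) R = smooth_sum Q R + (if degree P \<le> R then smooth_sum (insert P Q) (R - degree P) / pnorm P else 0)"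
proof -
  let ?A = "{f \<in> smooth_monics (insert P Q) R. P dvd f}"
  have P0: "P \<noteq> 0" and P1: "lead_coeff P = 1" using P(1) by (auto simp: mprimes_def)
  have split: "smooth_monics (insert P Q) R = smooth_monics Q R \<union> ?A" and disj: "smooth_monics Q R \<inter> ?A = {}"
    using P by (auto simp: smooth_monics_def)
  have A: "?A = (if degree P \<le> R then (\<lambda>g. P * g) ` smooth_monics (insert P Q) (R - degree P) else {})"
  proof (intro set_eqI iffI)
    fix f assume f: "f \<in> ?A"
    then obtain g where g: "f = P * g" by auto
    have "g \<noteq> 0" using f g by (auto simp: smooth_monics_def)
    moreover have "lead_coeff g = 1" using f P1 unfolding g by (simp add: smooth_monics_def lead_coeff_mult)
    moreover have "degree f = degree P + degree g" unfolding g using P0 \<open>g \<noteq> 0\<close> by (rule degree_mult_eq)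
    moreover have "degree f \<le> R" using f by (simp add: smooth_monics_def)
    moreover have "P' \<in> insert P Q" if "P' \<in> mprimes" "P' dvd g" for P'
      using f that unfolding g smooth_monics_def by (auto intro: dvd_mult)
    ultimately have "degree P \<le> R" "g \<in> smooth_monics (insert P Q) (R - degree P)"
      by (auto simp: smooth_monics_def)
    thus "f \<in> (if degree P \<le> R then (\<lambda>g. P * g) ` smooth_monics (insert P Q) (R - degree P) else {})"
      unfolding g by (simp add: imageI)
  next
    fix f assume f: "f \<in> (if degree P \<le> R then (\<lambda>g. P * g) ` smooth_monics (insert P Q) (R - degree P) else {})"
    hence d: "degree P \<le> R" by (auto split: if_splits)
    with f obtain g where g: "f = P * g" "g \<in> smooth_monics (insert P Q) (R - degree P)" by auto
    have "g \<noteq> 0" using g by (auto simp: smooth_monics_def)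
    hence "degree f = degree P + degree g" unfolding g(1) using P0 degree_mult_eq by blast
    moreover have "degree g \<le> R - degree P" using g(2) by (simp add: smooth_monics_def)
    ultimately have "degree f \<le> R" using d by linarith
    moreover have "P' \<in> insert P Q" if "P' \<in> mprimes" "P' dvd f" for P'
    proof -
      have "P' dvd P \<or> P' dvd g" using that mprimesD(4) prime_elem_dvd_mult_iff unfolding g(1) by blast
      thus ?thesis using that g(2) mprimes_dvd_iff[OF that(1) P(1)] by (auto simp: smooth_monics_def)
    qed
    moreover have "lead_coeff f = 1" unfolding g(1) lead_coeff_mult P1 using g(2) by (simp add: smooth_monics_def)
    ultimately show "f \<in> ?A" using g(1) by (simp add: smooth_monics_def)
  qed
  have "smooth_sum (insert P Q) R = smooth_sum Q R + (\<Sum>f\<in>?A. 1 / pnorm f)"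
    unfolding smooth_sum_def by (subst split, rule sum.union_disjoint[OF _ _ disj]) auto
  also have "(\<Sum>f\<in>?A. 1 / pnorm f) = (if degree P \<le> R then smooth_sum (insert P Q) (R - degree P) / pnorm P else 0)"
  proof (cases "degree P \<le> R")
    case True
    have "(\<Sum>f\<in>(\<lambda>g. P * g) ` smooth_monics (insert P Q) (R - degree P). 1 / pnorm f)
        = (\<Sum>g\<in>smooth_monics (insert P Q) (R - degree P). 1 / pnorm g / pnorm P)"
    proof (subst sum.reindex)
      show "inj_on ((*) P) (smooth_monics (insert P Q) (R - degree P))" using P0 by (auto simp: inj_on_def)
      show "sum ((\<lambda>f. 1 / pnorm f) \<circ> (*) P) (smooth_monics (insert P Q) (R - degree P))
         = (\<Sum>g\<in>smooth_monics (insert P Q) (R - degree P). 1 / pnorm g / pnorm P)"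
      proof (intro sum.cong refl)
        fix g assume "g \<in> smooth_monics (insert P Q) (R - degree P)"
        hence "g \<noteq> 0" by (auto simp: smooth_monics_def)
        thus "((\<lambda>f. 1 / pnorm f) \<circ> (*) P) g = 1 / pnorm g / pnorm P" using P0 by (simp add: pnorm_mult mult.commute)
      qed
    qed
    thus ?thesis unfolding A using True by (simp add: smooth_sum_def sum_divide_distrib)
  qed (simp add: A)
  finally show ?thesis .
qed

text \<open>Iterating \<open>smooth_sum_insert\<close> produces the geometric series with sum
  \<open>1 / (pnorm P - 1)\<close>; monotonicity in the degree bounds all its terms by the first
  smooth sum.\<close>

lemma smooth_sum_insert_le:
  assumes P: "P \<in> mprimes" "P \<notin> Q"
  shows "smooth_sum (insert P Q) R \<le> smooth_sum Q R + (if degree P \<le> R then smooth_sum Q (R - degree P) / (pnorm P - 1) else 0)"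
proof (induction R rule: less_induct)
  case (less R)
  have p2: "pnorm P \<ge> 2" by (rule pnorm_mprime[OF P(1)])
  show ?case
  proof (cases "degree P \<le> R")
    case True
    let ?d = "degree P" and ?x = "smooth_sum Q (R - degree P)"
    have "smooth_sum (insert P Q) (R - ?d) \<le> ?x + (if ?d \<le> R - ?d then smooth_sum Q (R - ?d - ?d) / (pnorm P - 1) else 0)"
      using True mprimesD(3)[OF P(1)] by (intro less) auto
    also have "\<dots> \<le> ?x + ?x / (pnorm P - 1)"
      using smooth_sum_mono[of Q Q "R - ?d - ?d" "R - ?d"] smooth_sum_nonneg[of Q "R - ?d"] p2 by (auto intro: divide_right_mono)
    finally have "smooth_sum (insert P Q) (R - ?d) / pnorm P \<le> (?x + ?x / (pnorm P - 1)) / pnorm P"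
      using p2 by (intro divide_right_mono) auto
    also have "\<dots> = ?x / (pnorm P - 1)" using p2 by (simp add: field_simps)
    finally show ?thesis using True smooth_sum_insert[OF P, of R] by simp
  qed (use smooth_sum_insert[OF P, of R] in simp)
qed

lemma smooth_sum_empty: "smooth_sum ({} :: 'a::{field,finite} poly set) R = 1"
proof -
  have "smooth_monics ({} :: 'a poly set) R = {1}"
  proof (intro set_eqI iffI)
    fix f :: "'a poly" assume f: "f \<in> smooth_monics {} R"
    have "degree f = 0" using f ex_mprime_dvd[of f] by (auto simp: smooth_monics_def)
    thus "f \<in> {1}" using f by (auto simp: smooth_monics_def one_pCons elim!: degree_eq_zeroE)
  next
    fix f :: "'a poly" assume "f \<in> {1}"
    moreover have "\<not> P dvd 1" if "P \<in> mprimes" for P :: "'a poly" using mprimesD(1)[OF that] irreducible_not_unit by auto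
    ultimately show "f \<in> smooth_monics {} R" by (auto simp: smooth_monics_def)
  qed
  thus ?thesis by (simp add: smooth_sum_def pnorm_def)
qed

text \<open>Adding a prime increases the right side by precisely the kind of term with which
  \<open>smooth_sum_insert_le\<close> bounds the increase on the left.\<close>

lemma smooth_sum_le_wt:
  fixes Q :: "'a::{field,finite} poly set"
  assumes "finite Q" "Q \<subseteq> mprimes"
  shows "smooth_sum Q R \<le> (\<Sum>S\<in>psets Q R. wt S)"
  using assms
proof (induction Q arbitrary: R rule: finite_induct)
  case empty
  have "psets ({} :: 'a poly set) R = {{}}" by (auto simp: psets_def sdeg_def)
  thus ?case by (simp add: wt_def smooth_sum_empty)
next
  case (insert P Q)
  have P: "P \<in> mprimes" and Q: "Q \<subseteq> mprimes" using insert.prems by auto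
  have p2: "pnorm P \<ge> 2" by (rule pnorm_mprime[OF P])
  let ?B = "if degree P \<le> R then insert P ` psets Q (R - degree P) else {}"
  have finB: "finite ?B" using finite_psets[OF Q] by simp
  have sd: "sdeg (insert P S) = degree P + sdeg S" if "S \<subseteq> Q" "finite S" for S
  proof -
    have "P \<notin> S" using that insert.hyps by auto
    thus ?thesis using that by (simp add: sdeg_def)
  qed
  have ps: "psets (insert P Q) R = psets Q R \<union> ?B"
  proof (intro set_eqI iffI)
    fix S assume S: "S \<in> psets (insert P Q) R"
    show "S \<in> psets Q R \<union> ?B"
    proof (cases "P \<in> S")
      case True
      let ?S = "S - {P}"
      have S': "?S \<subseteq> Q" "finite ?S" "S = insert P ?S" using S True by (auto simp: psets_def)
      have "degree P + sdeg ?S \<le> R" using sd[OF S'(1,2)] S'(3) S by (simp add: psets_def)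
      hence "degree P \<le> R" "?S \<in> psets Q (R - degree P)" using S' by (auto simp: psets_def)
      moreover from this(2) have "S \<in> insert P ` psets Q (R - degree P)" using S'(3) by (intro image_eqI)
      ultimately show ?thesis by simp
    qed (use S in \<open>auto simp: psets_def\<close>)
  next
    fix S assume "S \<in> psets Q R \<union> ?B"
    thus "S \<in> psets (insert P Q) R" using sd by (auto simp: psets_def split: if_splits)
  qed
  have disj: "psets Q R \<inter> ?B = {}" using insert.hyps by (auto simp: psets_def split: if_splits)
  have "(\<Sum>S\<in>psets (insert P Q) R. wt S) = (\<Sum>S\<in>psets Q R. wt S) + (\<Sum>S\<in>?B. wt S)"
    unfolding ps by (rule sum.union_disjoint[OF finite_psets[OF Q] finB disj])
  also have "(\<Sum>S\<in>?B. wt S) = (if degree P \<le> R then (\<Sum>S\<in>psets Q (R - degree P). wt S) / (pnorm P - 1) else 0)"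
  proof (cases "degree P \<le> R")
    case True
    have "inj_on (insert P) (psets Q (R - degree P))"
      using insert.hyps by (auto simp: inj_on_def psets_def)
    hence "(\<Sum>S\<in>insert P ` psets Q (R - degree P). wt S) = (\<Sum>S\<in>psets Q (R - degree P). wt (insert P S))"
      by (simp add: sum.reindex)
    also have "\<dots> = (\<Sum>S\<in>psets Q (R - degree P). wt S / (pnorm P - 1))"
    proof (intro sum.cong refl)
      fix S assume "S \<in> psets Q (R - degree P)"
      hence "finite S" "P \<notin> S" using insert.hyps by (auto simp: psets_def)
      thus "wt (insert P S) = wt S / (pnorm P - 1)" by (simp add: wt_def)
    qed
    finally show ?thesis using True by (simp add: sum_divide_distrib)
  qed simp
  finally have "(\<Sum>S\<in>psets (insert P Q) R. wt S) = (\<Sum>S\<in>psets Q R. wt S) + (if degree P \<le> R then (\<Sum>S\<in>psets Q (R - degree P). wt S) / (pnorm P - 1) else 0)" .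
  moreover have "smooth_sum Q R' \<le> (\<Sum>S\<in>psets Q R'. wt S)" for R' using insert.IH Q by auto
  moreover have "smooth_sum Q (R - degree P) / (pnorm P - 1) \<le> (\<Sum>S\<in>psets Q (R - degree P). wt S) / (pnorm P - 1)"
    using insert.IH[OF Q, of "R - degree P"] p2 by (intro divide_right_mono) auto
  ultimately show ?case using smooth_sum_insert_le[OF P insert.hyps(2), of R] by (smt (verit))
qed

text \<open>Each further prime multiplies the sum by at most \<open>1 + 1 / (pnorm P - 1)\<close>,
  the inverse of its factor in the product.\<close>

lemma smooth_sum_Un_le:
  assumes "finite Z" "Z \<subseteq> mprimes"
  shows "smooth_sum (Z \<union> Q) R * (\<Prod>P\<in>Z. (pnorm P - 1) / pnorm P) \<le> smooth_sum Q R"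
  using assms
proof (induction Z rule: finite_induct)
  case (insert P Z)
  have P: "P \<in> mprimes" using insert.prems by auto
  have p2: "pnorm P \<ge> 2" by (rule pnorm_mprime[OF P])
  have c: "0 \<le> (pnorm P - 1) / pnorm P" "(pnorm P - 1) / pnorm P \<le> 1" using p2 by auto
  let ?x = "smooth_sum (Z \<union> Q) R"
  have pr: "0 \<le> (\<Prod>P\<in>Z. (pnorm P - 1) / pnorm P)"
    using insert.prems pnorm_mprime by (intro prod_nonneg) force
  have "smooth_sum (insert P (Z \<union> Q)) R * ((pnorm P - 1) / pnorm P) \<le> ?x"
  proof (cases "P \<in> Z \<union> Q")
    case True
    hence "insert P (Z \<union> Q) = Z \<union> Q" by auto
    thus ?thesis using mult_left_le[OF c(2) smooth_sum_nonneg[of "Z \<union> Q" R]] by simp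
  next
    case False
    have "smooth_sum (insert P (Z \<union> Q)) R \<le> ?x + (if degree P \<le> R then smooth_sum (Z \<union> Q) (R - degree P) / (pnorm P - 1) else 0)"
      by (rule smooth_sum_insert_le[OF P False])
    also have "\<dots> \<le> ?x + ?x / (pnorm P - 1)"
      using smooth_sum_mono[of "Z \<union> Q" "Z \<union> Q" "R - degree P" R] smooth_sum_nonneg[of "Z \<union> Q" R] p2
      by (auto intro: divide_right_mono)
    finally have "smooth_sum (insert P (Z \<union> Q)) R * ((pnorm P - 1) / pnorm P) \<le> (?x + ?x / (pnorm P - 1)) * ((pnorm P - 1) / pnorm P)"
      by (intro mult_right_mono c)
    also have "\<dots> = ?x" using p2 by (simp add: field_simps)
    finally show ?thesis .
  qed
  from mult_right_mono[OF this pr]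
  have "smooth_sum (insert P Z \<union> Q) R * (\<Prod>P\<in>insert P Z. (pnorm P - 1) / pnorm P) \<le> ?x * (\<Prod>P\<in>Z. (pnorm P - 1) / pnorm P)"
    using insert.hyps by (simp add: mult_ac)
  also have "\<dots> \<le> smooth_sum Q R" using insert by auto
  finally show ?case .
qed simp

lemma smooth_sum_all:
  fixes Q :: "'a::{field,finite} poly set"
  assumes "{P\<in>mprimes. degree P \<le> R} \<subseteq> Q"
  shows "smooth_sum Q R = real R + 1"
proof -
  have "smooth_monics Q R = (\<Union>n\<in>{..R}. monics n :: 'a poly set)"
  proof (intro set_eqI iffI)
    fix f :: "'a poly" assume "f \<in> (\<Union>n\<in>{..R}. monics n)"
    hence f: "lead_coeff f = 1" "degree f \<le> R" by (auto simp: monics_def)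
    have "P \<in> Q" if "P \<in> mprimes" "P dvd f" for P
      using assms that f dvd_imp_degree_le[OF that(2)] by fastforce
    thus "f \<in> smooth_monics Q R" using f by (auto simp: smooth_monics_def)
  qed (auto simp: smooth_monics_def monics_def)
  hence "smooth_sum Q R = (\<Sum>n\<le>R. \<Sum>f\<in>(monics n :: 'a poly set). 1 / pnorm f)"
    unfolding smooth_sum_def by (simp only:) (rule sum.UNION_disjoint, simp_all add: finite_monics, auto simp: monics_def)
  also have "\<dots> = (\<Sum>n\<le>R. 1)"
  proof (intro sum.cong refl)
    fix n
    have "(\<Sum>f\<in>(monics n :: 'a poly set). 1 / pnorm f) = (\<Sum>f\<in>(monics n :: 'a poly set). 1 / real CARD('a) ^ n)"
      by (intro sum.cong refl) (auto simp: monics_def pnorm_def)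
    thus "(\<Sum>f\<in>(monics n :: 'a poly set). 1 / pnorm f) = 1" by (simp add: card_monics)
  qed
  finally show ?thesis by simp
qed

lemma (in sieve) L_lower_bound:
  assumes Z: "finite Z" "Z \<subseteq> mprimes" and all: "mprimes \<subseteq> Z \<union> PP"
  shows "L \<ge> (real R + 1) * (\<Prod>P\<in>Z. (pnorm P - 1) / pnorm P)"
proof -
  let ?Q = "{P\<in>PP. degree P \<le> R}"
  have finQ: "finite ?Q"
    by (rule finite_subset[of _ "polys_below (Suc R)"]) (auto simp: polys_below_degree less_Suc_eq_le)
  have "real R + 1 = smooth_sum (Z \<union> ?Q) R" using all by (intro smooth_sum_all[symmetric]) auto
  hence "(real R + 1) * (\<Prod>P\<in>Z. (pnorm P - 1) / pnorm P) \<le> smooth_sum ?Q R"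
    using smooth_sum_Un_le[OF Z, of ?Q R] by simp
  also have "\<dots> \<le> (\<Sum>S\<in>psets ?Q R. wt S)" using finQ PP by (intro smooth_sum_le_wt) auto
  also have "\<dots> \<le> L" unfolding L_def
  proof (rule sum_mono2)
    show "psets ?Q R \<subseteq> psets PP R" by (auto simp: psets_def)
  qed (use wt_nonneg psetsD in auto)
  finally show ?thesis .
qed

section \<open>Residue classes and leading coefficients\<close>

lemma crt_mprimes:
  fixes h :: "'a::{field,finite} poly \<Rightarrow> 'a poly"
  assumes "finite Q" "Q \<subseteq> mprimes"
  shows "\<exists>x. \<forall>P\<in>Q. P dvd x - h P"
  using assms
proof (induction Q rule: finite_induct)
  case (insert P Q)
  then obtain x where x: "\<forall>P'\<in>Q. P' dvd x - h P'" by auto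
  have P: "P \<in> mprimes" and Q: "Q \<subseteq> mprimes" using insert.prems by auto
  have "\<not> P dvd \<Prod>Q" using mprime_dvd_prod_iff[OF P insert.hyps(1) Q] insert.hyps by simp
  note bij = bij_mod_prime[OF mprimesD(1)[OF P] this, of x]
  have "h P mod P \<in> polys_below (degree P)" by (rule mod_in_polys_below[OF mprimesD(2)[OF P]])
  then obtain v where v: "(x + \<Prod>Q * v) mod P = h P mod P"
    using bij by (metis (no_types, lifting) bij_betw_imp_surj_on imageE)
  have "P dvd x + \<Prod>Q * v - h P" using v by (simp add: mod_eq_dvd_iff)
  moreover have "P' dvd x + \<Prod>Q * v - h P'" if "P' \<in> Q" for P'
  proof -
    have "P' dvd \<Prod>Q" using that insert.hyps by auto
    hence "P' dvd (x - h P') + \<Prod>Q * v" using x that by (intro dvd_add dvd_mult2) auto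
    thus ?thesis by (simp add: algebra_simps)
  qed
  ultimately show ?case by (intro exI[of _ "x + \<Prod>Q * v"]) auto
qed simp

lemma not_dvd_const:
  assumes "P \<in> mprimes" "c \<noteq> (0 :: 'a::{field,finite})"
  shows "\<not> P dvd [:c:]"
  using assms mprimesD(3)[OF assms(1)] dvd_imp_degree_le[of P "[:c:]"] by auto

text \<open>Modulo \<open>P\<close>, the residues \<open>(b, 1, b')\<close> are \<open>(1, 1, -2)\<close> if \<open>P\<close> divides \<open>f\<close>, and \<open>(f, 1, -1)\<close> otherwise.\<close>

lemma split_residues:
  fixes f :: "'a::{field,finite} poly"
  assumes "finite Q" "Q \<subseteq> mprimes" and two: "(2 :: 'a) \<noteq> 0"
  shows "\<exists>b b'. f = b + 1 + b' \<and> (\<forall>P\<in>Q. \<not> P dvd b \<and> \<not> P dvd b')"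
proof -
  obtain b where b: "\<forall>P\<in>Q. P dvd b - (if P dvd f then 1 else f)"
    using crt_mprimes[OF assms(1,2), of "\<lambda>P. if P dvd f then 1 else f"] by blast
  have "\<not> P dvd b \<and> \<not> P dvd f - 1 - b" if P: "P \<in> Q" for P
  proof -
    have PP: "P \<in> mprimes" using P assms by auto
    note const = not_dvd_const[OF PP]
    have 1: "\<not> P dvd 1" using const[of 1] by (simp add: one_pCons)
    show ?thesis
    proof (cases "P dvd f")
      case True
      hence d: "P dvd b - 1" using b P by auto
      have "\<not> P dvd b" using d 1 by (metis diff_diff_eq2 add_diff_cancel_left' dvd_diff)
      moreover have "\<not> P dvd f - 1 - b"
      proof
        assume h: "P dvd f - 1 - b"
        have "P dvd f - (f - 1 - b) - (b - 1)" by (rule dvd_diff[OF dvd_diff[OF True h] d])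
        hence "P dvd [:2:]" by (simp add: numeral_poly)
        thus False using const[OF two] by simp
      qed
      ultimately show ?thesis by simp
    next
      case False
      hence d: "P dvd b - f" using b P by auto
      have "\<not> P dvd b"
      proof
        assume h: "P dvd b"
        have "P dvd b - (b - f)" by (rule dvd_diff[OF h d])
        thus False using False by simp
      qed
      moreover have "\<not> P dvd f - 1 - b"
      proof
        assume h: "P dvd f - 1 - b"
        have "P dvd (f - 1 - b) + (b - f)" by (rule dvd_add[OF h d])
        also have "(f - 1 - b) + (b - f) = - 1" by simp
        finally show False using 1 by simp
      qed
      ultimately show ?thesis by simp
    qed
  qed
  thus ?thesis by (intro exI[of _ b] exI[of _ "f - 1 - b"]) auto
qed

context modulus
begin

lemma lead_coeff_W: "lead_coeff W = 1"
  unfolding W_def lead_coeff_prod using primes by (intro prod.neutral) (auto simp: mprimes_def)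

lemma degree_class:
  assumes "c \<noteq> 0" "b \<in> polys_below (M + D)" "m \<in> polys_below M"
  shows "degree (W * monom c M + b + W * m) = M + D"
proof -
  have "W * m \<in> polys_below (M + D)" using assms(3) by (intro polys_below_mult) auto
  hence 0: "b + W * m \<in> polys_below (M + D)" using assms(2) by (intro polys_below_add)
  have "degree (W * monom c M) = M + D" using assms(1) W_nz by (subst degree_mult_eq) (auto simp: degree_monom_eq)
  moreover have "degree (b + W * m) < degree (W * monom c M) \<or> b + W * m = 0"
    using 0 calculation by (auto simp: polys_below_degree)
  ultimately have "degree (W * monom c M + (b + W * m)) = M + D" by (metis add_0_right degree_add_eq_left)
  thus ?thesis by (simp add: add.assoc)
qed

text \<open>\<open>W * monom c M + b + W * m\<close> has leading coefficient \<open>c\<close>;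
  divided by \<open>c\<close> it is monic and congruent to \<open>smult (1 / c) b\<close>. The map
  \<open>F\<close> inverts this correspondence, so monic irreducibles of the class can be counted
  through \<open>m\<close>.\<close>

lemma card_irreducible_class_ge:
  assumes c: "c \<noteq> 0" and b: "b \<in> polys_below (M + D)"
  shows "card {P \<in> mprimes. degree P = M + D \<and> P mod W = smult (1 / c) b mod W}
    \<le> card {m \<in> polys_below M. irreducible (W * monom c M + b + W * m)}" (is "card ?A \<le> card ?B")
proof (rule card_inj_on_le)
  define F where "F P = (smult c P - b) div W - monom c M" for P
  have key: "F P \<in> polys_below M" "W * monom c M + b + W * F P = smult c P" if P: "P \<in> ?A" for P
  proof -
    have "W dvd P - smult (1 / c) b" using P by (simp add: mod_eq_dvd_iff)
    hence "W dvd smult c (P - smult (1 / c) b)" by (rule dvd_smult)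
    hence "W dvd smult c P - b" using c by (simp add: smult_diff_right)
    hence g: "smult c P - b = W * ((smult c P - b) div W)" by simp
    thus eq: "W * monom c M + b + W * F P = smult c P" by (simp add: F_def algebra_simps)
    have "coeff (W * F P) i = 0" if i: "i \<ge> M + D" for i
    proof -
      have "W * F P = smult c P - b - W * monom c M" using eq by (simp add: algebra_simps)
      hence "coeff (W * F P) i = c * coeff P i - coeff b i - coeff (W * monom c M) i" by simp
      moreover have "coeff b i = 0" using b i by (simp add: polys_below_def)
      moreover have "coeff (W * monom c M) i = c * coeff W (i - M)"
        using i by (simp add: mult.commute[of W] coeff_monom_mult)
      moreover have "coeff P i = coeff W (i - M)"
      proof (cases "i = M + D")
        case True
        thus ?thesis using P lead_coeff_W by (auto simp: mprimes_def)
      next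
        case False
        thus ?thesis using P i by (simp add: coeff_eq_0)
      qed
      ultimately show ?thesis by simp
    qed
    hence "W * F P \<in> polys_below (M + D)" by (simp add: polys_below_def)
    thus "F P \<in> polys_below M"
      using W_nz by (cases "F P = 0") (auto simp: polys_below_degree degree_mult_eq)
  qed
  show "inj_on F ?A"
  proof (rule inj_onI)
    fix P P' assume P: "P \<in> ?A" and P': "P' \<in> ?A" and eq: "F P = F P'"
    have "smult c P = smult c P'"
      unfolding key(2)[OF P, symmetric] key(2)[OF P', symmetric] eq by (rule refl)
    hence "smult (1 / c) (smult c P) = smult (1 / c) (smult c P')" by (rule arg_cong)
    thus "P = P'" using c by simp
  qed
  show "F ` ?A \<subseteq> ?B"
  proof (rule image_subsetI, rule CollectI, rule conjI)
    fix P assume P: "P \<in> ?A"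
    show "F P \<in> polys_below M" by (rule key(1)[OF P])
    have "irreducible P" using P mprimesD(1) by blast
    moreover have "is_unit [:c:]" using c by (simp add: is_unit_poly_iff dvd_field_iff)
    ultimately have "irreducible ([:c:] * P)" by (simp only: irreducible_mult_unit_left)
    thus "irreducible (W * monom c M + b + W * F P)" unfolding key(2)[OF P] by simp
  qed
qed simp

end

section \<open>Asymptotic conditions on the degree\<close>

lemma sieve_err_le:
  assumes "q \<ge> 3"
  shows "sieve_err q s \<le> 48 * real s * 3 powr (- real s / 2)"
  unfolding sieve_err_def using assms by (intro mult_left_mono powr_mono2') auto

lemma eventually_sieve_err_le:
  assumes "q \<ge> 3" "e > 0"
  shows "eventually (\<lambda>s. sieve_err q s \<le> e) sequentially"
proof -
  have "((\<lambda>s. 48 * real s * 3 powr (- real s / 2)) \<longlongrightarrow> 0) sequentially" by real_asymp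
  from order_tendstoD(2)[OF this \<open>e > 0\<close>] show ?thesis
    by (rule eventually_mono) (use sieve_err_le[OF assms(1)] in \<open>meson less_imp_le order_trans\<close>)
qed

text \<open>As \<open>256 \<le> 3 ^ 6\<close>, the right side is at least
  \<open>3 powr (- 6 * s / 50)\<close>, while \<open>sieve_err\<close> decays like
  \<open>3 powr (- s / 2)\<close>.\<close>

lemma eventually_sieve_err_power:
  assumes "q \<ge> 3"
  shows "eventually (\<lambda>s. 4 * sieve_err q s \<le> 1 / 256 ^ (s div 50)) sequentially"
proof -
  note le = sieve_err_le[OF assms]
  have pw: "256 ^ (s div 50) \<le> (3 :: real) powr (6 * real s / 50)" for s
  proof -
    have "(256 :: real) ^ (s div 50) \<le> (3 ^ 6) ^ (s div 50)" by (intro power_mono) auto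
    also have "\<dots> = 3 ^ (6 * (s div 50))" by (simp only: power_mult)
    also have "\<dots> = 3 powr (6 * real (s div 50))" using powr_realpow[of 3 "6 * (s div 50)"] by simp
    also have "\<dots> \<le> 3 powr (6 * real s / 50)" by (intro powr_mono) linarith+
    finally show ?thesis .
  qed
  have "((\<lambda>s. 192 * real s * 3 powr (- real s / 2) * 3 powr (6 * real s / 50)) \<longlongrightarrow> 0) sequentially" by real_asymp
  from order_tendstoD(2)[OF this, of 1] show "eventually (\<lambda>s. 4 * sieve_err q s \<le> 1 / 256 ^ (s div 50)) sequentially"
  proof (rule eventually_mono, simp)
    fix s assume *: "192 * real s * 3 powr (- real s / 2) * 3 powr (6 * real s / 50) < 1"
    have "4 * sieve_err q s \<le> 192 * real s * 3 powr (- real s / 2)" using le[of s] by simp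
    hence "4 * sieve_err q s * 256 ^ (s div 50) \<le> (192 * real s * 3 powr (- real s / 2)) * 3 powr (6 * real s / 50)"
      using pw[of s] by (rule mult_mono) simp_all
    hence "4 * sieve_err q s * 256 ^ (s div 50) \<le> 1" using * by linarith
    thus "4 * sieve_err q s \<le> 1 / 256 ^ (s div 50)" by (simp add: field_simps)
  qed
qed

text \<open>Meant for the term \<open>B / 16 ^ J\<close> of \<open>zero_sum_triple\<close>, where
  \<open>B\<close> is \<open>L\<close>, at most linear in \<open>s\<close>. The floor in
  \<open>s div 50\<close> costs one factor 16.\<close>

lemma eventually_linear_div_power:
  assumes "e > 0"
  shows "eventually (\<lambda>s. 2 * (50 * real s + d) / 16 ^ (s div 50) \<le> (e :: real)) sequentially"
proof -
  have "((\<lambda>s. 2 * (50 * real s + \<bar>d\<bar>) / 16 powr (real s / 50 - 1)) \<longlongrightarrow> 0) sequentially" by real_asymp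
  from order_tendstoD(2)[OF this assms] show ?thesis
  proof (rule eventually_mono)
    fix s assume *: "2 * (50 * real s + \<bar>d\<bar>) / 16 powr (real s / 50 - 1) < e"
    have "(16 :: real) powr (real s / 50 - 1) \<le> 16 powr real (s div 50)" by (intro powr_mono) linarith+
    also have "\<dots> = 16 ^ (s div 50)" by (simp add: powr_realpow)
    finally have p: "(16 :: real) powr (real s / 50 - 1) \<le> 16 ^ (s div 50)" .
    have "2 * (50 * real s + d) / 16 ^ (s div 50) \<le> 2 * (50 * real s + \<bar>d\<bar>) / 16 ^ (s div 50)"
      by (intro divide_right_mono) auto
    also have "\<dots> \<le> 2 * (50 * real s + \<bar>d\<bar>) / 16 powr (real s / 50 - 1)"
      using p by (intro divide_left_mono) auto
    finally show "2 * (50 * real s + d) / 16 ^ (s div 50) \<le> e" using * by linarith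
  qed
qed

text \<open>The parameters depend on each other in this order: \<open>y\<close> is absolute;
  \<open>j0\<close> makes the cube sum small; \<open>K\<close> bounds the number of large
  coefficients; \<open>w\<close> makes \<open>q ^ K * (1/2) ^ w\<close> small and fixes
  \<open>Z\<close>, hence the modulus; \<open>s\<close> is large in terms of all these and of the
  residues of \<open>f\<close>.\<close>

theorem sum_of_three_irreducibles:
  fixes f :: "'a::{field,finite} poly"
  assumes odd: "odd CARD('a)"
  shows "\<exists>x y z. irreducible x \<and> irreducible y \<and> irreducible z \<and> f = x + y + z"
proof -
  let ?q = "real CARD('a)"
  have q3: "CARD('a) \<ge> 3" using card_field_ge_2[where 'a = 'a] odd by presburger
  have two: "(2 :: 'a) \<noteq> 0"
  proof
    assume 2: "(2 :: 'a) = 0"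
    obtain l where "CARD('a) = 2 * l + 1" using odd by (elim oddE)
    hence "(of_nat CARD('a) :: 'a) = 2 * of_nat l + 1" by (metis of_nat_add of_nat_mult of_nat_numeral of_nat_1)
    thus False using 2 of_nat_card_field[where 'a = 'a] by simp
  qed
  \<comment> \<open>\<open>(q + 1) / 2\<close> inverts 2, because \<open>q\<close> is 0 in the
    field.\<close>
  obtain k where k: "CARD('a) + 1 = 2 * k" using odd by (metis even_plus_one_iff evenE)
  have half: "of_nat k * 2 = (1 :: 'a poly)"
  proof -
    have "of_nat k * 2 = (of_nat (2 * k) :: 'a poly)" by (simp add: mult.commute)
    also have "\<dots> = [:of_nat CARD('a):] + 1" unfolding k[symmetric] by (simp add: of_nat_poly one_pCons)
    finally show ?thesis using of_nat_card_field[where 'a = 'a] by simp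
  qed
  obtain y where y: "y \<ge> 1" "\<And>j. 4 * moment_bound (8 * j + 2) \<le> y ^ 3 * 2 ^ j"
    using moment_constant by blast
  have "\<exists>j. (1/2 :: real) ^ j < 1 / (2 * 10 ^ 15 * (16384 * y))"
    using y(1) by (intro real_arch_pow_inv) auto
  then obtain j0 where "(1/2 :: real) ^ j0 < 1 / (2 * 10 ^ 15 * (16384 * y))" by blast
  hence j0: "16384 * y * (1/2) ^ j0 \<le> 1 / (2 * 10 ^ 15)" using y(1) by (simp add: field_simps)
  define K where "K = nat \<lceil>12 * y * 2048 ^ j0\<rceil>"
  have K: "12 * y * 2048 ^ j0 \<le> real K" unfolding K_def by (rule real_nat_ceiling_ge)
  have "\<exists>j. (1/2 :: real) ^ j < 1 / (100 * ?q ^ K)"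
    using q3 by (intro real_arch_pow_inv) auto
  then obtain w0 where w0: "(1/2 :: real) ^ w0 < 1 / (100 * ?q ^ K)" by blast
  \<comment> \<open>The 83 is for \<open>6 ^ 32 \<le> 2 ^ 83\<close>, the size of sieving primes
    demanded by \<open>transference\<close>.\<close>
  define w where "w = max w0 83"
  have "(1/2 :: real) ^ w \<le> (1/2) ^ w0" unfolding w_def by (intro power_decreasing) auto
  hence w: "(1/2 :: real) ^ w \<le> 1 / (100 * ?q ^ K)" using w0 by linarith
  define Z where "Z = {P \<in> (mprimes :: 'a poly set). degree P \<le> w}"
  define PP where "PP = {P \<in> (mprimes :: 'a poly set). degree P > w}"
  have finZ: "finite Z"
    by (rule finite_subset[of _ "polys_below (Suc w)"]) (auto simp: Z_def polys_below_degree less_Suc_eq_le)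
  have Zsub: "Z \<subseteq> mprimes" by (auto simp: Z_def)
  have "Z \<noteq> {}"
  proof -
    obtain P where P: "P \<in> mprimes" "P dvd [:0, 1 :: 'a:]" using ex_mprime_dvd[of "[:0, 1 :: 'a:]"] by auto
    have "degree P \<le> 1" using dvd_imp_degree_le[OF P(2)] by simp
    hence "P \<in> Z" using P(1) by (simp add: Z_def w_def)
    thus ?thesis by auto
  qed
  interpret Z: modulus Z by (rule modulus.intro[OF finZ Zsub \<open>Z \<noteq> {}\<close>])
  obtain b0 b2 where b02: "f = b0 + 1 + b2" "\<forall>P\<in>Z. \<not> P dvd b0 \<and> \<not> P dvd b2"
    using split_residues[OF finZ Zsub two, of f] by (elim exE conjE)
  define b :: "nat \<Rightarrow> 'a poly" where "b = (\<lambda>i. if i = 0 then b0 else if i = 1 then 1 else b2)"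
  define c :: "nat \<Rightarrow> 'a" where "c = (\<lambda>i. if i = 0 then 1 else if i = 1 then 1 else - 2)"
  have c: "c i \<noteq> 0" for i using two by (simp add: c_def)
  have b: "\<not> P dvd b i" if "P \<in> Z" for i P
    using b02(2) that mprimesD(1) Zsub irreducible_not_unit by (auto simp: b_def)
  define \<phi> where "\<phi> = (\<Prod>P\<in>Z. (pnorm P - 1) / pnorm P)"
  have fac: "0 < (pnorm P - 1) / pnorm P" "(pnorm P - 1) / pnorm P \<le> 1" if "P \<in> Z" for P
    using pnorm_mprime[of P] Zsub that by auto
  have \<phi>: "0 < \<phi>" "\<phi> \<le> 1"
    unfolding \<phi>_def using fac by (blast intro: prod_pos, blast intro: prod_le_1 less_imp_le)
  define cls where "cls i n = {P \<in> mprimes. degree P = n \<and> P mod Z.W = smult (1 / c i) (b i) mod Z.W}" for i n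
  \<comment> \<open>The margin 0.98 below the limit suffices because
    \<open>0.98 * 24 / 50 > 0.47\<close>.\<close>
  have ev_cls: "eventually (\<lambda>s. real (50 * s + Z.D) * card (cls i (50 * s + Z.D)) / ?q ^ (50 * s + Z.D) > 98 / 100 / card Z.U) sequentially" for i
  proof -
    have "(\<lambda>n. real n * card (cls i n) / ?q ^ n) \<longlonglongrightarrow> 1 / card Z.U"
      unfolding cls_def using b c by (intro Z.primes_in_class) (simp add: dvd_smult_iff)
    moreover have "98 / 100 / real (card Z.U) < 1 / real (card Z.U)"
      using Z.card_U \<phi>(1) q3 unfolding \<phi>_def[symmetric] by (intro divide_strict_right_mono) auto
    ultimately have "eventually (\<lambda>n. real n * card (cls i n) / ?q ^ n > 98 / 100 / card Z.U) sequentially"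
      by (rule order_tendstoD(1))
    moreover have "filterlim (\<lambda>s. 50 * s + Z.D) sequentially sequentially"
      by (rule filterlim_subseq) (simp add: strict_mono_def)
    ultimately show ?thesis by (rule eventually_compose_filterlim)
  qed
  have q3': "?q \<ge> 3" using q3 by simp
  \<comment> \<open>\<open>D \<le> s / 25\<close> gives
    \<open>0.47 * (50 * s + D) \<le> 0.98 * (24 * s + 1)\<close>; the summand \<open>50 * j0\<close>
    gives \<open>j0 \<le> s div 50\<close>; the degrees of \<open>b0\<close> and \<open>b2\<close>
    keep the residues below the leading term.\<close>
  have "eventually (\<lambda>s. s \<ge> 25 * Z.D + 50 * j0 + degree b0 + degree b2 + 1
      \<and> (\<forall>i\<in>{..<3}. real (50 * s + Z.D) * card (cls i (50 * s + Z.D)) / ?q ^ (50 * s + Z.D) > 98 / 100 / card Z.U)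
      \<and> sieve_err ?q s \<le> 1 / (100 * ?q ^ K) \<and> 4 * sieve_err ?q s \<le> 1 / 256 ^ (s div 50)
      \<and> 2 * (50 * real s + real Z.D) / 16 ^ (s div 50) \<le> 1 / (2 * 10 ^ 15)) sequentially"
    using q3 by (intro eventually_conj eventually_ge_at_top eventually_ball_finite ballI ev_cls
        eventually_sieve_err_le[OF q3'] eventually_sieve_err_power[OF q3'] eventually_linear_div_power) simp_all
  then obtain s where s: "s \<ge> 25 * Z.D + 50 * j0 + degree b0 + degree b2 + 1"
      and s_cls: "\<And>i. i < 3 \<Longrightarrow> real (50 * s + Z.D) * card (cls i (50 * s + Z.D)) / ?q ^ (50 * s + Z.D) > 98 / 100 / card Z.U"
      and s_err: "sieve_err ?q s \<le> 1 / (100 * ?q ^ K)" "4 * sieve_err ?q s \<le> 1 / 256 ^ (s div 50)"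
      and s_lin: "2 * (50 * real s + real Z.D) / 16 ^ (s div 50) \<le> 1 / (2 * 10 ^ 15)"
    using eventually_happens'[OF sequentially_bot] by (metis (no_types, lifting) lessThan_iff)
  interpret T: transference Z.W PP s
  proof
    fix P assume P: "P \<in> PP"
    hence "P \<in> mprimes" "P \<notin> Z" by (auto simp: PP_def Z_def)
    thus "\<not> P dvd Z.W" unfolding Z.W_def using mprime_dvd_prod_iff[OF _ finZ Zsub] by blast
    have "(6 :: real) ^ 32 \<le> 2 ^ 83" by simp
    also have "\<dots> \<le> 2 ^ degree P" using P by (intro power_increasing) (auto simp: PP_def w_def)
    also have "\<dots> \<le> pnorm P" unfolding pnorm_def using q3 by (intro power_mono) auto
    finally show "6 ^ 32 \<le> pnorm P" .
  qed (use q3 in \<open>auto simp: PP_def\<close>)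
  define n where "n = 50 * s + Z.D"
  define x where "x = ?q ^ (50 * s)"
  have x: "x > 0" using q3 by (simp add: x_def)
  define r where "r i = Z.W * monom (c i) (50 * s) + b i" for i
  have below: "b i \<in> polys_below (50 * s + Z.D)" for i
    using s by (auto simp: b_def polys_below_degree)
  have deg: "degree (r i + Z.W * m) = n" if "m \<in> T.VV" for i m
    unfolding r_def n_def by (rule Z.degree_class[OF c below that])
  \<comment> \<open>An irreducible of degree \<open>n > 24 * s\<close> has no irreducible divisor of
    degree at most \<open>24 * s\<close>, so \<open>nu\<close> takes its full value \<open>L\<close>
    there.\<close>
  have irr_nu: "T.nu (r i + Z.W * m) = T.L" if m: "m \<in> T.VV" and irr: "irreducible (r i + Z.W * m)" for i m
  proof (rule T.nu_prime, rule notI)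
    fix P assume P: "P \<in> PP" "degree P \<le> 24 * s" and d: "P dvd r i + Z.W * m"
    have "\<not> is_unit P" using P(1) mprimesD(1) irreducible_not_unit by (auto simp: PP_def)
    hence "(r i + Z.W * m) dvd P" using irreducibleD'[OF irr d] by blast
    moreover have "P \<noteq> 0" using P(1) mprimesD(2) by (auto simp: PP_def)
    ultimately have "n \<le> degree P" using dvd_imp_degree_le deg[OF m] by metis
    thus False using P(2) Z.D_pos by (simp add: n_def)
  qed
  define N where "N i = real (card {m \<in> T.VV. irreducible (r i + Z.W * m)})" for i
  define a where "a i m = (if irreducible (r i + Z.W * m) then T.L else 0)" for i m
  have a_nu: "a i m \<le> T.nu (r i + Z.W * m)" if "m \<in> T.VV" for i m
    using irr_nu[OF that] T.nu_nonneg by (simp add: a_def)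
  have sum_a: "(\<Sum>m\<in>T.VV. a i m) = T.L * N i" for i
    unfolding a_def N_def by (subst sum.inter_filter[symmetric]) (simp_all add: mult.commute)
  have sum_a_le: "T.L * N i \<le> x" for i
    unfolding sum_a[symmetric] x_def T.sum_nu[of "r i", symmetric] by (intro sum_mono a_nu)
  have N_ge: "98 / 100 * x \<le> \<phi> * real n * N i" if i: "i < 3" for i
  proof -
    have "card (cls i n) \<le> card {m \<in> T.VV. irreducible (r i + Z.W * m)}"
      unfolding cls_def r_def n_def by (rule Z.card_irreducible_class_ge[OF c below])
    hence "real (card (cls i n)) \<le> N i" by (simp add: N_def)
    have qn: "?q ^ n = x * ?q ^ Z.D" by (simp add: n_def x_def power_add)
    have U: "real (card Z.U) = ?q ^ Z.D * \<phi>" unfolding \<phi>_def by (rule Z.card_U)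
    have "98 / 100 / (?q ^ Z.D * \<phi>) < real n * card (cls i n) / (x * ?q ^ Z.D)"
      using s_cls[OF i] unfolding n_def[symmetric] qn U .
    hence "98 / 100 * x < \<phi> * real n * card (cls i n)"
      using x \<phi>(1) q3 by (simp add: field_simps)
    also have "\<dots> \<le> \<phi> * real n * N i"
      using \<phi>(1) \<open>real (card (cls i n)) \<le> N i\<close> by (intro mult_left_mono) auto
    finally show ?thesis by simp
  qed
  have n_pos: "real n > 0" using Z.D_pos by (simp add: n_def)
  have "mprimes \<subseteq> Z \<union> PP" by (auto simp: Z_def PP_def)
  hence L_ge: "T.L \<ge> (24 * real s + 1) * \<phi>"
    using T.L_lower_bound[OF finZ Zsub] unfolding \<phi>_def by simp
  have avg: "(\<Sum>m\<in>T.VV. a i m) \<ge> 47 / 100 * ?q ^ (50 * s)" if i: "i < 3" for i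
  proof -
    have "real n * (47 / 100 * x) \<le> (24 * real s + 1) * (98 / 100 * x)"
    proof -
      have "real n * (47 / 100) \<le> (24 * real s + 1) * (98 / 100)" using s unfolding n_def by simp
      from mult_right_mono[OF this, of x] show ?thesis using x by (simp add: mult_ac)
    qed
    also have "\<dots> \<le> (24 * real s + 1) * (\<phi> * real n * N i)" using N_ge[OF i] by (intro mult_left_mono) auto
    also have "\<dots> = (24 * real s + 1) * \<phi> * (real n * N i)" by (simp only: mult_ac)
    also have "\<dots> \<le> T.L * (real n * N i)" using L_ge by (intro mult_right_mono) (auto simp: N_def)
    finally have "real n * (47 / 100 * x) \<le> real n * (T.L * N i)" by (simp only: mult_ac)
    thus ?thesis using n_pos unfolding sum_a x_def[symmetric] by (simp only: mult_le_cancel_left_pos)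
  qed
  \<comment> \<open>The upper bound for \<open>L\<close> comes from the majorant itself:
    \<open>nu\<close> has mean 1 and the irreducibles alone contribute \<open>L * N 0\<close>, where
    \<open>N 0\<close> is known to be large.\<close>
  have L_le: "T.L \<le> 2 * real n"
  proof -
    have "T.L * (98 / 100 * x) \<le> T.L * (\<phi> * real n * N 0)"
      using N_ge[of 0] T.L_ge_1 by (intro mult_left_mono) auto
    also have "\<dots> = \<phi> * (real n * (T.L * N 0))" by (simp only: mult_ac)
    also have "\<dots> \<le> 1 * (real n * (T.L * N 0))"
      using \<phi>(2) T.L_ge_1 by (intro mult_right_mono) (auto simp: N_def)
    also have "\<dots> \<le> real n * x" using sum_a_le[of 0] by (simp add: mult_left_mono)
    finally have "(T.L * (98 / 100)) * x \<le> real n * x" by (simp only: mult_ac)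
    hence "T.L * (98 / 100) \<le> real n" using x by simp
    thus ?thesis using T.L_ge_1 by linarith
  qed
  have "T.L / 16 ^ (s div 50) \<le> 2 * real n / 16 ^ (s div 50)" by (intro divide_right_mono L_le) auto
  also have "\<dots> \<le> 1 / (2 * 10 ^ 15)" using s_lin by (simp add: n_def)
  finally have "16384 * y * (1/2) ^ j0 + T.L / 16 ^ (s div 50) \<le> 1 / (2 * 10 ^ 15) + 1 / (2 * 10 ^ 15)"
    by (rule add_mono[OF j0])
  hence "16384 * y * (1/2) ^ j0 + T.L / 16 ^ (s div 50) \<le> 1 / 10 ^ 15" by (rule order_trans) simp
  moreover have "?q ^ K * ((1/2) ^ w + sieve_err ?q s) \<le> 1 / 50"
  proof -
    have "?q ^ K * ((1/2) ^ w + sieve_err ?q s) \<le> ?q ^ K * (1 / (100 * ?q ^ K) + 1 / (100 * ?q ^ K))"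
      using w s_err(1) by (intro mult_left_mono add_mono) auto
    also have "\<dots> = 1 / 50" using q3 by (simp add: field_simps)
    finally show ?thesis .
  qed
  moreover have "4 * (8 * (s div 50) + 2) \<le> 50 * s" "j0 \<le> s div 50" using s by simp_all
  moreover have "P \<in> PP \<Longrightarrow> w < degree P" for P by (simp add: PP_def)
  moreover have "0 \<le> a i m" "a i m \<le> T.L" for i m using T.L_ge_1 by (auto simp: a_def)
  ultimately have "\<exists>x1\<in>T.VV. \<exists>x2\<in>T.VV. \<exists>x3\<in>T.VV. x1 + x2 + x3 = 0 \<and> a 0 x1 > 0 \<and> a 1 x2 > 0 \<and> a 2 x3 > 0"
    using a_nu avg half y s_err(2) K by (intro T.zero_sum_triple[where r = r and B = T.L and J = "s div 50" and y = y and K = K and w = w])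
  then obtain x1 x2 x3 where xs: "x1 + x2 + x3 = 0" "a 0 x1 > 0" "a 1 x2 > 0" "a 2 x3 > 0" by blast
  have "irreducible (r 0 + Z.W * x1)" "irreducible (r 1 + Z.W * x2)" "irreducible (r 2 + Z.W * x3)"
    using xs(2-4) by (auto simp: a_def split: if_splits)
  moreover have "f = (r 0 + Z.W * x1) + (r 1 + Z.W * x2) + (r 2 + Z.W * x3)"
  proof -
    have "(r 0 + Z.W * x1) + (r 1 + Z.W * x2) + (r 2 + Z.W * x3)
        = Z.W * (monom (c 0) (50 * s) + monom (c 1) (50 * s) + monom (c 2) (50 * s)) + (b 0 + b 1 + b 2) + Z.W * (x1 + x2 + x3)"
      unfolding r_def by (simp only: distrib_left ac_simps)
    also have "monom (c 0) (50 * s) + monom (c 1) (50 * s) + monom (c 2) (50 * s) = 0"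
      by (simp add: add_monom c_def)
    finally show ?thesis using xs(1) b02(1) by (simp add: b_def)
  qed
  ultimately show ?thesis by blast
qed

section \<open>From sums of three irreducibles to optimality\<close>

theorem theorem2p18:
  fixes B :: "'a::{field,finite} poly set"
  assumes "odd CARD('a)"
    and "B = {p. irreducible p \<and> degree p \<ge> 1}"
  shows "optimal_subset 3 B"
proof -
  have B: "p \<in> B \<longleftrightarrow> irreducible p" for p
    using irreducible_degree_pos[of p] assms(2) by auto
  have "B \<noteq> {}" using sum_of_three_irreducibles[OF assms(1)] B by blast
  \<comment> \<open>Applied to \<open>B\<close> and to its semigroup: both threefold sumsets are
    everything, hence equal.\<close>
  have all: "nfold_sumset 3 C = UNIV" if "B \<subseteq> C" for C
  proof -
    have "f \<in> nfold_sumset 3 C" for f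
    proof -
      obtain x y z where "x \<in> B" "y \<in> B" "z \<in> B" "f = x + y + z"
        using sum_of_three_irreducibles[OF assms(1), of f] B by blast
      hence "f = sum_list [x, y, z] \<and> length [x, y, z] = 3 \<and> set [x, y, z] \<subseteq> C"
        using that by (auto simp: add.assoc)
      thus ?thesis unfolding nfold_sumset_def by blast
    qed
    thus ?thesis by auto
  qed
  have sub: "B \<subseteq> generated_semigroup B"
  proof
    fix p assume "p \<in> B"
    hence "p = prod_list [p] \<and> [p] \<noteq> [] \<and> set [p] \<subseteq> B" by simp
    thus "p \<in> generated_semigroup B" unfolding generated_semigroup_def by blast
  qed
  have "sum_factor_reduces 3 (generated_semigroup B) B"
    unfolding sum_factor_reduces_def using sub \<open>B \<noteq> {}\<close> all[OF sub] all[OF order_refl]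
    by (auto simp: generated_semigroup_def)
  \<comment> \<open>An irreducible \<open>p\<close> that is a product over
    \<open>C \<subseteq> B\<close> has a single factor: after the first one the remaining product is
    a unit, yet its members would be irreducible. So \<open>p\<close> itself lies in
    \<open>C\<close>.\<close>
  moreover have "C = B" if "sum_factor_reduces 3 B C" for C
  proof
    show "C \<subseteq> B" using that by (simp add: sum_factor_reduces_def)
    show "B \<subseteq> C"
    proof
      fix p assume p: "p \<in> B"
      then obtain cs where cs: "cs \<noteq> []" "set cs \<subseteq> C" "p = prod_list cs"
        using \<open>sum_factor_reduces 3 B C\<close> unfolding sum_factor_reduces_def by blast
      then obtain u us where us: "cs = u # us" by (cases cs) auto
      have irr: "irreducible v" if "v \<in> set cs" for v
        using that cs(2) \<open>C \<subseteq> B\<close> B by blast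
      have "is_unit (prod_list us)"
        using p irreducibleD[of p u "prod_list us"] irr[of u] irreducible_not_unit us cs(3) B by auto
      have "us = []"
      proof (rule ccontr)
        assume "us \<noteq> []"
        then obtain v vs where "us = v # vs" by (cases us) auto
        hence "is_unit v" using \<open>is_unit (prod_list us)\<close> by (simp add: is_unit_mult_iff)
        thus False using irr[of v] irreducible_not_unit us \<open>us = v # vs\<close> by auto
      qed
      thus "p \<in> C" using cs us by simp
    qed
  qed
  ultimately show ?thesis
    unfolding optimal_subset_def sum_factor_irreducible_def using \<open>B \<noteq> {}\<close> by blast
qed


end
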